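(* Let $\varphi:\Sigma\to\mathbb{R}$ be continuous. Then for every $\alpha\in[\alpha_{\min}(\varphi),\alpha_{\max}(\varphi)]$, \[\dim \Lambda^{\varphi}_{\alpha}=\sup\Big\{D_{LY}(\mu):\ \mu\in\mathcal{M}_{\sigma}(\Sigma),\ \int\varphi\,d\mu=\alpha\Big\}.\] In particular the map $\alpha\mapsto \dim\Lambda^{\varphi}_{\alpha}$ is continuous on $[\alpha_{\min}(\varphi),\alpha_{\max}(\varphi)]$.
   Context: Standing setting (Lalley–Gatzouras system). Let $p\ge 1$ and $m_1,\dots,m_p\ge1$ be integers and $\mathcal{D}=\{(i,j):1\le i\le p,\ 1\le j\le m_i\}$. For $(i,j)\in\mathcal{D}$ let $S_{ij}:[0,1]^2\to[0,1]^2$, $S_{ij}(x)=\begin{pmatrix}a_{ij}&0\\0&b_i\end{pmatrix}x+\begin{pmatrix}c_{ij}\\ d_i\end{pmatrix}$, where $a_{ij},b_i,c_{ij},d_i\in[0,1]$, $0<a_{ij}\le b_i<1$, $0\le d_1\le\dots\le d_p<1$, $d_{i+1}-d_i\ge b_i$, $b_p+d_p\le 1$, and for each $i$: $0\le c_{i1}\le\dots\le c_{im_i}<1$, $c_{i(j+1)}-c_{ij}\ge a_{ij}$, $a_{im_i}+c_{im_i}\le1$. Let $\Sigma=\mathcal{D}^{\mathbb{N}}$ with left shift $\sigma$, $\Sigma_v=\{1,\dots,p\}^{\mathbb{N}}$ with left shift $\sigma_v$, and $\pi:\Sigma\to\Sigma_v$, $((i_n,j_n))_n\mapsto(i_n)_n$.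 Write $\omega=(\omega_\nu)_{\nu\ge1}=((i_\nu,j_\nu))_{\nu\ge1}$ and $a_{\omega_\nu}=a_{i_\nu j_\nu}$. Let $\Pi:\Sigma\to\mathbb{R}^2$, $\Pi(\omega)=\lim_{n\to\infty}S_{\omega_1}\circ\cdots\circ S_{\omega_n}([0,1]^2)$ (a single point), and $\Lambda=\Pi(\Sigma)$. $\mathcal{M}_{\sigma^n}(\Sigma)$ denotes the $\sigma^n$-invariant Borel probability measures on $\Sigma$. For $\mu\in\mathcal{M}_{\sigma^n}(\Sigma)$: $\lambda(\mu,\sigma^n)=-\int\log(a_{\omega_1}\cdots a_{\omega_n})\,d\mu(\omega)$, $\lambda^v(\mu,\sigma^n)=-\int\log(b_{i_1}\cdots b_{i_n})\,d\mu(\omega)$, $h(\mu,\sigma^n)$ is the Kolmogorov–Sinai entropy of $\mu$ w.r.t. $\sigma^n$, $h^v(\mu,\sigma^n)$ is the entropy of $\mu\circ\pi^{-1}$ w.r.t. $\sigma_v^n$, and \[D^n_{LY}(\mu)=\frac{h(\mu,\sigma^n)}{\lambda(\mu,\sigma^n)}+\Big(\frac{1}{\lambda^v(\mu,\sigma^n)}-\frac{1}{\lambda(\mu,\sigma^n)}\Big)h^v(\mu,\sigma^n),\qquad D_{LY}:=D^1_{LY}.\] For continuous $\varphi:\Sigma\to\mathbb{R}$ and $\alpha\in\mathbb{R}$: $\Sigma^{\varphi}_{\alpha}=\{\omega\in\Sigma:\lim_{n\to\infty}\frac1n\sum_{l=0}^{n-1}\varphi(\sigma^l\omega)=\alpha\}$,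 $\Lambda^{\varphi}_{\alpha}=\Pi(\Sigma^{\varphi}_{\alpha})$, $\alpha_{\min}(\varphi)=\inf\{\int\varphi\,d\mu:\mu\in\mathcal{M}_\sigma(\Sigma)\}$, $\alpha_{\max}(\varphi)=\sup\{\int\varphi\,d\mu:\mu\in\mathcal{M}_\sigma(\Sigma)\}$. $\dim$ denotes Hausdorff dimension. *)

theory Defs
  imports "HOL-Probability.Probability"
begin

text \<open>Digits: the index set D = {(i,j) : 1 <= i <= p, 1 <= j <= m_i}.
  Sequences are indexed from 0, i.e. omega 0 is the paper's omega_1.\<close>

definition digits :: "nat \<Rightarrow> (nat \<Rightarrow> nat) \<Rightarrow> (nat \<times> nat) set" where
  "digits p m = {(i, j). 1 \<le> i \<and> i \<le> p \<and> 1 \<le> j \<and> j \<le> m i}"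

definition SigmaS :: "nat \<Rightarrow> (nat \<Rightarrow> nat) \<Rightarrow> (nat \<Rightarrow> nat \<times> nat) set" where
  "SigmaS p m = {\<omega>. \<forall>n. \<omega> n \<in> digits p m}"

text \<open>Sigma with its Borel sigma-algebra (product of discrete sigma-algebras)\<close>
definition SigmaM :: "nat \<Rightarrow> (nat \<Rightarrow> nat) \<Rightarrow> (nat \<Rightarrow> nat \<times> nat) measure" where
  "SigmaM p m = PiM UNIV (\<lambda>_. count_space (digits p m))"

definition SigmaVM :: "nat \<Rightarrow> (nat \<Rightarrow> nat) measure" where
  "SigmaVM p = PiM UNIV (\<lambda>_. count_space {1..p})"

definition shift :: "(nat \<Rightarrow> 'a) \<Rightarrow> (nat \<Rightarrow> 'a)" where
  "shift \<omega> = (\<lambda>n. \<omega> (Suc n))"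

definition proj_v :: "(nat \<Rightarrow> nat \<times> nat) \<Rightarrow> (nat \<Rightarrow> nat)" where
  "proj_v \<omega> = (\<lambda>n. fst (\<omega> n))"

definition inv_measures :: "nat \<Rightarrow> (nat \<Rightarrow> nat) \<Rightarrow> (nat \<Rightarrow> nat \<times> nat) measure set" where
  "inv_measures p m = {\<mu>. prob_space \<mu> \<and> sets \<mu> = sets (SigmaM p m)
      \<and> distr \<mu> (SigmaM p m) shift = \<mu>}"

definition finite_partition :: "'a measure \<Rightarrow> 'a set set \<Rightarrow> bool" where
  "finite_partition M \<xi> \<longleftrightarrow> finite \<xi> \<and> \<xi> \<subseteq> sets M \<and> disjoint \<xi> \<and> \<Union>\<xi> = space M"

definition join_partition :: "'a measure \<Rightarrow> ('a \<Rightarrow> 'a) \<Rightarrow> 'a set set \<Rightarrow> nat \<Rightarrow> 'a set set" where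
  "join_partition M T \<xi> n =
     (\<lambda>f. space M \<inter> (\<Inter>k\<in>{..<n}. (T ^^ k) -` f k)) ` (PiE {..<n} (\<lambda>_. \<xi>))"

text \<open>H_mu(xi) = - sum mu(A) log mu(A)  (with 0 log 0 = 0, as ln 0 = 0 here)\<close>
definition partition_entropy :: "'a measure \<Rightarrow> 'a set set \<Rightarrow> real" where
  "partition_entropy M \<xi> = (\<Sum>A\<in>\<xi>. - (measure M A * ln (measure M A)))"

definition entropy_wrt :: "'a measure \<Rightarrow> ('a \<Rightarrow> 'a) \<Rightarrow> 'a set set \<Rightarrow> real" where
  "entropy_wrt M T \<xi> =
     lim (\<lambda>n. partition_entropy M (join_partition M T \<xi> (Suc n)) / real (Suc n))"

definition ks_entropy :: "'a measure \<Rightarrow> ('a \<Rightarrow> 'a) \<Rightarrow> real" where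
  "ks_entropy M T = Sup (entropy_wrt M T ` {\<xi>. finite_partition M \<xi>})"

definition lyap :: "(nat \<Rightarrow> nat \<Rightarrow> real) \<Rightarrow> (nat \<Rightarrow> nat \<times> nat) measure \<Rightarrow> real" where
  "lyap a \<mu> = - (\<integral>\<omega>. ln (a (fst (\<omega> 0)) (snd (\<omega> 0))) \<partial>\<mu>)"

definition lyap_v :: "(nat \<Rightarrow> real) \<Rightarrow> (nat \<Rightarrow> nat \<times> nat) measure \<Rightarrow> real" where
  "lyap_v b \<mu> = - (\<integral>\<omega>. ln (b (fst (\<omega> 0))) \<partial>\<mu>)"

definition h_ent :: "(nat \<Rightarrow> nat \<times> nat) measure \<Rightarrow> real" where
  "h_ent \<mu> = ks_entropy \<mu> shift"

definition h_ent_v :: "nat \<Rightarrow> (nat \<Rightarrow> nat \<times> nat) measure \<Rightarrow> real" where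
  "h_ent_v p \<mu> = ks_entropy (distr \<mu> (SigmaVM p) proj_v) shift"

definition D_LY :: "nat \<Rightarrow> (nat \<Rightarrow> nat \<Rightarrow> real) \<Rightarrow> (nat \<Rightarrow> real)
                    \<Rightarrow> (nat \<Rightarrow> nat \<times> nat) measure \<Rightarrow> real" where
  "D_LY p a b \<mu> = h_ent \<mu> / lyap a \<mu> + (1 / lyap_v b \<mu> - 1 / lyap a \<mu>) * h_ent_v p \<mu>"

definition S_map :: "(nat \<Rightarrow> nat \<Rightarrow> real) \<Rightarrow> (nat \<Rightarrow> real) \<Rightarrow> (nat \<Rightarrow> nat \<Rightarrow> real) \<Rightarrow> (nat \<Rightarrow> real)
                     \<Rightarrow> nat \<times> nat \<Rightarrow> real \<times> real \<Rightarrow> real \<times> real" where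
  "S_map a b c d ij x = (a (fst ij) (snd ij) * fst x + c (fst ij) (snd ij), b (fst ij) * snd x + d (fst ij))"

fun S_comp :: "(nat \<Rightarrow> nat \<Rightarrow> real) \<Rightarrow> (nat \<Rightarrow> real) \<Rightarrow> (nat \<Rightarrow> nat \<Rightarrow> real) \<Rightarrow> (nat \<Rightarrow> real)
               \<Rightarrow> nat \<Rightarrow> (nat \<Rightarrow> nat \<times> nat) \<Rightarrow> real \<times> real \<Rightarrow> real \<times> real" where
  "S_comp a b c d 0 \<omega> = id"
| "S_comp a b c d (Suc n) \<omega> = S_comp a b c d n \<omega> \<circ> S_map a b c d (\<omega> n)"

definition unit_square :: "(real \<times> real) set" where
  "unit_square = {0..1} \<times> {0..1}"

definition coding :: "(nat \<Rightarrow> nat \<Rightarrow> real) \<Rightarrow> (nat \<Rightarrow> real) \<Rightarrow> (nat \<Rightarrow> nat \<Rightarrow> real) \<Rightarrow> (nat \<Rightarrow> real)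
                      \<Rightarrow> (nat \<Rightarrow> nat \<times> nat) \<Rightarrow> real \<times> real" where
  "coding a b c d \<omega> = (THE z. z \<in> (\<Inter>n. S_comp a b c d n \<omega> ` unit_square))"

definition birkhoff_level :: "nat \<Rightarrow> (nat \<Rightarrow> nat) \<Rightarrow> ((nat \<Rightarrow> nat \<times> nat) \<Rightarrow> real) \<Rightarrow> real
                              \<Rightarrow> (nat \<Rightarrow> nat \<times> nat) set" where
  "birkhoff_level p m \<phi> \<alpha> = {\<omega> \<in> SigmaS p m.
     (\<lambda>n. (\<Sum>l<n. \<phi> ((shift ^^ l) \<omega>)) / real n) \<longlonglongrightarrow> \<alpha>}"

definition alpha_min :: "nat \<Rightarrow> (nat \<Rightarrow> nat) \<Rightarrow> ((nat \<Rightarrow> nat \<times> nat) \<Rightarrow> real) \<Rightarrow> real" where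
  "alpha_min p m \<phi> = Inf ((\<lambda>\<mu>. \<integral>\<omega>. \<phi> \<omega> \<partial>\<mu>) ` inv_measures p m)"

definition alpha_max :: "nat \<Rightarrow> (nat \<Rightarrow> nat) \<Rightarrow> ((nat \<Rightarrow> nat \<times> nat) \<Rightarrow> real) \<Rightarrow> real" where
  "alpha_max p m \<phi> = Sup ((\<lambda>\<mu>. \<integral>\<omega>. \<phi> \<omega> \<partial>\<mu>) ` inv_measures p m)"

definition hausdorff_content :: "real \<Rightarrow> real \<Rightarrow> 'a::metric_space set \<Rightarrow> ennreal" where
  "hausdorff_content s \<delta> E =
     (INF U \<in> {U :: nat \<Rightarrow> 'a set. E \<subseteq> (\<Union>k. U k) \<and> (\<forall>k. bounded (U k) \<and> diameter (U k) \<le> \<delta>)}.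
        (\<Sum>k. ennreal (diameter (U k) powr s)))"

definition hausdorff_measure :: "real \<Rightarrow> 'a::metric_space set \<Rightarrow> ennreal" where
  "hausdorff_measure s E = (SUP \<delta> \<in> {0<..}. hausdorff_content s \<delta> E)"

definition hausdorff_dim :: "'a::metric_space set \<Rightarrow> real" where
  "hausdorff_dim E = Inf {s. 0 \<le> s \<and> hausdorff_measure s E = 0}"

definition LG_system :: "nat \<Rightarrow> (nat \<Rightarrow> nat) \<Rightarrow> (nat \<Rightarrow> nat \<Rightarrow> real) \<Rightarrow> (nat \<Rightarrow> real)
                         \<Rightarrow> (nat \<Rightarrow> nat \<Rightarrow> real) \<Rightarrow> (nat \<Rightarrow> real) \<Rightarrow> bool" where
  "LG_system p m a b c d \<longleftrightarrow>
     1 \<le> p \<and> (\<forall>i\<in>{1..p}. 1 \<le> m i)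
   \<and> (\<forall>(i,j)\<in>digits p m. 0 < a i j \<and> a i j \<le> b i \<and> b i < 1 \<and> 0 \<le> c i j \<and> c i j \<le> 1)
   \<and> (\<forall>i\<in>{1..p}. 0 \<le> d i \<and> d i \<le> 1)
   \<and> 0 \<le> d 1 \<and> (\<forall>i. 1 \<le> i \<and> i < p \<longrightarrow> d i \<le> d (Suc i) \<and> d (Suc i) - d i \<ge> b i) \<and> d p < 1
   \<and> b p + d p \<le> 1
   \<and> (\<forall>i\<in>{1..p}. 0 \<le> c i 1 \<and> c i (m i) < 1 \<and> a i (m i) + c i (m i) \<le> 1
        \<and> (\<forall>j. 1 \<le> j \<and> j < m i \<longrightarrow> c i j \<le> c i (Suc j) \<and> c i (Suc j) - c i j \<ge> a i j))"

end

theory Submission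
  imports Defs
begin

text \<open>The entropy of an invariant measure is an infimum of integrals of continuous functions: for
  positive weights \<open>\<kappa>\<close> on words of length \<open>r + 1\<close> that are substochastic in the first letter, Gibbs'
  inequality gives \<open>h \<mu> \<le> \<integral> - ln \<kappa> d\<mu>\<close>, and conditional probabilities of \<open>\<mu>\<close> show that these bounds are
  sharp. Hence \<open>D_LY\<close> is upper semicontinuous.

  Upper bound. If no invariant measure with mean \<open>\<alpha>\<close> has dimension at least \<open>s1\<close>, compactness applied to the
  empirical measures of the points of the level set yields finitely many weights such that, at every large
  scale, one of them certifies a local dimension below \<open>s1\<close>. An argument of Kenyon and Peres turns
  this into infinitely many scales at which the approximate square of the point has large weight,
  and the Kraft inequality bounds the number of such squares.

  Lower bound. For an arbitrary invariant \<open>\<mu>\<close>, which need not be ergodic, concatenate independent blocks of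
  lengths 1, 2, 3, ..., the block of length \<open>l\<close> having the law of the first \<open>l\<close> letters under \<open>\<mu>\<close>.
  The blocks grow so slowly that concentration inequalities give the Birkhoff averages, Lyapunov
  exponents and entropies of \<open>\<mu>\<close> for almost every concatenation, and the mass distribution principle applies.

  Continuity in \<open>\<alpha>\<close> follows from upper semicontinuity together with convex combinations, along which
  entropy is concave.\<close>

section \<open>Sequences, words and invariant measures\<close>

text \<open>Two obstacles shape the proof. A square of side about
  \<open>exp (- bsum la n \<omega>)\<close> is described by all digits up to time \<open>n\<close>
  and by the rows up to a later time \<open>Ln n \<omega>\<close>, whereas the empirical measure at
  time \<open>n\<close> sees only the digits before \<open>n\<close>. The vertical cost between the
  two times cannot be controlled at a single scale. But the vertical cost per unit of
  \<open>bsum lb\<close> is bounded, so it cannot grow by a fixed amount each time \<open>n\<close>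
  is replaced by \<open>Ln n \<omega>\<close>. This gives good scales infinitely often, which is
  enough for Hausdorff dimension. Second, typical points of a non-ergodic \<mu> have the averages of
  an ergodic component, so \<mu> itself may give measure zero to the level set. In a concatenation
  of independent blocks the law of large numbers takes the role of the ergodic theorem, and block
  entropy per letter tends to the entropy of \<mu>. Both bounds see entropy only through finite
  words. For this reason the Kolmogorov-Sinai entropy is first identified with the entropy rate
  \<open>hs\<close>.\<close>

definition shiftM :: "'a set \<Rightarrow> (nat \<Rightarrow> 'a) measure" where
  "shiftM A = PiM UNIV (\<lambda>_. count_space A)"

definition seqs :: "'a set \<Rightarrow> (nat \<Rightarrow> 'a) set" where
  "seqs A = {\<omega>. \<forall>n. \<omega> n \<in> A}"

definition pre :: "nat \<Rightarrow> (nat \<Rightarrow> 'a) \<Rightarrow> 'a list" where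
  "pre n \<omega> = map \<omega> [0..<n]"

definition words :: "'a set \<Rightarrow> nat \<Rightarrow> 'a list set" where
  "words A n = {xs. set xs \<subseteq> A \<and> length xs = n}"

definition app :: "'a list \<Rightarrow> (nat \<Rightarrow> 'a) \<Rightarrow> nat \<Rightarrow> 'a" where
  "app xs y = (\<lambda>n. if n < length xs then xs ! n else y (n - length xs))"

definition bsum :: "((nat \<Rightarrow> 'a) \<Rightarrow> real) \<Rightarrow> nat \<Rightarrow> (nat \<Rightarrow> 'a) \<Rightarrow> real" where
  "bsum F n \<omega> = (\<Sum>t<n. F ((shift ^^ t) \<omega>))"

definition inv_meas :: "'a set \<Rightarrow> (nat \<Rightarrow> 'a) measure set" where
  "inv_meas A = {\<mu>. prob_space \<mu> \<and> sets \<mu> = sets (shiftM A) \<and> distr \<mu> (shiftM A) shift = \<mu>}"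

lemma space_shiftM: "space (shiftM A) = seqs A"
  by (auto simp: shiftM_def seqs_def space_PiM PiE_iff)

lemma space_eq_seqs: "sets M = sets (shiftM A) \<Longrightarrow> space M = seqs A"
  using sets_eq_imp_space_eq space_shiftM by metis

lemma shift_pow: "(shift ^^ k) \<omega> n = \<omega> (n + k)"
proof (induction k arbitrary: n)
  case (Suc k)
  then show ?case by (simp add: shift_def)
qed simp

lemma shift_pow_fun: "(shift ^^ k) \<omega> = (\<lambda>n. \<omega> (n + k))"
  by (rule ext) (rule shift_pow)

lemma shift_pow_seqs [simp]: "\<omega> \<in> seqs A \<Longrightarrow> (shift ^^ k) \<omega> \<in> seqs A"
  by (auto simp: seqs_def shift_pow)

lemma shift_seqs [simp]: "\<omega> \<in> seqs A \<Longrightarrow> shift \<omega> \<in> seqs A"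
  by (auto simp: seqs_def shift_def)

lemma length_pre [simp]: "length (pre n \<omega>) = n"
  by (simp add: pre_def)

lemma nth_pre [simp]: "t < n \<Longrightarrow> pre n \<omega> ! t = \<omega> t"
  by (simp add: pre_def)

lemma pre_0 [simp]: "pre 0 \<omega> = []"
  by (simp add: pre_def)

lemma pre_eq_iff: "pre n \<omega> = pre n \<omega>' \<longleftrightarrow> (\<forall>t<n. \<omega> t = \<omega>' t)"
  by (auto simp: pre_def)

lemma pre_eq_list: "pre n \<omega> = xs \<longleftrightarrow> length xs = n \<and> (\<forall>t<n. \<omega> t = xs ! t)"
  by (auto simp: list_eq_iff_nth_eq)

lemma pre_in_words [simp]: "\<omega> \<in> seqs A \<Longrightarrow> pre n \<omega> \<in> words A n"
  by (auto simp: words_def pre_def seqs_def)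

lemma pre_Suc: "pre (Suc n) \<omega> = \<omega> 0 # pre n (shift \<omega>)"
  by (rule nth_equalityI) (auto simp: nth_Cons shift_def split: nat.split)

lemma pre_app [simp]: "pre (length xs) (app xs y) = xs"
  by (rule nth_equalityI) (auto simp: app_def)

lemma app_seqs [simp]: "xs \<in> words A n \<Longrightarrow> y \<in> seqs A \<Longrightarrow> app xs y \<in> seqs A"
  by (auto simp: words_def seqs_def app_def)

lemma shift_app [simp]: "shift (app (x # u) y) = app u y"
  by (auto simp: shift_def app_def)

lemma app_0 [simp]: "app (x # u) y 0 = x"
  by (simp add: app_def)

lemma words_0 [simp]: "words A 0 = {[]}"
  by (auto simp: words_def)

lemma finite_words [simp]: "finite A \<Longrightarrow> finite (words A n)"
  unfolding words_def by (rule finite_lists_length_eq)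

lemma words_Suc: "words A (Suc n) = (\<lambda>(x, u). x # u) ` (A \<times> words A n)"
  by (auto simp: words_def length_Suc_conv image_iff)

lemma sum_words_Suc:
  fixes F :: "'a list \<Rightarrow> 'b::comm_monoid_add"
  shows "(\<Sum>xs\<in>words A (Suc n). F xs) = (\<Sum>x\<in>A. \<Sum>u\<in>words A n. F (x # u))"
proof -
  have "(\<Sum>xs\<in>words A (Suc n). F xs) = (\<Sum>(x,u)\<in>A \<times> words A n. F (x # u))"
    unfolding words_Suc by (subst sum.reindex) (auto simp: inj_on_def case_prod_unfold)
  then show ?thesis by (simp add: sum.cartesian_product)
qed

lemma card_words: "finite A \<Longrightarrow> card (words A n) = card A ^ n"
  unfolding words_def by (rule card_lists_length_eq)

lemma bsum_0 [simp]: "bsum F 0 \<omega> = 0"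
  by (simp add: bsum_def)

lemma bsum_Suc: "bsum F (Suc n) \<omega> = F \<omega> + bsum F n (shift \<omega>)"
  unfolding bsum_def sum.lessThan_Suc_shift by (simp add: funpow_Suc_right del: funpow.simps)

lemma bsum_Suc': "bsum F (Suc n) \<omega> = bsum F n \<omega> + F ((shift ^^ n) \<omega>)"
  unfolding bsum_def by simp

lemma bsum_add: "bsum F (n + k) \<omega> = bsum F n \<omega> + bsum F k ((shift ^^ n) \<omega>)"
  by (induction k) (simp_all add: bsum_Suc' funpow_add shift_pow_fun add.assoc add.commute add.left_commute)

lemma sets_M_words:
  assumes "sets M = sets (shiftM A)" "finite A"
  shows "pre n \<in> measurable M (count_space (words A n))"
proof -
  have sp: "space M = seqs A" using assms(1) by (rule space_eq_seqs)
  have comp: "(\<lambda>\<omega>. \<omega> i) \<in> measurable M (count_space A)" for i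
    unfolding measurable_cong_sets[OF assms(1) refl] shiftM_def by simp
  show ?thesis
    unfolding measurable_count_space_eq2[OF finite_words[OF assms(2)]]
  proof safe
    fix \<omega> assume "\<omega> \<in> space M" then show "pre n \<omega> \<in> words A n" using sp by simp
  next
    fix xs assume xs: "xs \<in> words A n"
    have "pre n -` {xs} \<inter> space M = space M \<inter> (\<Inter>i\<in>{..<n}. {\<omega>\<in>space M. \<omega> i = xs ! i})"
      using xs by (auto simp: pre_eq_list words_def)
    also have "\<dots> \<in> sets M"
    proof -
      have "{\<omega>\<in>space M. \<omega> i = xs ! i} \<in> sets M" if i: "i < n" for i
      proof -
        have "xs ! i \<in> A" using xs i by (auto simp: words_def)
        then show ?thesis
        using measurable_sets[OF comp, of "{xs ! i}" i] by (auto simp: vimage_def Int_def conj_commute)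
      qed
      then show ?thesis by (cases "n = 0") (auto intro!: sets.Int sets.finite_INT)
    qed
    finally show "pre n -` {xs} \<inter> space M \<in> sets M" .
  qed
qed

lemma measurable_shift: "shift \<in> measurable (shiftM A) (shiftM A)"
  unfolding shiftM_def shift_def
  by (rule measurable_PiM_single') (auto simp: space_PiM PiE_iff)

lemma measurable_shift_pow: "(shift ^^ k) \<in> measurable (shiftM A) (shiftM A)"
proof (induction k)
  case (Suc k)
  then show ?case using measurable_compose[OF Suc measurable_shift] by (simp add: comp_def)
qed (simp add: id_def)

lemma inv_distr_pow:
  assumes "\<mu> \<in> inv_meas A"
  shows "distr \<mu> (shiftM A) (shift ^^ k) = \<mu>"
proof (induction k)
  case 0
  have "distr \<mu> (shiftM A) (\<lambda>x. x) = distr \<mu> \<mu> (\<lambda>x. x)"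
    using assms by (intro distr_cong) (auto simp: inv_meas_def)
  then show ?case using assms by (simp add: id_def)
next
  case (Suc k)
  have s: "sets \<mu> = sets (shiftM A)" using assms by (simp add: inv_meas_def)
  have "distr \<mu> (shiftM A) (shift ^^ Suc k) = distr (distr \<mu> (shiftM A) (shift ^^ k)) (shiftM A) shift"
    by (subst distr_distr) (auto simp: measurable_shift comp_def measurable_cong_sets[OF s refl] measurable_shift_pow)
  then show ?case using Suc assms by (simp add: inv_meas_def comp_def)
qed

lemma inv_integral_shift:
  fixes F :: "(nat \<Rightarrow> 'a) \<Rightarrow> real"
  assumes "\<mu> \<in> inv_meas A" "F \<in> borel_measurable (shiftM A)"
  shows "(\<integral>\<omega>. F ((shift ^^ k) \<omega>) \<partial>\<mu>) = (\<integral>\<omega>. F \<omega> \<partial>\<mu>)"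
proof -
  have s: "sets \<mu> = sets (shiftM A)" using assms by (simp add: inv_meas_def)
  have "(\<integral>\<omega>. F \<omega> \<partial>\<mu>) = (\<integral>\<omega>. F \<omega> \<partial>(distr \<mu> (shiftM A) (shift ^^ k)))"
    by (simp add: inv_distr_pow[OF assms(1)])
  also have "\<dots> = (\<integral>\<omega>. F ((shift ^^ k) \<omega>) \<partial>\<mu>)"
    by (rule integral_distr) (auto simp: measurable_cong_sets[OF s refl] measurable_shift_pow assms)
  finally show ?thesis ..
qed

section \<open>Entropy as an infimum over weights\<close>

definition entH :: "'b measure \<Rightarrow> ('b \<Rightarrow> 'c) \<Rightarrow> 'c set \<Rightarrow> real" where
  "entH M X B = (\<Sum>b\<in>B. - (measure M {\<omega>\<in>space M. X \<omega> = b} * ln (measure M {\<omega>\<in>space M. X \<omega> = b})))"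

lemma (in prob_space) finite_rv_integral:
  fixes F :: "'c \<Rightarrow> real"
  assumes X: "X \<in> measurable M (count_space B)" and "finite B"
  shows "integrable M (\<lambda>\<omega>. F (X \<omega>))"
    and "(\<integral>\<omega>. F (X \<omega>) \<partial>M) = (\<Sum>b\<in>B. prob {\<omega>\<in>space M. X \<omega> = b} * F b)"
proof -
  have B: "X \<omega> \<in> B" if "\<omega> \<in> space M" for \<omega>
    using measurable_space[OF X that] by simp
  have ev: "{\<omega>\<in>space M. X \<omega> = b} \<in> events" if "b \<in> B" for b
    using measurable_sets[OF X, of "{b}"] that by (auto simp: vimage_def Int_def conj_commute)
  have eq: "F (X \<omega>) = (\<Sum>b\<in>B. indicat_real {\<omega>\<in>space M. X \<omega> = b} \<omega> * F b)" if "\<omega> \<in> space M" for \<omega>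
  proof -
    have "(\<Sum>b\<in>B. indicat_real {\<omega>\<in>space M. X \<omega> = b} \<omega> * F b) = (\<Sum>b\<in>B. if b = X \<omega> then F b else 0)"
      using that by (intro sum.cong) (auto simp: indicator_def)
    also have "\<dots> = F (X \<omega>)" using B[OF that] assms(2) by (simp add: sum.delta)
    finally show ?thesis ..
  qed
  have int: "integrable M (\<lambda>\<omega>. \<Sum>b\<in>B. indicat_real {\<omega>\<in>space M. X \<omega> = b} \<omega> * F b)"
    by (intro Bochner_Integration.integrable_sum integrable_mult_left integrable_real_indicator ev)
       (auto simp: emeasure_eq_measure)
  show "integrable M (\<lambda>\<omega>. F (X \<omega>))"
    using int by (subst Bochner_Integration.integrable_cong[OF refl eq]) auto
  have "(\<integral>\<omega>. F (X \<omega>) \<partial>M) = (\<integral>\<omega>. (\<Sum>b\<in>B. indicat_real {\<omega>\<in>space M. X \<omega> = b} \<omega> * F b) \<partial>M)"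
    by (intro Bochner_Integration.integral_cong refl eq)
  also have "\<dots> = (\<Sum>b\<in>B. (\<integral>\<omega>. indicat_real {\<omega>\<in>space M. X \<omega> = b} \<omega> * F b \<partial>M))"
    by (intro Bochner_Integration.integral_sum integrable_mult_left integrable_real_indicator ev)
       (auto simp: emeasure_eq_measure)
  also have "\<dots> = (\<Sum>b\<in>B. prob {\<omega>\<in>space M. X \<omega> = b} * F b)"
    by (intro sum.cong refl) (simp add: Int_absorb2 Int_absorb1 Collect_restrict)
  finally show "(\<integral>\<omega>. F (X \<omega>) \<partial>M) = (\<Sum>b\<in>B. prob {\<omega>\<in>space M. X \<omega> = b} * F b)" .
qed

lemma (in prob_space) sum_finite_rv:
  assumes "X \<in> measurable M (count_space B)" "finite B"
  shows "(\<Sum>b\<in>B. prob {\<omega>\<in>space M. X \<omega> = b}) = 1"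
  using finite_rv_integral(2)[OF assms, of "\<lambda>b. 1"] by (simp add: prob_space)

text \<open>Apply \<open>ln x \<le> x - 1\<close> to the ratio of \<open>Q b\<close> to the
  probability of \<open>b\<close> and sum against the probabilities. The total of \<open>Q\<close>
  enters only from above, hence substochastic weights suffice.\<close>

lemma (in prob_space) gibbs_ineq:
  assumes X: "X \<in> measurable M (count_space B)" "finite B"
    and Q: "\<And>b. b \<in> B \<Longrightarrow> 0 \<le> Q b" "(\<Sum>b\<in>B. Q b) \<le> 1"
    and ac: "\<And>b. b \<in> B \<Longrightarrow> prob {\<omega>\<in>space M. X \<omega> = b} > 0 \<Longrightarrow> Q b > 0"
  shows "entH M X B \<le> (\<integral>\<omega>. - ln (Q (X \<omega>)) \<partial>M)"
proof -
  let ?p = "\<lambda>b. prob {\<omega>\<in>space M. X \<omega> = b}"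
  have "- (?p b * ln (?p b)) - ?p b * (- ln (Q b)) \<le> Q b - ?p b" if b: "b \<in> B" for b
  proof (cases "?p b = 0")
    case False
    then have p: "?p b > 0" by (simp add: zero_less_measure_iff)
    have q: "Q b > 0" using ac[OF b p] .
    have "?p b * ln (Q b / ?p b) \<le> ?p b * (Q b / ?p b - 1)"
      using p q by (intro mult_left_mono ln_le_minus_one) auto
    also have "\<dots> = Q b - ?p b" using p by (simp add: field_simps)
    finally show ?thesis using p q by (simp add: ln_div algebra_simps)
  qed (use Q(1)[OF b] in simp)
  then have "(\<Sum>b\<in>B. - (?p b * ln (?p b)) - ?p b * (- ln (Q b))) \<le> (\<Sum>b\<in>B. Q b - ?p b)"
    by (intro sum_mono) auto
  also have "\<dots> \<le> 0" using Q(2) sum_finite_rv[OF X] by (simp add: sum_subtractf)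
  finally show ?thesis
    unfolding finite_rv_integral(2)[OF X, of "\<lambda>b. - ln (Q b)"] entH_def by (simp add: sum_subtractf sum_negf)
qed

lemma pre_shift: "pre n ((shift ^^ t) \<omega>) = drop t (pre (t + n) \<omega>)"
  by (rule nth_equalityI) (auto simp: shift_pow add.commute)

lemma take_pre: "n \<le> k \<Longrightarrow> take n (pre k \<omega>) = pre n \<omega>"
  by (rule nth_equalityI) auto

lemma measurable_pre_pred:
  assumes "sets M = sets (shiftM A)" "finite A"
  shows "{\<omega>\<in>space M. P (pre n \<omega>)} \<in> sets M"
proof -
  have "{\<omega>\<in>space M. P (pre n \<omega>)} = pre n -` {xs\<in>words A n. P xs} \<inter> space M"
    using space_eq_seqs[OF assms(1)] by auto
  also have "\<dots> \<in> sets M"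
    by (rule measurable_sets[OF sets_M_words[OF assms]]) auto
  finally show ?thesis .
qed

lemma borel_measurable_pre:
  fixes F :: "'a list \<Rightarrow> real"
  assumes "finite A"
  shows "(\<lambda>\<omega>. F (pre n \<omega>)) \<in> borel_measurable (shiftM A)"
  by (rule measurable_compose[OF sets_M_words[OF refl assms]]) simp

lemma integrable_bounded_seqs:
  fixes F :: "(nat \<Rightarrow> 'a) \<Rightarrow> real"
  assumes "prob_space \<mu>" "sets \<mu> = sets (shiftM A)" "F \<in> borel_measurable (shiftM A)"
    and "\<And>\<omega>. \<omega> \<in> seqs A \<Longrightarrow> \<bar>F \<omega>\<bar> \<le> C"
  shows "integrable \<mu> F"
proof -
  interpret prob_space \<mu> by fact
  show ?thesis
    by (rule integrable_const_bound[of _ C])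
       (use assms in \<open>auto simp: space_eq_seqs[OF assms(2)] measurable_cong_sets[OF assms(2) refl]\<close>)
qed

lemma integral_bsum:
  fixes F :: "(nat \<Rightarrow> 'a) \<Rightarrow> real"
  assumes \<mu>: "\<mu> \<in> inv_meas A" and F: "F \<in> borel_measurable (shiftM A)"
    and C: "\<And>\<omega>. \<omega> \<in> seqs A \<Longrightarrow> \<bar>F \<omega>\<bar> \<le> C"
  shows "integrable \<mu> (bsum F n)" and "(\<integral>\<omega>. bsum F n \<omega> \<partial>\<mu>) = real n * (\<integral>\<omega>. F \<omega> \<partial>\<mu>)"
proof -
  have s: "prob_space \<mu>" "sets \<mu> = sets (shiftM A)" using \<mu> by (auto simp: inv_meas_def)
  have i: "integrable \<mu> (\<lambda>\<omega>. F ((shift ^^ t) \<omega>))" for t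
    by (rule integrable_bounded_seqs[OF s measurable_compose[OF measurable_shift_pow F], where C=C])
       (auto intro: C)
  show "integrable \<mu> (bsum F n)"
    unfolding bsum_def using i by auto
  show "(\<integral>\<omega>. bsum F n \<omega> \<partial>\<mu>) = real n * (\<integral>\<omega>. F \<omega> \<partial>\<mu>)"
    unfolding bsum_def using i by (simp add: inv_integral_shift[OF \<mu> F])
qed

text \<open>The weights are rational and extensional so that there are only countably many of them.\<close>

definition adm :: "'a set \<Rightarrow> nat \<Rightarrow> ('a list \<Rightarrow> real) \<Rightarrow> bool" where
  "adm A r \<kappa> \<longleftrightarrow> \<kappa> \<in> extensional (words A (Suc r)) \<and>
     (\<forall>xs\<in>words A (Suc r). 0 < \<kappa> xs \<and> \<kappa> xs \<in> \<rat>) \<and> (\<forall>u\<in>words A r. (\<Sum>x\<in>A. \<kappa> (x # u)) \<le> 1)"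

text \<open>Code length of the first letter given the \<open>r\<close> letters after it.
  Conditioning on the future fits one-sided sequences: the chain rule then removes letters from the
  front, exactly as \<open>bsum_Suc\<close> does.\<close>

definition gfun :: "nat \<Rightarrow> ('a list \<Rightarrow> real) \<Rightarrow> (nat \<Rightarrow> 'a) \<Rightarrow> real" where
  "gfun r \<kappa> \<omega> = - ln (\<kappa> (pre (Suc r) \<omega>))"

text \<open>The logarithms of admissible weights are nonpositive, so one sum bounds
  \<open>gfun\<close> uniformly.\<close>

definition gbound :: "'a set \<Rightarrow> nat \<Rightarrow> ('a list \<Rightarrow> real) \<Rightarrow> real" where
  "gbound A r \<kappa> = (\<Sum>xs\<in>words A (Suc r). - ln (\<kappa> xs))"

lemma adm_pos: "adm A r \<kappa> \<Longrightarrow> xs \<in> words A (Suc r) \<Longrightarrow> 0 < \<kappa> xs"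
  by (simp add: adm_def)

lemma adm_le_1:
  assumes "adm A r \<kappa>" "finite A" "xs \<in> words A (Suc r)"
  shows "\<kappa> xs \<le> 1"
proof -
  obtain x u where xu: "xs = x # u" "x \<in> A" "u \<in> words A r"
    using assms(3) unfolding words_Suc by auto
  have "\<kappa> (x # u) \<le> (\<Sum>x\<in>A. \<kappa> (x # u))"
    using assms xu by (intro member_le_sum) (auto simp: words_Suc intro!: less_imp_le[OF adm_pos[OF assms(1)]])
  also have "\<dots> \<le> 1" using assms(1) xu by (auto simp: adm_def)
  finally show ?thesis using xu by simp
qed

lemma gfun_nonneg:
  assumes "adm A r \<kappa>" "finite A" "\<omega> \<in> seqs A"
  shows "0 \<le> gfun r \<kappa> \<omega>"
  using adm_le_1[OF assms(1,2)] adm_pos[OF assms(1)] assms(3)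
  by (auto simp: gfun_def simp del: pre_in_words intro!: ln_le_zero_iff[THEN iffD2] pre_in_words)

lemma gbound_nonneg: "adm A r \<kappa> \<Longrightarrow> finite A \<Longrightarrow> 0 \<le> gbound A r \<kappa>"
  unfolding gbound_def by (intro sum_nonneg) (auto simp: adm_le_1 adm_pos)

lemma gfun_le_gbound:
  assumes "adm A r \<kappa>" "finite A" "\<omega> \<in> seqs A"
  shows "gfun r \<kappa> \<omega> \<le> gbound A r \<kappa>"
  unfolding gfun_def gbound_def
  by (rule member_le_sum) (use assms in \<open>auto simp: adm_le_1 adm_pos\<close>)

lemma gfun_abs_le:
  "adm A r \<kappa> \<Longrightarrow> finite A \<Longrightarrow> \<omega> \<in> seqs A \<Longrightarrow> \<bar>gfun r \<kappa> \<omega>\<bar> \<le> gbound A r \<kappa>"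
  using gfun_nonneg gfun_le_gbound by fastforce

lemma gfun_measurable: "finite A \<Longrightarrow> gfun r \<kappa> \<in> borel_measurable (shiftM A)"
  unfolding gfun_def using borel_measurable_pre[of A "\<lambda>xs. - ln (\<kappa> xs)"] by simp

text \<open>In the induction, summing out the first letter with all later letters fixed costs a
  factor at most 1 by admissibility. The continuation \<open>y\<close> supplies the letters beyond
  the word that the last \<open>r\<close> weights read.\<close>

lemma kraft:
  assumes adm: "adm A r \<kappa>" and "finite A" and y: "y \<in> seqs A"
  shows "(\<Sum>u\<in>words A n. exp (- bsum (gfun r \<kappa>) n (app u y))) \<le> 1"
proof (induction n)
  case (Suc n)
  have "(\<Sum>u\<in>words A (Suc n). exp (- bsum (gfun r \<kappa>) (Suc n) (app u y)))
      = (\<Sum>x\<in>A. \<Sum>u\<in>words A n. \<kappa> (x # pre r (app u y)) * exp (- bsum (gfun r \<kappa>) n (app u y)))"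
    unfolding sum_words_Suc
  proof (intro sum.cong refl)
    fix x u assume xu: "x \<in> A" "u \<in> words A n"
    then have "\<kappa> (x # pre r (app u y)) > 0"
      using app_seqs[OF xu(2) y] by (intro adm_pos[OF adm]) (auto simp: words_Suc)
    then show "exp (- bsum (gfun r \<kappa>) (Suc n) (app (x # u) y))
      = \<kappa> (x # pre r (app u y)) * exp (- bsum (gfun r \<kappa>) n (app u y))"
      by (simp add: bsum_Suc gfun_def pre_Suc[of r] exp_diff exp_minus divide_inverse)
  qed
  also have "\<dots> = (\<Sum>u\<in>words A n. (\<Sum>x\<in>A. \<kappa> (x # pre r (app u y))) * exp (- bsum (gfun r \<kappa>) n (app u y)))"
    by (subst sum.swap) (simp add: sum_distrib_right)
  also have "\<dots> \<le> (\<Sum>u\<in>words A n. 1 * exp (- bsum (gfun r \<kappa>) n (app u y)))"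
    using adm y by (intro sum_mono mult_right_mono) (auto simp: adm_def)
  finally show ?case using Suc by simp
qed simp

text \<open>Only the last \<open>r\<close> summands look past position \<open>n\<close>; each of
  them differs by at most \<open>gbound\<close> because information is nonnegative.\<close>

lemma bsum_gfun_tail:
  assumes adm: "adm A r \<kappa>" and "finite A" and \<omega>: "\<omega> \<in> seqs A" "\<omega>' \<in> seqs A" "pre n \<omega> = pre n \<omega>'"
  shows "bsum (gfun r \<kappa>) n \<omega> \<le> bsum (gfun r \<kappa>) n \<omega>' + real r * gbound A r \<kappa>"
proof -
  let ?g = "\<lambda>t \<omega>. gfun r \<kappa> ((shift ^^ t) \<omega>)"
  have "?g t \<omega> - ?g t \<omega>' \<le> (if t \<in> {n-r..<n} then gbound A r \<kappa> else 0)" if "t < n" for t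
  proof (cases "t \<in> {n-r..<n}")
    case True
    have "?g t \<omega> \<le> gbound A r \<kappa>" "0 \<le> ?g t \<omega>'"
      using assms by (auto intro!: gfun_le_gbound[OF adm] gfun_nonneg[OF adm])
    then show ?thesis using True by simp
  next
    case False
    then have "pre (Suc r) ((shift ^^ t) \<omega>) = pre (Suc r) ((shift ^^ t) \<omega>')"
      using \<omega>(3) that by (auto simp: pre_eq_iff shift_pow)
    then show ?thesis using False by (auto simp: gfun_def)
  qed
  then have "bsum (gfun r \<kappa>) n \<omega> - bsum (gfun r \<kappa>) n \<omega>' \<le> (\<Sum>t<n. if t \<in> {n-r..<n} then gbound A r \<kappa> else 0)"
    unfolding bsum_def sum_subtractf[symmetric] by (intro sum_mono) auto
  also have "\<dots> = real (card ({..<n} \<inter> {n-r..<n})) * gbound A r \<kappa>"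
    by (subst sum.inter_restrict[symmetric]) auto
  also have "\<dots> \<le> real r * gbound A r \<kappa>"
  proof (intro mult_right_mono gbound_nonneg adm)
    have "card ({..<n} \<inter> {n-r..<n}) \<le> card {n-r..<n}" by (intro card_mono) auto
    then show "real (card ({..<n} \<inter> {n-r..<n})) \<le> real r" by simp
  qed fact
  finally show ?thesis by simp
qed

definition blockH :: "'a set \<Rightarrow> (nat \<Rightarrow> 'a) measure \<Rightarrow> nat \<Rightarrow> real" where
  "blockH A \<mu> n = entH \<mu> (pre n) (words A n)"

text \<open>The entropy rate. Taken as an infimum, it lies below every block entropy per letter by
  definition; \<open>hs_lim\<close> shows that it is also the limit.\<close>

definition hs :: "'a set \<Rightarrow> (nat \<Rightarrow> 'a) measure \<Rightarrow> real" where
  "hs A \<mu> = (INF n. blockH A \<mu> (Suc n) / real (Suc n))"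

locale shift_measure =
  fixes A :: "'a set" and \<mu> :: "(nat \<Rightarrow> 'a) measure"
  assumes finA: "finite A" and inv: "\<mu> \<in> inv_meas A"
begin

lemma prob: "prob_space \<mu>" and sets_mu: "sets \<mu> = sets (shiftM A)"
  using inv by (auto simp: inv_meas_def)

sublocale prob_space \<mu> by (rule prob)

lemma space_mu: "space \<mu> = seqs A"
  by (rule space_eq_seqs[OF sets_mu])

lemma pre_meas: "pre n \<in> measurable \<mu> (count_space (words A n))"
  by (rule sets_M_words[OF sets_mu finA])

lemma ex_seq: "\<exists>y. y \<in> seqs A"
  using not_empty space_mu by auto

lemma blockH_nonneg: "0 \<le> blockH A \<mu> n"
  unfolding blockH_def entH_def
proof (intro sum_nonneg)
  fix b show "0 \<le> - (prob {\<omega> \<in> space \<mu>. pre n \<omega> = b} * ln (prob {\<omega> \<in> space \<mu>. pre n \<omega> = b}))"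
    by (cases "prob {\<omega> \<in> space \<mu>. pre n \<omega> = b} = 0")
       (simp_all add: mult_nonneg_nonpos zero_less_measure_iff)
qed

lemma blockH_0: "blockH A \<mu> 0 = 0"
  by (simp add: blockH_def entH_def prob_space)

text \<open>Gibbs' inequality for the word weights that \<open>kraft\<close> shows to be
  substochastic. The additive constant pays for replacing the true continuation by a fixed
  \<open>y\<close> and does not grow with \<open>n\<close>.\<close>

lemma blockH_le_gfun:
  assumes adm: "adm A r \<kappa>"
  shows "blockH A \<mu> n \<le> real n * (\<integral>\<omega>. gfun r \<kappa> \<omega> \<partial>\<mu>) + real r * gbound A r \<kappa>"
proof -
  obtain y where y: "y \<in> seqs A" using ex_seq by auto
  let ?Q = "\<lambda>u. exp (- bsum (gfun r \<kappa>) n (app u y))"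
  have "blockH A \<mu> n \<le> (\<integral>\<omega>. - ln (?Q (pre n \<omega>)) \<partial>\<mu>)"
    unfolding blockH_def
    by (rule gibbs_ineq[OF pre_meas]) (use finA kraft[OF adm finA y] in auto)
  also have "\<dots> = (\<integral>\<omega>. bsum (gfun r \<kappa>) n (app (pre n \<omega>) y) \<partial>\<mu>)" by simp
  also have "\<dots> \<le> (\<integral>\<omega>. bsum (gfun r \<kappa>) n \<omega> + real r * gbound A r \<kappa> \<partial>\<mu>)"
  proof (rule integral_mono)
    show "integrable \<mu> (\<lambda>\<omega>. bsum (gfun r \<kappa>) n (app (pre n \<omega>) y))"
      by (rule finite_rv_integral(1)[OF pre_meas]) (use finA in auto)
    show "integrable \<mu> (\<lambda>\<omega>. bsum (gfun r \<kappa>) n \<omega> + real r * gbound A r \<kappa>)"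
      using integral_bsum(1)[OF inv gfun_measurable[OF finA] gfun_abs_le[OF adm finA]] by simp
    fix \<omega> assume "\<omega> \<in> space \<mu>"
    then have \<omega>: "\<omega> \<in> seqs A" by (simp add: space_mu)
    have "pre n (app (pre n \<omega>) y) = pre n \<omega>" using pre_app[of "pre n \<omega>" y] by simp
    then show "bsum (gfun r \<kappa>) n (app (pre n \<omega>) y) \<le> bsum (gfun r \<kappa>) n \<omega> + real r * gbound A r \<kappa>"
      using \<omega> y by (intro bsum_gfun_tail[OF adm finA] app_seqs[of _ _ n]) auto
  qed
  also have "\<dots> = real n * (\<integral>\<omega>. gfun r \<kappa> \<omega> \<partial>\<mu>) + real r * gbound A r \<kappa>"
    using integral_bsum[OF inv gfun_measurable[OF finA] gfun_abs_le[OF adm finA], of n]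
    by (simp add: prob_space)
  finally show ?thesis .
qed

text \<open>This is where invariance enters: the letters 1 to \<open>r\<close> have the law of the
  letters 0 to \<open>r - 1\<close>, and the event is split according to letter 0.\<close>

lemma sum_first_letter:
  assumes u: "u \<in> words A r"
  shows "(\<Sum>x\<in>A. prob {\<omega>\<in>space \<mu>. pre (Suc r) \<omega> = x # u}) = prob {\<omega>\<in>space \<mu>. pre r \<omega> = u}"
proof -
  have "prob {\<omega>\<in>space \<mu>. pre r \<omega> = u} = measure (distr \<mu> (shiftM A) shift) {\<omega>\<in>space \<mu>. pre r \<omega> = u}"
    using inv by (simp add: inv_meas_def)
  also have "\<dots> = prob (shift -` {\<omega>\<in>space \<mu>. pre r \<omega> = u} \<inter> space \<mu>)"
    using measurable_pre_pred[OF sets_mu finA, of "\<lambda>xs. xs = u" r]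
    by (intro measure_distr) (auto simp: sets_mu measurable_cong_sets[OF sets_mu refl] measurable_shift)
  also have "shift -` {\<omega>\<in>space \<mu>. pre r \<omega> = u} \<inter> space \<mu> = (\<Union>x\<in>A. {\<omega>\<in>space \<mu>. pre (Suc r) \<omega> = x # u})"
    by (auto simp: space_mu pre_Suc) (auto simp: seqs_def)
  also have "prob \<dots> = (\<Sum>x\<in>A. prob {\<omega>\<in>space \<mu>. pre (Suc r) \<omega> = x # u})"
    using measurable_pre_pred[OF sets_mu finA]
    by (intro finite_measure_finite_Union) (auto simp: finA disjoint_family_on_def)
  finally show ?thesis ..
qed

text \<open>With the exact conditional probabilities of the first letter given the next
  \<open>r\<close>, the integral would equal the entropy increment. Admissible weights have to be
  positive and rational, and adjusting them to this costs at most \<epsilon>.\<close>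

lemma rounded_conditional_weight:
  assumes "0 < \<epsilon>"
  shows "\<exists>\<kappa>. adm A r \<kappa> \<and> (\<integral>\<omega>. gfun r \<kappa> \<omega> \<partial>\<mu>) \<le> blockH A \<mu> (Suc r) - blockH A \<mu> r + \<epsilon>"
proof -
  have neA: "A \<noteq> {}" using ex_seq by (auto simp: seqs_def)
  then have cA: "card A > 0" using finA by (simp add: card_gt_0_iff)
  define p where "p = (\<lambda>xs. prob {\<omega>\<in>space \<mu>. pre (Suc r) \<omega> = xs})"
  define q where "q = (\<lambda>u. prob {\<omega>\<in>space \<mu>. pre r \<omega> = u})"
  define c where "c = (\<lambda>xs. p xs / q (tl xs))"
  have sump: "(\<Sum>x\<in>A. p (x # u)) = q u" if "u \<in> words A r" for u
    using sum_first_letter[OF that] by (simp add: p_def q_def)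
  obtain M :: nat where M: "real M > real (card A) / \<epsilon>" using reals_Archimedean2 by blast
  then have M0: "real M > 0" using assms by (meson divide_nonneg_pos less_le_trans not_less of_nat_0_le_iff order_le_less_trans)
  define D where "D = real M + real (card A)"
  have D: "D > 0" using M0 by (simp add: D_def)
  have lnD: "ln (D / real M) \<le> \<epsilon>"
  proof -
    have "ln (D / real M) \<le> D / real M - 1" using D M0 by (intro ln_le_minus_one) auto
    also have "\<dots> = real (card A) / real M" using M0 by (simp add: D_def field_simps)
    also have "\<dots> \<le> \<epsilon>" using M M0 assms by (simp add: field_simps)
    finally show ?thesis .
  qed
  \<comment> \<open>Adding 1 to the integer part keeps every weight positive; the denominator
    \<open>D = M + card A\<close> absorbs these \<open>card A\<close> units, so the weights stay
    substochastic. The loss is \<open>ln (D / M)\<close>, which explains the choice of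
    \<open>M\<close>.\<close>
  define \<kappa> where "\<kappa> = restrict (\<lambda>xs. (of_int \<lfloor>real M * c xs\<rfloor> + 1) / D) (words A (Suc r))"
  have c0: "0 \<le> c xs" for xs by (simp add: c_def p_def q_def)
  have pos: "of_int \<lfloor>real M * c xs\<rfloor> + 1 > (0::real)" for xs
  proof -
    have "0 \<le> real M * c xs" using c0 M0 by simp
    then have "(0::int) \<le> \<lfloor>real M * c xs\<rfloor>" by simp
    then have "(0::real) \<le> of_int \<lfloor>real M * c xs\<rfloor>" by (simp only: of_int_0_le_iff)
    then show ?thesis by linarith
  qed
  have ratD: "D \<in> \<rat>" by (simp add: D_def)
  have adm: "adm A r \<kappa>"
    unfolding adm_def
  proof (intro conjI ballI)
    show "\<kappa> \<in> extensional (words A (Suc r))" by (simp add: \<kappa>_def)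
    fix xs assume "xs \<in> words A (Suc r)"
    then show "0 < \<kappa> xs" "\<kappa> xs \<in> \<rat>" using pos[of xs] D ratD by (auto simp: \<kappa>_def)
  next
    fix u assume u: "u \<in> words A r"
    have "(\<Sum>x\<in>A. \<kappa> (x # u)) = (\<Sum>x\<in>A. (of_int \<lfloor>real M * c (x # u)\<rfloor> + 1) / D)"
      using u by (intro sum.cong) (auto simp: \<kappa>_def words_Suc)
    also have "\<dots> \<le> (\<Sum>x\<in>A. (real M * c (x # u) + 1) / D)"
      using D by (intro sum_mono divide_right_mono) auto
    also have "\<dots> = (real M * (\<Sum>x\<in>A. c (x # u)) + real (card A)) / D"
      by (simp add: sum_divide_distrib[symmetric] sum.distrib sum_distrib_left)
    also have "\<dots> \<le> (real M * 1 + real (card A)) / D"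
    proof -
      \<comment> \<open>The quotient is 1, or 0 when \<open>q u = 0\<close>; both are at most
        1.\<close>
      have "(\<Sum>x\<in>A. c (x # u)) = q u / q u"
        unfolding c_def using sump[OF u] by (simp add: sum_divide_distrib[symmetric])
      then have "(\<Sum>x\<in>A. c (x # u)) \<le> 1" by simp
      then show ?thesis using D M0 by (intro divide_right_mono add_right_mono mult_left_mono) auto
    qed
    also have "\<dots> = 1" using D by (simp add: D_def)
    finally show "(\<Sum>x\<in>A. \<kappa> (x # u)) \<le> 1" .
  qed
  have tm: "p xs * (- ln (\<kappa> xs)) \<le> - (p xs * ln (p xs)) + p xs * ln (q (tl xs)) + p xs * \<epsilon>"
    if xs: "xs \<in> words A (Suc r)" for xs
  proof (cases "p xs = 0")
    case False
    then have p: "p xs > 0" by (simp add: p_def zero_less_measure_iff)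
    obtain x u where xu: "xs = x # u" "x \<in> A" "u \<in> words A r" using xs unfolding words_Suc by auto
    have "p xs \<le> q u" using sump[OF xu(3)] member_le_sum[of x A "\<lambda>x. p (x # u)"] xu finA
      by (auto simp: p_def)
    then have q: "q (tl xs) > 0" using p xu by simp
    have cp: "c xs > 0" using p q by (simp add: c_def)
    have "real M * c xs / D \<le> \<kappa> xs"
      unfolding \<kappa>_def using xs D by (auto intro!: divide_right_mono)
    then have "ln (real M * c xs / D) \<le> ln (\<kappa> xs)"
      using M0 cp D adm_pos[OF adm xs] by (subst ln_le_cancel_iff) auto
    moreover have "ln (real M * c xs / D) = ln (c xs) - ln (D / real M)"
      using M0 cp D by (simp add: ln_div ln_mult)
    moreover have "ln (c xs) = ln (p xs) - ln (q (tl xs))" using p q by (simp add: c_def ln_div)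
    ultimately have "- ln (\<kappa> xs) \<le> - ln (p xs) + ln (q (tl xs)) + \<epsilon>" using lnD by linarith
    then have "p xs * (- ln (\<kappa> xs)) \<le> p xs * (- ln (p xs) + ln (q (tl xs)) + \<epsilon>)"
      using p by (intro mult_left_mono) auto
    then show ?thesis by (simp add: algebra_simps)
  qed simp
  have "(\<integral>\<omega>. gfun r \<kappa> \<omega> \<partial>\<mu>) = (\<Sum>xs\<in>words A (Suc r). p xs * (- ln (\<kappa> xs)))"
    unfolding gfun_def p_def by (rule finite_rv_integral(2)[OF pre_meas]) (simp add: finA)
  also have "\<dots> \<le> (\<Sum>xs\<in>words A (Suc r). - (p xs * ln (p xs)) + p xs * ln (q (tl xs)) + p xs * \<epsilon>)"
    by (intro sum_mono tm)
  also have "\<dots> = blockH A \<mu> (Suc r) + (\<Sum>xs\<in>words A (Suc r). p xs * ln (q (tl xs))) + \<epsilon>"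
  proof -
    have "(\<Sum>xs\<in>words A (Suc r). p xs * \<epsilon>) = \<epsilon>"
      using sum_finite_rv[OF pre_meas finite_words[OF finA], of "Suc r"]
      by (simp add: sum_distrib_right[symmetric] p_def)
    then show ?thesis by (simp only: sum.distrib blockH_def entH_def p_def)
  qed
  also have "(\<Sum>xs\<in>words A (Suc r). p xs * ln (q (tl xs))) = (\<Sum>u\<in>words A r. q u * ln (q u))"
    unfolding sum_words_Suc by (subst sum.swap) (simp add: sum_distrib_right[symmetric] sump)
  also have "\<dots> = - blockH A \<mu> r"
    by (simp add: blockH_def entH_def q_def sum_negf)
  finally show ?thesis using adm by auto
qed

text \<open>The first \<open>R\<close> increments of the block entropy telescope from 0, so one of
  them is at most their average; the weight is taken at that order.\<close>

lemma gfun_le_blockH: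
  assumes "0 < R" "0 < \<epsilon>"
  shows "\<exists>r \<kappa>. adm A r \<kappa> \<and> (\<integral>\<omega>. gfun r \<kappa> \<omega> \<partial>\<mu>) \<le> blockH A \<mu> R / real R + \<epsilon>"
proof -
  have "\<exists>r<R. blockH A \<mu> (Suc r) - blockH A \<mu> r \<le> blockH A \<mu> R / real R"
  proof (rule ccontr)
    assume "\<not> ?thesis"
    then have "(\<Sum>r<R. blockH A \<mu> R / real R) < (\<Sum>r<R. blockH A \<mu> (Suc r) - blockH A \<mu> r)"
      using assms by (intro sum_strict_mono) auto
    then show False using assms by (simp add: sum_lessThan_telescope blockH_0)
  qed
  then show ?thesis using rounded_conditional_weight[OF assms(2)] by (metis add_right_mono order_trans)
qed

lemma hs_le: "0 < R \<Longrightarrow> hs A \<mu> \<le> blockH A \<mu> R / real R"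
proof -
  assume "0 < R"
  then obtain n where n: "R = Suc n" by (cases R) auto
  show ?thesis unfolding hs_def n
    by (rule cINF_lower) (auto intro!: bdd_belowI2[of _ 0] blockH_nonneg divide_nonneg_nonneg)
qed

lemma hs_nonneg: "0 \<le> hs A \<mu>"
  unfolding hs_def by (rule cINF_greatest) (auto intro!: blockH_nonneg divide_nonneg_nonneg)

text \<open>Divide \<open>blockH_le_gfun\<close> by the block length; its boundary term is constant
  and vanishes in the limit.\<close>

lemma hs_le_gfun:
  assumes adm: "adm A r \<kappa>"
  shows "hs A \<mu> \<le> (\<integral>\<omega>. gfun r \<kappa> \<omega> \<partial>\<mu>)"
proof (rule LIMSEQ_le_const)
  show "(\<lambda>n. (\<integral>\<omega>. gfun r \<kappa> \<omega> \<partial>\<mu>) + (real r * gbound A r \<kappa>) * inverse (real (Suc n))) \<longlonglongrightarrow> (\<integral>\<omega>. gfun r \<kappa> \<omega> \<partial>\<mu>)"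
    using tendsto_add[OF tendsto_const tendsto_mult_right_zero[OF LIMSEQ_inverse_real_of_nat]] by fastforce
  have "hs A \<mu> \<le> (\<integral>\<omega>. gfun r \<kappa> \<omega> \<partial>\<mu>) + (real r * gbound A r \<kappa>) * inverse (real (Suc n))" for n
  proof -
    have "hs A \<mu> \<le> blockH A \<mu> (Suc n) / real (Suc n)" by (rule hs_le) simp
    also have "\<dots> \<le> (real (Suc n) * (\<integral>\<omega>. gfun r \<kappa> \<omega> \<partial>\<mu>) + real r * gbound A r \<kappa>) / real (Suc n)"
      by (intro divide_right_mono blockH_le_gfun adm) auto
    also have "\<dots> = (\<integral>\<omega>. gfun r \<kappa> \<omega> \<partial>\<mu>) + (real r * gbound A r \<kappa>) * inverse (real (Suc n))"
      by (simp add: field_simps)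
    finally show ?thesis .
  qed
  then show "\<exists>N. \<forall>n\<ge>N. hs A \<mu> \<le> (\<integral>\<omega>. gfun r \<kappa> \<omega> \<partial>\<mu>) + (real r * gbound A r \<kappa>) * inverse (real (Suc n))"
    by auto
qed

lemma hs_approx:
  assumes "0 < \<epsilon>"
  shows "\<exists>r \<kappa>. adm A r \<kappa> \<and> (\<integral>\<omega>. gfun r \<kappa> \<omega> \<partial>\<mu>) < hs A \<mu> + \<epsilon>"
proof -
  have "hs A \<mu> < hs A \<mu> + \<epsilon>/2" using assms by simp
  then obtain n where n: "blockH A \<mu> (Suc n) / real (Suc n) < hs A \<mu> + \<epsilon>/2"
    unfolding hs_def by (subst (asm) cINF_less_iff) (auto intro!: bdd_belowI2[of _ 0] blockH_nonneg divide_nonneg_nonneg)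
  obtain r \<kappa> where "adm A r \<kappa>" "(\<integral>\<omega>. gfun r \<kappa> \<omega> \<partial>\<mu>) \<le> blockH A \<mu> (Suc n) / real (Suc n) + \<epsilon>/2"
    using gfun_le_blockH[of "Suc n" "\<epsilon>/2"] assms by auto
  then show ?thesis using n by force
qed

text \<open>The infimum bounds the sequence from below. From above, a single nearly optimal weight
  bounds all block entropies by a linear function whose slope is close to \<open>hs\<close>.\<close>

lemma hs_lim: "(\<lambda>n. blockH A \<mu> (Suc n) / real (Suc n)) \<longlonglongrightarrow> hs A \<mu>"
proof (rule LIMSEQ_I)
  fix e :: real assume e: "0 < e"
  obtain r \<kappa> where g: "adm A r \<kappa>" "(\<integral>\<omega>. gfun r \<kappa> \<omega> \<partial>\<mu>) < hs A \<mu> + e/2"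
    using hs_approx[of "e/2"] e by auto
  have "(\<lambda>n. (real r * gbound A r \<kappa>) * inverse (real (Suc n))) \<longlonglongrightarrow> 0"
    by (rule tendsto_mult_right_zero[OF LIMSEQ_inverse_real_of_nat])
  then obtain N where N: "\<And>n. n \<ge> N \<Longrightarrow> \<bar>(real r * gbound A r \<kappa>) * inverse (real (Suc n))\<bar> < e/2"
    using LIMSEQ_D[of "\<lambda>n. (real r * gbound A r \<kappa>) * inverse (real (Suc n))" 0 "e/2"] e
    unfolding real_norm_def by (metis diff_zero half_gt_zero)
  have "norm (blockH A \<mu> (Suc n) / real (Suc n) - hs A \<mu>) < e" if n: "n \<ge> N" for n
  proof -
    have "blockH A \<mu> (Suc n) / real (Suc n) \<le> (real (Suc n) * (\<integral>\<omega>. gfun r \<kappa> \<omega> \<partial>\<mu>) + real r * gbound A r \<kappa>) / real (Suc n)"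
      by (intro divide_right_mono blockH_le_gfun g) auto
    also have "\<dots> = (\<integral>\<omega>. gfun r \<kappa> \<omega> \<partial>\<mu>) + (real r * gbound A r \<kappa>) * inverse (real (Suc n))"
      by (simp add: field_simps)
    finally show ?thesis using N[OF n] g(2) hs_le[of "Suc n"] by (auto simp: real_norm_def)
  qed
  then show "\<exists>N. \<forall>n\<ge>N. norm (blockH A \<mu> (Suc n) / real (Suc n) - hs A \<mu>) < e" by auto
qed

end

section \<open>Kolmogorov-Sinai entropy of the shift\<close>

lemma sum_words_prod:
  fixes f :: "nat \<Rightarrow> 'a \<Rightarrow> real"
  assumes "finite A"
  shows "(\<Sum>w\<in>words A n. \<Prod>t<n. f t (w ! t)) = (\<Prod>t<n. \<Sum>b\<in>A. f t b)"
proof (induction n arbitrary: f)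
  case (Suc n)
  have "(\<Sum>w\<in>words A (Suc n). \<Prod>t<Suc n. f t (w ! t)) = (\<Sum>b\<in>A. \<Sum>w\<in>words A n. f 0 b * (\<Prod>t<n. f (Suc t) (w ! t)))"
    unfolding sum_words_Suc prod.lessThan_Suc_shift by simp
  also have "\<dots> = (\<Sum>b\<in>A. f 0 b) * (\<Prod>t<n. \<Sum>b\<in>A. f (Suc t) b)"
    by (simp add: sum_distrib_left[symmetric] sum_distrib_right[symmetric] Suc[of "\<lambda>t. f (Suc t)"])
  finally show ?case unfolding prod.lessThan_Suc_shift by simp
qed simp

lemma sets_shiftM: "sets (shiftM A) = sigma_sets (seqs A) {{f \<in> seqs A. f i \<in> X} | i X. X \<subseteq> A}"
proof -
  have *: "(\<Pi>\<^sub>E i\<in>(UNIV::nat set). space (count_space A)) = seqs A"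
    by (auto simp: seqs_def PiE_iff)
  show ?thesis unfolding shiftM_def sets_PiM_single by (simp only: * sets_count_space Pow_iff UNIV_I simp_thms)
qed

context shift_measure begin

text \<open>Approximation in measure by cylinder sets. The set \<open>W\<close> of words is
  arbitrary, so passing to a complement only replaces \<open>W\<close> by
  \<open>- W\<close>.\<close>

definition approximable :: "(nat \<Rightarrow> 'a) set \<Rightarrow> bool" where
  "approximable S \<longleftrightarrow> (\<forall>e>0. \<exists>n W. prob {\<omega>\<in>space \<mu>. (\<omega> \<in> S) \<noteq> (pre n \<omega> \<in> W)} \<le> e)"

lemma approximable_lift:
  assumes "approximable S" "0 < e"
  shows "\<exists>N. \<forall>n\<ge>N. \<exists>W. prob {\<omega>\<in>space \<mu>. (\<omega> \<in> S) \<noteq> (pre n \<omega> \<in> W)} \<le> e"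
proof -
  obtain N W where W: "prob {\<omega>\<in>space \<mu>. (\<omega> \<in> S) \<noteq> (pre N \<omega> \<in> W)} \<le> e"
    using assms by (auto simp: approximable_def)
  have "prob {\<omega>\<in>space \<mu>. (\<omega> \<in> S) \<noteq> (pre n \<omega> \<in> {xs. take N xs \<in> W})} \<le> e" if "n \<ge> N" for n
    using W that by (simp add: take_pre)
  then show ?thesis by blast
qed

lemma approx_sets:
  assumes "S \<in> sets \<mu>" shows "{\<omega>\<in>space \<mu>. (\<omega> \<in> S) \<noteq> (pre n \<omega> \<in> W)} \<in> events"
proof -
  have "{\<omega>\<in>space \<mu>. (\<omega> \<in> S) \<noteq> (pre n \<omega> \<in> W)} =
    (S - {\<omega>\<in>space \<mu>. pre n \<omega> \<in> W}) \<union> ({\<omega>\<in>space \<mu>. pre n \<omega> \<in> W} - S)"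
    using sets.sets_into_space[OF assms] by auto
  then show ?thesis using assms measurable_pre_pred[OF sets_mu finA] by auto
qed

text \<open>Continuity of the measure discards all but finitely many sets. These are approximated at
  a common depth \<open>n\<close>, which is possible because an approximation survives any increase
  of the depth.\<close>

lemma approximable_Union:
  fixes a :: "nat \<Rightarrow> (nat \<Rightarrow> 'a) set"
  assumes a: "\<And>i. a i \<in> sets \<mu>" "\<And>i. approximable (a i)"
  shows "approximable (\<Union>i. a i)"
  unfolding approximable_def
proof (intro allI impI)
  fix e :: real assume e: "0 < e"
  let ?U = "\<Union>i. a i"
  have "(\<lambda>k. prob (\<Union>i<k. a i)) \<longlonglongrightarrow> prob (\<Union>k. \<Union>i<k. a i)"
    using a(1) by (intro finite_Lim_measure_incseq) (auto simp: incseq_def intro: order_less_le_trans)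
  also have "(\<Union>k. \<Union>i<k. a i) = ?U" by auto
  finally have "(\<lambda>k. prob (\<Union>i<k. a i)) \<longlonglongrightarrow> prob ?U" .
  from LIMSEQ_D[OF this, of "e/2"] e obtain k where "\<bar>prob (\<Union>i<k. a i) - prob ?U\<bar> < e/2"
    by (auto simp: real_norm_def)
  moreover have "prob (?U - (\<Union>i<k. a i)) = prob ?U - prob (\<Union>i<k. a i)"
    using a(1) by (intro finite_measure_Diff) auto
  ultimately have k: "prob (?U - (\<Union>i<k. a i)) \<le> e/2" by linarith
  define e' where "e' = e / (2 * real (Suc k))"
  have e': "e' > 0" using e by (simp add: e'_def)
  have "\<forall>i. \<exists>N. \<forall>n\<ge>N. \<exists>W. prob {\<omega>\<in>space \<mu>. (\<omega> \<in> a i) \<noteq> (pre n \<omega> \<in> W)} \<le> e'"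
    by (intro allI approximable_lift[OF a(2) e'])
  from choice[OF this] obtain N where
    N: "\<And>i n. n \<ge> N i \<Longrightarrow> \<exists>W. prob {\<omega>\<in>space \<mu>. (\<omega> \<in> a i) \<noteq> (pre n \<omega> \<in> W)} \<le> e'"
    by auto
  define n where "n = (\<Sum>i<k. N i)"
  have "\<exists>W. prob {\<omega>\<in>space \<mu>. (\<omega> \<in> a i) \<noteq> (pre n \<omega> \<in> W)} \<le> e'" if "i < k" for i
    using that by (intro N) (auto simp: n_def intro!: member_le_sum)
  then have "\<forall>i\<in>{..<k}. \<exists>W. prob {\<omega>\<in>space \<mu>. (\<omega> \<in> a i) \<noteq> (pre n \<omega> \<in> W)} \<le> e'" by blast
  from bchoice[OF this] obtain W where
    W: "\<And>i. i < k \<Longrightarrow> prob {\<omega>\<in>space \<mu>. (\<omega> \<in> a i) \<noteq> (pre n \<omega> \<in> W i)} \<le> e'"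
    by auto
  let ?B = "\<lambda>i. {\<omega>\<in>space \<mu>. (\<omega> \<in> a i) \<noteq> (pre n \<omega> \<in> W i)}"
  have D: "?U - (\<Union>i<k. a i) \<in> events"
    using a(1) by (intro sets.Diff sets.countable_UN sets.finite_UN) auto
  have E: "(\<Union>i<k. ?B i) \<in> events"
    by (intro sets.finite_UN approx_sets a(1)) auto
  have "prob {\<omega>\<in>space \<mu>. (\<omega> \<in> ?U) \<noteq> (pre n \<omega> \<in> (\<Union>i<k. W i))} \<le> prob ((?U - (\<Union>i<k. a i)) \<union> (\<Union>i<k. ?B i))"
    by (rule finite_measure_mono[OF _ sets.Un[OF D E]]) auto
  also have "\<dots> \<le> prob (?U - (\<Union>i<k. a i)) + prob (\<Union>i<k. ?B i)"
    by (rule measure_Un_le[OF D E])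
  also have "\<dots> \<le> e/2 + (\<Sum>i<k. prob (?B i))"
    using k by (intro add_mono finite_measure_subadditive_finite image_subsetI approx_sets a(1)) auto
  also have "\<dots> \<le> e/2 + (\<Sum>i<k. e')"
    using W by (intro add_mono sum_mono) auto
  also have "\<dots> \<le> e" using e by (simp add: e'_def field_simps)
  finally show "\<exists>n W. prob {\<omega>\<in>space \<mu>. (\<omega> \<in> ?U) \<noteq> (pre n \<omega> \<in> W)} \<le> e" by blast
qed

text \<open>Induction over the generated sigma-algebra: a generator restricts one coordinate and is
  itself a cylinder set.\<close>

lemma sets_approximable:
  assumes "S \<in> sets \<mu>" shows "approximable S"
proof -
  have "S \<in> sigma_sets (seqs A) {{f \<in> seqs A. f i \<in> X} | i X. X \<subseteq> A}"
    using assms by (simp add: sets_mu sets_shiftM)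
  then show ?thesis
  proof (induction rule: sigma_sets.induct)
    case (Basic S)
    then obtain i X where S: "S = {f \<in> seqs A. f i \<in> X}" by auto
    have "{\<omega>\<in>space \<mu>. (\<omega> \<in> S) \<noteq> (pre (Suc i) \<omega> \<in> {xs. xs ! i \<in> X})} = {}"
      by (auto simp: S space_mu)
    note eq = this
    have "prob {\<omega>\<in>space \<mu>. (\<omega> \<in> S) \<noteq> (pre (Suc i) \<omega> \<in> {xs. xs ! i \<in> X})} \<le> e" if "0 < e" for e
      unfolding eq using that by simp
    then show ?case unfolding approximable_def by blast
  next
    case Empty
    have "prob {\<omega>\<in>space \<mu>. (\<omega> \<in> {}) \<noteq> (pre 0 \<omega> \<in> {})} \<le> e" if "0 < e" for e
      using that by simp
    then show ?case unfolding approximable_def by blast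
  next
    case (Compl S)
    have "{\<omega>\<in>space \<mu>. (\<omega> \<in> seqs A - S) \<noteq> (pre n \<omega> \<in> - W)} = {\<omega>\<in>space \<mu>. (\<omega> \<in> S) \<noteq> (pre n \<omega> \<in> W)}" for n W
      by (auto simp: space_mu)
    note eq = this
    show ?case unfolding approximable_def
    proof (intro allI impI)
      fix e :: real assume "0 < e"
      then obtain n W where "prob {\<omega>\<in>space \<mu>. (\<omega> \<in> S) \<noteq> (pre n \<omega> \<in> W)} \<le> e"
        using Compl.IH unfolding approximable_def by blast
      then show "\<exists>n W. prob {\<omega>\<in>space \<mu>. (\<omega> \<in> seqs A - S) \<noteq> (pre n \<omega> \<in> W)} \<le> e"
        using eq[of n W] by (intro exI[of _ n] exI[of _ "- W"]) simp
    qed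
  next
    case (Union a)
    then show ?case by (intro approximable_Union) (auto simp: sets_mu sets_shiftM)
  qed
qed

end

text \<open>Every finite partition induces, through its itineraries, a shift-invariant measure over the
  alphabet \<open>\<xi>\<close>. Its entropy rate is the entropy of the partition.\<close>

locale partition_process = shift_measure +
  fixes \<xi> :: "(nat \<Rightarrow> 'a) set set"
  assumes part: "finite_partition \<mu> \<xi>"
begin

definition piece :: "(nat \<Rightarrow> 'a) \<Rightarrow> (nat \<Rightarrow> 'a) set" where
  "piece \<omega> = (THE B. B \<in> \<xi> \<and> \<omega> \<in> B)"

definition itin :: "(nat \<Rightarrow> 'a) \<Rightarrow> nat \<Rightarrow> (nat \<Rightarrow> 'a) set" where
  "itin \<omega> = (\<lambda>n. piece ((shift ^^ n) \<omega>))"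

definition proc :: "(nat \<Rightarrow> (nat \<Rightarrow> 'a) set) measure" where
  "proc = distr \<mu> (shiftM \<xi>) itin"

lemma fin_xi: "finite \<xi>" and xi_sets: "B \<in> \<xi> \<Longrightarrow> B \<in> sets \<mu>" and Un_xi: "\<Union>\<xi> = seqs A"
  using part by (auto simp: finite_partition_def space_mu)

lemma piece_eq:
  assumes "B \<in> \<xi>" "\<omega> \<in> B" shows "piece \<omega> = B"
  unfolding piece_def
proof (rule the_equality)
  fix C assume C: "C \<in> \<xi> \<and> \<omega> \<in> C"
  show "C = B" using part assms C unfolding finite_partition_def disjoint_def by blast
qed (use assms in auto)

lemma piece_iff: "\<omega> \<in> seqs A \<Longrightarrow> B \<in> \<xi> \<Longrightarrow> piece \<omega> = B \<longleftrightarrow> \<omega> \<in> B"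
  using piece_eq Un_xi by (metis UnionE)

lemma piece_in: "\<omega> \<in> seqs A \<Longrightarrow> piece \<omega> \<in> \<xi>"
  using piece_eq Un_xi by (metis UnionE)

lemma mem_piece: "\<omega> \<in> seqs A \<Longrightarrow> \<omega> \<in> piece \<omega>"
  using piece_eq Un_xi by (metis UnionE)

lemma piece_meas: "piece \<in> measurable \<mu> (count_space \<xi>)"
  unfolding measurable_count_space_eq2[OF fin_xi]
proof safe
  fix \<omega> assume "\<omega> \<in> space \<mu>" then show "piece \<omega> \<in> \<xi>" by (simp add: space_mu piece_in)
next
  fix B assume B: "B \<in> \<xi>"
  have "piece -` {B} \<inter> space \<mu> = B"
    using B piece_eq[OF B] mem_piece Un_xi by (auto simp: space_mu)
  then show "piece -` {B} \<inter> space \<mu> \<in> events" using xi_sets[OF B] by simp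
qed

lemma itin_meas: "itin \<in> measurable \<mu> (shiftM \<xi>)"
  unfolding shiftM_def itin_def
proof (rule measurable_PiM_single')
  have s: "(shift ^^ n) \<in> measurable \<mu> \<mu>" for n
    using measurable_shift_pow[of n A] by (simp add: measurable_cong_sets[OF sets_mu sets_mu])
  show "(\<lambda>\<omega>. piece ((shift ^^ n) \<omega>)) \<in> measurable \<mu> (count_space \<xi>)" for n
    by (rule measurable_compose[OF s piece_meas])
qed (auto simp: space_mu piece_in)

lemma itin_shift: "itin (shift \<omega>) = shift (itin \<omega>)"
  by (auto simp: itin_def shift_def[of "\<lambda>n. piece ((shift ^^ n) \<omega>)"] funpow_Suc_right simp del: funpow.simps)

lemma proc_inv: "proc \<in> inv_meas \<xi>"
  unfolding inv_meas_def
proof safe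
  show "prob_space proc" unfolding proc_def by (rule prob_space_distr[OF itin_meas])
  show "x \<in> sets proc \<Longrightarrow> x \<in> sets (shiftM \<xi>)" "x \<in> sets (shiftM \<xi>) \<Longrightarrow> x \<in> sets proc" for x
    by (auto simp: proc_def)
  have "distr proc (shiftM \<xi>) shift = distr \<mu> (shiftM \<xi>) (shift \<circ> itin)"
    unfolding proc_def by (rule distr_distr[OF measurable_shift itin_meas])
  also have "shift \<circ> itin = itin \<circ> shift" by (auto simp: itin_shift)
  also have "distr \<mu> (shiftM \<xi>) (itin \<circ> shift) = distr (distr \<mu> (shiftM A) shift) (shiftM \<xi>) itin"
    using itin_meas measurable_shift[of A]
    by (subst distr_distr) (auto simp: measurable_cong_sets[OF sets_mu refl])
  also have "\<dots> = proc" using inv by (simp add: inv_meas_def proc_def)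
  finally show "distr proc (shiftM \<xi>) shift = proc" .
qed

sublocale proc: shift_measure \<xi> proc
  by unfold_locales (auto simp: fin_xi proc_inv)

lemma measure_proc:
  "measure proc {\<sigma>\<in>space proc. pre n \<sigma> = xs} = prob {\<omega>\<in>space \<mu>. pre n (itin \<omega>) = xs}"
proof -
  have "{\<sigma>\<in>space proc. pre n \<sigma> = xs} \<in> sets (shiftM \<xi>)"
    using measurable_pre_pred[OF proc.sets_mu fin_xi, of "\<lambda>ys. ys = xs"] by (simp add: proc.sets_mu)
  then have "measure proc {\<sigma>\<in>space proc. pre n \<sigma> = xs} = prob (itin -` {\<sigma>\<in>space proc. pre n \<sigma> = xs} \<inter> space \<mu>)"
    unfolding proc_def by (intro measure_distr itin_meas) (simp add: proc_def)
  also have "itin -` {\<sigma>\<in>space proc. pre n \<sigma> = xs} \<inter> space \<mu> = {\<omega>\<in>space \<mu>. pre n (itin \<omega>) = xs}"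
    using measurable_space[OF itin_meas] by (auto simp: proc_def)
  finally show ?thesis .
qed

lemma blockH_proc: "blockH \<xi> proc n = entH \<mu> (\<lambda>\<omega>. pre n (itin \<omega>)) (words \<xi> n)"
  by (simp add: blockH_def entH_def measure_proc)

text \<open>Different choice functions can define the same atom only if it is empty, and then its
  entropy term is zero. Hence the sum over atoms may be reindexed by functions, and these correspond
  to words over \<xi>.\<close>

lemma partition_entropy_join: "partition_entropy \<mu> (join_partition \<mu> shift \<xi> n) = blockH \<xi> proc n"
proof -
  let ?\<Phi> = "\<lambda>f. space \<mu> \<inter> (\<Inter>k\<in>{..<n}. (shift ^^ k) -` f k)"
  let ?\<eta> = "\<lambda>x. - (x * ln x) :: real"
  let ?P = "PiE {..<n} (\<lambda>_. \<xi>)"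
  have eq: "f k = piece ((shift ^^ k) \<omega>)" if "f \<in> ?P" "\<omega> \<in> ?\<Phi> f" "k < n" for f k \<omega>
    using that by (auto simp: PiE_iff intro!: piece_eq[symmetric])
  have "partition_entropy \<mu> (join_partition \<mu> shift \<xi> n) = (\<Sum>f\<in>?P. ?\<eta> (prob (?\<Phi> f)))"
    unfolding partition_entropy_def join_partition_def
  proof (subst sum.reindex_nontrivial)
    show "finite ?P" by (intro finite_PiE) (auto simp: fin_xi)
    fix f g assume fg: "f \<in> ?P" "g \<in> ?P" "f \<noteq> g" "?\<Phi> f = ?\<Phi> g"
    have "?\<Phi> f = {}"
    proof (rule ccontr)
      assume "?\<Phi> f \<noteq> {}"
      then obtain \<omega> where w: "\<omega> \<in> ?\<Phi> f" by blast
      then have "f k = g k" if "k < n" for k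
        using eq[OF fg(1) _ that, of \<omega>] eq[OF fg(2) _ that, of \<omega>] fg(4) by auto
      then have "f = g" using fg(1,2) by (intro PiE_ext[OF fg(1,2)]) auto
      then show False using fg by simp
    qed
    then show "?\<eta> (prob (?\<Phi> f)) = 0" by simp
  qed (simp add: comp_def)
  also have "\<dots> = (\<Sum>xs\<in>words \<xi> n. ?\<eta> (prob {\<omega>\<in>space \<mu>. pre n (itin \<omega>) = xs}))"
  proof (rule sum.reindex_bij_witness[of _ "\<lambda>xs. restrict (\<lambda>k. xs ! k) {..<n}" "\<lambda>f. map f [0..<n]"])
    fix f assume f: "f \<in> ?P"
    show "restrict ((!) (map f [0..<n])) {..<n} = f"
      using f by (auto simp: PiE_iff extensional_def fun_eq_iff)
    show "map f [0..<n] \<in> words \<xi> n" using f by (auto simp: words_def PiE_iff)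
    have "piece ((shift ^^ t) \<omega>) = f t \<longleftrightarrow> (shift ^^ t) \<omega> \<in> f t" if "t < n" "\<omega> \<in> seqs A" for t \<omega>
      using f that by (intro piece_iff) auto
    then have "{\<omega>\<in>space \<mu>. pre n (itin \<omega>) = map f [0..<n]} = ?\<Phi> f"
      by (auto simp: pre_eq_list itin_def space_mu simp del: set_eq_iff)
    then show "?\<eta> (prob {\<omega>\<in>space \<mu>. pre n (itin \<omega>) = map f [0..<n]}) = ?\<eta> (prob (?\<Phi> f))"
      by simp
  next
    fix xs assume xs: "xs \<in> words \<xi> n"
    show "map (restrict ((!) xs) {..<n}) [0..<n] = xs"
      using xs by (intro nth_equalityI) (auto simp: words_def)
    show "restrict ((!) xs) {..<n} \<in> ?P" using xs by (auto simp: words_def)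
  qed
  finally show ?thesis by (simp add: blockH_proc entH_def)
qed

lemma entropy_wrt_eq: "entropy_wrt \<mu> shift \<xi> = hs \<xi> proc"
  unfolding entropy_wrt_def partition_entropy_join by (rule limI[OF proc.hs_lim])

text \<open>Itineraries are coded through the letters. Each piece is approximated by a cylinder set
  of depth \<open>m\<close>, so that \<open>m\<close> letters predict the current piece with few
  errors. Words over \<open>A\<close> are weighted by \<kappa>, and an itinerary given the word by a
  channel that trusts the predictions. Gibbs' inequality for the resulting marginal gives the bound,
  the channel costing at most \<epsilon> per step on average.\<close>

lemma hs_proc_le:
  assumes adm: "adm A r \<kappa>" and \<epsilon>: "0 < \<epsilon>"
  shows "hs \<xi> proc \<le> (\<integral>\<omega>. gfun r \<kappa> \<omega> \<partial>\<mu>) + \<epsilon>"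
proof -
  obtain y where y: "y \<in> seqs A" using ex_seq by auto
  define N where "N = real (card \<xi>)"
  have "\<xi> \<noteq> {}" using Un_xi y by auto
  then have N: "N \<ge> 1" using fin_xi by (simp add: N_def Suc_le_eq card_gt_0_iff)
  \<comment> \<open>Chosen so that a correct prediction costs
    \<open>- ln (1 - \<delta>) = \<epsilon>/2\<close>; \<open>K\<close> below is the cost of a wrong
    one.\<close>
  define \<delta> where "\<delta> = 1 - exp (- \<epsilon>/2)"
  have \<delta>: "0 < \<delta>" "\<delta> < 1" using \<epsilon> by (auto simp: \<delta>_def)
  have lnd: "- ln (1 - \<delta>) = \<epsilon>/2" by (simp add: \<delta>_def)
  define K where "K = - ln (\<delta> / N)"
  have K: "K \<ge> 0" using \<delta> N by (auto simp: K_def intro!: ln_le_zero_iff[THEN iffD2] divide_pos_pos)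
  \<comment> \<open>The error probability will be at most \<open>N * e\<close>, so wrong predictions
    add at most \<open>(K + 1) * (N * e) = \<epsilon>/2\<close> to the mean cost.\<close>
  define e where "e = \<epsilon> / (2 * (K + 1) * N)"
  have e: "e > 0" using \<epsilon> K N by (simp add: e_def)
  have "\<forall>B\<in>\<xi>. \<exists>N. \<forall>n\<ge>N. \<exists>W. prob {\<omega>\<in>space \<mu>. (\<omega> \<in> B) \<noteq> (pre n \<omega> \<in> W)} \<le> e"
    by (intro ballI approximable_lift[OF sets_approximable[OF xi_sets] e])
  from bchoice[OF this] obtain N0 where
    N0: "\<And>B n. B \<in> \<xi> \<Longrightarrow> n \<ge> N0 B \<Longrightarrow> \<exists>W. prob {\<omega>\<in>space \<mu>. (\<omega> \<in> B) \<noteq> (pre n \<omega> \<in> W)} \<le> e"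
    by auto
  define m where "m = (\<Sum>B\<in>\<xi>. N0 B)"
  have "\<exists>W. prob {\<omega>\<in>space \<mu>. (\<omega> \<in> B) \<noteq> (pre m \<omega> \<in> W)} \<le> e" if "B \<in> \<xi>" for B
    using that by (intro N0) (auto simp: m_def fin_xi intro!: member_le_sum)
  then have "\<forall>B\<in>\<xi>. \<exists>W. prob {\<omega>\<in>space \<mu>. (\<omega> \<in> B) \<noteq> (pre m \<omega> \<in> W)} \<le> e" by blast
  from bchoice[OF this] obtain W where
    W: "\<And>B. B \<in> \<xi> \<Longrightarrow> prob {\<omega>\<in>space \<mu>. (\<omega> \<in> B) \<noteq> (pre m \<omega> \<in> W B)} \<le> e"
    by auto
  \<comment> \<open>The predicted piece. If the sets \<open>W B\<close> judge every membership
    correctly, the piece containing the point is the only candidate, so the prediction is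
    right.\<close>
  define G where "G = (\<lambda>xs. SOME B. B \<in> \<xi> \<and> xs \<in> W B)"
  define bad where "bad = {\<omega>\<in>space \<mu>. piece \<omega> \<noteq> G (pre m \<omega>)}"
  have bad_sets: "bad \<in> events"
  proof -
    have "bad = space \<mu> - (\<Union>B\<in>\<xi>. (piece -` {B} \<inter> space \<mu>) \<inter> {\<omega>\<in>space \<mu>. G (pre m \<omega>) = B})"
      using piece_in by (auto simp: bad_def space_mu)
    also have "\<dots> \<in> events"
      by (intro sets.Diff sets.top sets.finite_UN sets.Int measurable_sets[OF piece_meas]
            measurable_pre_pred[OF sets_mu finA] fin_xi) auto
    finally show ?thesis .
  qed
  have "bad \<subseteq> (\<Union>B\<in>\<xi>. {\<omega>\<in>space \<mu>. (\<omega> \<in> B) \<noteq> (pre m \<omega> \<in> W B)})"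
  proof (rule subsetI, rule ccontr)
    fix \<omega> assume w: "\<omega> \<in> bad" "\<omega> \<notin> (\<Union>B\<in>\<xi>. {\<omega>\<in>space \<mu>. (\<omega> \<in> B) \<noteq> (pre m \<omega> \<in> W B)})"
    then have sp: "\<omega> \<in> seqs A" by (auto simp: bad_def space_mu)
    have iff: "\<omega> \<in> B \<longleftrightarrow> pre m \<omega> \<in> W B" if "B \<in> \<xi>" for B using w that by (auto simp: bad_def)
    have "G (pre m \<omega>) \<in> \<xi> \<and> pre m \<omega> \<in> W (G (pre m \<omega>))"
      unfolding G_def by (rule someI[of _ "piece \<omega>"]) (use sp iff[OF piece_in[OF sp]] in \<open>auto simp: piece_in mem_piece\<close>)
    then have "piece \<omega> = G (pre m \<omega>)" using iff by (intro piece_eq) auto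
    then show False using w by (simp add: bad_def)
  qed
  then have "prob bad \<le> prob (\<Union>B\<in>\<xi>. {\<omega>\<in>space \<mu>. (\<omega> \<in> B) \<noteq> (pre m \<omega> \<in> W B)})"
    by (intro finite_measure_mono sets.finite_UN approx_sets xi_sets fin_xi)
  also have "\<dots> \<le> (\<Sum>B\<in>\<xi>. prob {\<omega>\<in>space \<mu>. (\<omega> \<in> B) \<noteq> (pre m \<omega> \<in> W B)})"
    by (intro finite_measure_subadditive_finite fin_xi image_subsetI approx_sets xi_sets)
  also have "\<dots> \<le> (\<Sum>B\<in>\<xi>. e)" using W by (intro sum_mono) auto
  also have "\<dots> = N * e" by (simp add: N_def)
  finally have bad_le: "prob bad \<le> N * e" .
  \<comment> \<open>Weight of the piece \<open>b\<close> given the prediction \<open>b'\<close>.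
    Wrong pieces receive a share of \<delta> each, which keeps the weight of every itinerary
    positive.\<close>
  define k where "k = (\<lambda>(b :: (nat \<Rightarrow> 'a) set) b'. if b = b' then 1 - \<delta> else \<delta> / N :: real)"
  have k_pos: "k b b' > 0" for b b' :: "(nat \<Rightarrow> 'a) set" using \<delta> N by (auto simp: k_def)
  have k_sum: "(\<Sum>b\<in>\<xi>. k b b') \<le> 1" for b' :: "(nat \<Rightarrow> 'a) set"
  proof -
    have "(\<Sum>b\<in>\<xi>. k b b') \<le> (\<Sum>b\<in>\<xi>. \<delta> / N + (if b = b' then 1 - \<delta> else 0))"
      using \<delta> N by (intro sum_mono) (auto simp: k_def)
    also have "\<dots> \<le> \<delta> + (1 - \<delta>)"
      using fin_xi N \<delta> by (auto simp: sum.distrib N_def)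
    finally show ?thesis by simp
  qed
  define kk where "kk = (\<lambda>\<omega>. - ln (k (piece \<omega>) (G (pre m \<omega>))))"
  have kk_eq: "kk \<omega> = \<epsilon>/2 + (K - \<epsilon>/2) * indicat_real bad \<omega>" if "\<omega> \<in> seqs A" for \<omega>
    using that by (auto simp: kk_def k_def bad_def space_mu K_def lnd split: split_indicator)
  have kk_meas: "kk \<in> borel_measurable (shiftM A)"
  proof -
    have "(\<lambda>\<omega>. \<epsilon>/2 + (K - \<epsilon>/2) * indicat_real bad \<omega>) \<in> borel_measurable (shiftM A)"
      using bad_sets by (simp add: sets_mu)
    then show ?thesis by (subst measurable_cong[where g="\<lambda>\<omega>. \<epsilon>/2 + (K - \<epsilon>/2) * indicat_real bad \<omega>"])
       (auto simp: space_shiftM kk_eq)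
  qed
  have kk_bound: "\<bar>kk \<omega>\<bar> \<le> \<epsilon> + K" if "\<omega> \<in> seqs A" for \<omega>
    using \<epsilon> K by (auto simp: kk_eq[OF that] split: split_indicator)
  have kk_int: "(\<integral>\<omega>. kk \<omega> \<partial>\<mu>) \<le> \<epsilon>"
  proof -
    have "(\<integral>\<omega>. kk \<omega> \<partial>\<mu>) = (\<integral>\<omega>. \<epsilon>/2 + (K - \<epsilon>/2) * indicat_real bad \<omega> \<partial>\<mu>)"
      by (intro Bochner_Integration.integral_cong) (auto simp: space_mu kk_eq)
    also have "\<dots> = \<epsilon>/2 + (K - \<epsilon>/2) * prob bad"
      using bad_sets sets.sets_into_space[OF bad_sets]
      by (subst Bochner_Integration.integral_add)
         (auto simp: prob_space Int_absorb2 Int_absorb1 emeasure_eq_measure intro!: integrable_mult_right)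
    also have "(K - \<epsilon>/2) * prob bad \<le> (K + 1) * (N * e)"
      using bad_le K \<epsilon> by (intro mult_mono) auto
    also have "(K + 1) * (N * e) = \<epsilon>/2" using K N by (simp add: e_def divide_simps)
    finally show ?thesis by simp
  qed
  let ?S = "bsum (gfun r \<kappa>)"
  have main: "blockH \<xi> proc n \<le> real (n + m) * (\<integral>\<omega>. gfun r \<kappa> \<omega> \<partial>\<mu>) + real r * gbound A r \<kappa> + real n * \<epsilon>" for n
  proof -
    \<comment> \<open>Joint weight of an itinerary \<open>w\<close> and a word \<open>xs\<close>.
      The word has \<open>m\<close> extra letters because each prediction reads \<open>m\<close>
      letters from its own time on.\<close>
    define T where "T = (\<lambda>w xs. exp (- ?S (n + m) (app xs y)) * (\<Prod>t<n. k (w ! t) (G (take m (drop t xs)))))"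
    define Q where "Q = (\<lambda>w. \<Sum>xs\<in>words A (n + m). T w xs)"
    have T_pos: "T w xs > 0" for w xs unfolding T_def by (intro mult_pos_pos prod_pos) (auto simp: k_pos)
    have wn: "words A (n + m) \<noteq> {}" using pre_in_words[OF y] by blast
    have Q_pos: "Q w > 0" for w unfolding Q_def by (intro sum_pos) (auto simp: finA wn T_pos)
    have "(\<Sum>w\<in>words \<xi> n. Q w) = (\<Sum>xs\<in>words A (n + m). exp (- ?S (n + m) (app xs y)) *
        (\<Sum>w\<in>words \<xi> n. \<Prod>t<n. k (w ! t) (G (take m (drop t xs)))))"
      unfolding Q_def T_def by (subst sum.swap) (simp add: sum_distrib_left)
    also have "\<dots> \<le> (\<Sum>xs\<in>words A (n + m). exp (- ?S (n + m) (app xs y)) * 1)"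
    proof (intro sum_mono mult_left_mono)
      fix xs
      show "(\<Sum>w\<in>words \<xi> n. \<Prod>t<n. k (w ! t) (G (take m (drop t xs)))) \<le> 1"
        unfolding sum_words_prod[OF fin_xi, where f = "\<lambda>t b. k b (G (take m (drop t xs)))"]
        by (intro prod_le_1) (auto intro!: k_sum sum_nonneg less_imp_le[OF k_pos])
    qed auto
    also have "\<dots> \<le> 1" using kraft[OF adm finA y] by simp
    finally have Q_sum: "(\<Sum>w\<in>words \<xi> n. Q w) \<le> 1" .
    have X: "(\<lambda>\<omega>. pre n (itin \<omega>)) \<in> measurable \<mu> (count_space (words \<xi> n))"
      by (rule measurable_compose[OF itin_meas sets_M_words[OF refl fin_xi]])
    have "blockH \<xi> proc n \<le> (\<integral>\<omega>. - ln (Q (pre n (itin \<omega>))) \<partial>\<mu>)"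
      unfolding blockH_proc by (rule gibbs_ineq[OF X]) (use Q_pos Q_sum fin_xi in \<open>auto intro: less_imp_le\<close>)
    also have "\<dots> \<le> (\<integral>\<omega>. ?S (n + m) \<omega> + real r * gbound A r \<kappa> + bsum kk n \<omega> \<partial>\<mu>)"
    proof (rule integral_mono)
      show "integrable \<mu> (\<lambda>\<omega>. - ln (Q (pre n (itin \<omega>))))"
        by (rule finite_rv_integral(1)[OF X]) (use fin_xi in auto)
      show "integrable \<mu> (\<lambda>\<omega>. ?S (n + m) \<omega> + real r * gbound A r \<kappa> + bsum kk n \<omega>)"
        using integral_bsum(1)[OF inv gfun_measurable[OF finA] gfun_abs_le[OF adm finA]]
          integral_bsum(1)[OF inv kk_meas kk_bound] by simp
      fix \<omega> assume "\<omega> \<in> space \<mu>"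
      then have \<omega>: "\<omega> \<in> seqs A" by (simp add: space_mu)
      let ?xs = "pre (n + m) \<omega>" let ?w = "pre n (itin \<omega>)"
      \<comment> \<open>Of the sum over all words, only the word actually read is kept.\<close>
      have "T ?w ?xs \<le> Q ?w" unfolding Q_def
        using \<omega> finA by (intro member_le_sum) (auto intro: less_imp_le[OF T_pos])
      then have "- ln (Q ?w) \<le> - ln (T ?w ?xs)" using T_pos Q_pos by (simp add: ln_le_cancel_iff)
      also have "\<dots> = ?S (n + m) (app ?xs y) + (\<Sum>t<n. - ln (k (?w ! t) (G (take m (drop t ?xs)))))"
        unfolding T_def using k_pos by (subst ln_mult_pos) (auto intro!: prod_pos ln_prod simp: sum_negf less_imp_neq[OF k_pos, symmetric])
      also have "(\<Sum>t<n. - ln (k (?w ! t) (G (take m (drop t ?xs))))) = bsum kk n \<omega>"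
        unfolding bsum_def kk_def
      proof (intro sum.cong refl arg_cong[where f="\<lambda>x. - ln x"] arg_cong2[where f=k] arg_cong[where f=G])
        fix t assume t: "t \<in> {..<n}"
        show "?w ! t = piece ((shift ^^ t) \<omega>)" using t by (simp add: itin_def)
        show "take m (drop t ?xs) = pre m ((shift ^^ t) \<omega>)"
          using t by (auto simp: pre_shift drop_take[symmetric] take_drop take_pre add.commute)
      qed
      also have "?S (n + m) (app ?xs y) \<le> ?S (n + m) \<omega> + real r * gbound A r \<kappa>"
      proof (rule bsum_gfun_tail[OF adm finA])
        show "pre (n + m) (app ?xs y) = pre (n + m) \<omega>" using pre_app[of ?xs y] by simp
      qed (use \<omega> y in \<open>auto intro: app_seqs[of _ _ "n+m"]\<close>)
      finally show "- ln (Q ?w) \<le> ?S (n + m) \<omega> + real r * gbound A r \<kappa> + bsum kk n \<omega>" by simp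
    qed
    also have "\<dots> = real (n + m) * (\<integral>\<omega>. gfun r \<kappa> \<omega> \<partial>\<mu>) + real r * gbound A r \<kappa> + real n * (\<integral>\<omega>. kk \<omega> \<partial>\<mu>)"
      using integral_bsum[OF inv gfun_measurable[OF finA] gfun_abs_le[OF adm finA], of "n+m"]
          integral_bsum[OF inv kk_meas kk_bound, of n] by (simp add: prob_space)
    also have "\<dots> \<le> real (n + m) * (\<integral>\<omega>. gfun r \<kappa> \<omega> \<partial>\<mu>) + real r * gbound A r \<kappa> + real n * \<epsilon>"
      using kk_int by (intro add_left_mono mult_left_mono) auto
    finally show ?thesis .
  qed
  let ?I = "(\<integral>\<omega>. gfun r \<kappa> \<omega> \<partial>\<mu>)"
  let ?C = "real m * ?I + real r * gbound A r \<kappa>"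
  show ?thesis
  proof (rule LIMSEQ_le_const)
    show "(\<lambda>n. (?I + \<epsilon>) + ?C * inverse (real (Suc n))) \<longlonglongrightarrow> ?I + \<epsilon>"
      using tendsto_add[OF tendsto_const tendsto_mult_right_zero[OF LIMSEQ_inverse_real_of_nat]] by fastforce
    have "hs \<xi> proc \<le> (?I + \<epsilon>) + ?C * inverse (real (Suc n))" for n
    proof -
      have "hs \<xi> proc \<le> blockH \<xi> proc (Suc n) / real (Suc n)" by (rule proc.hs_le) simp
      also have "\<dots> \<le> (real (Suc n + m) * ?I + real r * gbound A r \<kappa> + real (Suc n) * \<epsilon>) / real (Suc n)"
        by (intro divide_right_mono main) auto
      also have "\<dots> = (?I + \<epsilon>) + ?C * inverse (real (Suc n))"
        by (simp add: field_simps)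
      finally show ?thesis .
    qed
    then show "\<exists>N. \<forall>n\<ge>N. hs \<xi> proc \<le> (?I + \<epsilon>) + ?C * inverse (real (Suc n))" by auto
  qed
qed

lemma hs_proc_le_hs: "hs \<xi> proc \<le> hs A \<mu>"
proof (rule field_le_epsilon)
  fix e :: real assume e: "0 < e"
  obtain r \<kappa> where g: "adm A r \<kappa>" "(\<integral>\<omega>. gfun r \<kappa> \<omega> \<partial>\<mu>) < hs A \<mu> + e/2"
    using hs_approx[of "e/2"] e by auto
  show "hs \<xi> proc \<le> hs A \<mu> + e" using hs_proc_le[OF g(1), of "e/2"] g(2) e by simp
qed

end

context shift_measure begin

text \<open>The supremum over partitions is attained at the partition by the first letter: its
  itineraries are the sequences themselves, written in the alphabet of one-letter cylinders.\<close>

theorem ks_entropy_eq_hs: "ks_entropy \<mu> shift = hs A \<mu>"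
proof -
  have le: "entropy_wrt \<mu> shift \<xi> \<le> hs A \<mu>" if "finite_partition \<mu> \<xi>" for \<xi>
  proof -
    interpret partition_process A \<mu> \<xi> by unfold_locales fact
    show ?thesis using entropy_wrt_eq hs_proc_le_hs by simp
  qed
  define c where "c = (\<lambda>x. {\<omega>\<in>seqs A. \<omega> 0 = x})"
  have neA: "A \<noteq> {}" using ex_seq by (auto simp: seqs_def)
  have c_ne: "c x \<noteq> {}" if "x \<in> A" for x using that by (auto simp: c_def seqs_def intro!: exI[of _ "\<lambda>_. x"])
  have inj: "inj_on c A" using c_ne by (auto simp: inj_on_def c_def)
  have part: "finite_partition \<mu> (c ` A)"
    unfolding finite_partition_def
  proof (intro conjI)
    show "c ` A \<subseteq> events"
    proof safe
      fix x assume "x \<in> A"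
      have "c x = {\<omega>\<in>space \<mu>. pre 1 \<omega> ! 0 = x}" by (auto simp: c_def space_mu)
      then show "c x \<in> events" using measurable_pre_pred[OF sets_mu finA, of "\<lambda>xs. xs ! 0 = x" 1] by simp
    qed
    show "disjoint (c ` A)" by (auto simp: disjoint_def c_def)
    show "\<Union>(c ` A) = space \<mu>" by (auto simp: c_def space_mu seqs_def)
  qed (simp add: finA)
  interpret partition_process A \<mu> "c ` A" by unfold_locales fact
  have pc: "piece \<omega> = c (\<omega> 0)" if "\<omega> \<in> seqs A" for \<omega>
    by (rule piece_eq) (use that in \<open>auto simp: c_def seqs_def\<close>)
  have "blockH (c ` A) proc n = blockH A \<mu> n" for n
    unfolding blockH_proc unfolding blockH_def entH_def
  proof (rule sum.reindex_bij_witness[of _ "map c" "map (inv_into A c)"])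
    fix xs assume xs: "xs \<in> words (c ` A) n"
    have sub: "x \<in> c ` A" if "x \<in> set xs" for x using xs that unfolding words_def by blast
    show "map c (map (inv_into A c) xs) = xs"
      unfolding map_map by (rule map_idI) (use sub in \<open>simp add: f_inv_into_f\<close>)
    have "set (map (inv_into A c) xs) \<subseteq> A" using inv_into_into[OF sub] by auto
    then show "map (inv_into A c) xs \<in> words A n" using xs by (simp add: words_def)
    fix xs assume xs: "xs \<in> words (c ` A) n"
    have "{\<omega> \<in> space \<mu>. pre n \<omega> = map (inv_into A c) xs} = {\<omega> \<in> space \<mu>. pre n (itin \<omega>) = xs}"
    proof -
      have *: "\<omega> t = inv_into A c (xs ! t) \<longleftrightarrow> piece ((shift ^^ t) \<omega>) = xs ! t"
        if "t < n" "\<omega> \<in> seqs A" for t \<omega>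
      proof -
        have "xs ! t \<in> c ` A" using xs that nth_mem[of t xs] unfolding words_def by blast
        then obtain z where z: "z \<in> A" "xs ! t = c z" by blast
        have "\<omega> t \<in> A" using that by (simp add: seqs_def)
        moreover have "piece ((shift ^^ t) \<omega>) = c (\<omega> t)"
          using pc[OF shift_pow_seqs[OF that(2)]] by (simp add: shift_pow)
        ultimately show ?thesis
          using z by (simp add: inv_into_f_f[OF inj] inj_on_eq_iff[OF inj])
      qed
      show ?thesis
      proof (intro Collect_cong conj_cong refl)
        fix \<omega> assume "\<omega> \<in> space \<mu>"
        then have "\<omega> t = inv_into A c (xs ! t) \<longleftrightarrow> piece ((shift ^^ t) \<omega>) = xs ! t" if "t < n" for t
          using * that by (simp only: space_mu)
        moreover have "length xs = n" using xs by (simp add: words_def)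
        ultimately show "pre n \<omega> = map (inv_into A c) xs \<longleftrightarrow> pre n (itin \<omega>) = xs"
          unfolding pre_eq_list by (simp add: itin_def)
      qed
    qed
    then show "- (prob {\<omega> \<in> space \<mu>. pre n \<omega> = map (inv_into A c) xs} * ln (prob {\<omega> \<in> space \<mu>. pre n \<omega> = map (inv_into A c) xs}))
      = - (prob {\<omega> \<in> space \<mu>. pre n (itin \<omega>) = xs} * ln (prob {\<omega> \<in> space \<mu>. pre n (itin \<omega>) = xs}))"
      by simp
  next
    fix xs assume xs: "xs \<in> words A n"
    have sub: "x \<in> A" if "x \<in> set xs" for x using xs that unfolding words_def by blast
    show "map (inv_into A c) (map c xs) = xs"
      unfolding map_map by (rule map_idI) (use sub in \<open>simp add: inv_into_f_f[OF inj]\<close>)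
    show "map c xs \<in> words (c ` A) n" using xs sub by (auto simp: words_def)
  qed
  then have "hs A \<mu> = entropy_wrt \<mu> shift (c ` A)" by (simp add: entropy_wrt_eq hs_def)
  then have "hs A \<mu> \<in> entropy_wrt \<mu> shift ` {\<xi>. finite_partition \<mu> \<xi>}"
    by (rule image_eqI) (simp add: part)
  then show ?thesis
    unfolding ks_entropy_def by (rule cSup_eq_maximum) (use le in blast)
qed

end

section \<open>Weak limits of asymptotically invariant measures\<close>

definition ucn :: "'a set \<Rightarrow> ((nat \<Rightarrow> 'a) \<Rightarrow> real) \<Rightarrow> nat \<Rightarrow> real \<Rightarrow> bool" where
  "ucn A F n e \<longleftrightarrow> (\<forall>\<omega>\<in>seqs A. \<forall>\<omega>'\<in>seqs A. pre n \<omega> = pre n \<omega>' \<longrightarrow> \<bar>F \<omega> - F \<omega>'\<bar> \<le> e)"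

text \<open>Uniform continuity with closeness measured by common prefixes, a form that mentions no
  topology on the alphabet. It follows from continuity by \<open>continuous_imp_uc\<close>.\<close>

definition uc :: "'a set \<Rightarrow> ((nat \<Rightarrow> 'a) \<Rightarrow> real) \<Rightarrow> bool" where
  "uc A F \<longleftrightarrow> (\<forall>e>0. \<exists>n. ucn A F n e)"

lemma ucnD: "ucn A F n e \<Longrightarrow> \<omega> \<in> seqs A \<Longrightarrow> \<omega>' \<in> seqs A \<Longrightarrow> pre n \<omega> = pre n \<omega>' \<Longrightarrow> \<bar>F \<omega> - F \<omega>'\<bar> \<le> e"
  by (simp add: ucn_def)

lemma ucD: "uc A F \<Longrightarrow> 0 < e \<Longrightarrow> \<exists>n. ucn A F n e"
  by (simp add: uc_def)

lemma pre_mono_eq: "pre n \<omega> = pre n \<omega>' \<Longrightarrow> k \<le> n \<Longrightarrow> pre k \<omega> = pre k \<omega>'"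
  by (auto simp: pre_eq_iff)

lemma pre_app_pre [simp]: "pre n (app (pre n \<omega>) y) = pre n \<omega>"
  using pre_app[of "pre n \<omega>" y] by simp

lemma uc_local:
  assumes "\<And>\<omega> \<omega>'. \<omega> \<in> seqs A \<Longrightarrow> \<omega>' \<in> seqs A \<Longrightarrow> pre n \<omega> = pre n \<omega>' \<Longrightarrow> F \<omega> = F \<omega>'"
  shows "uc A F"
  unfolding uc_def ucn_def
proof (intro allI impI exI[of _ n] ballI)
  fix e :: real and \<omega> \<omega>' assume "0 < e" "\<omega> \<in> seqs A" "\<omega>' \<in> seqs A" "pre n \<omega> = pre n \<omega>'"
  then show "\<bar>F \<omega> - F \<omega>'\<bar> \<le> e" using assms[of \<omega> \<omega>'] by simp
qed

lemma uc_gfun: "uc A (gfun r \<kappa>)"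
  by (rule uc_local[of _ "Suc r"]) (simp add: gfun_def)

lemma compact_seqs:
  fixes A :: "'a::t2_space set"
  assumes "finite A" shows "compact (seqs A)"
proof -
  have "compactin (product_topology (\<lambda>_::nat. euclidean) UNIV) (PiE UNIV (\<lambda>_. A))"
    using assms by (auto simp: compactin_PiE finite_imp_compact)
  moreover have "PiE UNIV (\<lambda>_. A) = seqs A" by (auto simp: seqs_def PiE_iff)
  ultimately show ?thesis by (simp add: euclidean_product_topology)
qed

text \<open>The Heine-Cantor argument: a neighbourhood in the product restricts only finitely many
  coordinates and so contains a cylinder, and compactness makes the depth uniform.\<close>

lemma continuous_imp_uc:
  fixes F :: "(nat \<Rightarrow> 'a::t2_space) \<Rightarrow> real"
  assumes A: "finite A" and F: "continuous_on (seqs A) F"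
  shows "uc A F"
  unfolding uc_def
proof (intro allI impI)
  fix e :: real assume e: "0 < e"
  \<comment> \<open>The cylinder around \<omega>, written with complements of finite sets: these are
    open in every Hausdorff alphabet, whereas singletons need not be. On \<open>seqs A\<close>
    membership is equality of prefixes.\<close>
  define V where "V = (\<lambda>n \<omega>. {\<omega>'::nat \<Rightarrow> 'a. \<forall>t<n. \<omega>' t \<in> - (A - {\<omega> t})})"
  have V_open: "open (V n \<omega>)" for n \<omega>
  proof -
    have "V n \<omega> = (\<Inter>t\<in>{..<n}. (\<lambda>\<omega>'. \<omega>' t) -` (- (A - {\<omega> t})))" by (auto simp: V_def)
    also have "open \<dots>"
    proof (intro open_INT ballI)
      have "open (- (A - {\<omega> t}))" for t using A by (intro open_Compl finite_imp_closed finite_Diff)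
      then show "open ((\<lambda>\<omega>'::nat \<Rightarrow> 'a. \<omega>' t) -` (- (A - {\<omega> t})))" for t
        by (rule open_vimage) (rule continuous_on_product_coordinates)
    qed simp
    finally show ?thesis .
  qed
  have V_iff: "\<omega>' \<in> V n \<omega> \<longleftrightarrow> pre n \<omega>' = pre n \<omega>" if "\<omega>' \<in> seqs A" for n \<omega> \<omega>'
    using that by (auto simp: V_def pre_eq_iff seqs_def)
  have "\<exists>n. \<forall>\<omega>'\<in>seqs A. pre n \<omega>' = pre n \<omega> \<longrightarrow> \<bar>F \<omega>' - F \<omega>\<bar> < e/2" if \<omega>: "\<omega> \<in> seqs A" for \<omega>
  proof -
    obtain U where U: "open U" "\<omega> \<in> U" "\<And>\<omega>'. \<omega>' \<in> seqs A \<Longrightarrow> \<omega>' \<in> U \<Longrightarrow> F \<omega>' \<in> ball (F \<omega>) (e/2)"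
      using F[unfolded continuous_on_topological, rule_format, OF \<omega>, of "ball (F \<omega>) (e/2)"] e by auto
    have "openin (product_topology (\<lambda>_::nat. euclidean) UNIV) U"
      using U(1) by (simp add: euclidean_product_topology)
    then obtain X where X: "finite {i \<in> UNIV. X i \<noteq> topspace euclidean}" "\<omega> \<in> PiE UNIV X" "PiE UNIV X \<subseteq> U"
      unfolding openin_product_topology_alt using U(2) by blast
    obtain n where n: "\<forall>i\<in>{i. X i \<noteq> UNIV}. i < n"
      using X(1) finite_nat_set_iff_bounded by auto
    have "\<omega>' \<in> U" if "pre n \<omega>' = pre n \<omega>" for \<omega>'
    proof -
      have "\<omega>' i \<in> X i" for i
        using X(2) n that by (cases "X i = UNIV") (auto simp: pre_eq_iff PiE_iff)
      then show ?thesis using X(3) by (auto simp: PiE_iff)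
    qed
    then show ?thesis using U(3) by (auto simp: dist_real_def abs_minus_commute)
  qed
  then obtain N where N: "\<And>\<omega> \<omega>'. \<omega> \<in> seqs A \<Longrightarrow> \<omega>' \<in> seqs A \<Longrightarrow> pre (N \<omega>) \<omega>' = pre (N \<omega>) \<omega> \<Longrightarrow> \<bar>F \<omega>' - F \<omega>\<bar> < e/2"
    by metis
  have "seqs A \<subseteq> (\<Union>\<omega>\<in>seqs A. V (N \<omega>) \<omega>)" by (auto simp: V_def)
  then obtain C where C: "C \<subseteq> seqs A" "finite C" "seqs A \<subseteq> (\<Union>\<omega>\<in>C. V (N \<omega>) \<omega>)"
    using compactE_image[OF compact_seqs[OF A], of "seqs A" "\<lambda>\<omega>. V (N \<omega>) \<omega>"] V_open by metis
  have "\<bar>F \<omega> - F \<omega>'\<bar> \<le> e" if w: "\<omega> \<in> seqs A" "\<omega>' \<in> seqs A" "pre (\<Sum>\<omega>\<in>C. N \<omega>) \<omega> = pre (\<Sum>\<omega>\<in>C. N \<omega>) \<omega>'" for \<omega> \<omega>'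
  proof -
    obtain z where z: "z \<in> C" "\<omega> \<in> V (N z) z" using C(3) w(1) by auto
    have "N z \<le> (\<Sum>\<omega>\<in>C. N \<omega>)" using z C by (intro member_le_sum) auto
    then have "pre (N z) \<omega> = pre (N z) \<omega>'" using pre_mono_eq[OF w(3)] by simp
    have zA: "z \<in> seqs A" using z C(1) by blast
    have p: "pre (N z) \<omega> = pre (N z) z" using z(2) V_iff[OF w(1)] by simp
    then have p': "pre (N z) \<omega>' = pre (N z) z" using \<open>pre (N z) \<omega> = pre (N z) \<omega>'\<close> by simp
    show ?thesis using N[OF zA w(1) p] N[OF zA w(2) p'] by linarith
  qed
  then show "\<exists>n. ucn A F n e" unfolding ucn_def by blast
qed

lemma uc_bounded:
  assumes A: "finite A" and F: "uc A F"
  shows "\<exists>C\<ge>0. \<forall>\<omega>\<in>seqs A. \<bar>F \<omega>\<bar> \<le> C"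
proof (cases "seqs A = {}")
  case False
  then obtain y where y: "y \<in> seqs A" by auto
  obtain n where n: "ucn A F n 1"
    using ucD[OF F, of 1] by auto
  have "\<bar>F \<omega>\<bar> \<le> (\<Sum>xs\<in>words A n. \<bar>F (app xs y)\<bar>) + 1" if \<omega>: "\<omega> \<in> seqs A" for \<omega>
  proof -
    have "\<bar>F \<omega> - F (app (pre n \<omega>) y)\<bar> \<le> 1"
      using \<omega> y by (intro ucnD[OF n]) (auto intro: app_seqs[of _ _ n])
    moreover have "\<bar>F (app (pre n \<omega>) y)\<bar> \<le> (\<Sum>xs\<in>words A n. \<bar>F (app xs y)\<bar>)"
      using \<omega> A by (intro member_le_sum[of _ _ "\<lambda>xs. \<bar>F (app xs y)\<bar>"]) auto
    ultimately show ?thesis by linarith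
  qed
  then show ?thesis by (intro exI[of _ "(\<Sum>xs\<in>words A n. \<bar>F (app xs y)\<bar>) + 1"]) (auto intro!: add_nonneg_nonneg sum_nonneg)
qed auto

text \<open>Such a function is a pointwise limit of functions of finite prefixes.\<close>

lemma uc_measurable:
  assumes A: "finite A" and F: "uc A F"
  shows "F \<in> borel_measurable (shiftM A)"
proof (cases "seqs A = {}")
  case False
  then obtain y where y: "y \<in> seqs A" by auto
  show ?thesis
  proof (rule borel_measurable_LIMSEQ_real)
    show "(\<lambda>\<omega>. F (app (pre n \<omega>) y)) \<in> borel_measurable (shiftM A)" for n
      by (rule borel_measurable_pre[OF A, of "\<lambda>xs. F (app xs y)"])
    fix \<omega> assume "\<omega> \<in> space (shiftM A)"
    then have \<omega>: "\<omega> \<in> seqs A" by (simp add: space_shiftM)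
    show "(\<lambda>n. F (app (pre n \<omega>) y)) \<longlonglongrightarrow> F \<omega>"
    proof (rule LIMSEQ_I)
      fix e :: real assume e: "0 < e"
      obtain N where N: "ucn A F N (e/2)"
    using ucD[OF F, of "e/2"] e by auto
      have "norm (F (app (pre n \<omega>) y) - F \<omega>) < e" if "n \<ge> N" for n
      proof -
        have p: "pre N (app (pre n \<omega>) y) = pre N \<omega>" by (rule pre_mono_eq[OF pre_app_pre that])
        have "app (pre n \<omega>) y \<in> seqs A" by (rule app_seqs[OF pre_in_words[OF \<omega>] y])
        from ucnD[OF N this \<omega> p] e show ?thesis by simp
      qed
      then show "\<exists>N. \<forall>n\<ge>N. norm (F (app (pre n \<omega>) y) - F \<omega>) < e" by blast
    qed
  qed
next
  case True
  then have "space (shiftM A) = {}" by (simp add: space_shiftM)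
  then show ?thesis by (intro measurableI) (auto simp: sets_eq_bot2)
qed

lemma uc_integrable:
  assumes "finite A" "uc A F" "prob_space \<mu>" "sets \<mu> = sets (shiftM A)"
  shows "integrable \<mu> F"
proof -
  obtain C where "\<forall>\<omega>\<in>seqs A. \<bar>F \<omega>\<bar> \<le> C" using uc_bounded[OF assms(1,2)] by blast
  then show ?thesis by (intro integrable_bounded_seqs[OF assms(3,4) uc_measurable[OF assms(1,2)]]) blast
qed

lemma uc_approx_integral:
  assumes A: "finite A" and F: "uc A F" and M: "prob_space \<mu>" "sets \<mu> = sets (shiftM A)" and y: "y \<in> seqs A"
    and n: "ucn A F n e"
  shows "\<bar>(\<integral>\<omega>. F \<omega> \<partial>\<mu>) - (\<Sum>xs\<in>words A n. measure \<mu> {\<omega>\<in>space \<mu>. pre n \<omega> = xs} * F (app xs y))\<bar> \<le> e"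
proof -
  interpret prob_space \<mu> by fact
  have sp: "space \<mu> = seqs A" by (rule space_eq_seqs[OF M(2)])
  note f = finite_rv_integral[OF sets_M_words[OF M(2) A] finite_words[OF A], of "\<lambda>xs. F (app xs y)" n]
  have d: "\<bar>F \<omega> - F (app (pre n \<omega>) y)\<bar> \<le> e" if "\<omega> \<in> space \<mu>" for \<omega>
  proof -
    have \<omega>: "\<omega> \<in> seqs A" using that sp by simp
    show ?thesis by (rule ucnD[OF n \<omega> app_seqs[OF pre_in_words[OF \<omega>] y]]) simp
  qed
  have i: "integrable \<mu> F" by (rule uc_integrable[OF A F M])
  have "\<bar>(\<integral>\<omega>. F \<omega> \<partial>\<mu>) - (\<integral>\<omega>. F (app (pre n \<omega>) y) \<partial>\<mu>)\<bar> = \<bar>\<integral>\<omega>. F \<omega> - F (app (pre n \<omega>) y) \<partial>\<mu>\<bar>"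
    using i f(1) by simp
  also have "\<dots> \<le> (\<integral>\<omega>. \<bar>F \<omega> - F (app (pre n \<omega>) y)\<bar> \<partial>\<mu>)" by (rule integral_abs_bound)
  also have "\<dots> \<le> (\<integral>\<omega>. e \<partial>\<mu>)"
    using i f(1) d by (intro integral_mono) auto
  finally show ?thesis by (simp add: f(2) prob_space)
qed

text \<open>Up to \<epsilon>/4, uniformly in the measure, the integral is a finite combination of
  cylinder probabilities.\<close>

lemma weak_convergence_cylinders:
  assumes A: "finite A" and F: "uc A F"
    and M: "\<And>j. prob_space (e j)" "\<And>j. sets (e j) = sets (shiftM A)" "prob_space \<mu>" "sets \<mu> = sets (shiftM A)"
    and conv: "\<And>n xs. (\<lambda>j. measure (e j) {\<omega>\<in>seqs A. pre n \<omega> = xs}) \<longlonglongrightarrow> measure \<mu> {\<omega>\<in>seqs A. pre n \<omega> = xs}"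
  shows "(\<lambda>j. \<integral>\<omega>. F \<omega> \<partial>e j) \<longlonglongrightarrow> (\<integral>\<omega>. F \<omega> \<partial>\<mu>)"
proof (rule LIMSEQ_I)
  fix \<epsilon> :: real assume \<epsilon>: "0 < \<epsilon>"
  have "seqs A \<noteq> {}" using prob_space.not_empty[OF M(3)] space_eq_seqs[OF M(4)] by simp
  then obtain y where y: "y \<in> seqs A" by auto
  obtain n where n: "ucn A F n (\<epsilon>/4)"
    using ucD[OF F, of "\<epsilon>/4"] \<epsilon> by auto
  let ?S = "\<lambda>M. \<Sum>xs\<in>words A n. measure M {\<omega>\<in>seqs A. pre n \<omega> = xs} * F (app xs y)"
  have ap: "\<bar>(\<integral>\<omega>. F \<omega> \<partial>M) - ?S M\<bar> \<le> \<epsilon>/4" if "prob_space M" "sets M = sets (shiftM A)" for M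
    using uc_approx_integral[OF A F that y n] unfolding space_eq_seqs[OF that(2)] .
  have "(\<lambda>j. ?S (e j)) \<longlonglongrightarrow> ?S \<mu>"
    by (intro tendsto_sum tendsto_mult conv tendsto_const)
  moreover have "0 < \<epsilon>/4" using \<epsilon> by simp
  ultimately have "\<exists>N. \<forall>j\<ge>N. norm (?S (e j) - ?S \<mu>) < \<epsilon>/4" by (rule LIMSEQ_D)
  then obtain N where N: "\<forall>j\<ge>N. norm (?S (e j) - ?S \<mu>) < \<epsilon>/4" ..

  have "norm ((\<integral>\<omega>. F \<omega> \<partial>e j) - (\<integral>\<omega>. F \<omega> \<partial>\<mu>)) < \<epsilon>" if "j \<ge> N" for j
    using ap[OF M(1,2), of j] ap[OF M(3,4)] N[rule_format, OF that] \<epsilon> unfolding real_norm_def by linarith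
  then show "\<exists>N. \<forall>j\<ge>N. norm ((\<integral>\<omega>. F \<omega> \<partial>e j) - (\<integral>\<omega>. F \<omega> \<partial>\<mu>)) < \<epsilon>" by blast
qed

definition cylsets :: "'a set \<Rightarrow> (nat \<Rightarrow> 'a) set set" where
  "cylsets A = {{\<omega>\<in>seqs A. pre n \<omega> \<in> W} | n W. True}"

lemma cylsets_deep:
  assumes "S \<in> cylsets A"
  shows "\<exists>n0. \<forall>n\<ge>n0. \<exists>W. S = {\<omega>\<in>seqs A. pre n \<omega> \<in> W}"
proof -
  obtain n0 W where S: "S = {\<omega>\<in>seqs A. pre n0 \<omega> \<in> W}" using assms by (auto simp: cylsets_def)
  have "S = {\<omega>\<in>seqs A. pre n \<omega> \<in> {xs. take n0 xs \<in> W}}" if "n \<ge> n0" for n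
    using that by (auto simp: S take_pre)
  then show ?thesis by blast
qed

lemma cylsets_common:
  assumes "S \<in> cylsets A" "T \<in> cylsets A"
  obtains n U V where "S = {\<omega>\<in>seqs A. pre n \<omega> \<in> U}" "T = {\<omega>\<in>seqs A. pre n \<omega> \<in> V}"
proof -
  obtain n1 where n1: "\<And>n. n \<ge> n1 \<Longrightarrow> \<exists>W. S = {\<omega>\<in>seqs A. pre n \<omega> \<in> W}"
    using cylsets_deep[OF assms(1)] by blast
  obtain n2 where n2: "\<And>n. n \<ge> n2 \<Longrightarrow> \<exists>W. T = {\<omega>\<in>seqs A. pre n \<omega> \<in> W}"
    using cylsets_deep[OF assms(2)] by blast
  obtain U where U: "S = {\<omega>\<in>seqs A. pre (n1 + n2) \<omega> \<in> U}" using n1[of "n1 + n2"] by auto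
  obtain V where V: "T = {\<omega>\<in>seqs A. pre (n1 + n2) \<omega> \<in> V}" using n2[of "n1 + n2"] by auto
  show ?thesis by (rule that[OF U V])
qed

lemma cylsetsI: "{\<omega>\<in>seqs A. pre n \<omega> \<in> W} \<in> cylsets A"
  by (auto simp: cylsets_def)

lemma algebra_cylsets: "algebra (seqs A) (cylsets A)"
  unfolding algebra_iff_Un
proof (intro conjI ballI)
  show "cylsets A \<subseteq> Pow (seqs A)" by (auto simp: cylsets_def)
  show "{} \<in> cylsets A" using cylsetsI[of A 0 "{}"] by simp
next
  fix S assume "S \<in> cylsets A"
  then obtain n W where S: "S = {\<omega>\<in>seqs A. pre n \<omega> \<in> W}" by (auto simp: cylsets_def)
  have "seqs A - S = {\<omega>\<in>seqs A. pre n \<omega> \<in> - W}" by (auto simp: S)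
  then show "seqs A - S \<in> cylsets A" by (simp only: cylsetsI)
next
  fix S T assume "S \<in> cylsets A" "T \<in> cylsets A"
  then obtain n U V where "S = {\<omega>\<in>seqs A. pre n \<omega> \<in> U}" "T = {\<omega>\<in>seqs A. pre n \<omega> \<in> V}" by (rule cylsets_common)
  then have "S \<union> T = {\<omega>\<in>seqs A. pre n \<omega> \<in> U \<union> V}" by auto
  then show "S \<union> T \<in> cylsets A" by (simp only: cylsetsI)
qed

lemma cylsets_subset:
  assumes "finite A" shows "cylsets A \<subseteq> sets (shiftM A)"
  unfolding cylsets_def using measurable_pre_pred[OF refl assms] by (auto simp: space_shiftM)

lemma sigma_cylsets:
  assumes "finite A" shows "sigma_sets (seqs A) (cylsets A) = sets (shiftM A)"
proof
  show "sigma_sets (seqs A) (cylsets A) \<subseteq> sets (shiftM A)"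
    using sets.sigma_sets_subset[OF cylsets_subset[OF assms]] by (simp add: space_shiftM)
  have "{{f \<in> seqs A. f i \<in> X} | i X. X \<subseteq> A} \<subseteq> cylsets A"
  proof clarify
    fix i X assume "X \<subseteq> A"
    have "{f \<in> seqs A. f i \<in> X} = {\<omega>\<in>seqs A. pre (Suc i) \<omega> \<in> {xs. xs ! i \<in> X}}" by auto
    then show "{f \<in> seqs A. f i \<in> X} \<in> cylsets A" by (simp only: cylsetsI)
  qed
  then show "sets (shiftM A) \<subseteq> sigma_sets (seqs A) (cylsets A)"
    unfolding sets_shiftM by (rule sigma_sets_mono')
qed

lemma closed_cylsets:
  fixes A :: "'a::t2_space set"
  assumes A: "finite A" and S: "S \<in> cylsets A"
  shows "closed S"
proof -
  obtain n W where S: "S = {\<omega>\<in>seqs A. pre n \<omega> \<in> W}" using S by (auto simp: cylsets_def)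
  have "S = seqs A \<inter> (\<Union>xs\<in>W \<inter> words A n. \<Inter>t\<in>{..<n}. (\<lambda>\<omega>. \<omega> t) -` {xs ! t})"
  proof (intro set_eqI iffI)
    fix \<omega> assume "\<omega> \<in> S"
    then show "\<omega> \<in> seqs A \<inter> (\<Union>xs\<in>W \<inter> words A n. \<Inter>t\<in>{..<n}. (\<lambda>\<omega>. \<omega> t) -` {xs ! t})"
      by (auto simp: S intro!: bexI[of _ "pre n \<omega>"])
  next
    fix \<omega> assume "\<omega> \<in> seqs A \<inter> (\<Union>xs\<in>W \<inter> words A n. \<Inter>t\<in>{..<n}. (\<lambda>\<omega>. \<omega> t) -` {xs ! t})"
    then obtain xs where "\<omega> \<in> seqs A" "xs \<in> W" "xs \<in> words A n" "\<And>t. t < n \<Longrightarrow> \<omega> t = xs ! t" by auto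
    moreover then have "pre n \<omega> = xs" by (auto simp: pre_eq_list words_def)
    ultimately show "\<omega> \<in> S" by (auto simp: S)
  qed
  also have "closed \<dots>"
  proof (intro closed_Int closed_UN closed_INT ballI)
    have "seqs A = (\<Inter>t. (\<lambda>\<omega>. \<omega> t) -` A)" by (auto simp: seqs_def)
    also have "closed \<dots>"
      using A by (intro closed_INT ballI closed_vimage finite_imp_closed continuous_on_product_coordinates)
    finally show "closed (seqs A)" .
    show "closed ((\<lambda>\<omega>::nat \<Rightarrow> 'a. \<omega> t) -` {xs ! t})" for t xs
      by (intro closed_vimage continuous_on_product_coordinates closed_singleton)
  qed (use A in auto)
  finally show ?thesis .
qed

text \<open>The cylinder probabilities form a point in a product of unit intervals indexed by words.
  Words over a countable type are countable, so this compact product is metrizable and hence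
  sequentially compact.\<close>

lemma cylinder_subsequence:
  fixes e :: "nat \<Rightarrow> (nat \<Rightarrow> 'a::countable) measure"
  assumes A: "finite A" and M: "\<And>j. prob_space (e j)" "\<And>j. sets (e j) = sets (shiftM A)"
  shows "\<exists>r. strict_mono r \<and> (\<forall>S\<in>cylsets A. convergent (\<lambda>j. measure (e (r j)) S))"
proof -
  define P where "P = (\<lambda>j xs. measure (e j) {\<omega>\<in>seqs A. pre (length xs) \<omega> = xs})"
  let ?K = "PiE UNIV (\<lambda>_::'a list. {0..1::real})"
  have "compactin (product_topology (\<lambda>_::'a list. euclidean) UNIV) ?K"
    by (auto simp: compactin_PiE)
  then have "compact ?K" by (simp add: euclidean_product_topology)
  then have sc: "seq_compact ?K" by (simp add: compact_eq_seq_compact_metric)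
  have "P j \<in> ?K" for j using prob_space.prob_le_1[OF M(1)] by (auto simp: P_def PiE_iff)
  then obtain L r where r: "strict_mono r" "(P \<circ> r) \<longlonglongrightarrow> L"
    using sc unfolding seq_compact_def by meson
  have lim: "(\<lambda>j. P (r j) xs) \<longlonglongrightarrow> L xs" for xs
  proof -
    have "isCont (\<lambda>f::'a list \<Rightarrow> real. f xs) L"
    proof -
      have "continuous_on UNIV (\<lambda>f::'a list \<Rightarrow> real. f xs)" by (rule continuous_on_product_coordinates)
      from continuous_on_eq_continuous_at[OF open_UNIV, THEN iffD1, OF this] show ?thesis by blast
    qed
    from isCont_tendsto_compose[OF this r(2)] show ?thesis by (simp add: comp_def)
  qed
  have "convergent (\<lambda>j. measure (e (r j)) S)" if cyl: "S \<in> cylsets A" for S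
  proof -
    obtain n W where S: "S = {\<omega>\<in>seqs A. pre n \<omega> \<in> W}" using cyl by (auto simp: cylsets_def)
    have "measure (e j) S = (\<Sum>xs\<in>W \<inter> words A n. P j xs)" for j
    proof -
      interpret prob_space "e j" by (rule M)
      have "S = (\<Union>xs\<in>W \<inter> words A n. {\<omega>\<in>seqs A. pre (length xs) \<omega> = xs})"
      proof (intro set_eqI iffI)
        fix \<omega> assume "\<omega> \<in> S"
        then show "\<omega> \<in> (\<Union>xs\<in>W \<inter> words A n. {\<omega>\<in>seqs A. pre (length xs) \<omega> = xs})"
          by (intro UN_I[of "pre n \<omega>"]) (auto simp: S)
      next
        fix \<omega> assume "\<omega> \<in> (\<Union>xs\<in>W \<inter> words A n. {\<omega>\<in>seqs A. pre (length xs) \<omega> = xs})"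
        then show "\<omega> \<in> S" by (auto simp: S words_def)
      qed
      then have "measure (e j) S = measure (e j) (\<Union>xs\<in>W \<inter> words A n. {\<omega>\<in>seqs A. pre (length xs) \<omega> = xs})" by simp
      also have "\<dots> = (\<Sum>xs\<in>W \<inter> words A n. P j xs)"
        unfolding P_def
      proof (rule finite_measure_finite_Union)
        show "disjoint_family_on (\<lambda>xs. {\<omega>\<in>seqs A. pre (length xs) \<omega> = xs}) (W \<inter> words A n)"
          by (auto simp: disjoint_family_on_def words_def)
        show "(\<lambda>xs. {\<omega>\<in>seqs A. pre (length xs) \<omega> = xs}) ` (W \<inter> words A n) \<subseteq> sets (e j)"
          using measurable_pre_pred[OF M(2) A, of j] space_eq_seqs[OF M(2), of j] by (auto simp del: Collect_mem_eq)
      qed (use A in auto)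
      finally show ?thesis .
    qed
    moreover have "convergent (\<lambda>j. \<Sum>xs\<in>W \<inter> words A n. P (r j) xs)"
      by (rule convergentI[OF tendsto_sum[OF lim]])
    ultimately show ?thesis by simp
  qed
  then show ?thesis using r(1) by auto
qed

text \<open>Limits of cylinder probabilities are finitely additive on the algebra of cylinder sets.
  Compactness makes them countably additive there, and Caratheodory's theorem extends them.
  Invariance need only be checked on cylinder sets, whose preimages under \<open>shift\<close> are
  cylinder sets again.\<close>

theorem invariant_limit:
  fixes e :: "nat \<Rightarrow> (nat \<Rightarrow> 'a::{countable,t2_space}) measure"
  assumes A: "finite A" and M: "\<And>j. prob_space (e j)" "\<And>j. sets (e j) = sets (shiftM A)"
    and inv: "\<And>S. S \<in> sets (shiftM A) \<Longrightarrow> (\<lambda>j. measure (e j) (shift -` S \<inter> seqs A) - measure (e j) S) \<longlonglongrightarrow> 0"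
  shows "\<exists>r \<mu>. strict_mono r \<and> \<mu> \<in> inv_meas A \<and>
    (\<forall>F. uc A F \<longrightarrow> (\<lambda>j. \<integral>\<omega>. F \<omega> \<partial>e (r j)) \<longlonglongrightarrow> (\<integral>\<omega>. F \<omega> \<partial>\<mu>))"
proof -
  obtain r where r: "strict_mono r" "\<And>S. S \<in> cylsets A \<Longrightarrow> convergent (\<lambda>j. measure (e (r j)) S)"
    using cylinder_subsequence[of A e, OF A M] by blast
  define f where "f = (\<lambda>S. lim (\<lambda>j. measure (e (r j)) S))"
  have f: "(\<lambda>j. measure (e (r j)) S) \<longlonglongrightarrow> f S" if "S \<in> cylsets A" for S
    using r(2)[OF that] by (simp add: f_def convergent_LIMSEQ_iff)
  interpret alg: algebra "seqs A" "cylsets A" by (rule algebra_cylsets)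
  have sp: "space (e j) = seqs A" for j by (rule space_eq_seqs[OF M(2)])
  have f0: "f S \<ge> 0" if "S \<in> cylsets A" for S
    by (rule LIMSEQ_le_const[OF f[OF that]]) auto
  have f_empty: "f {} = 0" by (simp add: f_def)
  have f_add: "f (S \<union> T) = f S + f T" if "S \<in> cylsets A" "T \<in> cylsets A" "S \<inter> T = {}" for S T
  proof (rule LIMSEQ_unique[OF f])
    show "S \<union> T \<in> cylsets A" using that by auto
    have "measure (e (r j)) (S \<union> T) = measure (e (r j)) S + measure (e (r j)) T" for j
    proof -
      interpret prob_space "e (r j)" by (rule M)
      show ?thesis using that cylsets_subset[OF A] by (intro finite_measure_Union) (auto simp: M(2))
    qed
    then show "(\<lambda>j. measure (e (r j)) (S \<union> T)) \<longlonglongrightarrow> f S + f T"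
      using tendsto_add[OF f[OF that(1)] f[OF that(2)]] by simp
  qed
  have "\<exists>\<mu>. (\<forall>s\<in>cylsets A. \<mu> s = ennreal (f s)) \<and> measure_space (seqs A) (sigma_sets (seqs A) (cylsets A)) \<mu>"
  proof (rule alg.caratheodory_empty_continuous)
    show "positive (cylsets A) (\<lambda>s. ennreal (f s))" by (simp add: positive_def f_empty)
    show "additive (cylsets A) (\<lambda>s. ennreal (f s))"
      by (auto simp: additive_def f_add f0 simp flip: ennreal_plus)
    fix S :: "nat \<Rightarrow> (nat \<Rightarrow> 'a) set"
    assume S: "range S \<subseteq> cylsets A" "decseq S" "(\<Inter>i. S i) = {}"
    \<comment> \<open>Decreasing nonempty closed subsets of a compact space have a common point, so
      the sequence must reach the empty set.\<close>
    have "\<exists>i. S i = {}"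
    proof (rule ccontr)
      assume ne: "\<not> ?thesis"
      have "seqs A \<inter> \<Inter>(range S) \<noteq> {}"
      proof (rule compact_imp_fip[OF compact_seqs[OF A]])
        show "T \<in> range S \<Longrightarrow> closed T" for T using S(1) closed_cylsets[OF A] by auto
        fix F' assume F': "finite F'" "F' \<subseteq> range S"
        then obtain I where I: "finite I" "F' = S ` I" by (meson finite_subset_image)
        \<comment> \<open>The sum of the finitely many indices is at least each of them, and
          \<open>S\<close> is decreasing.\<close>
        have "S (\<Sum>i\<in>I. i) \<subseteq> \<Inter>F'"
        proof -
          have "S (\<Sum>i\<in>I. i) \<subseteq> S k" if "k \<in> I" for k
            using S(2) member_le_sum[of k I "\<lambda>i. i"] that I(1) by (auto simp: decseq_def)
          then show ?thesis unfolding I(2) by blast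
        qed
        moreover have "S (\<Sum>i\<in>I. i) \<subseteq> seqs A" using S(1) by (auto simp: cylsets_def)
        ultimately show "seqs A \<inter> \<Inter>F' \<noteq> {}" using ne by blast
      qed
      then show False using S(3) by auto
    qed
    then obtain i where i: "S i = {}" by auto
    have "S j = {}" if "j \<ge> i" for j using S(2) that i by (auto simp: decseq_def)
    then have "eventually (\<lambda>j. ennreal (f (S j)) = 0) sequentially"
      using f_empty by (auto simp: eventually_sequentially intro!: exI[of _ i])
    then show "(\<lambda>i. ennreal (f (S i))) \<longlonglongrightarrow> 0" by (rule tendsto_eventually)
  qed auto
  then obtain \<mu>0 where \<mu>0: "\<And>S. S \<in> cylsets A \<Longrightarrow> \<mu>0 S = ennreal (f S)"
    "measure_space (seqs A) (sigma_sets (seqs A) (cylsets A)) \<mu>0" by auto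
  define \<mu> where "\<mu> = measure_of (seqs A) (cylsets A) \<mu>0"
  have sets: "sets \<mu> = sets (shiftM A)"
    using alg.space_closed by (simp add: \<mu>_def sets_measure_of sigma_cylsets[OF A])
  have space: "space \<mu> = seqs A" by (rule space_eq_seqs[OF sets])
  have em: "emeasure \<mu> S = ennreal (f S)" if "S \<in> cylsets A" for S
  proof -
    have "positive (sets \<mu>) \<mu>0" "countably_additive (sets \<mu>) \<mu>0"
      using \<mu>0(2) by (simp_all add: measure_space_def sets sigma_cylsets[OF A])
    moreover have "S \<in> sets \<mu>" using that cylsets_subset[OF A] by (auto simp: sets)
    ultimately have "emeasure \<mu> S = \<mu>0 S" using emeasure_measure_of[OF \<mu>_def alg.space_closed] by blast
    then show ?thesis using \<mu>0(1)[OF that] by simp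
  qed
  have ms: "measure \<mu> S = f S" if "S \<in> cylsets A" for S
    using em[OF that] f0[OF that] by (simp add: measure_def)
  have "f (seqs A) = 1"
  proof (rule LIMSEQ_unique[OF f])
    show "seqs A \<in> cylsets A" by auto
    have "measure (e (r j)) (seqs A) = 1" for j using prob_space.prob_space[OF M(1)] sp by metis
    then show "(\<lambda>j. measure (e (r j)) (seqs A)) \<longlonglongrightarrow> 1" by simp
  qed
  then have prob: "prob_space \<mu>" using em[of "seqs A"] by (intro prob_spaceI) (auto simp: space)
  interpret \<mu>: prob_space \<mu> by (rule prob)
  interpret ds: prob_space "distr \<mu> (shiftM A) shift"
    by (rule \<mu>.prob_space_distr) (simp add: measurable_cong_sets[OF sets refl] measurable_shift)
  have "distr \<mu> (shiftM A) shift = \<mu>"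
  proof (rule measure_eqI_generator_eq[of "cylsets A" "seqs A" _ _ "\<lambda>_. seqs A"])
    show "Int_stable (cylsets A)" by (rule alg.Int_stable)
    show "cylsets A \<subseteq> Pow (seqs A)" by (rule alg.space_closed)
    show "sets (distr \<mu> (shiftM A) shift) = sigma_sets (seqs A) (cylsets A)"
      "sets \<mu> = sigma_sets (seqs A) (cylsets A)" by (auto simp: sets sigma_cylsets[OF A])
    fix S assume S: "S \<in> cylsets A"
    obtain n W where W: "S = {\<omega>\<in>seqs A. pre n \<omega> \<in> W}" using S by (auto simp: cylsets_def)
    have eq: "shift -` S \<inter> seqs A = {\<omega>\<in>seqs A. pre (Suc n) \<omega> \<in> {xs. tl xs \<in> W}}"
      by (auto simp: W pre_Suc)
    have S': "shift -` S \<inter> seqs A \<in> cylsets A" unfolding eq by (rule cylsetsI)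
    have "f (shift -` S \<inter> seqs A) - f S = 0"
    proof (rule LIMSEQ_unique[OF tendsto_diff[OF f[OF S'] f[OF S]]])
      show "(\<lambda>j. measure (e (r j)) (shift -` S \<inter> seqs A) - measure (e (r j)) S) \<longlonglongrightarrow> 0"
        using LIMSEQ_subseq_LIMSEQ[OF inv r(1), of S] S cylsets_subset[OF A] by (auto simp: comp_def)
    qed
    then show "emeasure (distr \<mu> (shiftM A) shift) S = emeasure \<mu> S"
      using S cylsets_subset[OF A] measurable_shift[of A]
      by (subst emeasure_distr) (auto simp: measurable_cong_sets[OF sets refl] space em S')
  qed (use ds.emeasure_finite in \<open>auto simp: sets space\<close>)
  then have inv\<mu>: "\<mu> \<in> inv_meas A" using prob sets by (simp add: inv_meas_def)
  have "(\<lambda>j. \<integral>\<omega>. F \<omega> \<partial>e (r j)) \<longlonglongrightarrow> (\<integral>\<omega>. F \<omega> \<partial>\<mu>)" if F: "uc A F" for F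
  proof (rule weak_convergence_cylinders[OF A F M(1) M(2) prob sets])
    fix n xs
    have c: "{\<omega>\<in>seqs A. pre n \<omega> = xs} \<in> cylsets A" using cylsetsI[of A n "{xs}"] by simp
    show "(\<lambda>j. measure (e (r j)) {\<omega>\<in>seqs A. pre n \<omega> = xs}) \<longlonglongrightarrow> measure \<mu> {\<omega>\<in>seqs A. pre n \<omega> = xs}"
      using f[OF c] ms[OF c] by simp
  qed
  then show ?thesis using r(1) inv\<mu> by blast
qed

section \<open>Semicontinuity of the Ledrappier-Young dimension\<close>

text \<open>The empirical measure of an orbit segment; meaningful for \<open>0 < n\<close> only, as
  \<open>pmf_of_set\<close> is unspecified on the empty set.\<close>

definition emp :: "'a set \<Rightarrow> nat \<Rightarrow> (nat \<Rightarrow> 'a) \<Rightarrow> (nat \<Rightarrow> 'a) measure" where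
  "emp A n \<omega> = distr (measure_pmf (pmf_of_set {..<n})) (shiftM A) (\<lambda>t. (shift ^^ t) \<omega>)"

lemma sets_emp: "sets (emp A n \<omega>) = sets (shiftM A)"
  by (simp add: emp_def)

lemma emp_rv: "\<omega> \<in> seqs A \<Longrightarrow> (\<lambda>t. (shift ^^ t) \<omega>) \<in> measurable (measure_pmf P) (shiftM A)"
  by (auto simp: measurable_pmf_measure1 space_shiftM)

lemma prob_space_emp: "\<omega> \<in> seqs A \<Longrightarrow> prob_space (emp A n \<omega>)"
  unfolding emp_def by (rule prob_space.prob_space_distr[OF measure_pmf.prob_space_axioms emp_rv])

lemma integral_emp:
  fixes F :: "(nat \<Rightarrow> 'a) \<Rightarrow> real"
  assumes "\<omega> \<in> seqs A" "0 < n" "F \<in> borel_measurable (shiftM A)"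
  shows "(\<integral>x. F x \<partial>emp A n \<omega>) = bsum F n \<omega> / real n"
  unfolding emp_def integral_distr[OF emp_rv[OF assms(1)] assms(3)]
  using assms(2) by (subst integral_pmf_of_set) (auto simp: bsum_def lessThan_empty_iff)

text \<open>Counting visits along the shifted orbit drops time 0 and adds time \<open>n\<close>;
  everything between cancels.\<close>

lemma emp_almost_invariant:
  assumes w: "\<omega> \<in> seqs A" "0 < n" and S: "S \<in> sets (shiftM A)"
  shows "\<bar>measure (emp A n \<omega>) (shift -` S \<inter> seqs A) - measure (emp A n \<omega>) S\<bar> \<le> 1 / real n"
proof -
  have sp: "space (emp A n \<omega>) = seqs A" by (rule space_eq_seqs[OF sets_emp])
  have SA: "S \<subseteq> seqs A" using sets.sets_into_space[OF S] by (simp add: space_shiftM)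
  have S': "shift -` S \<inter> seqs A \<in> sets (shiftM A)"
    using measurable_sets[OF measurable_shift S] by (simp add: space_shiftM)
  have m: "measure (emp A n \<omega>) T = bsum (indicat_real T) n \<omega> / real n" if "T \<in> sets (shiftM A)" for T
  proof -
    have "T \<subseteq> seqs A" using sets.sets_into_space[OF that] by (simp add: space_shiftM)
    then have "measure (emp A n \<omega>) T = (\<integral>x. indicat_real T x \<partial>emp A n \<omega>)" by (simp add: sp Int_absorb2)
    also have "\<dots> = bsum (indicat_real T) n \<omega> / real n" using that by (intro integral_emp w) auto
    finally show ?thesis .
  qed
  have "bsum (indicat_real (shift -` S \<inter> seqs A)) n \<omega> = bsum (indicat_real S) n (shift \<omega>)"
    unfolding bsum_def
  proof (intro sum.cong refl)
    fix t
    have "shift ((shift ^^ t) \<omega>) = (shift ^^ t) (shift \<omega>)" by (simp add: funpow_swap1)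
    then show "indicat_real (shift -` S \<inter> seqs A) ((shift ^^ t) \<omega>) = indicat_real S ((shift ^^ t) (shift \<omega>))"
      using w(1) by (simp add: indicator_def)
  qed
  moreover have "bsum (indicat_real S) n (shift \<omega>) - bsum (indicat_real S) n \<omega> = indicat_real S ((shift ^^ n) \<omega>) - indicat_real S \<omega>"
    using bsum_Suc[of "indicat_real S" n \<omega>] bsum_Suc'[of "indicat_real S" n \<omega>] by simp
  ultimately have "measure (emp A n \<omega>) (shift -` S \<inter> seqs A) - measure (emp A n \<omega>) S
      = (indicat_real S ((shift ^^ n) \<omega>) - indicat_real S \<omega>) / real n"
    by (simp add: m[OF S] m[OF S'] diff_divide_distrib[symmetric])
  moreover have "\<bar>indicat_real S ((shift ^^ n) \<omega>) - indicat_real S \<omega>\<bar> \<le> 1"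
    by (simp add: indicator_def)
  ultimately show ?thesis by (simp add: abs_divide divide_right_mono)
qed

lemma ex_adm:
  assumes "finite A" "A \<noteq> {}"
  shows "\<exists>r \<kappa>. adm A r \<kappa>"
proof -
  have "adm A 0 (restrict (\<lambda>_. 1 / real (card A)) (words A (Suc 0)))"
    unfolding adm_def
  proof (intro conjI ballI)
    fix u assume "u \<in> words A 0"
    then have "(\<Sum>x\<in>A. restrict (\<lambda>_. 1 / real (card A)) (words A (Suc 0)) (x # u)) = (\<Sum>x\<in>A. 1 / real (card A))"
      by (intro sum.cong refl) (auto simp: words_def)
    then show "(\<Sum>x\<in>A. restrict (\<lambda>_. 1 / real (card A)) (words A (Suc 0)) (x # u)) \<le> 1" by simp
  qed (use assms in \<open>auto simp: card_gt_0_iff\<close>)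
  then show ?thesis by blast
qed

text \<open>The Ledrappier-Young formula with entropies and exponents as free arguments, so that
  code lengths and finite-time averages can be inserted.\<close>

definition Dfun :: "real \<Rightarrow> real \<Rightarrow> real \<Rightarrow> real \<Rightarrow> real" where
  "Dfun h hv l lv = h / l + (1 / lv - 1 / l) * hv"

text \<open>The coefficient of \<open>hv\<close> is nonnegative because the vertical exponent is at
  most the horizontal one, which reflects the condition \<open>a i j \<le> b i\<close> of the
  system.\<close>

lemma Dfun_mono:
  assumes "h \<le> h'" "hv \<le> hv'" "0 < lv" "lv \<le> l"
  shows "Dfun h hv l lv \<le> Dfun h' hv' l lv"
proof -
  have "h / l \<le> h' / l" using assms by (intro divide_right_mono) auto
  moreover have "1 / l \<le> 1 / lv" using assms by (intro divide_left_mono) auto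
  ultimately show ?thesis unfolding Dfun_def using assms by (intro add_mono mult_left_mono) auto
qed

lemma tendsto_Dfun:
  assumes "(h \<longlongrightarrow> h0) F" "(hv \<longlongrightarrow> hv0) F" "(l \<longlongrightarrow> l0) F" "(lv \<longlongrightarrow> lv0) F" "l0 \<noteq> 0" "lv0 \<noteq> 0"
  shows "((\<lambda>x. Dfun (h x) (hv x) (l x) (lv x)) \<longlongrightarrow> Dfun h0 hv0 l0 lv0) F"
  unfolding Dfun_def by (intro tendsto_intros assms)

locale lg =
  fixes p :: nat and m :: "nat \<Rightarrow> nat"
    and a c :: "nat \<Rightarrow> nat \<Rightarrow> real" and b d :: "nat \<Rightarrow> real"
  assumes LG: "LG_system p m a b c d"
begin

abbreviation Dg where "Dg \<equiv> digits p m"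
definition Vg :: "nat set" where "Vg = {1..p}"

lemma finite_Vg: "finite Vg" by (simp add: Vg_def)

definition la :: "(nat \<Rightarrow> nat \<times> nat) \<Rightarrow> real" where
  "la \<omega> = - ln (a (fst (\<omega> 0)) (snd (\<omega> 0)))"
definition lb :: "(nat \<Rightarrow> nat \<times> nat) \<Rightarrow> real" where
  "lb \<omega> = - ln (b (fst (\<omega> 0)))"

lemma finite_Dg: "finite Dg"
proof -
  have "Dg = Sigma {1..p} (\<lambda>i. {1..m i})" by (auto simp: digits_def)
  then show ?thesis by simp
qed

lemma Dg_ne: "Dg \<noteq> {}" and Vg_ne: "Vg \<noteq> {}"
proof -
  have "1 \<le> p" "1 \<le> m 1" using LG by (auto simp: LG_system_def)
  then have "(1, 1) \<in> Dg" by (auto simp: digits_def)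
  then show "Dg \<noteq> {}" by blast
  show "Vg \<noteq> {}" using \<open>1 \<le> p\<close> by (simp add: Vg_def)
qed

lemma ab_bounds:
  assumes "ij \<in> Dg"
  shows "0 < a (fst ij) (snd ij)" "a (fst ij) (snd ij) \<le> b (fst ij)" "b (fst ij) < 1" "0 < b (fst ij)"
proof -
  have "\<forall>(i,j)\<in>Dg. 0 < a i j \<and> a i j \<le> b i \<and> b i < 1 \<and> 0 \<le> c i j \<and> c i j \<le> 1"
    using LG unfolding LG_system_def by blast
  then show "0 < a (fst ij) (snd ij)" "a (fst ij) (snd ij) \<le> b (fst ij)" "b (fst ij) < 1"
    using assms by (auto simp: case_prod_unfold)
  then show "0 < b (fst ij)" by linarith
qed

text \<open>Since \<open>lb \<le> la\<close> pointwise, the least vertical and the greatest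
  horizontal rate bound both functions on both sides.\<close>

definition lmin :: real where "lmin = Min ((\<lambda>ij. - ln (b (fst ij))) ` Dg)"
definition lmax :: real where "lmax = Max ((\<lambda>ij. - ln (a (fst ij) (snd ij))) ` Dg)"

lemma lmin_pos: "0 < lmin"
  unfolding lmin_def using finite_Dg Dg_ne ab_bounds
  by (subst Min_gr_iff) (auto simp: ln_less_zero_iff)

lemma l_bounds:
  assumes "\<omega> \<in> seqs Dg"
  shows "lmin \<le> lb \<omega>" "lb \<omega> \<le> la \<omega>" "la \<omega> \<le> lmax"
proof -
  have w: "\<omega> 0 \<in> Dg" using assms by (simp add: seqs_def)
  show "lmin \<le> lb \<omega>" unfolding lmin_def lb_def using finite_Dg w by (intro Min_le) auto
  show "la \<omega> \<le> lmax" unfolding lmax_def la_def using finite_Dg w by (intro Max_ge) (auto intro: rev_image_eqI)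
  show "lb \<omega> \<le> la \<omega>" unfolding la_def lb_def using ab_bounds[OF w] by simp
qed

lemma lmin_le_lmax: "lmin \<le> lmax"
proof -
  obtain x where x: "x \<in> Dg" using Dg_ne by auto
  then have "(\<lambda>_. x) \<in> seqs Dg" by (simp add: seqs_def)
  from l_bounds[OF this] show ?thesis by linarith
qed

lemma uc_la: "uc Dg la" and uc_lb: "uc Dg lb"
  by (rule uc_local[of _ 1], simp add: la_def lb_def pre_eq_iff)+

lemma proj_seqs [simp]: "\<omega> \<in> seqs Dg \<Longrightarrow> proj_v \<omega> \<in> seqs Vg"
  by (auto simp: seqs_def proj_v_def digits_def case_prod_unfold Vg_def)

lemma pre_proj: "pre n (proj_v \<omega>) = map fst (pre n \<omega>)"
  by (rule nth_equalityI) (auto simp: proj_v_def)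

lemma proj_shift: "proj_v ((shift ^^ t) \<omega>) = (shift ^^ t) (proj_v \<omega>)"
  by (auto simp: proj_v_def shift_pow)

lemma uc_proj:
  assumes "uc Vg F" shows "uc Dg (\<lambda>\<omega>. F (proj_v \<omega>))"
  unfolding uc_def
proof (intro allI impI)
  fix e :: real assume "0 < e"
  then obtain n where n: "ucn Vg F n e" using ucD[OF assms] by blast
  have "ucn Dg (\<lambda>\<omega>. F (proj_v \<omega>)) n e"
    unfolding ucn_def
  proof (intro ballI impI)
    fix \<omega> \<omega>' assume "\<omega> \<in> seqs Dg" "\<omega>' \<in> seqs Dg" "pre n \<omega> = pre n \<omega>'"
    then show "\<bar>F (proj_v \<omega>) - F (proj_v \<omega>')\<bar> \<le> e"
      by (intro ucnD[OF n]) (simp_all add: pre_proj)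
  qed
  then show "\<exists>n. ucn Dg (\<lambda>\<omega>. F (proj_v \<omega>)) n e" by blast
qed

lemma measurable_proj: "proj_v \<in> measurable (shiftM Dg) (shiftM Vg)"
  unfolding shiftM_def
proof (rule measurable_PiM_single')
  fix i
  have "(\<lambda>\<omega>. \<omega> i) \<in> measurable (PiM UNIV (\<lambda>_::nat. count_space Dg)) (count_space Dg)"
    by (rule measurable_component_singleton) simp
  moreover have "fst \<in> measurable (count_space Dg) (count_space Vg)"
    by (auto simp: digits_def Vg_def)
  ultimately show "(\<lambda>\<omega>. proj_v \<omega> i) \<in> measurable (PiM UNIV (\<lambda>_::nat. count_space Dg)) (count_space Vg)"
    unfolding proj_v_def by (rule measurable_compose)
next
  show "proj_v \<in> space (PiM UNIV (\<lambda>_::nat. count_space Dg)) \<rightarrow> (\<Pi>\<^sub>E i\<in>UNIV. space (count_space Vg))"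
    by (auto simp: proj_v_def space_PiM PiE_iff digits_def case_prod_unfold Vg_def)
qed

definition pv :: "(nat \<Rightarrow> nat \<times> nat) measure \<Rightarrow> (nat \<Rightarrow> nat) measure" where
  "pv \<mu> = distr \<mu> (shiftM Vg) proj_v"

lemma measurable_proj': "sets \<mu> = sets (shiftM Dg) \<Longrightarrow> proj_v \<in> measurable \<mu> (shiftM Vg)"
  using measurable_proj measurable_cong_sets by blast

lemma pv_inv:
  assumes "\<mu> \<in> inv_meas Dg" shows "pv \<mu> \<in> inv_meas Vg"
proof -
  have s: "sets \<mu> = sets (shiftM Dg)" "prob_space \<mu>" using assms by (auto simp: inv_meas_def)
  have "distr (pv \<mu>) (shiftM Vg) shift = distr \<mu> (shiftM Vg) (shift \<circ> proj_v)"
    unfolding pv_def by (rule distr_distr[OF measurable_shift measurable_proj'[OF s(1)]])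
  also have "shift \<circ> proj_v = proj_v \<circ> shift" using proj_shift[of 1] by auto
  also have "distr \<mu> (shiftM Vg) (proj_v \<circ> shift) = distr (distr \<mu> (shiftM Dg) shift) (shiftM Vg) proj_v"
    by (rule distr_distr[OF measurable_proj, symmetric])
       (simp add: measurable_cong_sets[OF s(1) refl] measurable_shift)
  also have "\<dots> = pv \<mu>" using assms by (simp add: inv_meas_def pv_def)
  finally show ?thesis
    using prob_space.prob_space_distr[OF s(2) measurable_proj'[OF s(1)]] by (simp add: inv_meas_def pv_def)
qed

lemma integral_pv:
  fixes F :: "(nat \<Rightarrow> nat) \<Rightarrow> real"
  assumes "sets \<mu> = sets (shiftM Dg)" "F \<in> borel_measurable (shiftM Vg)"
  shows "(\<integral>x. F x \<partial>pv \<mu>) = (\<integral>\<omega>. F (proj_v \<omega>) \<partial>\<mu>)"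
  unfolding pv_def by (rule integral_distr[OF measurable_proj'[OF assms(1)] assms(2)])

lemma inv_measures_eq: "inv_measures p m = inv_meas Dg"
  by (simp add: inv_measures_def inv_meas_def SigmaM_def shiftM_def)

lemma SigmaS_eq: "SigmaS p m = seqs Dg"
  by (simp add: SigmaS_def seqs_def)

lemma shift_measure_D: "\<mu> \<in> inv_meas Dg \<Longrightarrow> shift_measure Dg \<mu>"
  by unfold_locales (auto simp: finite_Dg)

lemma shift_measure_V: "\<mu> \<in> inv_meas Dg \<Longrightarrow> shift_measure Vg (pv \<mu>)"
  by unfold_locales (auto simp: pv_inv finite_Vg)

lemma D_LY_eq:
  assumes "\<mu> \<in> inv_meas Dg"
  shows "D_LY p a b \<mu> = Dfun (hs Dg \<mu>) (hs Vg (pv \<mu>)) (\<integral>\<omega>. la \<omega> \<partial>\<mu>) (\<integral>\<omega>. lb \<omega> \<partial>\<mu>)"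
proof -
  have "h_ent \<mu> = hs Dg \<mu>"
    unfolding h_ent_def by (rule shift_measure.ks_entropy_eq_hs[OF shift_measure_D[OF assms]])
  moreover have "h_ent_v p \<mu> = hs Vg (pv \<mu>)"
    using shift_measure.ks_entropy_eq_hs[OF shift_measure_V[OF assms]]
    by (simp add: h_ent_v_def pv_def SigmaVM_def shiftM_def Vg_def)
  moreover have "lyap a \<mu> = (\<integral>\<omega>. la \<omega> \<partial>\<mu>)" "lyap_v b \<mu> = (\<integral>\<omega>. lb \<omega> \<partial>\<mu>)"
    by (simp_all add: lyap_def la_def lyap_v_def lb_def)
  ultimately show ?thesis by (simp add: D_LY_def Dfun_def)
qed

lemma lyap_bounds:
  assumes "prob_space \<mu>" "sets \<mu> = sets (shiftM Dg)"
  shows "lmin \<le> (\<integral>\<omega>. lb \<omega> \<partial>\<mu>)" "(\<integral>\<omega>. lb \<omega> \<partial>\<mu>) \<le> (\<integral>\<omega>. la \<omega> \<partial>\<mu>)" "(\<integral>\<omega>. la \<omega> \<partial>\<mu>) \<le> lmax"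
proof -
  interpret prob_space \<mu> by fact
  have sp: "space \<mu> = seqs Dg" by (rule space_eq_seqs[OF assms(2)])
  have i: "integrable \<mu> la" "integrable \<mu> lb"
    by (rule uc_integrable[OF finite_Dg uc_la assms], rule uc_integrable[OF finite_Dg uc_lb assms])
  have "(\<integral>\<omega>. lmin \<partial>\<mu>) \<le> (\<integral>\<omega>. lb \<omega> \<partial>\<mu>)" using i l_bounds by (intro integral_mono) (auto simp: sp)
  then show "lmin \<le> (\<integral>\<omega>. lb \<omega> \<partial>\<mu>)" by (simp add: prob_space)
  show "(\<integral>\<omega>. lb \<omega> \<partial>\<mu>) \<le> (\<integral>\<omega>. la \<omega> \<partial>\<mu>)" using i l_bounds by (intro integral_mono) (auto simp: sp)
  have "(\<integral>\<omega>. la \<omega> \<partial>\<mu>) \<le> (\<integral>\<omega>. lmax \<partial>\<mu>)" using i l_bounds by (intro integral_mono) (auto simp: sp)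
  then show "(\<integral>\<omega>. la \<omega> \<partial>\<mu>) \<le> lmax" by (simp add: prob_space)
qed

lemma hs_pv_le_gfun:
  assumes "\<mu> \<in> inv_meas Dg" "adm Vg r \<kappa>"
  shows "hs Vg (pv \<mu>) \<le> (\<integral>\<omega>. gfun r \<kappa> (proj_v \<omega>) \<partial>\<mu>)"
proof -
  have "sets \<mu> = sets (shiftM Dg)" using assms by (auto simp: inv_meas_def)
  then show ?thesis
    using shift_measure.hs_le_gfun[OF shift_measure_V[OF assms(1)] assms(2)]
    by (simp add: integral_pv gfun_measurable finite_Vg)
qed

lemma D_LY_le_gfun:
  assumes \<mu>: "\<mu> \<in> inv_meas Dg" and "adm Dg r \<kappa>" "adm Vg r' \<kappa>'"
  shows "D_LY p a b \<mu> \<le> Dfun (\<integral>\<omega>. gfun r \<kappa> \<omega> \<partial>\<mu>) (\<integral>\<omega>. gfun r' \<kappa>' (proj_v \<omega>) \<partial>\<mu>) (\<integral>\<omega>. la \<omega> \<partial>\<mu>) (\<integral>\<omega>. lb \<omega> \<partial>\<mu>)"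
proof -
  have s: "prob_space \<mu>" "sets \<mu> = sets (shiftM Dg)" using \<mu> by (auto simp: inv_meas_def)
  show ?thesis
    unfolding D_LY_eq[OF \<mu>]
    by (intro Dfun_mono hs_pv_le_gfun assms shift_measure.hs_le_gfun[OF shift_measure_D])
       (use lyap_bounds[OF s] lmin_pos in auto)
qed

lemma D_LY_nonneg: "\<mu> \<in> inv_meas Dg \<Longrightarrow> 0 \<le> D_LY p a b \<mu>"
proof -
  assume \<mu>: "\<mu> \<in> inv_meas Dg"
  then have s: "prob_space \<mu>" "sets \<mu> = sets (shiftM Dg)" by (auto simp: inv_meas_def)
  have "Dfun 0 0 (\<integral>\<omega>. la \<omega> \<partial>\<mu>) (\<integral>\<omega>. lb \<omega> \<partial>\<mu>) \<le> D_LY p a b \<mu>"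
    unfolding D_LY_eq[OF \<mu>]
    by (intro Dfun_mono shift_measure.hs_nonneg[OF shift_measure_D[OF \<mu>]] shift_measure.hs_nonneg[OF shift_measure_V[OF \<mu>]])
       (use lyap_bounds[OF s] lmin_pos in auto)
  then show ?thesis by (simp add: Dfun_def)
qed

text \<open>Any fixed pair of weights gives a bound. It ensures that the \<open>Sup\<close> in the
  theorem is a genuine supremum.\<close>

lemma D_LY_bounded: "\<exists>C. \<forall>\<mu>\<in>inv_meas Dg. D_LY p a b \<mu> \<le> C"
proof -
  obtain r \<kappa> where g: "adm Dg r \<kappa>" using ex_adm[OF finite_Dg Dg_ne] by blast
  obtain r' \<kappa>' where g': "adm Vg r' \<kappa>'" using ex_adm[OF finite_Vg Vg_ne] by blast
  have "D_LY p a b \<mu> \<le> gbound Dg r \<kappa> / lmin + (1 / lmin) * gbound Vg r' \<kappa>'" if \<mu>: "\<mu> \<in> inv_meas Dg" for \<mu>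
  proof -
    have s: "prob_space \<mu>" "sets \<mu> = sets (shiftM Dg)" using \<mu> by (auto simp: inv_meas_def)
    interpret prob_space \<mu> by fact
    have sp: "space \<mu> = seqs Dg" by (rule space_eq_seqs[OF s(2)])
    let ?l = "\<integral>\<omega>. la \<omega> \<partial>\<mu>" and ?lv = "\<integral>\<omega>. lb \<omega> \<partial>\<mu>"
    note b = lyap_bounds[OF s] lmin_pos
    have i: "integrable \<mu> (gfun r \<kappa>)" "integrable \<mu> (\<lambda>\<omega>. gfun r' \<kappa>' (proj_v \<omega>))"
      by (rule uc_integrable[OF finite_Dg uc_gfun s], rule uc_integrable[OF finite_Dg uc_proj[OF uc_gfun] s])
    have "(\<integral>\<omega>. gfun r \<kappa> \<omega> \<partial>\<mu>) \<le> (\<integral>\<omega>. gbound Dg r \<kappa> \<partial>\<mu>)"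
      using i gfun_le_gbound[OF g finite_Dg] by (intro integral_mono) (auto simp: sp)
    then have 1: "(\<integral>\<omega>. gfun r \<kappa> \<omega> \<partial>\<mu>) \<le> gbound Dg r \<kappa>" by (simp add: prob_space)
    have "(\<integral>\<omega>. gfun r' \<kappa>' (proj_v \<omega>) \<partial>\<mu>) \<le> (\<integral>\<omega>. gbound Vg r' \<kappa>' \<partial>\<mu>)"
      using i gfun_le_gbound[OF g' finite_Vg] by (intro integral_mono) (auto simp: sp)
    then have 2: "(\<integral>\<omega>. gfun r' \<kappa>' (proj_v \<omega>) \<partial>\<mu>) \<le> gbound Vg r' \<kappa>'" by (simp add: prob_space)
    have "D_LY p a b \<mu> \<le> Dfun (gbound Dg r \<kappa>) (gbound Vg r' \<kappa>') ?l ?lv"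
      by (rule order_trans[OF D_LY_le_gfun[OF \<mu> g g'] Dfun_mono[OF 1 2]]) (use b in auto)
    also have "\<dots> \<le> gbound Dg r \<kappa> / lmin + (1 / lmin) * gbound Vg r' \<kappa>'"
    proof -
      have "gbound Dg r \<kappa> / ?l \<le> gbound Dg r \<kappa> / lmin"
        using b gbound_nonneg[OF g finite_Dg] by (intro divide_left_mono) auto
      moreover have "1 / ?lv - 1 / ?l \<le> 1 / lmin"
      proof -
        have "1 / ?lv \<le> 1 / lmin" using b by (intro divide_left_mono) auto
        moreover have "0 \<le> 1 / ?l" using b by auto
        ultimately show ?thesis by linarith
      qed
      then have "(1 / ?lv - 1 / ?l) * gbound Vg r' \<kappa>' \<le> (1 / lmin) * gbound Vg r' \<kappa>'"
        using gbound_nonneg[OF g' finite_Vg] by (intro mult_right_mono) auto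
      ultimately show ?thesis unfolding Dfun_def by linarith
    qed
    finally show ?thesis .
  qed
  then show ?thesis by blast
qed

text \<open>The hypothesis speaks of weights instead of entropies because the measures
  \<open>e j\<close> need not be invariant: it is applied to empirical measures as well as to
  invariant ones. For a fixed pair of weights all integrals pass to the limit, and the weights are
  optimised only for the limit measure.\<close>

theorem D_LY_usc:
  assumes e: "\<And>j. prob_space (e j)" "\<And>j. sets (e j) = sets (shiftM Dg)"
    and inv: "\<And>S. S \<in> sets (shiftM Dg) \<Longrightarrow> (\<lambda>j. measure (e j) (shift -` S \<inter> seqs Dg) - measure (e j) S) \<longlonglongrightarrow> 0"
    and \<phi>: "uc Dg \<phi>" "(\<lambda>j. \<integral>\<omega>. \<phi> \<omega> \<partial>e j) \<longlonglongrightarrow> \<alpha>"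
    and s: "\<And>r \<kappa> r' \<kappa>'. adm Dg r \<kappa> \<Longrightarrow> adm Vg r' \<kappa>' \<Longrightarrow> eventually (\<lambda>j. s \<le> Dfun (\<integral>\<omega>. gfun r \<kappa> \<omega> \<partial>e j)
        (\<integral>\<omega>. gfun r' \<kappa>' (proj_v \<omega>) \<partial>e j) (\<integral>\<omega>. la \<omega> \<partial>e j) (\<integral>\<omega>. lb \<omega> \<partial>e j)) sequentially"
  shows "\<exists>\<mu>\<in>inv_meas Dg. (\<integral>\<omega>. \<phi> \<omega> \<partial>\<mu>) = \<alpha> \<and> s \<le> D_LY p a b \<mu>"
proof -
  obtain q \<mu> where q: "strict_mono q" and \<mu>: "\<mu> \<in> inv_meas Dg"
    and lim: "\<And>F. uc Dg F \<Longrightarrow> (\<lambda>j. \<integral>\<omega>. F \<omega> \<partial>e (q j)) \<longlonglongrightarrow> (\<integral>\<omega>. F \<omega> \<partial>\<mu>)"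
    using invariant_limit[of Dg e, OF finite_Dg e inv] by blast
  have sm: "prob_space \<mu>" "sets \<mu> = sets (shiftM Dg)" using \<mu> by (auto simp: inv_meas_def)
  have "(\<integral>\<omega>. \<phi> \<omega> \<partial>\<mu>) = \<alpha>"
    by (rule LIMSEQ_unique[OF lim[OF \<phi>(1)]]) (use LIMSEQ_subseq_LIMSEQ[OF \<phi>(2) q] in \<open>simp add: comp_def\<close>)
  moreover have "s \<le> D_LY p a b \<mu>"
  proof (rule field_le_epsilon)
    fix \<epsilon> :: real assume \<epsilon>: "0 < \<epsilon>"
    let ?l = "\<integral>\<omega>. la \<omega> \<partial>\<mu>" and ?lv = "\<integral>\<omega>. lb \<omega> \<partial>\<mu>"
    note b = lyap_bounds[OF sm] lmin_pos
    \<comment> \<open>Raising both entropies by \<delta> raises \<open>Dfun\<close> by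
      \<open>\<delta> / ?lv\<close>, which is then \<epsilon>.\<close>
    define \<delta> where "\<delta> = \<epsilon> * ?lv"
    have \<delta>: "0 < \<delta>" using \<epsilon> b by (simp add: \<delta>_def)
    obtain r \<kappa> where g: "adm Dg r \<kappa>" "(\<integral>\<omega>. gfun r \<kappa> \<omega> \<partial>\<mu>) < hs Dg \<mu> + \<delta>"
      using shift_measure.hs_approx[OF shift_measure_D[OF \<mu>] \<delta>] by blast
    obtain r' \<kappa>' where g': "adm Vg r' \<kappa>'" "(\<integral>\<omega>. gfun r' \<kappa>' \<omega> \<partial>pv \<mu>) < hs Vg (pv \<mu>) + \<delta>"
      using shift_measure.hs_approx[OF shift_measure_V[OF \<mu>] \<delta>] by blast
    have "s \<le> Dfun (\<integral>\<omega>. gfun r \<kappa> \<omega> \<partial>\<mu>) (\<integral>\<omega>. gfun r' \<kappa>' (proj_v \<omega>) \<partial>\<mu>) ?l ?lv"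
    proof (rule tendsto_lowerbound)
      show "(\<lambda>j. Dfun (\<integral>\<omega>. gfun r \<kappa> \<omega> \<partial>e (q j)) (\<integral>\<omega>. gfun r' \<kappa>' (proj_v \<omega>) \<partial>e (q j)) (\<integral>\<omega>. la \<omega> \<partial>e (q j)) (\<integral>\<omega>. lb \<omega> \<partial>e (q j)))
        \<longlonglongrightarrow> Dfun (\<integral>\<omega>. gfun r \<kappa> \<omega> \<partial>\<mu>) (\<integral>\<omega>. gfun r' \<kappa>' (proj_v \<omega>) \<partial>\<mu>) ?l ?lv"
        by (intro tendsto_Dfun lim uc_gfun uc_proj uc_la uc_lb) (use b in auto)
      show "eventually (\<lambda>j. s \<le> Dfun (\<integral>\<omega>. gfun r \<kappa> \<omega> \<partial>e (q j))
        (\<integral>\<omega>. gfun r' \<kappa>' (proj_v \<omega>) \<partial>e (q j)) (\<integral>\<omega>. la \<omega> \<partial>e (q j)) (\<integral>\<omega>. lb \<omega> \<partial>e (q j))) sequentially"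
        by (rule eventually_subseq[OF q s[OF g(1) g'(1)]])
    qed simp
    also have "\<dots> \<le> Dfun (hs Dg \<mu> + \<delta>) (hs Vg (pv \<mu>) + \<delta>) ?l ?lv"
      using g(2) g'(2) b by (intro Dfun_mono) (auto simp: integral_pv[OF sm(2)] gfun_measurable finite_Vg)
    also have "\<dots> = D_LY p a b \<mu> + \<delta> / ?lv"
      unfolding D_LY_eq[OF \<mu>] Dfun_def by (simp add: algebra_simps add_divide_distrib)
    also have "\<delta> / ?lv = \<epsilon>" using b by (simp add: \<delta>_def)
    finally show "s \<le> D_LY p a b \<mu> + \<epsilon>" .
  qed
  ultimately show ?thesis using \<mu> by blast
qed

end

section \<open>Hausdorff measure criteria\<close>

text \<open>A covering of Borel-Cantelli type: every point of \<open>E\<close> lies in sets of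
  arbitrarily late generations, so each tail of the generations covers \<open>E\<close>, and its
  total cost is a tail of a convergent series.\<close>

lemma hausdorff_measure_zeroI:
  fixes E :: "'a::metric_space set" and V :: "nat \<Rightarrow> 'k \<Rightarrow> 'a set"
  assumes s: "0 < s"
    and fin: "\<And>n. finite (F n)"
    and cov: "\<And>N. E \<subseteq> (\<Union>n\<in>{N..}. \<Union>k\<in>F n. V n k)"
    and bd: "\<And>n k. k \<in> F n \<Longrightarrow> bounded (V n k)" and dm: "\<And>n k. k \<in> F n \<Longrightarrow> diameter (V n k) \<le> D n"
    and D: "D \<longlonglongrightarrow> 0"
    and sm: "\<And>n. real (card (F n)) * 0 \<le> c n" "\<And>n. (\<Sum>k\<in>F n. diameter (V n k) powr s) \<le> c n" "summable c"
  shows "hausdorff_measure s E = 0"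
proof -
  have "hausdorff_content s \<delta> E \<le> ennreal e" if \<delta>: "0 < \<delta>" and e: "0 < e" for \<delta> e
  proof -
    obtain N1 where N1: "\<forall>n\<ge>N1. norm (D n - 0) < \<delta>" using LIMSEQ_D[OF D \<delta>] by blast
    obtain N2 where N2: "\<forall>n\<ge>N2. norm (\<Sum>i. c (i + n)) < e" using suminf_exist_split[OF e sm(3)] by blast
    define N where "N = max N1 N2"
    have "\<exists>h. bij_betw h {0..<card (F n)} (F n)" for n using ex_bij_betw_nat_finite[OF fin] .
    then obtain h where h: "\<And>n. bij_betw (h n) {0..<card (F n)} (F n)" by metis
    \<comment> \<open>Each finite generation is padded with empty sets, which have diameter 0 and
      cost nothing; \<open>prod_decode\<close> then lists the whole tail as one sequence.\<close>
    define W where "W = (\<lambda>(n, j). if j < card (F (n + N)) then V (n + N) (h (n + N) j) else {})"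
    have hF: "h n j \<in> F n" if "j < card (F n)" for n j using h[of n] that by (auto simp: bij_betw_def)
    have "E \<subseteq> (\<Union>k. W (prod_decode k))"
    proof
      fix x assume "x \<in> E"
      then obtain n k where nk: "n \<ge> N" "k \<in> F n" "x \<in> V n k" using cov[of N] by blast
      have "k \<in> h n ` {0..<card (F n)}" using h[of n] nk(2) by (simp add: bij_betw_def)
      then obtain j where j: "j < card (F n)" "h n j = k" by auto
      have "x \<in> W (n - N, j)" using nk j by (simp add: W_def)
      then have "x \<in> W (prod_decode (prod_encode (n - N, j)))" by simp
      then show "x \<in> (\<Union>k. W (prod_decode k))" by blast
    qed
    moreover have "bounded (W q) \<and> diameter (W q) \<le> \<delta>" for q
    proof (cases q)
      case (Pair n j)
      show ?thesis
      proof (cases "j < card (F (n + N))")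
        case True
        have "D (n + N) < \<delta>" using N1[rule_format, of "n + N"] unfolding real_norm_def N_def by linarith
        then show ?thesis using bd[OF hF[OF True]] dm[OF hF[OF True]] True by (simp add: W_def Pair)
      qed (use \<delta> in \<open>simp add: W_def Pair diameter_def\<close>)
    qed
    ultimately have "hausdorff_content s \<delta> E \<le> (\<Sum>k. ennreal (diameter (W (prod_decode k)) powr s))"
      unfolding hausdorff_content_def by (intro INF_lower) auto
    also have "\<dots> = (\<Sum>n. \<Sum>j. ennreal (diameter (W (n, j)) powr s))"
      by (rule suminf_ennreal_2dimen[where f = "\<lambda>q. ennreal (diameter (W q) powr s)"]) (rule refl)
    also have "\<dots> \<le> (\<Sum>n. ennreal (c (n + N)))"
    proof (intro suminf_le allI)
      fix n
      have "(\<Sum>j. ennreal (diameter (W (n, j)) powr s)) = (\<Sum>j<card (F (n + N)). ennreal (diameter (W (n, j)) powr s))"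
        using s by (intro suminf_finite) (auto simp: W_def diameter_def)
      also have "\<dots> = ennreal (\<Sum>j<card (F (n + N)). diameter (V (n + N) (h (n + N) j)) powr s)"
        by (simp add: W_def sum_ennreal)
      also have "(\<Sum>j<card (F (n + N)). diameter (V (n + N) (h (n + N) j)) powr s) = (\<Sum>k\<in>F (n + N). diameter (V (n + N) k) powr s)"
        using sum.reindex_bij_betw[OF h, of "\<lambda>k. diameter (V (n + N) k) powr s" "n + N"] by (simp add: lessThan_atLeast0)
      finally show "(\<Sum>j. ennreal (diameter (W (n, j)) powr s)) \<le> ennreal (c (n + N))"
        using sm(2)[of "n + N"] by (simp add: ennreal_leI)
    qed auto
    also have "\<dots> = ennreal (\<Sum>n. c (n + N))"
      using sm(1,3) by (intro suminf_ennreal2) (auto simp: summable_iff_shift)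
    also have "\<dots> \<le> ennreal e"
      using N2[rule_format, of N] by (intro ennreal_leI) (simp add: N_def real_norm_def)
    finally show ?thesis .
  qed
  note small = this
  have "hausdorff_content s \<delta> E \<le> 0" if "0 < \<delta>" for \<delta>
  proof (rule ennreal_le_epsilon)
    fix e :: real assume "0 < e"
    from small[OF that this] show "hausdorff_content s \<delta> E \<le> 0 + ennreal e" by simp
  qed
  then have "hausdorff_measure s E \<le> 0" unfolding hausdorff_measure_def by (intro SUP_least) simp
  then show ?thesis by simp
qed

lemma hausdorff_dim_le: "0 \<le> s \<Longrightarrow> hausdorff_measure s E = 0 \<Longrightarrow> hausdorff_dim E \<le> s"
  unfolding hausdorff_dim_def by (intro cInf_lower bdd_belowI[of _ 0]) auto

text \<open>The witness \<open>s0\<close> makes the set of exponents nonempty; the infimum of the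
  empty set would be unspecified.\<close>

lemma hausdorff_dim_ge:
  assumes "\<And>s. 0 \<le> s \<Longrightarrow> s \<le> t \<Longrightarrow> hausdorff_measure s E \<noteq> 0"
    and "0 \<le> s0" "hausdorff_measure s0 E = 0"
  shows "t \<le> hausdorff_dim E"
  unfolding hausdorff_dim_def
proof (rule cInf_greatest)
  show "{s. 0 \<le> s \<and> hausdorff_measure s E = 0} \<noteq> {}" using assms(2,3) by auto
  fix s assume "s \<in> {s. 0 \<le> s \<and> hausdorff_measure s E = 0}"
  then show "t \<le> s" using assms(1)[of s] by (cases "t \<le> s") auto
qed

text \<open>A form of the mass distribution principle in which the mass is spread over the fibres of a
  discrete-valued map \<open>key \<rho>\<close> at every scale \<open>\<rho>\<close>, so that the sets of a cover need not be measurable.\<close>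

lemma (in prob_space) mass_distribution:
  fixes E :: "'e::metric_space set" and Z :: "'a \<Rightarrow> 'e" and key :: "real \<Rightarrow> 'a \<Rightarrow> 'k"
  assumes G: "G \<in> events" "0 < prob G" "\<And>x. x \<in> G \<Longrightarrow> Z x \<in> E"
    and t: "0 < t" and r0: "0 < r0" "r0 \<le> 1"
    and cnt: "\<And>U \<rho>. 0 < \<rho> \<Longrightarrow> \<rho> < r0 \<Longrightarrow> bounded U \<Longrightarrow> diameter U \<le> \<rho> \<Longrightarrow>
        finite (key \<rho> ` {x\<in>space M. Z x \<in> U}) \<and> card (key \<rho> ` {x\<in>space M. Z x \<in> U}) \<le> C"
    and ev: "\<And>\<rho> x. 0 < \<rho> \<Longrightarrow> \<rho> < r0 \<Longrightarrow> x \<in> G \<Longrightarrow> {x'\<in>space M. key \<rho> x' = key \<rho> x} \<in> events"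
    and mass: "\<And>\<rho> x. 0 < \<rho> \<Longrightarrow> \<rho> < r0 \<Longrightarrow> x \<in> G \<Longrightarrow> prob {x'\<in>space M. key \<rho> x' = key \<rho> x} \<le> \<rho> powr t"
    and s: "0 \<le> s" "s \<le> t"
  shows "hausdorff_measure s E \<noteq> 0"
proof -
  have GS: "G \<subseteq> space M" using sets.sets_into_space[OF G(1)] .
  define \<delta> where "\<delta> = r0 / 2"
  have \<delta>: "0 < \<delta>" "\<delta> < r0" "\<delta> < 1" using r0 by (auto simp: \<delta>_def)
  have main: "ennreal (prob G) \<le> ennreal (real C) * y" if U: "E \<subseteq> (\<Union>k. U k)" "\<And>k. bounded (U k) \<and> diameter (U k) \<le> \<delta>"
    and y: "y = (\<Sum>k. ennreal (diameter (U k) powr s))" for U :: "nat \<Rightarrow> 'e set" and y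
  proof (rule ennreal_le_epsilon)
    fix \<eta> :: real assume \<eta>: "0 < \<eta>"
    \<comment> \<open>A covering set may have diameter 0, which is not an admissible scale;
      \<open>e k\<close> is the mass lost by enlarging it. The first entry of the minimum makes the
      total loss at most \<eta>, the second keeps the enlarged scales at most \<delta>.\<close>
    define e where "e = (\<lambda>k::nat. min (\<eta> / (real C + 1)) (\<delta> powr t) * (1/2)^(Suc k))"
    have e: "e k > 0" for k using \<eta> \<delta> by (auto simp: e_def)
    define \<rho> where "\<rho> = (\<lambda>k. max (diameter (U k)) (e k powr (1/t)))"
    have \<rho>0: "0 < \<rho> k" for k using e[of k] by (auto simp: \<rho>_def less_max_iff_disj)
    have ek: "e k powr (1/t) \<le> \<delta>" for k
    proof -
      have "e k \<le> (\<delta> powr t) * 1"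
        unfolding e_def using \<delta> by (intro mult_mono power_le_one) auto
      then have "e k powr (1/t) \<le> (\<delta> powr t) powr (1/t)" using e[of k] t by (intro powr_mono2) auto
      then show ?thesis using t \<delta> by (simp add: powr_powr)
    qed
    have \<rho>1: "\<rho> k < r0" for k using U(2)[of k] ek[of k] \<delta> by (auto simp: \<rho>_def)
    have dn: "diameter (U k) \<ge> 0" for k using U(2)[of k] by (simp add: diameter_ge_0)
    have \<rho>t: "\<rho> k powr t \<le> diameter (U k) powr s + e k" for k
    proof (cases "diameter (U k) \<le> e k powr (1/t)")
      case True
      then have "\<rho> k powr t = e k" using e[of k] t by (simp add: \<rho>_def powr_powr max_def)
      then show ?thesis by simp
    next
      case False
      then have "\<rho> k powr t = diameter (U k) powr t" by (simp add: \<rho>_def max_def)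
      also have "\<dots> \<le> diameter (U k) powr s"
        using s dn[of k] U(2)[of k] \<delta> by (intro powr_mono') auto
      finally show ?thesis using e[of k] by linarith
    qed
    \<comment> \<open>Only keys of points of \<open>G\<close> are collected, because
      \<open>ev\<close> and \<open>mass\<close> are assumed just for these.\<close>
    define Kk where "Kk = (\<lambda>k. key (\<rho> k) ` {x\<in>G. Z x \<in> U k})"
    have Kk: "finite (Kk k)" "card (Kk k) \<le> C" for k
    proof -
      have sub: "Kk k \<subseteq> key (\<rho> k) ` {x\<in>space M. Z x \<in> U k}" unfolding Kk_def using GS by (intro image_mono) auto
      have c: "finite (key (\<rho> k) ` {x\<in>space M. Z x \<in> U k}) \<and> card (key (\<rho> k) ` {x\<in>space M. Z x \<in> U k}) \<le> C"
        using U(2)[of k] by (intro cnt[OF \<rho>0 \<rho>1]) (auto simp: \<rho>_def)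
      show "finite (Kk k)" using c sub finite_subset by blast
      show "card (Kk k) \<le> C" using c card_mono[OF _ sub] by linarith
    qed
    define B where "B = (\<lambda>k. \<Union>q\<in>Kk k. {x'\<in>space M. key (\<rho> k) x' = q})"
    have Bev: "B k \<in> events" for k
      unfolding B_def by (intro sets.finite_UN Kk) (auto simp: Kk_def intro!: ev[OF \<rho>0 \<rho>1])
    have "G \<subseteq> (\<Union>k. B k)"
    proof
      fix x assume x: "x \<in> G"
      then obtain k where "Z x \<in> U k" using G(3)[OF x] U(1) by blast
      then have "x \<in> B k" using x GS by (auto simp: B_def Kk_def)
      then show "x \<in> (\<Union>k. B k)" by blast
    qed
    then have "emeasure M G \<le> emeasure M (\<Union>k. B k)" using Bev by (intro emeasure_mono) auto
    also have "\<dots> \<le> (\<Sum>k. emeasure M (B k))" using Bev by (intro emeasure_subadditive_countably) auto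
    also have "\<dots> \<le> (\<Sum>k. ennreal (real C) * ennreal (diameter (U k) powr s) + ennreal (real C * e k))"
    proof (intro suminf_le allI)
      fix k
      have "prob (B k) \<le> (\<Sum>q\<in>Kk k. prob {x'\<in>space M. key (\<rho> k) x' = q})"
        unfolding B_def
        by (intro finite_measure_subadditive_finite Kk) (auto simp: Kk_def intro!: ev[OF \<rho>0 \<rho>1])
      also have "\<dots> \<le> (\<Sum>q\<in>Kk k. \<rho> k powr t)"
        by (intro sum_mono) (auto simp: Kk_def intro!: mass[OF \<rho>0 \<rho>1])
      also have "\<dots> \<le> real C * (\<rho> k powr t)" using Kk[of k] by (simp add: mult_right_mono)
      also have "\<dots> \<le> real C * (diameter (U k) powr s + e k)" using \<rho>t by (intro mult_left_mono) auto
      finally have "emeasure M (B k) \<le> ennreal (real C * (diameter (U k) powr s + e k))"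
        by (simp add: emeasure_eq_measure ennreal_leI)
      also have "\<dots> = ennreal (real C) * ennreal (diameter (U k) powr s) + ennreal (real C * e k)"
        using e[of k] by (simp add: distrib_left ennreal_plus ennreal_mult')
      finally show "emeasure M (B k) \<le> ennreal (real C) * ennreal (diameter (U k) powr s) + ennreal (real C * e k)" .
    qed auto
    also have "\<dots> = (\<Sum>k. ennreal (real C) * ennreal (diameter (U k) powr s)) + (\<Sum>k. ennreal (real C * e k))"
      by (rule suminf_add[symmetric]) auto
    also have "(\<Sum>k. ennreal (real C) * ennreal (diameter (U k) powr s)) = ennreal (real C) * y"
      unfolding y by (rule ennreal_suminf_cmult)
    also have "(\<Sum>k. ennreal (real C * e k)) \<le> ennreal \<eta>"
    proof -
      let ?m = "real C * min (\<eta> / (real C + 1)) (\<delta> powr t)"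
      have m0: "0 \<le> ?m" using \<eta> by auto
      have "(\<lambda>k. ?m * (1/2)^(Suc k)) sums (?m * 1)" by (intro sums_mult power_half_series)
      then have "(\<Sum>k. ennreal (?m * (1/2)^(Suc k))) = ennreal (?m * 1)"
        using m0 by (intro suminf_ennreal_eq) auto
      then have "(\<Sum>k. ennreal (real C * e k)) = ennreal ?m" by (simp add: e_def mult.assoc)
      also have "?m \<le> real C * (\<eta> / (real C + 1))" by (intro mult_left_mono) auto
      also have "\<dots> \<le> \<eta>" using \<eta> by (simp add: field_simps)
      finally show ?thesis by (simp add: ennreal_leI)
    qed
    finally show "ennreal (prob G) \<le> ennreal (real C) * y + ennreal \<eta>"
      by (simp add: emeasure_eq_measure)
  qed
  have "ennreal (prob G / (real C + 1)) \<le> hausdorff_content s \<delta> E"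
    unfolding hausdorff_content_def
  proof (rule INF_greatest)
    fix U :: "nat \<Rightarrow> 'e set" assume "U \<in> {U. E \<subseteq> (\<Union>k. U k) \<and> (\<forall>k. bounded (U k) \<and> diameter (U k) \<le> \<delta>)}"
    then have "ennreal (prob G) \<le> ennreal (real C) * (\<Sum>k. ennreal (diameter (U k) powr s))"
      by (intro main[OF _ _ refl]) auto
    also have "\<dots> \<le> ennreal (real C + 1) * (\<Sum>k. ennreal (diameter (U k) powr s))"
      by (intro mult_right_mono ennreal_leI) auto
    finally have "ennreal (prob G) * ennreal (1 / (real C + 1)) \<le>
      ennreal (real C + 1) * (\<Sum>k. ennreal (diameter (U k) powr s)) * ennreal (1 / (real C + 1))"
      by (rule mult_right_mono) simp
    also have "\<dots> = (ennreal (1 / (real C + 1)) * ennreal (real C + 1)) * (\<Sum>k. ennreal (diameter (U k) powr s))"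
      by (simp only: mult_ac)
    also have "ennreal (1 / (real C + 1)) * ennreal (real C + 1) = 1"
      by (subst ennreal_mult[symmetric]) auto
    finally show "ennreal (prob G / (real C + 1)) \<le> (\<Sum>k. ennreal (diameter (U k) powr s))"
      by (simp add: ennreal_mult[symmetric])
  qed
  also have "\<dots> \<le> hausdorff_measure s E"
    unfolding hausdorff_measure_def using \<delta> by (intro SUP_upper) auto
  finally have le: "ennreal (prob G / (real C + 1)) \<le> hausdorff_measure s E" .
  have "0 < ennreal (prob G / (real C + 1))" using G(2) by (simp add: ennreal_zero_less_divide)
  then show ?thesis using le by auto
qed

section \<open>Approximate squares\<close>

text \<open>Together with \<open>pos\<close>: length and left end of the level-\<open>n\<close>
  interval coded by \<omega> in a system of contractions of the line.\<close>

definition rat :: "('e \<Rightarrow> real) \<Rightarrow> nat \<Rightarrow> (nat \<Rightarrow> 'e) \<Rightarrow> real" where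
  "rat \<alpha> n \<omega> = (\<Prod>t<n. \<alpha> (\<omega> t))"

definition pos :: "('e \<Rightarrow> real) \<Rightarrow> ('e \<Rightarrow> real) \<Rightarrow> nat \<Rightarrow> (nat \<Rightarrow> 'e) \<Rightarrow> real" where
  "pos \<alpha> \<gamma> n \<omega> = (\<Sum>t<n. rat \<alpha> t \<omega> * \<gamma> (\<omega> t))"

definition stp :: "('e \<Rightarrow> real) \<Rightarrow> real \<Rightarrow> (nat \<Rightarrow> 'e) \<Rightarrow> nat" where
  "stp \<alpha> \<rho> \<omega> = (LEAST n. rat \<alpha> n \<omega> \<le> \<rho>)"

lemma rat_Suc: "rat \<alpha> (Suc n) \<omega> = rat \<alpha> n \<omega> * \<alpha> (\<omega> n)"
  by (simp add: rat_def)

lemma rat_0 [simp]: "rat \<alpha> 0 \<omega> = 1" by (simp add: rat_def)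
lemma pos_0 [simp]: "pos \<alpha> \<gamma> 0 \<omega> = 0" by (simp add: pos_def)
lemma pos_Suc: "pos \<alpha> \<gamma> (Suc n) \<omega> = pos \<alpha> \<gamma> n \<omega> + rat \<alpha> n \<omega> * \<gamma> (\<omega> n)"
  by (simp add: pos_def)

text \<open>Both coordinates of the planar system are instances over the same digits. The vertical
  one ignores the second component, so different letters may give the same map.\<close>

locale line_ifs =
  fixes E :: "'e set" and \<alpha> \<gamma> :: "'e \<Rightarrow> real" and \<kappa> q :: real
  assumes kq: "0 < \<kappa>" "q < 1" and al: "\<And>e. e \<in> E \<Longrightarrow> \<kappa> \<le> \<alpha> e" "\<And>e. e \<in> E \<Longrightarrow> \<alpha> e \<le> q"
    and ga: "\<And>e. e \<in> E \<Longrightarrow> 0 \<le> \<gamma> e" "\<And>e. e \<in> E \<Longrightarrow> \<alpha> e + \<gamma> e \<le> 1"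
begin

lemma al_pos: "e \<in> E \<Longrightarrow> 0 < \<alpha> e" using kq al(1) by fastforce

lemma seqE: "\<omega> \<in> seqs E \<Longrightarrow> \<omega> n \<in> E" by (simp add: seqs_def)

lemma rat_pos: "\<omega> \<in> seqs E \<Longrightarrow> 0 < rat \<alpha> n \<omega>"
  unfolding rat_def by (intro prod_pos) (auto intro: al_pos seqE)

lemma rat_le: "\<omega> \<in> seqs E \<Longrightarrow> rat \<alpha> n \<omega> \<le> q ^ n"
proof (induction n)
  case (Suc n)
  have "rat \<alpha> (Suc n) \<omega> \<le> q ^ n * q" unfolding rat_Suc
    using Suc al(2)[OF seqE[OF Suc.prems]] al_pos[OF seqE[OF Suc.prems]] rat_pos[OF Suc.prems, of n]
    by (intro mult_mono) (auto intro: order_trans[OF less_imp_le])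
  then show ?case by (simp add: mult.commute)
qed simp

lemma q_pos: "\<omega> \<in> seqs E \<Longrightarrow> 0 < q"
  using al(2)[OF seqE, of \<omega> 0] al_pos[OF seqE, of \<omega> 0] by linarith

lemma rat_tendsto: "\<omega> \<in> seqs E \<Longrightarrow> (\<lambda>n. rat \<alpha> n \<omega>) \<longlonglongrightarrow> 0"
  by (rule tendsto_sandwich[of "\<lambda>_. 0" _ _ "\<lambda>n. q ^ n"])
     (use kq q_pos in \<open>auto intro!: always_eventually rat_le less_imp_le[OF rat_pos] LIMSEQ_realpow_zero less_imp_le[OF q_pos]\<close>)

lemma pos_mono: "\<omega> \<in> seqs E \<Longrightarrow> n \<le> k \<Longrightarrow> pos \<alpha> \<gamma> n \<omega> \<le> pos \<alpha> \<gamma> k \<omega>"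
  by (rule lift_Suc_mono_le[of "\<lambda>n. pos \<alpha> \<gamma> n \<omega>"])
     (auto simp: pos_Suc intro!: mult_nonneg_nonneg less_imp_le[OF rat_pos] ga(1) seqE)

lemma end_step: "\<omega> \<in> seqs E \<Longrightarrow> pos \<alpha> \<gamma> (Suc n) \<omega> + rat \<alpha> (Suc n) \<omega> \<le> pos \<alpha> \<gamma> n \<omega> + rat \<alpha> n \<omega>"
proof -
  assume w: "\<omega> \<in> seqs E"
  have "rat \<alpha> n \<omega> * (\<alpha> (\<omega> n) + \<gamma> (\<omega> n)) \<le> rat \<alpha> n \<omega> * 1"
    using ga(2)[OF seqE[OF w]] less_imp_le[OF rat_pos[OF w]] by (intro mult_left_mono)
  then show ?thesis by (simp add: pos_Suc rat_Suc algebra_simps)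
qed

lemma end_mono: "\<omega> \<in> seqs E \<Longrightarrow> n \<le> k \<Longrightarrow> pos \<alpha> \<gamma> k \<omega> + rat \<alpha> k \<omega> \<le> pos \<alpha> \<gamma> n \<omega> + rat \<alpha> n \<omega>"
  by (rule lift_Suc_antimono_le[of "\<lambda>n. pos \<alpha> \<gamma> n \<omega> + rat \<alpha> n \<omega>"]) (auto intro: end_step)

lemma limit_point:
  assumes w: "\<omega> \<in> seqs E"
  shows "\<exists>!x. \<forall>n. pos \<alpha> \<gamma> n \<omega> \<le> x \<and> x \<le> pos \<alpha> \<gamma> n \<omega> + rat \<alpha> n \<omega>"
proof (rule ex_ex1I)
  let ?x = "SUP n. pos \<alpha> \<gamma> n \<omega>"
  have le: "pos \<alpha> \<gamma> k \<omega> \<le> pos \<alpha> \<gamma> n \<omega> + rat \<alpha> n \<omega>" for k n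
    using pos_mono[OF w, of k "max k n"] end_mono[OF w, of n "max k n"] rat_pos[OF w, of "max k n"] by simp
  have bdd: "bdd_above (range (\<lambda>n. pos \<alpha> \<gamma> n \<omega>))" using le[of _ 0] by (intro bdd_aboveI2)
  have "pos \<alpha> \<gamma> n \<omega> \<le> ?x" for n using bdd by (intro cSUP_upper) auto
  moreover have "?x \<le> pos \<alpha> \<gamma> n \<omega> + rat \<alpha> n \<omega>" for n using le by (intro cSUP_least) auto
  ultimately show "\<exists>x. \<forall>n. pos \<alpha> \<gamma> n \<omega> \<le> x \<and> x \<le> pos \<alpha> \<gamma> n \<omega> + rat \<alpha> n \<omega>" by blast
next
  fix x y assume xy: "\<forall>n. pos \<alpha> \<gamma> n \<omega> \<le> x \<and> x \<le> pos \<alpha> \<gamma> n \<omega> + rat \<alpha> n \<omega>"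
    "\<forall>n. pos \<alpha> \<gamma> n \<omega> \<le> y \<and> y \<le> pos \<alpha> \<gamma> n \<omega> + rat \<alpha> n \<omega>"
  have "\<bar>x - y\<bar> \<le> rat \<alpha> n \<omega>" for n
    using spec[OF xy(1), of n] spec[OF xy(2), of n] by linarith
  then have "\<bar>x - y\<bar> \<le> 0" by (intro LIMSEQ_le_const[OF rat_tendsto[OF w]]) auto
  then show "x = y" by simp
qed

lemma rat_cong: "(\<And>s. s < n \<Longrightarrow> \<alpha> (\<omega> s) = \<alpha> (\<omega>' s)) \<Longrightarrow> rat \<alpha> n \<omega> = rat \<alpha> n \<omega>'"
  unfolding rat_def by (intro prod.cong) auto

lemma pos_cong: "(\<And>s. s < n \<Longrightarrow> \<alpha> (\<omega> s) = \<alpha> (\<omega>' s) \<and> \<gamma> (\<omega> s) = \<gamma> (\<omega>' s)) \<Longrightarrow> pos \<alpha> \<gamma> n \<omega> = pos \<alpha> \<gamma> n \<omega>'"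
  unfolding pos_def by (intro sum.cong refl arg_cong2[where f="(*)"] rat_cong) auto

text \<open>Once two intervals with a common parent lie side by side, all their descendants keep
  that order.\<close>

lemma separation:
  assumes w: "\<omega> \<in> seqs E" "\<omega>' \<in> seqs E"
    and eq: "\<And>s. s < t \<Longrightarrow> \<alpha> (\<omega> s) = \<alpha> (\<omega>' s) \<and> \<gamma> (\<omega> s) = \<gamma> (\<omega>' s)"
    and sep: "\<alpha> (\<omega> t) + \<gamma> (\<omega> t) \<le> \<gamma> (\<omega>' t)" and t: "t < n" "t < n'"
  shows "pos \<alpha> \<gamma> n \<omega> + rat \<alpha> n \<omega> \<le> pos \<alpha> \<gamma> n' \<omega>'"
proof -
  have "pos \<alpha> \<gamma> n \<omega> + rat \<alpha> n \<omega> \<le> pos \<alpha> \<gamma> (Suc t) \<omega> + rat \<alpha> (Suc t) \<omega>"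
    using t by (intro end_mono w) auto
  also have "\<dots> = pos \<alpha> \<gamma> t \<omega> + rat \<alpha> t \<omega> * (\<alpha> (\<omega> t) + \<gamma> (\<omega> t))"
    by (simp add: pos_Suc rat_Suc algebra_simps)
  also have "\<dots> \<le> pos \<alpha> \<gamma> t \<omega> + rat \<alpha> t \<omega> * \<gamma> (\<omega>' t)"
    using sep less_imp_le[OF rat_pos[OF w(1)]] by (intro add_left_mono mult_left_mono) auto
  also have "\<dots> = pos \<alpha> \<gamma> (Suc t) \<omega>'"
    using pos_cong[of t \<omega> \<omega>'] rat_cong[of t \<omega> \<omega>'] eq by (simp add: pos_Suc)
  also have "\<dots> \<le> pos \<alpha> \<gamma> n' \<omega>'" using t by (intro pos_mono w) auto
  finally show ?thesis .
qed

lemma stp_ex: "\<omega> \<in> seqs E \<Longrightarrow> 0 < \<rho> \<Longrightarrow> \<exists>n. rat \<alpha> n \<omega> \<le> \<rho>"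
  using LIMSEQ_D[OF rat_tendsto, of \<omega> \<rho>] by (metis abs_le_D1 diff_zero less_imp_le order_refl real_norm_def)

lemma stp_le: "\<omega> \<in> seqs E \<Longrightarrow> 0 < \<rho> \<Longrightarrow> rat \<alpha> (stp \<alpha> \<rho> \<omega>) \<omega> \<le> \<rho>"
  unfolding stp_def by (rule LeastI_ex) (rule stp_ex)

lemma stp_min: "n < stp \<alpha> \<rho> \<omega> \<Longrightarrow> \<rho> < rat \<alpha> n \<omega>"
  unfolding stp_def using not_less_Least not_le by blast

text \<open>One level earlier the length still exceeds \<rho>, and a single contraction is at least
  \<kappa>. Level 0 cannot be the stopping level because \<open>\<rho> < 1\<close>.\<close>

lemma stp_lower:
  assumes w: "\<omega> \<in> seqs E" and r: "0 < \<rho>" "\<rho> < 1"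
  shows "\<kappa> * \<rho> < rat \<alpha> (stp \<alpha> \<rho> \<omega>) \<omega>"
proof (cases "stp \<alpha> \<rho> \<omega>")
  case 0
  then show ?thesis using stp_le[OF w r(1)] r by simp
next
  case (Suc k)
  have "\<kappa> * \<rho> < \<kappa> * rat \<alpha> k \<omega>" using stp_min[of k \<rho> \<omega>] Suc kq by simp
  also have "\<dots> \<le> \<alpha> (\<omega> k) * rat \<alpha> k \<omega>"
    using al(1)[OF seqE[OF w]] rat_pos[OF w, of k] by (intro mult_right_mono) auto
  finally show ?thesis by (simp add: Suc rat_Suc mult.commute)
qed

text \<open>Up to the smaller stopping level both lengths agree, so the sequence that stops there
  forces the other one to stop as well.\<close>

lemma stp_cong:
  assumes w: "\<omega> \<in> seqs E" "\<omega>' \<in> seqs E" "0 < \<rho>"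
    and eq: "\<And>s. s < min (stp \<alpha> \<rho> \<omega>) (stp \<alpha> \<rho> \<omega>') \<Longrightarrow> \<alpha> (\<omega> s) = \<alpha> (\<omega>' s)"
  shows "stp \<alpha> \<rho> \<omega> = stp \<alpha> \<rho> \<omega>'"
proof -
  have e: "rat \<alpha> (min (stp \<alpha> \<rho> \<omega>) (stp \<alpha> \<rho> \<omega>')) \<omega> = rat \<alpha> (min (stp \<alpha> \<rho> \<omega>) (stp \<alpha> \<rho> \<omega>')) \<omega>'"
    using eq by (rule rat_cong)
  show ?thesis
  proof (rule ccontr)
    assume "stp \<alpha> \<rho> \<omega> \<noteq> stp \<alpha> \<rho> \<omega>'"
    then consider "stp \<alpha> \<rho> \<omega> < stp \<alpha> \<rho> \<omega>'" | "stp \<alpha> \<rho> \<omega>' < stp \<alpha> \<rho> \<omega>" by linarith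
    then show False
    proof cases
      case 1 then show False using stp_min[OF 1] stp_le[OF w(1,3)] e by (simp add: min_def)
    next
      case 2 then show False using stp_min[OF 2] stp_le[OF w(2,3)] e by (simp add: min_def split: if_splits)
    qed
  qed
qed

text \<open>At a first difference, \<open>separation\<close> would put the left ends at least one
  interval length apart, which exceeds \<open>\<kappa> * \<rho>\<close>. The map \<open>v\<close>
  reads the part of a letter that the coordinate distinguishes: the row for the vertical, the whole
  digit for the horizontal one.\<close>

lemma close_imp_same:
  fixes v :: "'e \<Rightarrow> 'f"
  assumes w: "\<omega> \<in> seqs E" "\<omega>' \<in> seqs E" and r: "0 < \<rho>" "\<rho> < 1"
    and v: "\<And>e e'. e \<in> E \<Longrightarrow> e' \<in> E \<Longrightarrow> v e = v e' \<Longrightarrow> \<alpha> e = \<alpha> e' \<and> \<gamma> e = \<gamma> e'"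
    and sep: "\<And>t. t < stp \<alpha> \<rho> \<omega> \<Longrightarrow> t < stp \<alpha> \<rho> \<omega>' \<Longrightarrow> v (\<omega> t) \<noteq> v (\<omega>' t) \<Longrightarrow>
       \<alpha> (\<omega> t) + \<gamma> (\<omega> t) \<le> \<gamma> (\<omega>' t) \<or> \<alpha> (\<omega>' t) + \<gamma> (\<omega>' t) \<le> \<gamma> (\<omega> t)"
    and close: "\<bar>pos \<alpha> \<gamma> (stp \<alpha> \<rho> \<omega>) \<omega> - pos \<alpha> \<gamma> (stp \<alpha> \<rho> \<omega>') \<omega>'\<bar> < \<kappa> * \<rho>"
  shows "stp \<alpha> \<rho> \<omega> = stp \<alpha> \<rho> \<omega>' \<and> (\<forall>s<stp \<alpha> \<rho> \<omega>. v (\<omega> s) = v (\<omega>' s))"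
proof -
  let ?N = "stp \<alpha> \<rho> \<omega>" and ?N' = "stp \<alpha> \<rho> \<omega>'"
  have all: "v (\<omega> t) = v (\<omega>' t)" if "t < min ?N ?N'" for t
    using that
  proof (induction t rule: less_induct)
    case (less t)
    have eq: "\<alpha> (\<omega> s) = \<alpha> (\<omega>' s) \<and> \<gamma> (\<omega> s) = \<gamma> (\<omega>' s)" if "s < t" for s
      using less that by (intro v seqE w) auto
    show ?case
    proof (rule ccontr)
      assume ne: "v (\<omega> t) \<noteq> v (\<omega>' t)"
      have t: "t < ?N" "t < ?N'" using less.prems by auto
      from sep[OF t ne] show False
      proof
        assume "\<alpha> (\<omega> t) + \<gamma> (\<omega> t) \<le> \<gamma> (\<omega>' t)"
        from separation[OF w eq this t] show False
          using stp_lower[OF w(1) r] close by linarith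
      next
        assume "\<alpha> (\<omega>' t) + \<gamma> (\<omega>' t) \<le> \<gamma> (\<omega> t)"
        from separation[OF w(2,1) _ this t(2,1)] eq show False
          using stp_lower[OF w(2) r] close by force
      qed
    qed
  qed
  have "?N = ?N'"
  proof (rule stp_cong[OF w r(1)])
    fix s assume "s < min ?N ?N'"
    then show "\<alpha> (\<omega> s) = \<alpha> (\<omega>' s)" using v[OF seqE[OF w(1)] seqE[OF w(2)] all] by blast
  qed
  then show ?thesis using all by auto
qed

end

section \<open>Geometry of the coding map\<close>

context lg begin

definition aA :: "nat \<times> nat \<Rightarrow> real" where "aA ij = a (fst ij) (snd ij)"
definition cC :: "nat \<times> nat \<Rightarrow> real" where "cC ij = c (fst ij) (snd ij)"
definition bB :: "nat \<times> nat \<Rightarrow> real" where "bB ij = b (fst ij)"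
definition dD :: "nat \<times> nat \<Rightarrow> real" where "dD ij = d (fst ij)"
abbreviation cod :: "(nat \<Rightarrow> nat \<times> nat) \<Rightarrow> real \<times> real" where "cod \<equiv> coding a b c d"

lemma c_chain:
  assumes i: "i \<in> {1..p}" and j: "1 \<le> j" "j < j'" "j' \<le> m i"
  shows "a i j + c i j \<le> c i j'"
  using j(2,3)
proof (induction j')
  case (Suc k)
  have st: "c i k' \<le> c i (Suc k') \<and> a i k' \<le> c i (Suc k') - c i k'" if "1 \<le> k'" "k' < m i" for k'
    using LG i that unfolding LG_system_def by blast
  show ?case
  proof (cases "j = k")
    case True
    then show ?thesis using st[of k] j(1) Suc.prems by simp
  next
    case False
    then show ?thesis using Suc.IH Suc.prems st[of k] j(1) by simp
  qed
qed simp

lemma d_chain: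
  assumes i: "1 \<le> i" "i < i'" "i' \<le> p"
  shows "b i + d i \<le> d i'"
  using i(2,3)
proof (induction i')
  case (Suc k)
  have st: "d k' \<le> d (Suc k') \<and> b k' \<le> d (Suc k') - d k'" if "1 \<le> k'" "k' < p" for k'
    using LG that unfolding LG_system_def by blast
  show ?case
  proof (cases "i = k")
    case True
    then show ?thesis using st[of k] i(1) Suc.prems by simp
  next
    case False
    then show ?thesis using Suc.IH Suc.prems st[of k] i(1) by simp
  qed
qed simp

lemma Dg_cases: "ij \<in> Dg \<Longrightarrow> fst ij \<in> {1..p} \<and> 1 \<le> snd ij \<and> snd ij \<le> m (fst ij)"
  by (auto simp: digits_def)

lemma cC_bounds:
  assumes "ij \<in> Dg" shows "0 \<le> cC ij" "aA ij + cC ij \<le> 1"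
proof -
  have "\<forall>(i,j)\<in>Dg. 0 < a i j \<and> a i j \<le> b i \<and> b i < 1 \<and> 0 \<le> c i j \<and> c i j \<le> 1"
    using LG unfolding LG_system_def by blast
  then show "0 \<le> cC ij" using assms by (auto simp: cC_def)
  have I: "c (fst ij) (m (fst ij)) < 1" "a (fst ij) (m (fst ij)) + c (fst ij) (m (fst ij)) \<le> 1"
    using LG Dg_cases[OF assms] unfolding LG_system_def by blast+
  show "aA ij + cC ij \<le> 1"
  proof (cases "snd ij = m (fst ij)")
    case True then show ?thesis using I by (simp add: aA_def cC_def)
  next
    case False
    then have "aA ij + cC ij \<le> c (fst ij) (m (fst ij))"
      unfolding aA_def cC_def using Dg_cases[OF assms] by (intro c_chain) auto
    then show ?thesis using I by linarith
  qed
qed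

lemma dD_bounds:
  assumes "ij \<in> Dg" shows "0 \<le> dD ij" "bB ij + dD ij \<le> 1"
proof -
  have "\<forall>i\<in>{1..p}. 0 \<le> d i \<and> d i \<le> 1" using LG unfolding LG_system_def by blast
  then show "0 \<le> dD ij" using Dg_cases[OF assms] by (auto simp: dD_def)
  have I: "d p < 1" "b p + d p \<le> 1" using LG unfolding LG_system_def by blast+
  show "bB ij + dD ij \<le> 1"
  proof (cases "fst ij = p")
    case True then show ?thesis using I by (simp add: bB_def dD_def)
  next
    case False
    then have "bB ij + dD ij \<le> d p"
      unfolding bB_def dD_def using Dg_cases[OF assms] by (intro d_chain) auto
    then show ?thesis using I by linarith
  qed
qed

lemma ab_lnbounds:
  assumes "ij \<in> Dg"
  shows "exp (- lmax) \<le> aA ij" "aA ij \<le> bB ij" "bB ij \<le> exp (- lmin)"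
proof -
  have s: "(\<lambda>_. ij) \<in> seqs Dg" using assms by (simp add: seqs_def)
  note l = l_bounds[OF s, unfolded la_def lb_def]
  have "exp (- lmax) \<le> exp (ln (aA ij))" using l by (simp add: aA_def)
  then show "exp (- lmax) \<le> aA ij" using ab_bounds[OF assms] by (simp add: aA_def)
  show "aA ij \<le> bB ij" using ab_bounds[OF assms] by (simp add: aA_def bB_def)
  have "exp (ln (bB ij)) \<le> exp (- lmin)" using l by (simp add: bB_def)
  then show "bB ij \<le> exp (- lmin)" using ab_bounds[OF assms] by (simp add: bB_def)
qed

sublocale X: line_ifs Dg aA cC "exp (- lmax)" "exp (- lmin)"
proof
  fix e assume e: "e \<in> Dg"
  show "exp (- lmax) \<le> aA e" "aA e \<le> exp (- lmin)" using ab_lnbounds[OF e] by auto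
qed (use lmin_pos cC_bounds in auto)

sublocale Y: line_ifs Dg bB dD "exp (- lmax)" "exp (- lmin)"
proof
  fix e assume e: "e \<in> Dg"
  show "exp (- lmax) \<le> bB e" "bB e \<le> exp (- lmin)" using ab_lnbounds[OF e] by auto
qed (use lmin_pos dD_bounds in auto)

lemma rat_a: "\<omega> \<in> seqs Dg \<Longrightarrow> rat aA n \<omega> = exp (- bsum la n \<omega>)"
proof (induction n)
  case (Suc n)
  have "0 < aA (\<omega> n)" using X.al_pos X.seqE[OF Suc.prems] by blast
  then have "exp (- la ((shift ^^ n) \<omega>)) = aA (\<omega> n)" by (simp add: la_def shift_pow aA_def)
  then show ?case using Suc by (simp add: rat_Suc bsum_Suc' exp_add[symmetric] exp_diff exp_minus divide_inverse)
qed simp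

lemma rat_b: "\<omega> \<in> seqs Dg \<Longrightarrow> rat bB n \<omega> = exp (- bsum lb n \<omega>)"
proof (induction n)
  case (Suc n)
  have "0 < bB (\<omega> n)" using Y.al_pos X.seqE[OF Suc.prems] by blast
  then have "exp (- lb ((shift ^^ n) \<omega>)) = bB (\<omega> n)" by (simp add: lb_def shift_pow bB_def)
  then show ?case using Suc by (simp add: rat_Suc bsum_Suc' exp_add[symmetric] exp_diff exp_minus divide_inverse)
qed simp

lemma rat_a_le_b: "\<omega> \<in> seqs Dg \<Longrightarrow> rat aA n \<omega> \<le> rat bB n \<omega>"
  unfolding rat_def by (intro prod_mono conjI less_imp_le[OF X.al_pos] ab_lnbounds(2) X.seqE)

lemma stp_a_le_b:
  assumes "\<omega> \<in> seqs Dg" "0 < \<rho>" shows "stp aA \<rho> \<omega> \<le> stp bB \<rho> \<omega>"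
  unfolding stp_def[of aA]
  by (rule Least_le) (use rat_a_le_b[OF assms(1), of "stp bB \<rho> \<omega>"] Y.stp_le[OF assms] in linarith)

lemma S_comp_eq: "S_comp a b c d n \<omega> z = (rat aA n \<omega> * fst z + pos aA cC n \<omega>, rat bB n \<omega> * snd z + pos bB dD n \<omega>)"
proof (induction n arbitrary: z)
  case 0 then show ?case by simp
next
  case (Suc n)
  show ?case
    by (simp add: Suc S_map_def rat_Suc pos_Suc aA_def bB_def cC_def dD_def algebra_simps)
qed

lemma S_comp_image:
  assumes w: "\<omega> \<in> seqs Dg"
  shows "z \<in> S_comp a b c d n \<omega> ` unit_square \<longleftrightarrow>
    (pos aA cC n \<omega> \<le> fst z \<and> fst z \<le> pos aA cC n \<omega> + rat aA n \<omega>) \<and>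
    (pos bB dD n \<omega> \<le> snd z \<and> snd z \<le> pos bB dD n \<omega> + rat bB n \<omega>)" (is "?l \<longleftrightarrow> ?r")
proof
  note ra = X.rat_pos[OF w, of n] and rb = Y.rat_pos[OF w, of n]
  show ?r if ?l
  proof -
    obtain u where u: "u \<in> unit_square" "z = S_comp a b c d n \<omega> u" using \<open>?l\<close> by blast
    have "0 \<le> fst u" "fst u \<le> 1" "0 \<le> snd u" "snd u \<le> 1" using u(1) by (auto simp: unit_square_def)
    then have "0 \<le> rat aA n \<omega> * fst u" "rat aA n \<omega> * fst u \<le> rat aA n \<omega>"
      "0 \<le> rat bB n \<omega> * snd u" "rat bB n \<omega> * snd u \<le> rat bB n \<omega>"
      using ra rb by (auto intro: mult_left_le)
    then show ?r using u(2) by (simp add: S_comp_eq)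
  qed
  show ?l if r: ?r
  proof (rule image_eqI)
    let ?u = "((fst z - pos aA cC n \<omega>) / rat aA n \<omega>, (snd z - pos bB dD n \<omega>) / rat bB n \<omega>)"
    show "z = S_comp a b c d n \<omega> ?u" using ra rb by (simp add: S_comp_eq prod_eq_iff)
    show "?u \<in> unit_square" using r ra rb by (simp add: unit_square_def)
  qed
qed

text \<open>Membership in all the rectangles constrains the two coordinates separately, so
  \<open>limit_point\<close> in each of them justifies the definite description in
  \<open>coding\<close>.\<close>

lemma cod_bounds:
  assumes w: "\<omega> \<in> seqs Dg"
  shows "pos aA cC n \<omega> \<le> fst (cod \<omega>)" "fst (cod \<omega>) \<le> pos aA cC n \<omega> + rat aA n \<omega>"
    "pos bB dD n \<omega> \<le> snd (cod \<omega>)" "snd (cod \<omega>) \<le> pos bB dD n \<omega> + rat bB n \<omega>"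
proof -
  obtain x where x: "\<forall>n. pos aA cC n \<omega> \<le> x \<and> x \<le> pos aA cC n \<omega> + rat aA n \<omega>"
    and xu: "\<And>x'. \<forall>n. pos aA cC n \<omega> \<le> x' \<and> x' \<le> pos aA cC n \<omega> + rat aA n \<omega> \<Longrightarrow> x' = x"
    using X.limit_point[OF w] by (auto elim!: ex1E)
  obtain y where y: "\<forall>n. pos bB dD n \<omega> \<le> y \<and> y \<le> pos bB dD n \<omega> + rat bB n \<omega>"
    and yu: "\<And>y'. \<forall>n. pos bB dD n \<omega> \<le> y' \<and> y' \<le> pos bB dD n \<omega> + rat bB n \<omega> \<Longrightarrow> y' = y"
    using Y.limit_point[OF w] by (auto elim!: ex1E)
  have "cod \<omega> = (x, y)"
    unfolding coding_def
  proof (rule the_equality)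
    show "(x, y) \<in> (\<Inter>n. S_comp a b c d n \<omega> ` unit_square)"
      using x y by (simp add: S_comp_image[OF w])
    fix z assume "z \<in> (\<Inter>n. S_comp a b c d n \<omega> ` unit_square)"
    then have "\<forall>n. z \<in> S_comp a b c d n \<omega> ` unit_square" by blast
    then have "fst z = x" "snd z = y"
      unfolding S_comp_image[OF w] by (intro xu yu; simp)+
    then show "z = (x, y)" by (simp add: prod_eq_iff)
  qed
  then show "pos aA cC n \<omega> \<le> fst (cod \<omega>)" "fst (cod \<omega>) \<le> pos aA cC n \<omega> + rat aA n \<omega>"
    "pos bB dD n \<omega> \<le> snd (cod \<omega>)" "snd (cod \<omega>) \<le> pos bB dD n \<omega> + rat bB n \<omega>"
    using x y by auto
qed

lemma dist_cod:
  assumes w: "\<omega> \<in> seqs Dg" "\<omega>' \<in> seqs Dg" and eq: "pre n \<omega> = pre n \<omega>'" "pre k (proj_v \<omega>) = pre k (proj_v \<omega>')"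
  shows "dist (cod \<omega>) (cod \<omega>') \<le> rat aA n \<omega> + rat bB k \<omega>"
proof -
  have "rat aA n \<omega> = rat aA n \<omega>'" "pos aA cC n \<omega> = pos aA cC n \<omega>'"
    using eq(1) by (auto intro!: X.rat_cong X.pos_cong simp: pre_eq_iff)
  then have 1: "\<bar>fst (cod \<omega>) - fst (cod \<omega>')\<bar> \<le> rat aA n \<omega>"
    using cod_bounds(1,2)[OF w(1), of n] cod_bounds(1,2)[OF w(2), of n] by linarith
  have "rat bB k \<omega> = rat bB k \<omega>'" "pos bB dD k \<omega> = pos bB dD k \<omega>'"
    using eq(2) by (auto intro!: Y.rat_cong Y.pos_cong simp: pre_eq_iff proj_v_def bB_def dD_def)
  then have 2: "\<bar>snd (cod \<omega>) - snd (cod \<omega>')\<bar> \<le> rat bB k \<omega>"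
    using cod_bounds(3,4)[OF w(1), of k] cod_bounds(3,4)[OF w(2), of k] by linarith
  have "dist (cod \<omega>) (cod \<omega>') \<le> dist (fst (cod \<omega>)) (fst (cod \<omega>')) + dist (snd (cod \<omega>)) (snd (cod \<omega>'))"
    unfolding dist_prod_def by (rule order_trans[OF sqrt_sum_squares_le_sum]) auto
  then show ?thesis using 1 2 by (simp add: dist_real_def)
qed

text \<open>The approximate square of side about \<open>\<rho>\<close> containing \<open>\<omega>\<close>.\<close>

definition key :: "real \<Rightarrow> (nat \<Rightarrow> nat \<times> nat) \<Rightarrow> (nat \<times> nat) list \<times> nat list" where
  "key \<rho> \<omega> = (pre (stp aA \<rho> \<omega>) \<omega>, pre (stp bB \<rho> \<omega>) (proj_v \<omega>))"

text \<open>The vertical coordinate must come first. It shows that the rows agree up to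
  \<open>stp bB \<rho> \<omega>\<close>, hence also up to the time
  \<open>stp aA \<rho> \<omega>\<close>, which is not later; the horizontal intervals are known to
  be separated only within a common row.\<close>

lemma key_eqI:
  assumes w: "\<omega> \<in> seqs Dg" "\<omega>' \<in> seqs Dg" and r: "0 < \<rho>" "\<rho> < 1"
    and x: "\<bar>pos aA cC (stp aA \<rho> \<omega>) \<omega> - pos aA cC (stp aA \<rho> \<omega>') \<omega>'\<bar> < exp (- lmax) * \<rho>"
    and y: "\<bar>pos bB dD (stp bB \<rho> \<omega>) \<omega> - pos bB dD (stp bB \<rho> \<omega>') \<omega>'\<bar> < exp (- lmax) * \<rho>"
  shows "key \<rho> \<omega> = key \<rho> \<omega>'"
proof -
  have D: "\<omega> t \<in> Dg" "\<omega>' t \<in> Dg" for t using w by (auto simp: seqs_def)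
  have v: "stp bB \<rho> \<omega> = stp bB \<rho> \<omega>' \<and> (\<forall>s<stp bB \<rho> \<omega>. fst (\<omega> s) = fst (\<omega>' s))"
  proof (rule Y.close_imp_same[OF w r _ _ y])
    fix t assume "fst (\<omega> t) \<noteq> fst (\<omega>' t)"
    then consider "fst (\<omega> t) < fst (\<omega>' t)" | "fst (\<omega>' t) < fst (\<omega> t)" by linarith
    then show "bB (\<omega> t) + dD (\<omega> t) \<le> dD (\<omega>' t) \<or> bB (\<omega>' t) + dD (\<omega>' t) \<le> dD (\<omega> t)"
    proof cases
      case 1
      then have "b (fst (\<omega> t)) + d (fst (\<omega> t)) \<le> d (fst (\<omega>' t))"
        using Dg_cases[OF D(1)[of t]] Dg_cases[OF D(2)[of t]] by (intro d_chain) simp_all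
      then show ?thesis by (simp add: bB_def dD_def)
    next
      case 2
      then have "b (fst (\<omega>' t)) + d (fst (\<omega>' t)) \<le> d (fst (\<omega> t))"
        using Dg_cases[OF D(1)[of t]] Dg_cases[OF D(2)[of t]] by (intro d_chain) simp_all
      then show ?thesis by (simp add: bB_def dD_def)
    qed
  qed (auto simp: bB_def dD_def)
  have h: "stp aA \<rho> \<omega> = stp aA \<rho> \<omega>' \<and> (\<forall>s<stp aA \<rho> \<omega>. id (\<omega> s) = id (\<omega>' s))"
  proof (rule X.close_imp_same[OF w r _ _ x])
    fix t assume t: "t < stp aA \<rho> \<omega>" "id (\<omega> t) \<noteq> id (\<omega>' t)"
    then have "t < stp bB \<rho> \<omega>" using stp_a_le_b[OF w(1) r(1)] by linarith
    then have f: "fst (\<omega> t) = fst (\<omega>' t)" using v by blast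
    then have "snd (\<omega> t) \<noteq> snd (\<omega>' t)" using t(2) by (simp add: prod_eq_iff)
    then consider "snd (\<omega> t) < snd (\<omega>' t)" | "snd (\<omega>' t) < snd (\<omega> t)" by linarith
    then show "aA (\<omega> t) + cC (\<omega> t) \<le> cC (\<omega>' t) \<or> aA (\<omega>' t) + cC (\<omega>' t) \<le> cC (\<omega> t)"
    proof cases
      case 1
      then have "a (fst (\<omega> t)) (snd (\<omega> t)) + c (fst (\<omega> t)) (snd (\<omega> t)) \<le> c (fst (\<omega> t)) (snd (\<omega>' t))"
        using Dg_cases[OF D(1)[of t]] Dg_cases[OF D(2)[of t]] f by (intro c_chain) simp_all
      then show ?thesis by (simp add: aA_def cC_def f)
    next
      case 2
      then have "a (fst (\<omega>' t)) (snd (\<omega>' t)) + c (fst (\<omega>' t)) (snd (\<omega>' t)) \<le> c (fst (\<omega>' t)) (snd (\<omega> t))"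
        using Dg_cases[OF D(1)[of t]] Dg_cases[OF D(2)[of t]] f by (intro c_chain) simp_all
      then show ?thesis by (simp add: aA_def cC_def f)
    qed
  qed auto
  show ?thesis unfolding key_def using v h by (simp add: pre_eq_iff proj_v_def)
qed

lemma floor_window:
  fixes x z \<rho> k :: real
  assumes "0 < \<rho>" "0 < k" "\<bar>x - z\<bar> \<le> 2 * \<rho>"
  shows "\<lfloor>(x - z) / (k * \<rho>)\<rfloor> \<in> {\<lfloor>- (2 / k)\<rfloor>..\<lfloor>2 / k\<rfloor>}"
proof -
  have "(x - z) / (k * \<rho>) \<le> (2 * \<rho>) / (k * \<rho>)" using assms by (intro divide_right_mono) auto
  moreover have "(- (2 * \<rho>)) / (k * \<rho>) \<le> (x - z) / (k * \<rho>)" using assms by (intro divide_right_mono) auto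
  moreover have "(2 * \<rho>) / (k * \<rho>) = 2 / k" "(- (2 * \<rho>)) / (k * \<rho>) = - (2 / k)" using assms(1) by auto
  ultimately show ?thesis unfolding atLeastAtMost_iff by (intro conjI floor_mono) simp_all
qed

lemma floor_close:
  fixes x x' k z :: real
  assumes "0 < k" "\<lfloor>(x - z) / k\<rfloor> = \<lfloor>(x' - z) / k\<rfloor>" shows "\<bar>x - x'\<bar> < k"
proof -
  have close: "\<bar>u - v\<bar> < 1" if "\<lfloor>u\<rfloor> = f" "\<lfloor>v\<rfloor> = f" for u v :: real and f
    using that unfolding floor_eq_iff abs_less_iff by (elim conjE) (intro conjI; linarith)
  have "\<bar>(x - z) / k - (x' - z) / k\<bar> < 1" by (rule close[OF assms(2) refl])
  moreover have "(x - z) / k - (x' - z) / k = (x - x') / k" by (simp add: diff_divide_distrib)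
  ultimately have "\<bar>x - x'\<bar> / k < 1" using assms(1) by (simp only: abs_divide abs_of_pos)
  then show ?thesis using assms(1) by (simp add: pos_divide_less_eq)
qed

text \<open>A set of diameter at most \<open>\<rho>\<close> meets a bounded number of approximate squares of side \<open>\<rho>\<close>:
  the corners of two distinct ones are \<open>exp (- lmax) * \<rho>\<close> apart in some coordinate.\<close>

lemma key_count:
  "\<exists>C. \<forall>\<rho> U. 0 < \<rho> \<longrightarrow> \<rho> < 1 \<longrightarrow> bounded U \<longrightarrow> diameter U \<le> \<rho> \<longrightarrow>
     finite (key \<rho> ` {\<omega>\<in>seqs Dg. cod \<omega> \<in> U}) \<and> card (key \<rho> ` {\<omega>\<in>seqs Dg. cod \<omega> \<in> U}) \<le> C"
proof -
  let ?k = "exp (- lmax)"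
  define I where "I = {\<lfloor>- (2 / ?k)\<rfloor>..\<lfloor>2 / ?k\<rfloor>}"
  have main: "finite (key \<rho> ` {\<omega>\<in>seqs Dg. cod \<omega> \<in> U}) \<and> card (key \<rho> ` {\<omega>\<in>seqs Dg. cod \<omega> \<in> U}) \<le> card (I \<times> I)"
    if r: "0 < \<rho>" "\<rho> < 1" and U: "bounded U" "diameter U \<le> \<rho>" for \<rho> U
  proof (cases "{\<omega>\<in>seqs Dg. cod \<omega> \<in> U} = {}")
    case False
    let ?Z = "{\<omega>\<in>seqs Dg. cod \<omega> \<in> U}"
    obtain \<omega>0 where w0: "\<omega>0 \<in> ?Z" using False by blast
    define z where "z = cod \<omega>0"
    \<comment> \<open>Grid cell of the corner, of mesh \<open>exp (- lmax) * \<rho>\<close>,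
      relative to a reference point. Equal cells force equal keys by \<open>key_eqI\<close>. Few
      cells occur, as a corner is within \<open>2 * \<rho>\<close> of \<open>z\<close> in each
      coordinate: \<rho> for the diameter of \<open>U\<close> and \<rho> for the size of the
      square.\<close>
    define f where "f = (\<lambda>\<omega>. (\<lfloor>(pos aA cC (stp aA \<rho> \<omega>) \<omega> - fst z) / (?k * \<rho>)\<rfloor>, \<lfloor>(pos bB dD (stp bB \<rho> \<omega>) \<omega> - snd z) / (?k * \<rho>)\<rfloor>))"
    have fI: "f \<omega> \<in> I \<times> I" if w: "\<omega> \<in> ?Z" for \<omega>
    proof -
      have w': "\<omega> \<in> seqs Dg" using w by simp
      have "dist (cod \<omega>) z \<le> \<rho>" using diameter_bounded_bound[OF U(1), of "cod \<omega>" "cod \<omega>0"] w w0 U(2) unfolding z_def by simp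
      then have "\<bar>fst (cod \<omega>) - fst z\<bar> \<le> \<rho>" "\<bar>snd (cod \<omega>) - snd z\<bar> \<le> \<rho>"
        using dist_fst_le[of "cod \<omega>" z] dist_snd_le[of "cod \<omega>" z] by (simp_all add: dist_real_def)
      then have "\<bar>pos aA cC (stp aA \<rho> \<omega>) \<omega> - fst z\<bar> \<le> 2 * \<rho>" "\<bar>pos bB dD (stp bB \<rho> \<omega>) \<omega> - snd z\<bar> \<le> 2 * \<rho>"
        using cod_bounds[OF w', of "stp aA \<rho> \<omega>"] cod_bounds[OF w', of "stp bB \<rho> \<omega>"]
          X.stp_le[OF w' r(1)] Y.stp_le[OF w' r(1)] by linarith+
      then show ?thesis unfolding f_def I_def using r by (intro SigmaI floor_window) auto
    qed
    have "finite (I \<times> I)" by (simp add: I_def)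
    moreover have sub: "f ` ?Z \<subseteq> I \<times> I" using fI by (rule image_subsetI)
    ultimately have fin: "finite (f ` ?Z)" by (rule rev_finite_subset)
    have key_f: "key \<rho> \<omega> = key \<rho> \<omega>'" if w: "\<omega> \<in> ?Z" "\<omega>' \<in> ?Z" "f \<omega> = f \<omega>'" for \<omega> \<omega>'
    proof -
      have "\<lfloor>(pos aA cC (stp aA \<rho> \<omega>) \<omega> - fst z) / (?k * \<rho>)\<rfloor> = \<lfloor>(pos aA cC (stp aA \<rho> \<omega>') \<omega>' - fst z) / (?k * \<rho>)\<rfloor>"
        "\<lfloor>(pos bB dD (stp bB \<rho> \<omega>) \<omega> - snd z) / (?k * \<rho>)\<rfloor> = \<lfloor>(pos bB dD (stp bB \<rho> \<omega>') \<omega>' - snd z) / (?k * \<rho>)\<rfloor>"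
        using w(3) unfolding f_def by (simp_all only: prod.inject)
      from this[THEN floor_close[rotated]] show ?thesis using w(1,2) r by (intro key_eqI) simp_all
    qed
    define g where "g = (\<lambda>q. key \<rho> (SOME \<omega>. \<omega> \<in> ?Z \<and> f \<omega> = q))"
    have "key \<rho> \<omega> = g (f \<omega>)" if w: "\<omega> \<in> ?Z" for \<omega>
    proof -
      have "(SOME \<omega>'. \<omega>' \<in> ?Z \<and> f \<omega>' = f \<omega>) \<in> ?Z \<and> f (SOME \<omega>'. \<omega>' \<in> ?Z \<and> f \<omega>' = f \<omega>) = f \<omega>"
        by (rule someI[of _ \<omega>]) (use w in blast)
      then show ?thesis unfolding g_def using w by (intro key_f) simp_all
    qed
    then have eq: "key \<rho> ` ?Z = g ` f ` ?Z" unfolding image_image by (intro image_cong refl)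
    have "card (g ` f ` ?Z) \<le> card (f ` ?Z)" by (rule card_image_le[OF fin])
    also have "\<dots> \<le> card (I \<times> I)" using sub by (intro card_mono) (simp_all add: I_def)
    finally show ?thesis unfolding eq using fin by simp
  next
    case True
    show ?thesis unfolding True by simp
  qed
  show ?thesis by (intro exI[of _ "card (I \<times> I)"] allI impI main)
qed

end

section \<open>Upper bound for the dimension\<close>

lemma countable_adm:
  assumes "finite A" shows "countable {(r, \<kappa>). adm A r \<kappa>}"
proof (rule countable_subset)
  show "{(r, \<kappa>). adm A r \<kappa>} \<subseteq> (SIGMA r:UNIV. PiE (words A (Suc r)) (\<lambda>_. \<rat>))"
    by (auto simp: adm_def PiE_iff extensional_def)
  show "countable (SIGMA r:(UNIV::nat set). PiE (words A (Suc r)) (\<lambda>_. \<rat> :: real set))"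
    using assms by (intro countable_SIGMA countable_PiE) (auto simp: countable_rat)
qed

text \<open>A bounded function cannot increase by a fixed amount along every orbit of a map \<open>L\<close>
  (the trick of Kenyon and Peres).\<close>

lemma bounded_frequently_almost_decreasing:
  fixes f :: "nat \<Rightarrow> real"
  assumes bd: "\<And>n. 0 \<le> f n" "\<And>n. f n \<le> C" and L: "\<And>n. n \<le> L n" and e: "0 < e"
  shows "\<exists>n\<ge>N. f (L n) \<le> f n + e"
proof (rule ccontr)
  assume "\<not> ?thesis"
  then have inc: "f n + e < f (L n)" if "n \<ge> N" for n using that by force
  have "N \<le> (L ^^ k) N \<and> f N + real k * e \<le> f ((L ^^ k) N)" for k
  proof (induction k)
    case (Suc k)
    have "N \<le> (L ^^ Suc k) N" using Suc L[of "(L ^^ k) N"] by simp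
    moreover have "f N + real (Suc k) * e \<le> f ((L ^^ Suc k) N)"
      using Suc inc[of "(L ^^ k) N"] by (simp add: distrib_right)
    ultimately show ?case by blast
  qed simp
  then have "real k * e \<le> C" for k using bd(1)[of N] bd(2)[of "(L ^^ k) N"] by (smt (verit))
  moreover obtain k where "real k > C / e" using reals_Archimedean2 by blast
  ultimately show False using e by (metis divide_less_eq less_le_not_le)
qed

lemma bsum_bounds:
  assumes "\<omega> \<in> seqs A" "\<And>\<omega>. \<omega> \<in> seqs A \<Longrightarrow> l \<le> F \<omega>" "\<And>\<omega>. \<omega> \<in> seqs A \<Longrightarrow> F \<omega> \<le> u"
  shows "real n * l \<le> bsum F n \<omega>" "bsum F n \<omega> \<le> real n * u"
proof -
  have "(\<Sum>t<n. l) \<le> bsum F n \<omega>" "bsum F n \<omega> \<le> (\<Sum>t<n. u)"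
    unfolding bsum_def by (intro sum_mono assms shift_pow_seqs)+
  then show "real n * l \<le> bsum F n \<omega>" "bsum F n \<omega> \<le> real n * u" by auto
qed

lemma Min_attained:
  fixes f :: "nat \<Rightarrow> real"
  shows "\<exists>i\<le>j. f i = Min (f ` {..j})"
proof -
  have "Min (f ` {..j}) \<in> f ` {..j}" by (rule Min_in) auto
  then obtain i where "i \<in> {..j}" "Min (f ` {..j}) = f i" by (auto simp del: Min_in)
  then show ?thesis by auto
qed

lemma summable_linear_exp:
  assumes "0 < e" shows "summable (\<lambda>n. (real K * real n + 1) * exp (- e * real n))"
proof -
  \<comment> \<open>Half of the exponential decay absorbs the linear factor.\<close>
  let ?x = "exp (- (e/2))"
  have x: "\<bar>?x\<bar> < 1" using assms by simp
  show ?thesis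
  proof (rule summable_comparison_test')
    show "summable (\<lambda>n. (2 * real K / e + 1) * ?x ^ n)"
      using x by (intro summable_mult summable_geometric) auto
    fix n :: nat assume "0 \<le> n"
    let ?y = "e * real n / 2"
    have y0: "0 \<le> ?y" using assms by simp
    have "?y \<le> exp ?y" using exp_ge_add_one_self[of ?y] by linarith
    moreover have "1 \<le> exp ?y" using y0 by simp
    moreover have "real K * real n = (2 * real K / e) * ?y" using assms by simp
    moreover have "0 \<le> 2 * real K / e" using assms by simp
    ultimately have "real K * real n + 1 \<le> (2 * real K / e) * exp ?y + exp ?y"
      using mult_left_mono[of ?y "exp ?y" "2 * real K / e"] by linarith
    then have "(real K * real n + 1) * exp (- e * real n) \<le> ((2 * real K / e + 1) * exp ?y) * exp (- e * real n)"
      by (intro mult_right_mono) (auto simp: algebra_simps)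
    also have "\<dots> = (2 * real K / e + 1) * exp (?y + - e * real n)" by (simp only: exp_add mult.assoc)
    also have "?y + - e * real n = real n * - (e/2)" by (simp add: field_simps)
    also have "exp (real n * - (e/2)) = ?x ^ n" by (simp only: exp_of_nat_mult)
    finally show "norm ((real K * real n + 1) * exp (- e * real n)) \<le> (2 * real K / e + 1) * ?x ^ n"
      by (simp add: abs_mult)
  qed
qed

text \<open>Multiplied by the horizontal sum \<open>A\<close>, the dimension formula becomes the
  code length of an approximate square: \<open>T\<close> for all digits up to the given time, and
  \<open>A * (V / B) - V\<close> for the later rows, since the vertical sum must grow from
  \<open>B\<close> to about \<open>A\<close> at the cost \<open>V / B\<close> per unit.\<close>

lemma Dfun_scale:
  assumes "0 < n" "0 < A" "0 < B"
  shows "Dfun (T / n) (V / n) (A / n) (B / n) * A = T - V + A * (V / B)"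
proof -
  have "T / n / (A / n) = T / A" "(1 / (B / n) - 1 / (A / n)) * (V / n) = V / B - V / A"
  proof -
    have "1 / (B / n) * (V / n) = V / B" "1 / (A / n) * (V / n) = V / A" using assms by simp_all
    then show "(1 / (B / n) - 1 / (A / n)) * (V / n) = V / B - V / A" by (simp only: left_diff_distrib)
  qed (use assms in simp)
  then have "Dfun (T / n) (V / n) (A / n) (B / n) * A = T / A * A + (V / B - V / A) * A"
    unfolding Dfun_def by (simp only: distrib_right)
  also have "\<dots> = T - V + A * (V / B)" using assms by (simp add: left_diff_distrib)
  finally show ?thesis .
qed

context lg begin

definition gD where "gD i = from_nat_into {(r, \<kappa>). adm Dg r \<kappa>} i"
definition gV where "gV i = from_nat_into {(r, \<kappa>). adm Vg r \<kappa>} i"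
definition gg :: "nat \<Rightarrow> (nat \<Rightarrow> nat \<times> nat) \<Rightarrow> real" where "gg i = gfun (fst (gD i)) (snd (gD i))"
definition gv :: "nat \<Rightarrow> (nat \<Rightarrow> nat) \<Rightarrow> real" where "gv i = gfun (fst (gV i)) (snd (gV i))"

lemma adm_gD: "adm Dg (fst (gD i)) (snd (gD i))"
proof -
  have "{(r, \<kappa>). adm Dg r \<kappa>} \<noteq> {}" using ex_adm[OF finite_Dg Dg_ne] by blast
  from from_nat_into[OF this, of i] show ?thesis by (simp add: gD_def case_prod_unfold)
qed

lemma adm_gV: "adm Vg (fst (gV i)) (snd (gV i))"
proof -
  have "{(r, \<kappa>). adm Vg r \<kappa>} \<noteq> {}" using ex_adm[OF finite_Vg Vg_ne] by blast
  from from_nat_into[OF this, of i] show ?thesis by (simp add: gV_def case_prod_unfold)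
qed

lemma gg_surj: "adm Dg r \<kappa> \<Longrightarrow> \<exists>i. gg i = gfun r \<kappa>"
  using from_nat_into_surj[OF countable_adm[OF finite_Dg], of "(r, \<kappa>)"] by (auto simp: gg_def gD_def) (metis fst_conv snd_conv)

lemma gv_surj: "adm Vg r \<kappa> \<Longrightarrow> \<exists>i. gv i = gfun r \<kappa>"
  using from_nat_into_surj[OF countable_adm[OF finite_Vg], of "(r, \<kappa>)"] by (auto simp: gv_def gV_def) (metis fst_conv snd_conv)

text \<open>\<open>gg\<close> and \<open>gv\<close> enumerate the information functions of all weights; \<open>Tm\<close> and \<open>Tv\<close> are the best
  code lengths achieved by the first \<open>j + 1\<close> of them.\<close>

definition Tm :: "nat \<Rightarrow> nat \<Rightarrow> (nat \<Rightarrow> nat \<times> nat) \<Rightarrow> real" where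
  "Tm j n \<omega> = Min ((\<lambda>i. bsum (gg i) n \<omega>) ` {..j})"
definition Tv :: "nat \<Rightarrow> nat \<Rightarrow> (nat \<Rightarrow> nat \<times> nat) \<Rightarrow> real" where
  "Tv j n \<omega> = Min ((\<lambda>i. bsum (gv i) n (proj_v \<omega>)) ` {..j})"

lemma bsum_proj: "bsum (\<lambda>\<omega>. F (proj_v \<omega>)) n \<omega> = bsum F n (proj_v \<omega>)"
  by (simp add: bsum_def proj_shift)

lemma Tv_nonneg: "\<omega> \<in> seqs Dg \<Longrightarrow> 0 \<le> Tv j n \<omega>"
  unfolding Tv_def gv_def bsum_def
  by (subst Min_ge_iff) (auto intro!: sum_nonneg gfun_nonneg[OF adm_gV finite_Vg])

lemma Tv_le:
  assumes "\<omega> \<in> seqs Dg" shows "Tv j n \<omega> \<le> real n * gbound Vg (fst (gV 0)) (snd (gV 0))"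
proof -
  have "Tv j n \<omega> \<le> bsum (gv 0) n (proj_v \<omega>)" unfolding Tv_def by (intro Min_le) auto
  also have "\<dots> \<le> real n * gbound Vg (fst (gV 0)) (snd (gV 0))"
    unfolding gv_def using assms
    by (intro bsum_bounds(2)[of _ Vg 0]) (auto intro: gfun_nonneg[OF adm_gV finite_Vg] gfun_le_gbound[OF adm_gV finite_Vg])
  finally show ?thesis .
qed

lemma bsum_l:
  assumes "\<omega> \<in> seqs Dg"
  shows "real n * lmin \<le> bsum lb n \<omega>" "real n * lmin \<le> bsum la n \<omega>" "bsum la n \<omega> \<le> real n * lmax" "bsum lb n \<omega> \<le> bsum la n \<omega>"
proof -
  have l: "lmin \<le> la \<omega>" "lb \<omega> \<le> lmax" if "\<omega> \<in> seqs Dg" for \<omega> using l_bounds[OF that] by auto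
  show "real n * lmin \<le> bsum lb n \<omega>" by (rule bsum_bounds(1)[OF assms l_bounds(1) l(2)])
  show "real n * lmin \<le> bsum la n \<omega>" by (rule bsum_bounds(1)[OF assms l(1) l_bounds(3)])
  show "bsum la n \<omega> \<le> real n * lmax" by (rule bsum_bounds(2)[OF assms l(1) l_bounds(3)])
  show "bsum lb n \<omega> \<le> bsum la n \<omega>" unfolding bsum_def using assms by (intro sum_mono l_bounds(2)) auto
qed

text \<open>Otherwise every \<open>j\<close> has a counterexample, at times tending to infinity and
  with averages tending to \<alpha>, and a limit of the empirical measures is an invariant measure
  excluded by \<open>no\<close>. Letting the list of weights grow with \<open>j\<close> makes this a
  diagonal argument: every fixed pair of weights is eventually among those minimised over.\<close>

lemma uniform_bound:
  assumes \<phi>: "uc Dg \<phi>" and no: "\<not> (\<exists>\<mu>\<in>inv_meas Dg. (\<integral>\<omega>. \<phi> \<omega> \<partial>\<mu>) = \<alpha> \<and> s \<le> D_LY p a b \<mu>)"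
  shows "\<exists>j. \<forall>n>j. \<forall>\<omega>\<in>seqs Dg. \<bar>bsum \<phi> n \<omega> / real n - \<alpha>\<bar> \<le> 1 / real (Suc j) \<longrightarrow>
    Dfun (Tm j n \<omega> / real n) (Tv j n \<omega> / real n) (bsum la n \<omega> / real n) (bsum lb n \<omega> / real n) < s"
proof (rule ccontr)
  assume "\<not> ?thesis"
  then have "\<forall>j. \<exists>n \<omega>. n > j \<and> \<omega> \<in> seqs Dg \<and> \<bar>bsum \<phi> n \<omega> / real n - \<alpha>\<bar> \<le> 1 / real (Suc j) \<and>
    s \<le> Dfun (Tm j n \<omega> / real n) (Tv j n \<omega> / real n) (bsum la n \<omega> / real n) (bsum lb n \<omega> / real n)"
    by (simp add: not_less) blast
  then obtain n w where nw: "\<And>j. n j > j" "\<And>j. w j \<in> seqs Dg"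
    "\<And>j. \<bar>bsum \<phi> (n j) (w j) / real (n j) - \<alpha>\<bar> \<le> 1 / real (Suc j)"
    "\<And>j. s \<le> Dfun (Tm j (n j) (w j) / real (n j)) (Tv j (n j) (w j) / real (n j)) (bsum la (n j) (w j) / real (n j)) (bsum lb (n j) (w j) / real (n j))"
    by metis
  define e where "e = (\<lambda>j. emp Dg (n j) (w j))"
  have n0: "0 < n j" for j using nw(1)[of j] by simp
  have ie: "(\<integral>x. F x \<partial>e j) = bsum F (n j) (w j) / real (n j)" if "uc Dg F" for F j
    unfolding e_def by (rule integral_emp[OF nw(2) n0 uc_measurable[OF finite_Dg that]])
  have z: "(\<lambda>j. 1 / real (Suc j)) \<longlonglongrightarrow> 0"
    using LIMSEQ_inverse_real_of_nat by (simp add: inverse_eq_divide)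
  have "\<exists>\<mu>\<in>inv_meas Dg. (\<integral>\<omega>. \<phi> \<omega> \<partial>\<mu>) = \<alpha> \<and> s \<le> D_LY p a b \<mu>"
  proof (rule D_LY_usc[where e = e])
    show "prob_space (e j)" "sets (e j) = sets (shiftM Dg)" for j
      unfolding e_def by (rule prob_space_emp[OF nw(2)], rule sets_emp)
    show "(\<lambda>j. measure (e j) (shift -` S \<inter> seqs Dg) - measure (e j) S) \<longlonglongrightarrow> 0" if S: "S \<in> sets (shiftM Dg)" for S
    proof (rule Lim_null_comparison[OF always_eventually z], rule allI)
      fix j
      have "\<bar>measure (e j) (shift -` S \<inter> seqs Dg) - measure (e j) S\<bar> \<le> 1 / real (n j)"
        unfolding e_def by (rule emp_almost_invariant[OF nw(2) n0 S])
      also have "\<dots> \<le> 1 / real (Suc j)" using nw(1)[of j] by (intro divide_left_mono) auto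
      finally show "norm (measure (e j) (shift -` S \<inter> seqs Dg) - measure (e j) S) \<le> 1 / real (Suc j)" by simp
    qed
    show "uc Dg \<phi>" by fact
    have "(\<lambda>j. (\<integral>\<omega>. \<phi> \<omega> \<partial>e j) - \<alpha>) \<longlonglongrightarrow> 0"
      by (rule Lim_null_comparison[OF always_eventually z]) (use nw(3) in \<open>simp add: ie[OF \<phi>]\<close>)
    then show "(\<lambda>j. \<integral>\<omega>. \<phi> \<omega> \<partial>e j) \<longlonglongrightarrow> \<alpha>" by (simp add: LIM_zero_iff)
    fix r \<kappa> r' \<kappa>' assume g: "adm Dg r \<kappa>" "adm Vg r' \<kappa>'"
    obtain i where i: "gg i = gfun r \<kappa>" using gg_surj[OF g(1)] by blast
    obtain i' where i': "gv i' = gfun r' \<kappa>'" using gv_surj[OF g(2)] by blast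
    show "eventually (\<lambda>j. s \<le> Dfun (\<integral>\<omega>. gfun r \<kappa> \<omega> \<partial>e j)
        (\<integral>\<omega>. gfun r' \<kappa>' (proj_v \<omega>) \<partial>e j) (\<integral>\<omega>. la \<omega> \<partial>e j) (\<integral>\<omega>. lb \<omega> \<partial>e j)) sequentially"
    proof (rule eventually_sequentiallyI[of "max i i'"])
      fix j assume j: "max i i' \<le> j"
      have 1: "Tm j (n j) (w j) / real (n j) \<le> (\<integral>\<omega>. gfun r \<kappa> \<omega> \<partial>e j)"
        unfolding ie[OF uc_gfun] Tm_def using j by (intro divide_right_mono Min_le) (auto simp flip: i)
      have 2: "Tv j (n j) (w j) / real (n j) \<le> (\<integral>\<omega>. gfun r' \<kappa>' (proj_v \<omega>) \<partial>e j)"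
        unfolding ie[OF uc_proj[OF uc_gfun]] Tv_def bsum_proj using j by (intro divide_right_mono Min_le) (auto simp flip: i')
      have b: "0 < bsum lb (n j) (w j) / real (n j)"
      proof -
        have "0 < real (n j) * lmin" using n0[of j] lmin_pos by simp
        then have "0 < bsum lb (n j) (w j)" using bsum_l(1)[OF nw(2), of "n j" j] by linarith
        then show ?thesis using n0[of j] by simp
      qed
      have b': "bsum lb (n j) (w j) / real (n j) \<le> bsum la (n j) (w j) / real (n j)"
        using bsum_l(4)[OF nw(2)] by (intro divide_right_mono) auto
      show "s \<le> Dfun (\<integral>\<omega>. gfun r \<kappa> \<omega> \<partial>e j) (\<integral>\<omega>. gfun r' \<kappa>' (proj_v \<omega>) \<partial>e j) (\<integral>\<omega>. la \<omega> \<partial>e j) (\<integral>\<omega>. lb \<omega> \<partial>e j)"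
        using order_trans[OF nw(4)[of j] Dfun_mono[OF 1 2 b b']] by (simp add: ie[OF uc_la] ie[OF uc_lb])
    qed
  qed
  then show False using no by blast
qed

text \<open>The vertical level at which the height has fallen to the width of horizontal level
  \<open>n\<close>.\<close>

abbreviation Ln :: "nat \<Rightarrow> (nat \<Rightarrow> nat \<times> nat) \<Rightarrow> nat" where "Ln n \<omega> \<equiv> stp bB (rat aA n \<omega>) \<omega>"

definition Kc :: nat where "Kc = nat \<lceil>lmax / lmin\<rceil>"

lemma Ln_le: "\<omega> \<in> seqs Dg \<Longrightarrow> Ln n \<omega> \<le> Kc * n"
  unfolding stp_def
proof (rule Least_le)
  assume w: "\<omega> \<in> seqs Dg"
  have "lmax \<le> real Kc * lmin" using lmin_pos lmin_le_lmax
    by (simp add: Kc_def pos_divide_le_eq[symmetric] le_of_int_ceiling)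
  then have "real n * lmax \<le> real (Kc * n) * lmin"
    using mult_left_mono[of lmax "real Kc * lmin" "real n"] by (simp add: mult_ac)
  then have "bsum la n \<omega> \<le> bsum lb (Kc * n) \<omega>"
    using bsum_l(1)[OF w, of "Kc * n"] bsum_l(3)[OF w, of n] by linarith
  then show "rat bB (Kc * n) \<omega> \<le> rat aA n \<omega>" by (simp add: rat_a[OF w] rat_b[OF w])
qed

lemma Ln_ge: assumes w: "\<omega> \<in> seqs Dg" shows "n \<le> Ln n \<omega>"
proof (rule ccontr)
  assume "\<not> ?thesis"
  then have lt: "Ln n \<omega> < n" by simp
  have "0 < bsum la (n - Ln n \<omega>) ((shift ^^ Ln n \<omega>) \<omega>)"
    using bsum_l(2)[OF shift_pow_seqs[OF w], of "n - Ln n \<omega>" "Ln n \<omega>"] lt lmin_pos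
    by (smt (verit) mult_pos_pos of_nat_0_less_iff zero_less_diff)
  then have "bsum la (Ln n \<omega>) \<omega> < bsum la n \<omega>"
    using bsum_add[of la "Ln n \<omega>" "n - Ln n \<omega>" \<omega>] lt by simp
  moreover have "rat bB (Ln n \<omega>) \<omega> \<le> rat aA n \<omega>" by (rule Y.stp_le[OF w X.rat_pos[OF w]])
  then have "bsum la n \<omega> \<le> bsum lb (Ln n \<omega>) \<omega>" by (simp add: rat_a[OF w] rat_b[OF w])
  ultimately show False using bsum_l(4)[OF w, of "Ln n \<omega>"] by linarith
qed

text \<open>The first level of sufficiently small height overshoots by at most one digit.\<close>

lemma bsum_lb_Ln:
  assumes w: "\<omega> \<in> seqs Dg" and n: "0 < n"
  shows "bsum lb (Ln n \<omega>) \<omega> \<le> bsum la n \<omega> + lmax"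
proof -
  have "0 < real n * lmin" using n lmin_pos by simp
  then have "rat aA n \<omega> < 1" using bsum_l(2)[OF w, of n] by (simp add: rat_a[OF w])
  from Y.stp_lower[OF w X.rat_pos[OF w] this]
  have "exp (- lmax - bsum la n \<omega>) < exp (- bsum lb (Ln n \<omega>) \<omega>)"
    by (simp add: rat_a[OF w] rat_b[OF w] exp_diff exp_minus divide_inverse)
  then show ?thesis by simp
qed

text \<open>The cost of coding the approximate square of \<open>\<omega>\<close> at level \<open>n\<close>: all digits up to time \<open>n\<close>
  and only their first components up to time \<open>Ln n \<omega>\<close>.\<close>

definition cheap :: "nat \<Rightarrow> real \<Rightarrow> real \<Rightarrow> real \<Rightarrow> nat \<Rightarrow> (nat \<Rightarrow> nat \<times> nat) \<Rightarrow> bool" where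
  "cheap j s e C n \<omega> \<longleftrightarrow> \<omega> \<in> seqs Dg \<and> (\<exists>i\<le>j. \<exists>i'\<le>j.
     bsum (gg i) n \<omega> + bsum (gv i') (Ln n \<omega> - n) ((shift ^^ n) (proj_v \<omega>)) \<le> s * bsum la n \<omega> - e * real n + C)"

text \<open>Let \<open>f\<close> be the vertical cost per unit of \<open>bsum lb\<close>. At the
  times supplied by \<open>bounded_frequently_almost_decreasing\<close> it grows by at most
  \<epsilon> between \<open>n\<close> and \<open>Ln n \<omega>\<close>, so the bound on
  \<open>Dfun\<close> at time \<open>n\<close> extends to the whole square through
  \<open>Dfun_scale\<close>. Half of the gap \<open>s - s1\<close> pays for this growth and the
  other half is the linear surplus; \<open>C\<close> collects the overshoot of at most
  \<open>lmax\<close>.\<close>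

lemma frequently_cheap:
  assumes s: "s1 < s"
    and j: "\<And>n \<omega>. n > j \<Longrightarrow> \<omega> \<in> seqs Dg \<Longrightarrow> \<bar>bsum \<phi> n \<omega> / real n - \<alpha>\<bar> \<le> 1 / real (Suc j) \<Longrightarrow>
      Dfun (Tm j n \<omega> / real n) (Tv j n \<omega> / real n) (bsum la n \<omega> / real n) (bsum lb n \<omega> / real n) < s1"
    and w: "\<omega> \<in> seqs Dg" and lim: "(\<lambda>n. bsum \<phi> n \<omega> / real n) \<longlonglongrightarrow> \<alpha>"
    and C: "C = lmax * (gbound Vg (fst (gV 0)) (snd (gV 0)) / lmin + (s - s1) / 2)"
  shows "\<exists>n\<ge>N. cheap j s ((s - s1) / 2 * lmin) C n \<omega>"
proof -
  define Cf where "Cf = gbound Vg (fst (gV 0)) (snd (gV 0)) / lmin"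
  define f where "f = (\<lambda>n. Tv j n \<omega> / bsum lb n \<omega>)"
  define \<epsilon> where "\<epsilon> = (s - s1) / 2"
  have e: "0 < \<epsilon>" using s by (simp add: \<epsilon>_def)
  note A = bsum_l[OF w]
  have lb0: "0 \<le> bsum lb n \<omega>" for n 
    using A(1)[of n] mult_nonneg_nonneg[OF of_nat_0_le_iff[of n] less_imp_le[OF lmin_pos]] by linarith
  have f0: "0 \<le> f n" for n unfolding f_def using Tv_nonneg[OF w] lb0 by (intro divide_nonneg_nonneg)
  have gb: "0 \<le> gbound Vg (fst (gV 0)) (snd (gV 0))" by (rule gbound_nonneg[OF adm_gV finite_Vg])
  have f1: "f n \<le> Cf" for n
  proof (cases "n = 0")
    case True then show ?thesis using gb lmin_pos by (simp add: f_def Cf_def)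
  next
    case False
    have "f n \<le> (real n * gbound Vg (fst (gV 0)) (snd (gV 0))) / (real n * lmin)"
      unfolding f_def using Tv_le[OF w] A(1) False lmin_pos gb by (intro frac_le) auto
    then show ?thesis using False by (simp add: Cf_def)
  qed
  obtain N1 where N1: "\<forall>n\<ge>N1. norm (bsum \<phi> n \<omega> / real n - \<alpha>) < 1 / real (Suc j)"
    using LIMSEQ_D[OF lim, of "1 / real (Suc j)"] by auto
  obtain n where n: "n \<ge> max N (max N1 (Suc j))" "f (Ln n \<omega>) \<le> f n + \<epsilon>"
    using bounded_frequently_almost_decreasing[of f Cf "\<lambda>n. Ln n \<omega>" \<epsilon> "max N (max N1 (Suc j))", OF f0 f1 Ln_ge[OF w] e]
    by (elim exE conjE)
  then have n0: "0 < n" "n > j" "n \<ge> N1" "n \<ge> N" by auto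
  have D: "Dfun (Tm j n \<omega> / real n) (Tv j n \<omega> / real n) (bsum la n \<omega> / real n) (bsum lb n \<omega> / real n) < s1"
    using N1[rule_format, OF n0(3)] by (intro j[OF n0(2) w]) simp
  let ?A = "bsum la n \<omega>" and ?B = "bsum lb n \<omega>" and ?L = "Ln n \<omega>"
  have "0 < real n * lmin" using n0 lmin_pos by simp
  then have pos: "0 < ?B" "0 < ?A" using A(1,2)[of n] by linarith+
  have "Dfun (Tm j n \<omega> / real n) (Tv j n \<omega> / real n) (?A / real n) (?B / real n) * ?A
      = Tm j n \<omega> - Tv j n \<omega> + ?A * f n"
    unfolding f_def using pos n0(1) by (intro Dfun_scale) auto
  then have D': "Tm j n \<omega> - Tv j n \<omega> + ?A * f n \<le> s1 * ?A"
    using mult_right_mono[OF less_imp_le[OF D], of ?A] pos by simp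
  have nL: "n \<le> ?L" by (rule Ln_ge[OF w])
  obtain i where i: "i \<le> j" "bsum (gg i) n \<omega> = Tm j n \<omega>" unfolding Tm_def using Min_attained[of j "\<lambda>i. bsum (gg i) n \<omega>"] by blast
  obtain i' where i': "i' \<le> j" "bsum (gv i') ?L (proj_v \<omega>) = Tv j ?L \<omega>" unfolding Tv_def using Min_attained[of j "\<lambda>i. bsum (gv i) (Ln n \<omega>) (proj_v \<omega>)"] by blast
  \<comment> \<open>The weight \<open>i'\<close> is optimal up to \<open>?L\<close>, not up to
    \<open>n\<close>. Its cost before \<open>n\<close> is still at least the minimum
    \<open>Tv j n \<omega>\<close>, and subtracting that minimum bounds its cost after
    \<open>n\<close>.\<close>
  have "bsum (gv i') ?L (proj_v \<omega>) = bsum (gv i') n (proj_v \<omega>) + bsum (gv i') (?L - n) ((shift ^^ n) (proj_v \<omega>))"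
    using bsum_add[of "gv i'" n "?L - n" "proj_v \<omega>"] nL by simp
  moreover have "Tv j n \<omega> \<le> bsum (gv i') n (proj_v \<omega>)" unfolding Tv_def using i'(1) by (intro Min_le) auto
  moreover have TL: "Tv j ?L \<omega> \<le> (?A + lmax) * (f n + \<epsilon>)"
  proof -
    have "0 < real ?L * lmin" using nL n0 lmin_pos by simp
    then have "0 < bsum lb ?L \<omega>" using A(1)[of ?L] by linarith
    then have "Tv j ?L \<omega> = bsum lb ?L \<omega> * f ?L" by (simp add: f_def)
    also have "\<dots> \<le> (?A + lmax) * (f n + \<epsilon>)"
      using bsum_lb_Ln[OF w n0(1)] n(2) f0 lb0 pos lmin_pos lmin_le_lmax by (intro mult_mono) auto
    finally show ?thesis .
  qed
  ultimately have "bsum (gg i) n \<omega> + bsum (gv i') (?L - n) ((shift ^^ n) (proj_v \<omega>))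
      \<le> Tm j n \<omega> + (?A + lmax) * (f n + \<epsilon>) - Tv j n \<omega>"
    using i(2) i'(2) by linarith
  also have "\<dots> = (Tm j n \<omega> - Tv j n \<omega> + ?A * f n) + \<epsilon> * ?A + lmax * (f n + \<epsilon>)" by (simp add: algebra_simps)
  also have "\<dots> \<le> s1 * ?A + \<epsilon> * ?A + lmax * (Cf + \<epsilon>)"
    using D' f1[of n] e lmin_pos lmin_le_lmax by (intro add_mono mult_left_mono) auto
  also have "s1 * ?A + \<epsilon> * ?A = s * ?A - \<epsilon> * ?A" by (simp add: \<epsilon>_def field_simps)
  also have "s * ?A - \<epsilon> * ?A + lmax * (Cf + \<epsilon>) \<le> s * ?A - \<epsilon> * lmin * real n + C"
    using mult_left_mono[OF A(2)[of n], of \<epsilon>] e by (simp add: C Cf_def \<epsilon>_def mult_ac)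
  finally show ?thesis
    unfolding cheap_def using w i(1) i'(1) n0(4) by (intro exI[of _ n]) (auto simp: \<epsilon>_def)
qed

end

lemma diameter_le_dist:
  fixes S :: "(real \<times> real) set"
  assumes "0 \<le> r" "\<And>x y. x \<in> S \<Longrightarrow> y \<in> S \<Longrightarrow> dist x y \<le> r"
  shows "bounded S" "diameter S \<le> r"
proof -
  show "bounded S" unfolding bounded_two_points using assms(2) by blast
  show "diameter S \<le> r" by (rule diameter_le) (use assms in \<open>auto simp: dist_norm\<close>)
qed

context lg begin

lemma level_set_eq: "birkhoff_level p m \<phi> \<alpha> = {\<omega>\<in>seqs Dg. (\<lambda>n. bsum \<phi> n \<omega> / real n) \<longlonglongrightarrow> \<alpha>}"
  by (simp add: birkhoff_level_def SigmaS_eq bsum_def)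

definition tailw :: "nat \<Rightarrow> (nat \<Rightarrow> nat \<times> nat) \<Rightarrow> nat list" where
  "tailw n \<omega> = pre (Ln n \<omega> - n) ((shift ^^ n) (proj_v \<omega>))"

text \<open>Indexed by words instead of points, so that finitely many indices serve all points at a
  given level.\<close>

definition square :: "nat \<Rightarrow> (nat \<times> nat) list \<times> nat list \<Rightarrow> (real \<times> real) set" where
  "square n k = cod ` {\<omega>\<in>seqs Dg. pre n \<omega> = fst k \<and> pre (length (snd k)) ((shift ^^ n) (proj_v \<omega>)) = snd k}"

lemma square_dist:
  assumes w: "\<omega> \<in> seqs Dg" and x: "x \<in> square n (pre n \<omega>, tailw n \<omega>)" and y: "y \<in> square n (pre n \<omega>, tailw n \<omega>)"
  shows "dist x y \<le> 2 * rat aA n \<omega>"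
proof -
  obtain \<omega>1 where 1: "\<omega>1 \<in> seqs Dg" "x = cod \<omega>1" "pre n \<omega>1 = pre n \<omega>"
    "pre (Ln n \<omega> - n) ((shift ^^ n) (proj_v \<omega>1)) = pre (Ln n \<omega> - n) ((shift ^^ n) (proj_v \<omega>))"
    using x by (auto simp: square_def tailw_def)
  obtain \<omega>2 where 2: "\<omega>2 \<in> seqs Dg" "y = cod \<omega>2" "pre n \<omega>2 = pre n \<omega>"
    "pre (Ln n \<omega> - n) ((shift ^^ n) (proj_v \<omega>2)) = pre (Ln n \<omega> - n) ((shift ^^ n) (proj_v \<omega>))"
    using y by (auto simp: square_def tailw_def)
  have v: "pre (Ln n \<omega>) (proj_v \<omega>') = pre (Ln n \<omega>) (proj_v \<omega>)"
    if "pre n \<omega>' = pre n \<omega>" "pre (Ln n \<omega> - n) ((shift ^^ n) (proj_v \<omega>')) = pre (Ln n \<omega> - n) ((shift ^^ n) (proj_v \<omega>))" for \<omega>'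
    unfolding pre_eq_iff
  proof (intro allI impI)
    fix t assume t: "t < Ln n \<omega>"
    show "proj_v \<omega>' t = proj_v \<omega> t"
    proof (cases "t < n")
      case True then show ?thesis using that(1) by (simp add: pre_eq_iff proj_v_def)
    next
      case False
      then show ?thesis using that(2) t unfolding pre_eq_iff shift_pow
        by (metis diff_less_mono le_add_diff_inverse2 not_less)
    qed
  qed
  have ra: "rat aA n \<omega>1 = rat aA n \<omega>" using 1(3) by (intro X.rat_cong) (simp add: pre_eq_iff)
  have "rat bB (Ln n \<omega>) \<omega>1 = rat bB (Ln n \<omega>) \<omega>"
    using v[OF 1(3,4)] by (intro Y.rat_cong) (simp add: pre_eq_iff proj_v_def bB_def)
  also have "\<dots> \<le> rat aA n \<omega>" by (rule Y.stp_le[OF w X.rat_pos[OF w]])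
  finally have rb: "rat bB (Ln n \<omega>) \<omega>1 \<le> rat aA n \<omega>" .
  have "dist x y \<le> rat aA n \<omega>1 + rat bB (Ln n \<omega>) \<omega>1"
    unfolding 1(2) 2(2) using 1 2 v[OF 1(3,4)] v[OF 2(3,4)] by (intro dist_cod) simp_all
  then show ?thesis using ra rb by linarith
qed

text \<open>All of the first \<open>j + 1\<close> weights are added because the best one depends on
  the point; this costs only a factor independent of the word length. The exponential constants
  compensate for the error in \<open>bsum_gfun_tail\<close> when the word is continued by
  \<open>y\<close>.\<close>

definition wD :: "nat \<Rightarrow> (nat \<Rightarrow> nat \<times> nat) \<Rightarrow> (nat \<times> nat) list \<Rightarrow> real" where
  "wD j y w = (\<Sum>i\<le>j. exp (real (fst (gD i)) * gbound Dg (fst (gD i)) (snd (gD i))) * exp (- bsum (gg i) (length w) (app w y)))"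
definition wV :: "nat \<Rightarrow> (nat \<Rightarrow> nat) \<Rightarrow> nat list \<Rightarrow> real" where
  "wV j y w = (\<Sum>i\<le>j. exp (real (fst (gV i)) * gbound Vg (fst (gV i)) (snd (gV i))) * exp (- bsum (gv i) (length w) (app w y)))"

lemma wD_sum:
  assumes y: "y \<in> seqs Dg"
  shows "(\<Sum>w\<in>words Dg n. wD j y w) \<le> (\<Sum>i\<le>j. exp (real (fst (gD i)) * gbound Dg (fst (gD i)) (snd (gD i))))"
proof -
  let ?G = "\<lambda>i. exp (real (fst (gD i)) * gbound Dg (fst (gD i)) (snd (gD i)))"
  have "(\<Sum>w\<in>words Dg n. wD j y w) = (\<Sum>i\<le>j. ?G i * (\<Sum>w\<in>words Dg n. exp (- bsum (gg i) (length w) (app w y))))"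
    unfolding wD_def by (subst sum.swap) (simp add: sum_distrib_left)
  also have "\<dots> \<le> (\<Sum>i\<le>j. ?G i * 1)"
  proof (intro sum_mono mult_left_mono)
    fix i
    have "(\<Sum>w\<in>words Dg n. exp (- bsum (gg i) (length w) (app w y))) = (\<Sum>w\<in>words Dg n. exp (- bsum (gg i) n (app w y)))"
      by (intro sum.cong refl) (simp add: words_def)
    also have "\<dots> \<le> 1" unfolding gg_def by (rule kraft[OF adm_gD finite_Dg y])
    finally show "(\<Sum>w\<in>words Dg n. exp (- bsum (gg i) (length w) (app w y))) \<le> 1" .
  qed simp
  finally show ?thesis by simp
qed

lemma wV_sum:
  assumes y: "y \<in> seqs Vg"
  shows "(\<Sum>w\<in>words Vg n. wV j y w) \<le> (\<Sum>i\<le>j. exp (real (fst (gV i)) * gbound Vg (fst (gV i)) (snd (gV i))))"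
proof -
  let ?G = "\<lambda>i. exp (real (fst (gV i)) * gbound Vg (fst (gV i)) (snd (gV i)))"
  have "(\<Sum>w\<in>words Vg n. wV j y w) = (\<Sum>i\<le>j. ?G i * (\<Sum>w\<in>words Vg n. exp (- bsum (gv i) (length w) (app w y))))"
    unfolding wV_def by (subst sum.swap) (simp add: sum_distrib_left)
  also have "\<dots> \<le> (\<Sum>i\<le>j. ?G i * 1)"
  proof (intro sum_mono mult_left_mono)
    fix i
    have "(\<Sum>w\<in>words Vg n. exp (- bsum (gv i) (length w) (app w y))) = (\<Sum>w\<in>words Vg n. exp (- bsum (gv i) n (app w y)))"
      by (intro sum.cong refl) (simp add: words_def)
    also have "\<dots> \<le> 1" unfolding gv_def by (rule kraft[OF adm_gV finite_Vg y])
    finally show "(\<Sum>w\<in>words Vg n. exp (- bsum (gv i) (length w) (app w y))) \<le> 1" .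
  qed simp
  finally show ?thesis by simp
qed

text \<open>The pair of weights that witnesses \<open>cheap\<close> contributes one summand to the
  product of \<open>wD\<close> and \<open>wV\<close>.\<close>

lemma cheap_weight:
  assumes ch: "cheap j s e C n \<omega>" and y: "y \<in> seqs Dg" "y' \<in> seqs Vg"
  shows "exp (- (s * bsum la n \<omega>)) \<le> exp (C - e * real n) * (wD j y (pre n \<omega>) * wV j y' (tailw n \<omega>))"
proof -
  obtain i i' where w: "\<omega> \<in> seqs Dg" and i: "i \<le> j" "i' \<le> j"
    and le: "bsum (gg i) n \<omega> + bsum (gv i') (Ln n \<omega> - n) ((shift ^^ n) (proj_v \<omega>)) \<le> s * bsum la n \<omega> - e * real n + C"
    using ch by (auto simp: cheap_def)
  let ?b = "real (fst (gD i)) * gbound Dg (fst (gD i)) (snd (gD i))"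
  let ?b' = "real (fst (gV i')) * gbound Vg (fst (gV i')) (snd (gV i'))"
  have 1: "bsum (gg i) n (app (pre n \<omega>) y) \<le> bsum (gg i) n \<omega> + ?b"
    unfolding gg_def using w y by (intro bsum_gfun_tail[OF adm_gD finite_Dg] app_seqs[OF pre_in_words]) simp_all
  have w': "(shift ^^ n) (proj_v \<omega>) \<in> seqs Vg" using w by simp
  have 2: "bsum (gv i') (Ln n \<omega> - n) (app (tailw n \<omega>) y') \<le> bsum (gv i') (Ln n \<omega> - n) ((shift ^^ n) (proj_v \<omega>)) + ?b'"
    unfolding gv_def tailw_def using w' y by (intro bsum_gfun_tail[OF adm_gV finite_Vg] app_seqs[OF pre_in_words]) simp_all
  let ?S = "bsum (gg i) n (app (pre n \<omega>) y)" and ?S' = "bsum (gv i') (Ln n \<omega> - n) (app (tailw n \<omega>) y')"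
  have "exp (- (s * bsum la n \<omega>)) \<le> exp (C - e * real n + ((?b - ?S) + (?b' - ?S')))"
    using le 1 2 by simp
  also have "\<dots> = exp (C - e * real n) * ((exp ?b * exp (- ?S)) * (exp ?b' * exp (- ?S')))"
    by (simp only: exp_add[symmetric]) simp
  also have "\<dots> \<le> exp (C - e * real n) * (wD j y (pre n \<omega>) * wV j y' (tailw n \<omega>))"
  proof (intro mult_left_mono mult_mono)
    have "exp ?b * exp (- bsum (gg i) (length (pre n \<omega>)) (app (pre n \<omega>) y)) \<le> wD j y (pre n \<omega>)"
      unfolding wD_def using i
      by (intro member_le_sum[of i "{..j}" "\<lambda>i. exp (real (fst (gD i)) * gbound Dg (fst (gD i)) (snd (gD i))) * exp (- bsum (gg i) (length (pre n \<omega>)) (app (pre n \<omega>) y))"]) auto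
    then show "exp ?b * exp (- ?S) \<le> wD j y (pre n \<omega>)" by simp
    have "exp ?b' * exp (- bsum (gv i') (length (tailw n \<omega>)) (app (tailw n \<omega>) y')) \<le> wV j y' (tailw n \<omega>)"
      unfolding wV_def using i
      by (intro member_le_sum[of i' "{..j}" "\<lambda>i. exp (real (fst (gV i)) * gbound Vg (fst (gV i)) (snd (gV i))) * exp (- bsum (gv i) (length (tailw n \<omega>)) (app (tailw n \<omega>) y'))"]) auto
    then show "exp ?b' * exp (- ?S') \<le> wV j y' (tailw n \<omega>)" by (simp add: tailw_def)
    show "0 \<le> wD j y (pre n \<omega>)" unfolding wD_def by (intro sum_nonneg) auto
  qed auto
  finally show ?thesis .
qed

text \<open>The squares of cheap points cover the level set infinitely often. Up to a constant, the
  power \<open>s\<close> of a diameter is at most the weight of the square times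
  \<open>exp (- e * real n)\<close>, and the weights at one level have a sum that grows only
  linearly in \<open>n\<close>.\<close>

theorem upper_bound:
  assumes \<phi>: "uc Dg \<phi>" and s: "0 < s" "s1 < s"
    and no: "\<not> (\<exists>\<mu>\<in>inv_meas Dg. (\<integral>\<omega>. \<phi> \<omega> \<partial>\<mu>) = \<alpha> \<and> s1 \<le> D_LY p a b \<mu>)"
  shows "hausdorff_measure s (cod ` birkhoff_level p m \<phi> \<alpha>) = 0"
proof -
  obtain j where j: "\<And>n \<omega>. n > j \<Longrightarrow> \<omega> \<in> seqs Dg \<Longrightarrow> \<bar>bsum \<phi> n \<omega> / real n - \<alpha>\<bar> \<le> 1 / real (Suc j) \<Longrightarrow>
      Dfun (Tm j n \<omega> / real n) (Tv j n \<omega> / real n) (bsum la n \<omega> / real n) (bsum lb n \<omega> / real n) < s1"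
    using uniform_bound[OF \<phi> no] by blast
  define C where "C = lmax * (gbound Vg (fst (gV 0)) (snd (gV 0)) / lmin + (s - s1) / 2)"
  define e where "e = (s - s1) / 2 * lmin"
  have e: "0 < e" using s lmin_pos by (simp add: e_def)
  obtain z where "z \<in> Dg" using Dg_ne by blast
  then have "(\<lambda>_. z) \<in> seqs Dg" by (simp add: seqs_def)
  then obtain y where y: "y \<in> seqs Dg" by blast
  then have y': "proj_v y \<in> seqs Vg" by simp
  define F where "F = (\<lambda>n. (\<lambda>\<omega>. (pre n \<omega>, tailw n \<omega>)) ` {\<omega>. cheap j s e C n \<omega>})"
  \<comment> \<open>The length of the vertical word depends on the point. The Kraft bound holds for
    each length separately, and at most \<open>Kc * n + 1\<close> lengths occur; this is the source
    of the linear factor.\<close>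
  define W where "W = (\<lambda>n. words Dg n \<times> (\<Union>l\<le>Kc * n. words Vg l))"
  have finW: "finite (W n)" for n unfolding W_def using finite_Dg finite_Vg by auto
  have FW: "F n \<subseteq> W n" for n
  proof
    fix k assume "k \<in> F n"
    then obtain \<omega> where w: "cheap j s e C n \<omega>" "k = (pre n \<omega>, tailw n \<omega>)" by (auto simp: F_def)
    then have w': "\<omega> \<in> seqs Dg" by (simp add: cheap_def)
    have "Ln n \<omega> - n \<le> Kc * n" using Ln_le[OF w', of n] by simp
    moreover have "tailw n \<omega> \<in> words Vg (Ln n \<omega> - n)" unfolding tailw_def using w' by simp
    ultimately show "k \<in> W n" unfolding W_def w(2) using w' by auto
  qed
  define M1 where "M1 = (\<Sum>i\<le>j. exp (real (fst (gD i)) * gbound Dg (fst (gD i)) (snd (gD i))))"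
  define M2 where "M2 = (\<Sum>i\<le>j. exp (real (fst (gV i)) * gbound Vg (fst (gV i)) (snd (gV i))))"
  have M: "0 \<le> M1" "0 \<le> M2" by (auto simp: M1_def M2_def intro!: sum_nonneg)
  have wn: "0 \<le> wD j y w" "0 \<le> wV j (proj_v y) u" for w u by (auto simp: wD_def wV_def intro!: sum_nonneg)
  have sumW: "(\<Sum>k\<in>W n. wD j y (fst k) * wV j (proj_v y) (snd k)) \<le> M1 * M2 * (real Kc * real n + 1)" for n
  proof -
    have "(\<Sum>u\<in>(\<Union>l\<le>Kc * n. words Vg l). wV j (proj_v y) u) = (\<Sum>l\<le>Kc * n. \<Sum>u\<in>words Vg l. wV j (proj_v y) u)"
    proof (rule sum.UNION_disjoint)
      show "\<forall>l\<in>{..Kc * n}. finite (words Vg l)" using finite_Vg by simp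
      show "\<forall>l\<in>{..Kc * n}. \<forall>l'\<in>{..Kc * n}. l \<noteq> l' \<longrightarrow> words Vg l \<inter> words Vg l' = {}"
        by (auto simp: words_def)
    qed simp
    also have "\<dots> \<le> (\<Sum>l\<le>Kc * n. M2)" unfolding M2_def by (intro sum_mono wV_sum y')
    also have "\<dots> = M2 * (real Kc * real n + 1)" by simp
    finally have v: "(\<Sum>u\<in>(\<Union>l\<le>Kc * n. words Vg l). wV j (proj_v y) u) \<le> M2 * (real Kc * real n + 1)" .
    have "(\<Sum>k\<in>W n. wD j y (fst k) * wV j (proj_v y) (snd k)) =
       (\<Sum>w\<in>words Dg n. wD j y w) * (\<Sum>u\<in>(\<Union>l\<le>Kc * n. words Vg l). wV j (proj_v y) u)"
      unfolding W_def by (simp add: sum_product sum.cartesian_product case_prod_unfold)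
    also have "\<dots> \<le> M1 * (M2 * (real Kc * real n + 1))"
      using v wD_sum[OF y, of j n] M by (intro mult_mono) (auto simp: M1_def intro!: sum_nonneg wn)
    finally show ?thesis by (simp add: mult_ac)
  qed
  define c where "c = (\<lambda>n. 2 powr s * exp C * M1 * M2 * ((real Kc * real n + 1) * exp (- e * real n)))"
  have sq: "bounded (square n k)" "diameter (square n k) \<le> 2 * exp (- lmin) ^ n"
    "diameter (square n k) powr s \<le> 2 powr s * exp (C - e * real n) * (wD j y (fst k) * wV j (proj_v y) (snd k))"
    if k: "k \<in> F n" for n k
  proof -
    obtain \<omega> where w: "cheap j s e C n \<omega>" "k = (pre n \<omega>, tailw n \<omega>)" using k by (auto simp: F_def)
    then have w': "\<omega> \<in> seqs Dg" by (simp add: cheap_def)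
    have r0: "0 \<le> 2 * rat aA n \<omega>" using less_imp_le[OF X.rat_pos[OF w']] by simp
    have sd: "dist x y \<le> 2 * rat aA n \<omega>" if "x \<in> square n k" "y \<in> square n k" for x y
      using that unfolding w(2) by (rule square_dist[OF w'])
    note dl = diameter_le_dist[of "2 * rat aA n \<omega>" "square n k", OF r0 sd]
    show b: "bounded (square n k)" by (rule dl(1))
    show "diameter (square n k) \<le> 2 * exp (- lmin) ^ n" using dl(2) X.rat_le[OF w', of n] by linarith
    have "diameter (square n k) powr s \<le> (2 * rat aA n \<omega>) powr s"
      using dl(2) s diameter_ge_0[OF b] by (intro powr_mono2) auto
    also have "\<dots> = 2 powr s * exp (- (s * bsum la n \<omega>))"
    proof -
      have "(2 * rat aA n \<omega>) powr s = 2 powr s * (rat aA n \<omega>) powr s"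
        by (rule powr_mult)
      moreover have "(rat aA n \<omega>) powr s = exp (- (s * bsum la n \<omega>))" by (simp add: rat_a[OF w'] powr_def)
      ultimately show ?thesis by simp
    qed
    also have "\<dots> \<le> 2 powr s * (exp (C - e * real n) * (wD j y (pre n \<omega>) * wV j (proj_v y) (tailw n \<omega>)))"
      by (intro mult_left_mono cheap_weight[OF w(1) y y']) auto
    finally show "diameter (square n k) powr s \<le> 2 powr s * exp (C - e * real n) * (wD j y (fst k) * wV j (proj_v y) (snd k))"
      by (simp add: w(2) mult.assoc)
  qed
  show ?thesis
  proof (rule hausdorff_measure_zeroI[OF s(1), where F = F and V = square and D = "\<lambda>n. 2 * exp (- lmin) ^ n" and c = c])
    show "finite (F n)" for n by (rule finite_subset[OF FW finW])
    show "cod ` birkhoff_level p m \<phi> \<alpha> \<subseteq> (\<Union>n\<in>{N..}. \<Union>k\<in>F n. square n k)" for N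
    proof
      fix x assume "x \<in> cod ` birkhoff_level p m \<phi> \<alpha>"
      then obtain \<omega> where w: "\<omega> \<in> seqs Dg" "(\<lambda>n. bsum \<phi> n \<omega> / real n) \<longlonglongrightarrow> \<alpha>" "x = cod \<omega>"
        unfolding level_set_eq by blast
      obtain n where n: "n \<ge> N" "cheap j s e C n \<omega>"
        using frequently_cheap[OF s(2) j w(1,2) C_def, of N] unfolding e_def by blast
      have "(pre n \<omega>, tailw n \<omega>) \<in> F n" unfolding F_def using n(2) by blast
      moreover have "x \<in> square n (pre n \<omega>, tailw n \<omega>)" unfolding square_def using w by (auto simp: tailw_def)
      ultimately show "x \<in> (\<Union>n\<in>{N..}. \<Union>k\<in>F n. square n k)" using n(1) by blast
    qed
    show "bounded (square n k)" "diameter (square n k) \<le> 2 * exp (- lmin) ^ n" if "k \<in> F n" for n k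
      using sq[OF that] by auto
    show "(\<lambda>n. 2 * exp (- lmin) ^ n) \<longlonglongrightarrow> 0"
      using lmin_pos by (intro tendsto_mult_right_zero LIMSEQ_realpow_zero) auto
    show "real (card (F n)) * 0 \<le> c n" for n
      using M by (auto simp: c_def intro!: mult_nonneg_nonneg)
    show "(\<Sum>k\<in>F n. diameter (square n k) powr s) \<le> c n" for n
    proof -
      have "(\<Sum>k\<in>F n. diameter (square n k) powr s) \<le> (\<Sum>k\<in>F n. 2 powr s * exp (C - e * real n) * (wD j y (fst k) * wV j (proj_v y) (snd k)))"
        by (intro sum_mono sq)
      also have "\<dots> \<le> (\<Sum>k\<in>W n. 2 powr s * exp (C - e * real n) * (wD j y (fst k) * wV j (proj_v y) (snd k)))"
        using wn by (intro sum_mono2 finW FW) auto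
      also have "\<dots> = 2 powr s * exp (C - e * real n) * (\<Sum>k\<in>W n. wD j y (fst k) * wV j (proj_v y) (snd k))"
        by (simp add: sum_distrib_left)
      also have "\<dots> \<le> 2 powr s * exp (C - e * real n) * (M1 * M2 * (real Kc * real n + 1))"
        by (intro mult_left_mono sumW) auto
      also have "exp (C - e * real n) = exp C * exp (- e * real n)" by (simp add: exp_add[symmetric])
      finally show ?thesis by (simp add: c_def mult_ac)
    qed
    show "summable c" unfolding c_def by (intro summable_mult summable_linear_exp e)
  qed
qed

end

section \<open>Lower bound: concatenation of independent blocks\<close>

text \<open>The block \<open>l\<close> has length \<open>l + 1\<close> and occupies the positions \<open>bst l\<close> up to \<open>bst (l + 1) - 1\<close>;
  \<open>blk n\<close> is the block that contains the position \<open>n\<close>.\<close>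

definition bst :: "nat \<Rightarrow> nat" where "bst l = (\<Sum>i<l. Suc i)"

lemma bst_0 [simp]: "bst 0 = 0" by (simp add: bst_def)
lemma bst_Suc: "bst (Suc l) = bst l + Suc l" by (simp add: bst_def)

lemma bst_mono: "k \<le> l \<Longrightarrow> bst k \<le> bst l"
  by (rule lift_Suc_mono_le[of bst]) (auto simp: bst_Suc)

lemma bst_ge: "l \<le> bst l"
  by (induction l) (auto simp: bst_Suc)

lemma bst_double: "2 * bst l = l * (l + 1)"
  by (induction l) (auto simp: bst_Suc)

lemma bst_real: "2 * real (bst l) = real l * (real l + 1)"
  using arg_cong[OF bst_double[of l], of real] by (simp add: algebra_simps)

definition blk :: "nat \<Rightarrow> nat" where "blk n = (LEAST l. n < bst (Suc l))"

lemma blk_bounds: "bst (blk n) \<le> n" "n < bst (Suc (blk n))"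
proof -
  have ex: "n < bst (Suc n)" using bst_ge[of "Suc n"] by simp
  show "n < bst (Suc (blk n))" unfolding blk_def by (rule LeastI, rule ex)
  show "bst (blk n) \<le> n"
  proof (cases "blk n")
    case (Suc k)
    then have "\<not> n < bst (Suc k)" unfolding blk_def using not_less_Least[of k "\<lambda>l. n < bst (Suc l)"] by simp
    then show ?thesis using Suc by simp
  qed simp
qed

lemma blk_eq: "t < Suc l \<Longrightarrow> blk (bst l + t) = l"
proof -
  assume t: "t < Suc l"
  show ?thesis unfolding blk_def
  proof (rule Least_equality)
    show "bst l + t < bst (Suc l)" using t by (simp add: bst_Suc)
    fix k assume "bst l + t < bst (Suc k)"
    then have "bst l < bst (Suc k)" by linarith
    then show "l \<le> k" using bst_mono[of "Suc k" l] by (meson not_less not_less_eq_eq)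
  qed
qed

lemma blk_mono: "n \<le> k \<Longrightarrow> blk n \<le> blk k"
  unfolding blk_def[of n] by (rule Least_le) (use blk_bounds(2)[of k] in linarith)

lemma blk_ge: "bst l \<le> n \<Longrightarrow> l \<le> blk n"
  using blk_mono[of "bst l" n] blk_eq[of 0 l] by simp

text \<open>A Cesaro mean weighted by block lengths. The weights sum to \<open>bst M\<close>, which
  is unbounded, so finitely many terms do not matter.\<close>

lemma cesaro_blocks:
  fixes u :: "nat \<Rightarrow> real"
  assumes "u \<longlonglongrightarrow> c"
  shows "(\<lambda>M. (\<Sum>l<M. real (Suc l) * u l) / real (bst M)) \<longlonglongrightarrow> c"
proof (rule LIMSEQ_I)
  fix e :: real assume e: "0 < e"
  obtain N where N: "\<forall>l\<ge>N. norm (u l - c) < e/2" using LIMSEQ_D[OF assms half_gt_zero[OF e]] by blast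
  define K where "K = (\<Sum>l<N. real (Suc l) * \<bar>u l - c\<bar>)"
  have K: "0 \<le> K" unfolding K_def by (intro sum_nonneg) auto
  obtain N' :: nat where N': "real N' > 2 * K / e" using reals_Archimedean2 by blast
  have "norm ((\<Sum>l<M. real (Suc l) * u l) / real (bst M) - c) < e" if M: "M \<ge> Suc (max N N')" for M
  proof -
    have b: "real (bst M) > 0" using bst_ge[of M] M by simp
    have "(\<Sum>l<M. real (Suc l) * u l) - real (bst M) * c = (\<Sum>l<M. real (Suc l) * (u l - c))"
      by (simp add: bst_def sum_subtractf right_diff_distrib sum_distrib_right)
    then have "(\<Sum>l<M. real (Suc l) * u l) / real (bst M) - c = (\<Sum>l<M. real (Suc l) * (u l - c)) / real (bst M)"
      using b by (simp add: field_simps)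
    moreover have "\<bar>\<Sum>l<M. real (Suc l) * (u l - c)\<bar> \<le> K + real (bst M) * (e/2)"
    proof -
      have "\<bar>\<Sum>l<M. real (Suc l) * (u l - c)\<bar> \<le> (\<Sum>l<M. real (Suc l) * \<bar>u l - c\<bar>)"
        by (rule order_trans[OF sum_abs]) (simp add: abs_mult)
      also have "\<dots> = K + (\<Sum>l\<in>{N..<M}. real (Suc l) * \<bar>u l - c\<bar>)"
        unfolding K_def using M by (subst sum.union_disjoint[symmetric]) (auto intro!: sum.cong)
      also have "(\<Sum>l\<in>{N..<M}. real (Suc l) * \<bar>u l - c\<bar>) \<le> (\<Sum>l\<in>{N..<M}. real (Suc l) * (e/2))"
        using N by (intro sum_mono mult_left_mono) (auto intro: less_imp_le)
      also have "\<dots> \<le> (\<Sum>l<M. real (Suc l) * (e/2))"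
        using e by (intro sum_mono2) auto
      also have "\<dots> = real (bst M) * (e/2)" by (simp add: bst_def sum_distrib_right)
      finally show ?thesis by simp
    qed
    moreover have "K < real (bst M) * (e/2)"
    proof -
      have "K < real N' * (e/2)" using N' e by (simp add: field_simps)
      also have "\<dots> \<le> real (bst M) * (e/2)" using bst_ge[of M] M e by (intro mult_right_mono) auto
      finally show ?thesis .
    qed
    ultimately have "\<bar>\<Sum>l<M. real (Suc l) * (u l - c)\<bar> < real (bst M) * e" by argo
    then have "\<bar>(\<Sum>l<M. real (Suc l) * (u l - c)) / real (bst M)\<bar> < e"
      using b by (simp add: abs_divide pos_divide_less_eq mult.commute)
    then show ?thesis using \<open>_ - c = _\<close> by simp
  qed
  then show "\<exists>N. \<forall>M\<ge>N. norm ((\<Sum>l<M. real (Suc l) * u l) / real (bst M) - c) < e" by blast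
qed

text \<open>The total length grows quadratically in the number of blocks, so an unfinished block is
  negligible.\<close>

lemma block_ratio: "(\<lambda>M. real (Suc M) / real (bst M)) \<longlonglongrightarrow> 0"
proof -
  have l: "(\<lambda>M. 4 * inverse (real (Suc M))) \<longlonglongrightarrow> 0"
    by (rule tendsto_mult_right_zero[OF LIMSEQ_inverse_real_of_nat])
  show ?thesis
  proof (rule Lim_null_comparison[OF _ l], rule eventually_sequentiallyI[of 1])
    fix M :: nat assume M: "1 \<le> M"
    have b: "real (bst M) > 0" using bst_ge[of M] M by simp
    have "real (Suc M) * real (Suc M) \<le> 4 * real (bst M)"
    proof -
      have "real (Suc M) \<le> 2 * real M" using M by simp
      then have "real (Suc M) * real (Suc M) \<le> (2 * real M) * real (Suc M)" by (intro mult_right_mono) auto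
      also have "\<dots> = 2 * (real M * (real M + 1))" by (simp add: algebra_simps)
      also have "\<dots> = 4 * real (bst M)" using bst_real[of M] by simp
      finally show ?thesis .
    qed
    then show "norm (real (Suc M) / real (bst M)) \<le> 4 * inverse (real (Suc M))"
      using b by (simp add: field_simps)
  qed
qed

section \<open>Concentration for independent blocks\<close>

lemma (in prob_space) indep_coordinates:
  "prob_space.indep_vars (PiM UNIV (\<lambda>_::nat. M)) (\<lambda>_. M) (\<lambda>i x. x i) (UNIV :: nat set)"
proof -
  interpret P: product_prob_space "\<lambda>_::nat. M" UNIV ..
  have "distr (PiM UNIV (\<lambda>_::nat. M)) (PiM UNIV (\<lambda>_. M)) (\<lambda>x. \<lambda>i\<in>UNIV. x i) = PiM UNIV (\<lambda>_. M)"
    using distr_id[of "PiM UNIV (\<lambda>_::nat. M)"] by (simp add: id_def restrict_UNIV)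
  also have "\<dots> = PiM UNIV (\<lambda>i. distr (PiM UNIV (\<lambda>_::nat. M)) M (\<lambda>x. x i))"
    by (intro PiM_cong refl) (simp add: P.PiM_component)
  finally show ?thesis by (subst P.indep_vars_iff_distr_eq_PiM') auto
qed

text \<open>The squared ranges in Hoeffding's inequality add up to order \<open>N^3\<close>, while
  the square of the deviation \<open>e * real (bst N)\<close> has order \<open>N^4\<close>. Hence
  the tail is exponentially small in \<open>N\<close> and the Borel-Cantelli lemma applies, for
  countably many tolerances.\<close>

lemma (in prob_space) block_lln:
  fixes f :: "nat \<Rightarrow> 'a \<Rightarrow> real"
  assumes f: "\<And>l. f l \<in> borel_measurable M" and C: "0 < C"
    and bd: "\<And>l x. x \<in> space M \<Longrightarrow> \<bar>f l x\<bar> \<le> C * real (Suc l)"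
  shows "AE x in PiM UNIV (\<lambda>_::nat. M). (\<lambda>N. (\<Sum>l<N. f l (x l) - (\<integral>y. f l y \<partial>M)) / real (bst N)) \<longlonglongrightarrow> 0"
proof -
  interpret P: product_prob_space "\<lambda>_::nat. M" UNIV ..
  let ?P = "PiM UNIV (\<lambda>_::nat. M)"
  have fm: "(\<lambda>x. f l (x l)) \<in> borel_measurable ?P" for l
  proof -
    have "(\<lambda>x. x l) \<in> measurable ?P M" by (rule measurable_component_singleton) simp
    then show ?thesis by (rule measurable_compose[OF _ f])
  qed
  have ex: "(\<integral>x. f l (x l) \<partial>?P) = (\<integral>y. f l y \<partial>M)" for l
  proof -
    have "(\<integral>y. f l y \<partial>M) = (\<integral>y. f l y \<partial>distr ?P M (\<lambda>x. x l))" by (simp add: P.PiM_component)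
    also have "\<dots> = (\<integral>x. f l (x l) \<partial>?P)" by (rule integral_distr) (auto simp: f)
    finally show ?thesis ..
  qed
  define S where "S = (\<lambda>N x. \<Sum>l<N. f l (x l) - (\<integral>y. f l y \<partial>M))"
  have Sm: "S N \<in> borel_measurable ?P" for N unfolding S_def using fm by auto
  have tail: "P.prob {x\<in>space ?P. \<bar>S N x\<bar> \<ge> e * real (bst N)} \<le> 2 * exp (- (e\<^sup>2 / (8 * C\<^sup>2))) ^ N"
    if e: "0 < e" for e N
  proof (cases "N = 0")
    case True
    show ?thesis by (rule order_trans[OF P.prob_le_1]) (simp add: True)
  next
    case False
    interpret H: Hoeffding_ineq ?P "{..<N}" "\<lambda>l x. f l (x l)" "\<lambda>l. - (C * real (Suc l))" "\<lambda>l. C * real (Suc l)" "(\<Sum>l<N. P.expectation (\<lambda>x. f l (x l)))"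
    proof unfold_locales
      show "P.indep_vars (\<lambda>_. borel) (\<lambda>l x. f l (x l)) {..<N}"
        using P.indep_vars_compose2[OF P.indep_vars_subset[OF indep_coordinates], of "{..<N}" f "\<lambda>_. borel"] f by simp
      fix l assume "l \<in> {..<N}"
      show "AE x in ?P. f l (x l) \<in> {- (C * real (Suc l))..C * real (Suc l)}"
      proof (rule AE_I2)
        fix x assume "x \<in> space ?P"
        then have "x l \<in> space M" by (simp add: space_PiM PiE_iff)
        from bd[OF this, of l] show "f l (x l) \<in> {- (C * real (Suc l))..C * real (Suc l)}"
          unfolding abs_le_iff atLeastAtMost_iff by linarith
      qed
    qed auto
    let ?V = "\<Sum>l<N. (C * real (Suc l) - - (C * real (Suc l)))\<^sup>2"
    have V0: "0 < ?V"
    proof (rule sum_pos)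
      show "{..<N} \<noteq> {}" using False by auto
    qed (use C in auto)
    have V: "?V \<le> 4 * C\<^sup>2 * (real N * real N * real N)"
    proof -
      have "?V \<le> (\<Sum>l<N. 4 * C\<^sup>2 * (real N * real N))"
      proof (rule sum_mono)
        fix l assume "l \<in> {..<N}"
        then have "real (Suc l) * real (Suc l) \<le> real N * real N" by (intro mult_mono) auto
        then have "4 * C\<^sup>2 * (real (Suc l) * real (Suc l)) \<le> 4 * C\<^sup>2 * (real N * real N)" by (intro mult_left_mono) auto
        then show "(C * real (Suc l) - - (C * real (Suc l)))\<^sup>2 \<le> 4 * C\<^sup>2 * (real N * real N)"
          by (simp add: power2_eq_square algebra_simps)
      qed
      then show ?thesis by (simp add: mult_ac)
    qed
    have B: "real N * real N \<le> 2 * real (bst N)" using bst_real[of N] by (simp add: algebra_simps)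
    have BB: "(real N * real N) * (real N * real N) \<le> (2 * real (bst N)) * (2 * real (bst N))"
      by (rule mult_mono[OF B B]) simp_all
    have "P.prob {x\<in>space ?P. \<bar>(\<Sum>l<N. f l (x l)) - (\<Sum>l<N. P.expectation (\<lambda>x. f l (x l)))\<bar> \<ge> e * real (bst N)}
       \<le> 2 * exp (-2 * (e * real (bst N))\<^sup>2 / ?V)"
      by (rule H.Hoeffding_ineq_abs_ge[OF _ V0]) (use e in auto)
    also have "\<dots> \<le> 2 * exp (- (real N * (e\<^sup>2 / (8 * C\<^sup>2))))"
    proof -
      have "real N * (e\<^sup>2 / (8 * C\<^sup>2)) * ?V \<le> real N * (e\<^sup>2 / (8 * C\<^sup>2)) * (4 * C\<^sup>2 * (real N * real N * real N))"
        using V by (intro mult_left_mono) auto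
      also have "\<dots> = e\<^sup>2 / 2 * ((real N * real N) * (real N * real N))"
        using C by (simp add: field_simps)
      also have "\<dots> \<le> e\<^sup>2 / 2 * ((2 * real (bst N)) * (2 * real (bst N)))"
        by (rule mult_left_mono[OF BB]) simp
      also have "\<dots> = 2 * (e * real (bst N))\<^sup>2" by (simp add: power2_eq_square)
      finally have "real N * (e\<^sup>2 / (8 * C\<^sup>2)) \<le> 2 * (e * real (bst N))\<^sup>2 / ?V"
        using V0 by (simp add: pos_le_divide_eq)
      then show ?thesis by simp
    qed
    also have "exp (- (real N * (e\<^sup>2 / (8 * C\<^sup>2)))) = exp (- (e\<^sup>2 / (8 * C\<^sup>2))) ^ N"
      by (simp add: exp_of_nat_mult[symmetric])
    finally show ?thesis by (simp add: S_def sum_subtractf ex)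
  qed
  have "AE x in ?P. eventually (\<lambda>N. x \<in> space ?P - {x\<in>space ?P. \<bar>S N x\<bar> \<ge> inverse (real (Suc k)) * real (bst N)}) sequentially" for k
  proof (rule borel_cantelli_AE1)
    let ?e = "inverse (real (Suc k))"
    show "{x\<in>space ?P. \<bar>S N x\<bar> \<ge> ?e * real (bst N)} \<in> sets ?P" for N
      by (intro borel_measurable_le borel_measurable_abs borel_measurable_const Sm)
    show "emeasure ?P {x\<in>space ?P. \<bar>S N x\<bar> \<ge> ?e * real (bst N)} < \<infinity>" for N
      by (simp add: P.emeasure_eq_measure)
    define q where "q = exp (- (?e\<^sup>2 / (8 * C\<^sup>2)))"
    have "0 < ?e\<^sup>2 / (8 * C\<^sup>2)" using C by (intro divide_pos_pos) simp_all
    then have q: "norm q < 1" by (simp add: q_def)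
    show "summable (\<lambda>N. P.prob {x\<in>space ?P. \<bar>S N x\<bar> \<ge> ?e * real (bst N)})"
    proof (rule summable_comparison_test')
      show "summable (\<lambda>N. 2 * q ^ N)" by (intro summable_mult summable_geometric q)
      fix N :: nat
      have "0 < ?e" by simp
      from tail[OF this, of N]
      show "norm (P.prob {x\<in>space ?P. \<bar>S N x\<bar> \<ge> ?e * real (bst N)}) \<le> 2 * q ^ N"
        unfolding q_def real_norm_def abs_of_nonneg[OF measure_nonneg] .
    qed
  qed
  then have "AE x in ?P. \<forall>k. eventually (\<lambda>N. x \<in> space ?P - {x\<in>space ?P. \<bar>S N x\<bar> \<ge> inverse (real (Suc k)) * real (bst N)}) sequentially"
    unfolding AE_all_countable by (intro allI)
  then show ?thesis
  proof eventually_elim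
    case (elim x)
    show ?case
    proof (rule LIMSEQ_I)
      fix e :: real assume "0 < e"
      then obtain k where k: "inverse (real (Suc k)) < e" using reals_Archimedean by blast
      from elim have "eventually (\<lambda>N. x \<in> space ?P - {x\<in>space ?P. \<bar>S N x\<bar> \<ge> inverse (real (Suc k)) * real (bst N)}) sequentially" ..
      then obtain N0 where N: "\<forall>N\<ge>N0. x \<in> space ?P - {x\<in>space ?P. \<bar>S N x\<bar> \<ge> inverse (real (Suc k)) * real (bst N)}"
        unfolding eventually_sequentially ..
      have N0: "\<bar>S N x\<bar> < inverse (real (Suc k)) * real (bst N)" if "N \<ge> N0" for N
      proof -
        have "x \<in> space ?P - {x\<in>space ?P. \<bar>S N x\<bar> \<ge> inverse (real (Suc k)) * real (bst N)}" using N that by blast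
        then have "\<not> \<bar>S N x\<bar> \<ge> inverse (real (Suc k)) * real (bst N)" by blast
        then show ?thesis by linarith
      qed
      have "norm ((\<Sum>l<N. f l (x l) - (\<integral>y. f l y \<partial>M)) / real (bst N) - 0) < e" if "N \<ge> Suc N0" for N
      proof -
        have b: "real (bst N) > 0" using bst_ge[of N] that by simp
        have "\<bar>S N x\<bar> / real (bst N) < inverse (real (Suc k))"
          unfolding pos_divide_less_eq[OF b] using that by (intro N0) simp
        then show ?thesis using k by (simp add: S_def abs_divide)
      qed
      then show "\<exists>N0. \<forall>N\<ge>N0. norm ((\<Sum>l<N. f l (x l) - (\<integral>y. f l y \<partial>M)) / real (bst N) - 0) < e" by blast
    qed
  qed
qed

text \<open>The inequality \<open>ln y \<le> y - 1\<close> at \<open>y = 1 / sqrt x\<close> yields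
  \<open>- ln x \<le> 2 / sqrt x\<close>.\<close>

lemma xlnx_bound:
  fixes x T :: real
  assumes "0 < x" "x \<le> exp (- T)" shows "x * (- ln x) \<le> 2 * exp (- T / 2)"
proof -
  have "ln (1 / sqrt x) \<le> 1 / sqrt x - 1" using assms by (intro ln_le_minus_one) auto
  then have "ln (1 / sqrt x) \<le> 1 / sqrt x" by simp
  moreover have "ln (1 / sqrt x) = - ln x / 2" using assms by (simp add: ln_div ln_sqrt)
  ultimately have "- ln x \<le> 2 / sqrt x" by simp
  then have "x * (- ln x) \<le> x * (2 / sqrt x)" using assms by (intro mult_left_mono) auto
  also have "\<dots> = 2 * sqrt x" 
  proof -
    have "x * (2 / sqrt x) = 2 * (x / sqrt x)" by simp
    then show ?thesis using real_div_sqrt[of x] assms(1) by simp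
  qed
  also have "sqrt x \<le> sqrt (exp (- T))" using assms by simp
  also have "sqrt (exp (- T)) = exp (- T / 2)"
    by (rule real_sqrt_unique) (auto simp: power2_eq_square exp_add[symmetric])
  finally show ?thesis by simp
qed

text \<open>A value whose information exceeds \<open>T\<close> has \<open>c b\<close> below
  \<open>exp (- T)\<close> and loses at most \<open>2 * exp (- T / 2)\<close> by truncation; there
  are at most \<open>exp (T / 2)\<close> values. Assuming only that \<open>c\<close> dominates the
  probabilities admits conditional probabilities for \<open>c\<close>.\<close>

lemma (in prob_space) truncated_information:
  assumes X: "X \<in> measurable M (count_space B)" "finite B"
    and c: "\<And>b. b \<in> B \<Longrightarrow> prob {\<omega>\<in>space M. X \<omega> = b} \<le> c b" "\<And>b. b \<in> B \<Longrightarrow> c b \<le> 1"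
    and card: "real (card B) \<le> exp (T / 2)" and T: "0 \<le> T"
  shows "(\<integral>\<omega>. - ln (c (X \<omega>)) \<partial>M) - 2 \<le> (\<integral>\<omega>. min (- ln (c (X \<omega>))) T \<partial>M)"
proof -
  let ?p = "\<lambda>b. prob {\<omega>\<in>space M. X \<omega> = b}"
  have "?p b * (- ln (c b)) - ?p b * min (- ln (c b)) T \<le> 2 * exp (- T / 2)" if b: "b \<in> B" for b
  proof (cases "- ln (c b) \<le> T \<or> c b \<le> 0")
    case True
    then show ?thesis
    proof
      assume "c b \<le> 0"
      then have "?p b = 0" using c(1)[OF b] measure_nonneg[of M] by (metis order_antisym order_trans)
      then show ?thesis by simp
    qed (simp add: min_def)
  next
    case False
    then have cb: "0 < c b" "T < - ln (c b)" by auto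
    then have "ln (c b) < - T" by simp
    then have "exp (ln (c b)) < exp (- T)" by (simp only: exp_less_cancel_iff)
    then have le: "c b \<le> exp (- T)" using cb by simp
    have "0 \<le> - ln (c b)" using cb T by linarith
    then have "?p b * (- ln (c b)) \<le> c b * (- ln (c b))" using c(1)[OF b] by (intro mult_right_mono)
    also have "\<dots> \<le> 2 * exp (- T / 2)" by (rule xlnx_bound[OF cb(1) le])
    finally have "?p b * (- ln (c b)) \<le> 2 * exp (- T / 2)" .
    moreover have "0 \<le> ?p b * min (- ln (c b)) T" using cb T by (intro mult_nonneg_nonneg) auto
    ultimately show ?thesis by linarith
  qed
  then have "(\<Sum>b\<in>B. ?p b * (- ln (c b)) - ?p b * min (- ln (c b)) T) \<le> (\<Sum>b\<in>B. 2 * exp (- T / 2))"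
    by (intro sum_mono)
  also have "\<dots> = 2 * (real (card B) * exp (- T / 2))" by simp
  also have "real (card B) * exp (- T / 2) \<le> exp (T / 2) * exp (- T / 2)" using card by (intro mult_right_mono) auto
  also have "\<dots> = 1" by (simp add: exp_add[symmetric])
  finally have "(\<Sum>b\<in>B. ?p b * (- ln (c b))) - (\<Sum>b\<in>B. ?p b * min (- ln (c b)) T) \<le> 2"
    by (simp add: sum_subtractf)
  then show ?thesis
    unfolding finite_rv_integral(2)[OF X, of "\<lambda>b. - ln (c b)"]
      finite_rv_integral(2)[OF X, of "\<lambda>b. min (- ln (c b)) T"] by linarith
qed

section \<open>Birkhoff averages of concatenated blocks\<close>

definition conc :: "(nat \<Rightarrow> nat \<Rightarrow> 'a) \<Rightarrow> nat \<Rightarrow> 'a" where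
  "conc x n = x (blk n) (n - bst (blk n))"

lemma conc_at: "t < Suc l \<Longrightarrow> conc x (bst l + t) = x l t"
  by (simp add: conc_def blk_eq)

lemma conc_seqs: "(\<And>l. x l \<in> seqs A) \<Longrightarrow> conc x \<in> seqs A"
  by (simp add: seqs_def conc_def)

lemma pre_conc_block: "pre (Suc l) ((shift ^^ bst l) (conc x)) = pre (Suc l) (x l)"
  using conc_at[of _ l x] by (simp add: pre_eq_iff shift_pow add.commute)

lemma bsum_conc_blocks: "bsum F (bst M) (conc x) = (\<Sum>l<M. bsum F (Suc l) ((shift ^^ bst l) (conc x)))"
proof (induction M)
  case (Suc M)
  show ?case unfolding bst_Suc bsum_add Suc by simp
qed simp

lemma measurable_conc:
  assumes "sets \<mu> = sets (shiftM A)"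
  shows "conc \<in> measurable (PiM UNIV (\<lambda>_::nat. \<mu>)) (shiftM A)"
  unfolding shiftM_def
proof (rule measurable_PiM_single')
  fix n
  have "(\<lambda>\<omega>. \<omega> k) \<in> measurable \<mu> (count_space A)" for k
    unfolding measurable_cong_sets[OF assms refl] shiftM_def by simp
  then have "(\<lambda>x. x (blk n) (n - bst (blk n))) \<in> measurable (PiM UNIV (\<lambda>_::nat. \<mu>)) (count_space A)"
    by (intro measurable_compose[OF measurable_component_singleton]) simp
  then show "(\<lambda>x. conc x n) \<in> measurable (PiM UNIV (\<lambda>_::nat. \<mu>)) (count_space A)" by (simp add: conc_def)
next
  show "conc \<in> space (PiM UNIV (\<lambda>_::nat. \<mu>)) \<rightarrow> (\<Pi>\<^sub>E i\<in>UNIV. space (count_space A))"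
    using space_eq_seqs[OF assms] by (auto simp: conc_def space_PiM PiE_iff seqs_def)
qed

text \<open>Two errors have to vanish. Near its end a block sees the next one, which concerns a
  fixed number \<open>k\<close> of positions for each precision; and at a general time
  \<open>n\<close> the last block is incomplete.\<close>

lemma block_average_imp_average:
  fixes \<phi> :: "(nat \<Rightarrow> 'a) \<Rightarrow> real"
  assumes \<phi>: "uc A \<phi>" and A: "finite A" and x: "\<And>l. x l \<in> seqs A"
    and lim: "(\<lambda>M. (\<Sum>l<M. bsum \<phi> (Suc l) (x l)) / real (bst M)) \<longlonglongrightarrow> \<alpha>"
  shows "(\<lambda>n. bsum \<phi> n (conc x) / real n) \<longlonglongrightarrow> \<alpha>"
proof -
  let ?w = "conc x"
  have w: "?w \<in> seqs A" by (rule conc_seqs[OF x])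
  obtain C where C: "0 \<le> C" "\<And>\<omega>. \<omega> \<in> seqs A \<Longrightarrow> \<bar>\<phi> \<omega>\<bar> \<le> C" using uc_bounded[OF A \<phi>] by blast
  define u where "u = (\<lambda>l. (bsum \<phi> (Suc l) ((shift ^^ bst l) ?w) - bsum \<phi> (Suc l) (x l)) / real (Suc l))"
  have u: "u \<longlonglongrightarrow> 0"
  proof (rule LIMSEQ_I)
    fix e :: real assume e: "0 < e"
    obtain k where k: "ucn A \<phi> k (e/2)" using ucD[OF \<phi> half_gt_zero[OF e]] by blast
    \<comment> \<open>For such long blocks the \<open>k\<close> positions next to the boundary
      contribute at most \<open>2 * C * k\<close>, less than \<open>e/2\<close> times the block
      length.\<close>
    obtain N :: nat where N: "real N > 4 * C * real k / e" using reals_Archimedean2 by blast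
    have "norm (u l - 0) < e" if l: "l \<ge> N" for l
    proof -
      have "\<bar>\<phi> ((shift ^^ t) ((shift ^^ bst l) ?w)) - \<phi> ((shift ^^ t) (x l))\<bar>
          \<le> e/2 + (if t \<in> {Suc l - k..<Suc l} then 2 * C else 0)" if t: "t < Suc l" for t
      proof (cases "t \<in> {Suc l - k..<Suc l}")
        case True
        have "\<bar>\<phi> ((shift ^^ t) ((shift ^^ bst l) ?w))\<bar> \<le> C" "\<bar>\<phi> ((shift ^^ t) (x l))\<bar> \<le> C"
          using w x by (auto intro!: C(2))
        then show ?thesis using True e by simp
      next
        case False
        then have tk: "t + k \<le> Suc l" using t by auto
        have "pre k ((shift ^^ t) ((shift ^^ bst l) ?w)) = pre k ((shift ^^ t) (x l))"
          using pre_conc_block[of l x] tk by (simp add: pre_eq_iff shift_pow)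
        then have "\<bar>\<phi> ((shift ^^ t) ((shift ^^ bst l) ?w)) - \<phi> ((shift ^^ t) (x l))\<bar> \<le> e/2"
          using w x by (intro ucnD[OF k]) simp_all
        then show ?thesis using C(1) by auto
      qed
      then have "(\<Sum>t<Suc l. \<bar>\<phi> ((shift ^^ t) ((shift ^^ bst l) ?w)) - \<phi> ((shift ^^ t) (x l))\<bar>)
          \<le> (\<Sum>t<Suc l. e/2 + (if t \<in> {Suc l - k..<Suc l} then 2 * C else 0))"
        by (intro sum_mono) simp
      also have "\<dots> = real (Suc l) * (e/2) + (\<Sum>t<Suc l. if t \<in> {Suc l - k..<Suc l} then 2 * C else 0)"
        by (simp only: sum.distrib sum_constant card_lessThan)
      also have "(\<Sum>t<Suc l. if t \<in> {Suc l - k..<Suc l} then 2 * C else 0) = (\<Sum>t\<in>{..<Suc l} \<inter> {Suc l - k..<Suc l}. 2 * C)"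
        by (rule sum.inter_restrict[symmetric]) simp
      also have "\<dots> \<le> (\<Sum>t\<in>{Suc l - k..<Suc l}. 2 * C)" using C(1) by (intro sum_mono2) auto
      also have "\<dots> \<le> 2 * C * real k"
      proof -
        have "real (card {Suc l - k..<Suc l}) \<le> real k" by simp
        from mult_right_mono[OF this, of "2 * C"] C(1) show ?thesis by (simp add: mult_ac)
      qed
      finally have "\<bar>bsum \<phi> (Suc l) ((shift ^^ bst l) ?w) - bsum \<phi> (Suc l) (x l)\<bar> \<le> real (Suc l) * (e/2) + 2 * C * real k"
        unfolding bsum_def sum_subtractf[symmetric] by (rule order_trans[OF sum_abs]) auto
      also have "\<dots> < real (Suc l) * e"
      proof -
        have "4 * C * real k < real N * e" using N e by (simp add: pos_divide_less_eq)
        also have "\<dots> \<le> real (Suc l) * e" using l e by (intro mult_right_mono) auto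
        finally show ?thesis by linarith
      qed
      finally show ?thesis unfolding u_def
        by (simp add: abs_divide pos_divide_less_eq mult.commute del: of_nat_Suc)
    qed
    then show "\<exists>N. \<forall>l\<ge>N. norm (u l - 0) < e" by blast
  qed
  have "(\<lambda>M. (\<Sum>l<M. bsum \<phi> (Suc l) (x l)) / real (bst M) + (\<Sum>l<M. real (Suc l) * u l) / real (bst M)) \<longlonglongrightarrow> \<alpha> + 0"
    by (intro tendsto_add lim cesaro_blocks[OF u])
  moreover have "(\<Sum>l<M. bsum \<phi> (Suc l) (x l)) / real (bst M) + (\<Sum>l<M. real (Suc l) * u l) / real (bst M)
      = bsum \<phi> (bst M) ?w / real (bst M)" for M
    unfolding bsum_conc_blocks u_def add_divide_distrib[symmetric] sum.distrib[symmetric]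
    by (intro arg_cong2[where f="(/)"] sum.cong refl) simp
  ultimately have blim: "(\<lambda>M. bsum \<phi> (bst M) ?w / real (bst M)) \<longlonglongrightarrow> \<alpha>" by simp
  \<comment> \<open>Bounds the deviation at every time within block \<open>M\<close>: the deviation
    at the start of the block plus the effect of its letters read so far.\<close>
  define v where "v = (\<lambda>M. \<bar>bsum \<phi> (bst M) ?w / real (bst M) - \<alpha>\<bar> + (C + \<bar>\<alpha>\<bar>) * (real (Suc M) / real (bst M)))"
  have v0: "v \<longlonglongrightarrow> 0"
  proof -
    have "(\<lambda>M. \<bar>bsum \<phi> (bst M) ?w / real (bst M) - \<alpha>\<bar>) \<longlonglongrightarrow> 0"
      using blim by (intro tendsto_rabs_zero) (simp add: LIM_zero)
    from tendsto_add[OF this tendsto_mult_right_zero[OF block_ratio, of "C + \<bar>\<alpha>\<bar>"]]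
    show ?thesis by (simp add: v_def)
  qed
  have "filterlim blk sequentially sequentially"
    unfolding filterlim_at_top
  proof (intro allI)
    fix Z show "eventually (\<lambda>n. Z \<le> blk n) sequentially"
      by (rule eventually_sequentiallyI[of "bst Z"]) (rule blk_ge)
  qed
  then have vb: "(\<lambda>n. v (blk n)) \<longlonglongrightarrow> 0" by (rule filterlim_compose[OF v0])
  have "(\<lambda>n. bsum \<phi> n ?w / real n - \<alpha>) \<longlonglongrightarrow> 0"
  proof (rule Lim_null_comparison[OF _ vb], rule eventually_sequentiallyI[of 1])
    fix n :: nat assume n: "1 \<le> n"
    let ?M = "blk n"
    have M: "1 \<le> ?M" using blk_ge[of 1 n] n by (simp add: bst_def)
    have b: "0 < real (bst ?M)" "real (bst ?M) \<le> real n" using bst_ge[of ?M] M blk_bounds(1)[of n] by auto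
    have k: "n = bst ?M + (n - bst ?M)" "n - bst ?M \<le> Suc ?M"
      using blk_bounds[of n] by (auto simp: bst_Suc)
    have "\<bar>bsum \<phi> (n - bst ?M) ((shift ^^ bst ?M) ?w)\<bar> \<le> real (n - bst ?M) * C"
    proof -
      have "- C \<le> \<phi> \<omega>" "\<phi> \<omega> \<le> C" if "\<omega> \<in> seqs A" for \<omega> using C(2)[OF that] by auto
      then have "real (n - bst ?M) * (- C) \<le> bsum \<phi> (n - bst ?M) ((shift ^^ bst ?M) ?w)"
        "bsum \<phi> (n - bst ?M) ((shift ^^ bst ?M) ?w) \<le> real (n - bst ?M) * C"
        using bsum_bounds[of "(shift ^^ bst ?M) ?w" A "- C" \<phi> C "n - bst ?M"] w by simp_all
      then show ?thesis unfolding abs_le_iff by linarith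
    qed
    also have "\<dots> \<le> real (Suc ?M) * C" using k(2) C(1) by (intro mult_right_mono) auto
    finally have 1: "\<bar>bsum \<phi> n ?w - bsum \<phi> (bst ?M) ?w\<bar> \<le> real (Suc ?M) * C"
      using bsum_add[of \<phi> "bst ?M" "n - bst ?M" ?w] k(1) by simp
    have 2: "\<bar>real (bst ?M) * \<alpha> - real n * \<alpha>\<bar> \<le> real (Suc ?M) * \<bar>\<alpha>\<bar>"
    proof -
      have "\<bar>real (bst ?M) * \<alpha> - real n * \<alpha>\<bar> = (real n - real (bst ?M)) * \<bar>\<alpha>\<bar>"
        using b(2) by (simp add: left_diff_distrib[symmetric] abs_mult)
      also have "real n - real (bst ?M) \<le> real (Suc ?M)" using k by linarith
      finally show ?thesis by (simp add: mult_right_mono)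
    qed
    have "\<bar>bsum \<phi> n ?w - real n * \<alpha>\<bar> \<le> \<bar>bsum \<phi> (bst ?M) ?w - real (bst ?M) * \<alpha>\<bar> + real (Suc ?M) * (C + \<bar>\<alpha>\<bar>)"
      using 1 2 by (simp add: distrib_left)
    also have "\<dots> = real (bst ?M) * v ?M"
    proof -
      have "bsum \<phi> (bst ?M) ?w - real (bst ?M) * \<alpha> = real (bst ?M) * (bsum \<phi> (bst ?M) ?w / real (bst ?M) - \<alpha>)"
        using b by (simp add: right_diff_distrib)
      then show ?thesis using b unfolding v_def by (simp add: abs_mult distrib_left mult_ac del: of_nat_Suc)
    qed
    also have "\<dots> \<le> real n * v ?M"
      using b C(1) by (intro mult_right_mono) (auto simp: v_def)
    finally have "\<bar>bsum \<phi> n ?w - real n * \<alpha>\<bar> / real n \<le> v ?M" using n by (simp add: pos_divide_le_eq mult.commute)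
    moreover have "bsum \<phi> n ?w / real n - \<alpha> = (bsum \<phi> n ?w - real n * \<alpha>) / real n" using n by (simp add: diff_divide_distrib)
    ultimately show "norm (bsum \<phi> n ?w / real n - \<alpha>) \<le> v ?M" by (simp add: abs_divide)
  qed
  then show ?thesis by (simp add: LIM_zero_iff)
qed

text \<open>A weak form of Egorov's theorem: the sets where \<open>Q\<close> holds from
  \<open>N\<close> on cover almost everything, so one of them has positive measure. As
  \<open>R\<close> may fail to be measurable, exceptional points are removed together with a
  measurable null set \<open>Z\<close>.\<close>

lemma (in prob_space) positive_good_set:
  assumes R: "AE x in M. R x" and Q: "AE x in M. eventually (\<lambda>n. Q n x) sequentially"
    and meas: "\<And>n. {x\<in>space M. Q n x} \<in> events"
  shows "\<exists>N G. G \<in> events \<and> 0 < prob G \<and> (\<forall>x\<in>G. R x \<and> (\<forall>n\<ge>N. Q n x))"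
proof -
  have "AE x in M. R x \<and> eventually (\<lambda>n. Q n x) sequentially" using R Q by eventually_elim simp
  then have "\<exists>Z\<in>null_sets M. {x\<in>space M. \<not> (R x \<and> eventually (\<lambda>n. Q n x) sequentially)} \<subseteq> Z"
    by (simp only: eventually_ae_filter)
  then obtain Z where "Z \<in> null_sets M" and Z1: "{x\<in>space M. \<not> (R x \<and> eventually (\<lambda>n. Q n x) sequentially)} \<subseteq> Z" ..
  then have Z: "emeasure M Z = 0" "Z \<in> events" by (simp_all add: null_setsD1 null_setsD2)
  define G where "G = (\<lambda>N. {x\<in>space M. \<forall>n\<ge>N. Q n x} - Z)"
  have Gev: "G N \<in> events" for N
  proof -
    have "{x\<in>space M. \<forall>n\<ge>N. Q n x} = (\<Inter>n\<in>{N..}. {x\<in>space M. Q n x})" by auto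
    also have "\<dots> \<in> events" by (intro sets.countable_INT' image_subsetI meas) simp_all
    finally show ?thesis unfolding G_def using Z(2) by (rule sets.Diff)
  qed
  have RQ: "R x \<and> (\<exists>N. \<forall>n\<ge>N. Q n x)" if "x \<in> space M" "x \<notin> Z" for x
  proof -
    have "R x \<and> eventually (\<lambda>n. Q n x) sequentially" using Z1 that by blast
    then show ?thesis by (simp only: eventually_sequentially)
  qed
  have "space M - Z \<subseteq> (\<Union>N. G N)"
  proof
    fix x assume x: "x \<in> space M - Z"
    then obtain N where "\<forall>n\<ge>N. Q n x" using RQ[of x] by blast
    then have "x \<in> G N" using x by (simp add: G_def)
    then show "x \<in> (\<Union>N. G N)" by blast
  qed
  have "\<exists>N. 0 < prob (G N)"
  proof (rule ccontr)
    assume "\<not> ?thesis"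
    then have "emeasure M (G N) = 0" for N
      unfolding emeasure_eq_measure using zero_less_measure_iff[of M "G N"] by simp
    then have "emeasure M (\<Union>N. G N) = 0" using Gev by (intro emeasure_UN_eq_0) auto
    moreover have "emeasure M (space M - Z) \<le> emeasure M (\<Union>N. G N)"
      using Gev by (intro emeasure_mono \<open>space M - Z \<subseteq> (\<Union>N. G N)\<close>) auto
    moreover have "emeasure M (space M - Z) = 1"
      using prob_compl[OF Z(2)] Z(1) unfolding emeasure_eq_measure by simp
    ultimately show False by simp
  qed
  then obtain N where "0 < prob (G N)" by blast
  moreover have "R x \<and> (\<forall>n\<ge>N. Q n x)" if "x \<in> G N" for x using that RQ[of x] by (simp add: G_def)
  ultimately show ?thesis using Gev by blast
qed

lemma neg_ln_nonneg: "0 \<le> c \<Longrightarrow> c \<le> 1 \<Longrightarrow> 0 \<le> - ln c" for c :: real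
  by (cases "c = 0") auto

section \<open>Mass of approximate squares\<close>

locale lg_measure = lg +
  fixes \<mu> :: "(nat \<Rightarrow> nat \<times> nat) measure"
  assumes inv_mu: "\<mu> \<in> inv_meas Dg"
begin

lemma prob_mu: "prob_space \<mu>" and sets_mu: "sets \<mu> = sets (shiftM Dg)"
  using inv_mu by (auto simp: inv_meas_def)

sublocale M: prob_space \<mu> by (rule prob_mu)
sublocale P: product_prob_space "\<lambda>_::nat. \<mu>" UNIV ..

lemma space_mu: "space \<mu> = seqs Dg" by (rule space_eq_seqs[OF sets_mu])

abbreviation PP where "PP \<equiv> PiM UNIV (\<lambda>_::nat. \<mu>)"

lemma space_PP: "x \<in> space PP \<longleftrightarrow> (\<forall>l. x l \<in> seqs Dg)"
  by (simp add: space_PiM PiE_iff space_mu)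

definition wp :: "(nat \<times> nat) list \<Rightarrow> real" where
  "wp xs = measure \<mu> {\<omega>\<in>space \<mu>. pre (length xs) \<omega> = xs}"
definition vp :: "nat list \<Rightarrow> real" where
  "vp xs = measure \<mu> {\<omega>\<in>space \<mu>. pre (length xs) (proj_v \<omega>) = xs}"

lemma pre_meas: "pre n \<in> measurable \<mu> (count_space (words Dg n))"
  by (rule sets_M_words[OF sets_mu finite_Dg])

lemma pre_proj_meas: "(\<lambda>\<omega>. pre n (proj_v \<omega>)) \<in> measurable \<mu> (count_space (words Vg n))"
  by (rule measurable_compose[OF measurable_proj'[OF sets_mu] sets_M_words[OF refl finite_Vg]])

lemma cyl_sets: "{\<omega>\<in>space \<mu>. pre n \<omega> = xs} \<in> sets \<mu>"
  by (rule measurable_pre_pred[OF sets_mu finite_Dg])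

lemma vcyl_sets: "{\<omega>\<in>space \<mu>. pre n (proj_v \<omega>) = xs} \<in> sets \<mu>"
  unfolding pre_proj by (rule measurable_pre_pred[OF sets_mu finite_Dg])

lemma wp_bounds: "0 \<le> wp xs" "wp xs \<le> vp (map fst xs)" "vp v \<le> 1" "0 \<le> vp v"
proof -
  show "wp xs \<le> vp (map fst xs)"
    unfolding wp_def vp_def by (rule M.finite_measure_mono) (auto simp: pre_proj vcyl_sets[unfolded pre_proj])
qed (auto simp: wp_def vp_def)

text \<open>The ratio is the conditional probability of the word given its rows, with value 0 when
  the rows have probability 0.\<close>

lemma ratio_bounds: "0 \<le> wp xs / vp (map fst xs)" "wp xs / vp (map fst xs) \<le> 1" "wp xs \<le> wp xs / vp (map fst xs)"
proof -
  note b = wp_bounds(1,2)[of xs] wp_bounds(3,4)[of "map fst xs"]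
  show "0 \<le> wp xs / vp (map fst xs)" using b by simp
  show "wp xs / vp (map fst xs) \<le> 1" using b by (simp add: divide_le_eq_1) linarith
  show "wp xs \<le> wp xs / vp (map fst xs)"
  proof (cases "vp (map fst xs) = 0")
    case True then show ?thesis using b by simp
  next
    case False
    then have "0 < vp (map fst xs)" using b by simp
    then show ?thesis using b mult_left_mono[of "vp (map fst xs)" 1 "wp xs"] by (simp add: pos_le_divide_eq)
  qed
qed

text \<open>Twice the exponential growth rate of the number of words: truncating information at this level
  changes its expectation by a bounded amount only.\<close>

definition Tc :: real where "Tc = 2 * ln (real (card Dg + card Vg))"

lemma card_pos: "1 \<le> card Dg" "1 \<le> card Vg"
  using finite_Dg Dg_ne finite_Vg Vg_ne by (simp_all add: Suc_le_eq card_gt_0_iff)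

lemma Tc_nonneg: "0 \<le> Tc" unfolding Tc_def using card_pos by simp

lemma card_words_le:
  "real (card (words Dg n)) \<le> exp (Tc * real n / 2)" "real (card (words Vg n)) \<le> exp (Tc * real n / 2)"
proof -
  let ?N = "real (card Dg + card Vg)"
  have "exp (Tc * real n / 2) = exp (real n * ln ?N)" by (simp add: Tc_def)
  also have "\<dots> = ?N ^ n" using card_pos by (simp only: exp_of_nat_mult) simp
  finally have e: "exp (Tc * real n / 2) = ?N ^ n" .
  show "real (card (words Dg n)) \<le> exp (Tc * real n / 2)" "real (card (words Vg n)) \<le> exp (Tc * real n / 2)"
    unfolding e card_words[OF finite_Dg] card_words[OF finite_Vg] of_nat_power by (intro power_mono; simp)+
qed

text \<open>Truncated conditional and vertical information of the block \<open>0..l\<close>; the truncation makes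
  Hoeffding's inequality applicable.\<close>

definition ic :: "nat \<Rightarrow> (nat \<Rightarrow> nat \<times> nat) \<Rightarrow> real" where
  "ic l \<omega> = min (- ln (wp (pre (Suc l) \<omega>) / vp (map fst (pre (Suc l) \<omega>)))) (Tc * real (Suc l))"
definition iv :: "nat \<Rightarrow> (nat \<Rightarrow> nat \<times> nat) \<Rightarrow> real" where
  "iv l \<omega> = min (- ln (vp (pre (Suc l) (proj_v \<omega>)))) (Tc * real (Suc l))"

lemma ic_bounds: "0 \<le> ic l \<omega>" "ic l \<omega> \<le> Tc * real (Suc l)"
proof -
  let ?c = "wp (pre (Suc l) \<omega>) / vp (map fst (pre (Suc l) \<omega>))"
  have "0 \<le> - ln ?c"
    using ratio_bounds(1,2)[of "pre (Suc l) \<omega>"] by (rule neg_ln_nonneg)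
  then show "0 \<le> ic l \<omega>" using Tc_nonneg by (simp add: ic_def)
  show "ic l \<omega> \<le> Tc * real (Suc l)" by (simp add: ic_def)
qed

lemma iv_bounds: "0 \<le> iv l \<omega>" "iv l \<omega> \<le> Tc * real (Suc l)"
proof -
  let ?c = "vp (pre (Suc l) (proj_v \<omega>))"
  have "0 \<le> - ln ?c" using wp_bounds(4,3)[of "pre (Suc l) (proj_v \<omega>)"] by (rule neg_ln_nonneg)
  then show "0 \<le> iv l \<omega>" using Tc_nonneg by (simp add: iv_def)
  show "iv l \<omega> \<le> Tc * real (Suc l)" by (simp add: iv_def)
qed

lemma ic_meas: "ic l \<in> borel_measurable \<mu>"
  using borel_measurable_pre[OF finite_Dg, of "\<lambda>xs. min (- ln (wp xs / vp (map fst xs))) (Tc * real (Suc l))" "Suc l"]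
  by (simp add: ic_def[abs_def] measurable_cong_sets[OF sets_mu refl])

lemma iv_meas: "iv l \<in> borel_measurable \<mu>"
  using borel_measurable_pre[OF finite_Dg, of "\<lambda>xs. min (- ln (vp (map fst xs))) (Tc * real (Suc l))" "Suc l"]
  by (simp add: iv_def[abs_def] pre_proj measurable_cong_sets[OF sets_mu refl])

lemma blockH_wp: "blockH Dg \<mu> n = (\<Sum>xs\<in>words Dg n. - (wp xs * ln (wp xs)))"
  unfolding blockH_def entH_def wp_def by (intro sum.cong refl) (simp add: words_def)

lemma blockH_vp: "blockH Vg (pv \<mu>) n = (\<Sum>xs\<in>words Vg n. - (vp xs * ln (vp xs)))"
  unfolding blockH_def entH_def
proof (intro sum.cong refl)
  fix xs assume xs: "xs \<in> words Vg n"
  have sp: "space (pv \<mu>) = seqs Vg" by (simp add: pv_def space_shiftM)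
  have "measure (pv \<mu>) {\<omega>\<in>space (pv \<mu>). pre n \<omega> = xs} = measure \<mu> (proj_v -` {\<omega>\<in>space (pv \<mu>). pre n \<omega> = xs} \<inter> space \<mu>)"
    unfolding pv_def
    by (rule measure_distr[OF measurable_proj'[OF sets_mu]])
       (use measurable_pre_pred[OF refl finite_Vg, of "\<lambda>ys. ys = xs" n] in simp)
  also have "proj_v -` {\<omega>\<in>space (pv \<mu>). pre n \<omega> = xs} \<inter> space \<mu> = {\<omega>\<in>space \<mu>. pre (length xs) (proj_v \<omega>) = xs}"
    using xs by (auto simp: sp space_mu words_def)
  finally show "- (measure (pv \<mu>) {\<omega>\<in>space (pv \<mu>). pre n \<omega> = xs} * ln (measure (pv \<mu>) {\<omega>\<in>space (pv \<mu>). pre n \<omega> = xs}))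
    = - (vp xs * ln (vp xs))" by (simp add: vp_def)
qed

lemma vp_integral: "(\<integral>\<omega>. F (pre n (proj_v \<omega>)) \<partial>\<mu>) = (\<Sum>v\<in>words Vg n. vp v * F v)" for F :: "nat list \<Rightarrow> real"
  unfolding M.finite_rv_integral(2)[OF pre_proj_meas finite_words[OF finite_Vg]] vp_def
  by (intro sum.cong refl) (simp add: words_def)

lemma wp_integral: "(\<integral>\<omega>. F (pre n \<omega>) \<partial>\<mu>) = (\<Sum>v\<in>words Dg n. wp v * F v)" for F :: "(nat \<times> nat) list \<Rightarrow> real"
  unfolding M.finite_rv_integral(2)[OF pre_meas finite_words[OF finite_Dg]] wp_def
  by (intro sum.cong refl) (simp add: words_def)

lemma iv_expect: "blockH Vg (pv \<mu>) (Suc l) - 2 \<le> (\<integral>\<omega>. iv l \<omega> \<partial>\<mu>)"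
proof -
  have "blockH Vg (pv \<mu>) (Suc l) = (\<integral>\<omega>. - ln (vp (pre (Suc l) (proj_v \<omega>))) \<partial>\<mu>)"
    unfolding blockH_vp vp_integral[of "\<lambda>v. - ln (vp v)"] by simp
  moreover have "(\<integral>\<omega>. - ln (vp (pre (Suc l) (proj_v \<omega>))) \<partial>\<mu>) - 2 \<le> (\<integral>\<omega>. iv l \<omega> \<partial>\<mu>)"
    unfolding iv_def
  proof (rule M.truncated_information[OF pre_proj_meas finite_words[OF finite_Vg]])
    show "M.prob {\<omega>\<in>space \<mu>. pre (Suc l) (proj_v \<omega>) = b} \<le> vp b" if "b \<in> words Vg (Suc l)" for b
      using that by (simp add: vp_def words_def)
  qed (use wp_bounds card_words_le[of "Suc l"] Tc_nonneg in auto)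
  ultimately show ?thesis by simp
qed

text \<open>By the chain rule, the conditional information before truncation has as its mean the
  difference of the two block entropies; truncation costs at most 2.\<close>

lemma ic_expect: "blockH Dg \<mu> (Suc l) - blockH Vg (pv \<mu>) (Suc l) - 2 \<le> (\<integral>\<omega>. ic l \<omega> \<partial>\<mu>)"
proof -
  let ?c = "\<lambda>xs. wp xs / vp (map fst xs)"
  have t: "wp xs * (- ln (?c xs)) = - (wp xs * ln (wp xs)) + wp xs * ln (vp (map fst xs))" for xs
  proof (cases "wp xs = 0")
    case False
    then have "0 < wp xs" "0 < vp (map fst xs)" using wp_bounds(1,2)[of xs] by linarith+
    then show ?thesis by (simp add: ln_div algebra_simps)
  qed simp
  have "(\<integral>\<omega>. - ln (?c (pre (Suc l) \<omega>)) \<partial>\<mu>) = blockH Dg \<mu> (Suc l) + (\<Sum>xs\<in>words Dg (Suc l). wp xs * ln (vp (map fst xs)))"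
    unfolding wp_integral[of "\<lambda>xs. - ln (?c xs)"] t sum.distrib blockH_wp ..
  also have "(\<Sum>xs\<in>words Dg (Suc l). wp xs * ln (vp (map fst xs))) = (\<integral>\<omega>. ln (vp (pre (Suc l) (proj_v \<omega>))) \<partial>\<mu>)"
    unfolding pre_proj by (rule wp_integral[symmetric])
  also have "\<dots> = - blockH Vg (pv \<mu>) (Suc l)"
    unfolding vp_integral[of "\<lambda>v. ln (vp v)"] blockH_vp by (simp add: sum_negf)
  finally have "(\<integral>\<omega>. - ln (?c (pre (Suc l) \<omega>)) \<partial>\<mu>) = blockH Dg \<mu> (Suc l) - blockH Vg (pv \<mu>) (Suc l)" by simp
  moreover have "(\<integral>\<omega>. - ln (?c (pre (Suc l) \<omega>)) \<partial>\<mu>) - 2 \<le> (\<integral>\<omega>. ic l \<omega> \<partial>\<mu>)"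
    unfolding ic_def
  proof (rule M.truncated_information[OF pre_meas finite_words[OF finite_Dg]])
    show "M.prob {\<omega>\<in>space \<mu>. pre (Suc l) \<omega> = b} \<le> ?c b" if "b \<in> words Dg (Suc l)" for b
      using that ratio_bounds(3)[of b] by (simp add: wp_def words_def)
  qed (use ratio_bounds(2) card_words_le[of "Suc l"] Tc_nonneg in auto)
  ultimately show ?thesis by simp
qed

abbreviation "hD \<equiv> hs Dg \<mu>"
abbreviation "hV \<equiv> hs Vg (pv \<mu>)"
abbreviation "LA \<equiv> \<integral>\<omega>. la \<omega> \<partial>\<mu>"
abbreviation "LB \<equiv> \<integral>\<omega>. lb \<omega> \<partial>\<mu>"

lemma const_over_Suc: "(\<lambda>l. (C::real) / real (Suc l)) \<longlonglongrightarrow> 0"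
  using tendsto_mult_right_zero[OF LIMSEQ_inverse_real_of_nat, of C] by (simp add: divide_inverse)

text \<open>By \<open>block_lln\<close> the sums follow their means. These fall short of the
  \<open>e l\<close> by at most 2 per block, which is negligible against the block lengths.\<close>

lemma info_lower_limit:
  assumes f: "\<And>l. f l \<in> borel_measurable \<mu>" "\<And>l \<omega>. 0 \<le> f l \<omega>" "\<And>l \<omega>. f l \<omega> \<le> Tc * real (Suc l)"
    and E: "\<And>l. e l - 2 \<le> (\<integral>\<omega>. f l \<omega> \<partial>\<mu>)" and lim: "(\<lambda>l. e l / real (Suc l)) \<longlonglongrightarrow> h" and \<epsilon>: "0 < \<epsilon>"
  shows "AE x in PP. eventually (\<lambda>N. real (bst N) * (h - \<epsilon>) \<le> (\<Sum>l<N. f l (x l))) sequentially"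
proof -
  have "AE x in PP. (\<lambda>N. (\<Sum>l<N. f l (x l) - (\<integral>y. f l y \<partial>\<mu>)) / real (bst N)) \<longlonglongrightarrow> 0"
    using f Tc_nonneg
    by (intro M.block_lln[of f "Tc + 1"]) (auto simp: abs_le_iff intro: order_trans[OF f(3)] mult_right_mono)
  then show ?thesis
  proof eventually_elim
    case (elim x)
    have "(\<lambda>l. e l / real (Suc l) - 2 / real (Suc l)) \<longlonglongrightarrow> h - 0"
      by (intro tendsto_diff lim const_over_Suc)
    then have g: "(\<lambda>l. (e l - 2) / real (Suc l)) \<longlonglongrightarrow> h" by (simp add: diff_divide_distrib)
    have "(\<lambda>N. (\<Sum>l<N. f l (x l) - (\<integral>y. f l y \<partial>\<mu>)) / real (bst N) + (\<Sum>l<N. real (Suc l) * ((e l - 2) / real (Suc l))) / real (bst N)) \<longlonglongrightarrow> 0 + h"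
      by (intro tendsto_add elim cesaro_blocks g)
    then have "eventually (\<lambda>N. h - \<epsilon> < (\<Sum>l<N. f l (x l) - (\<integral>y. f l y \<partial>\<mu>)) / real (bst N) + (\<Sum>l<N. real (Suc l) * ((e l - 2) / real (Suc l))) / real (bst N)) sequentially"
      by (rule order_tendstoD(1)) (use \<epsilon> in simp)
    with eventually_gt_at_top[of 0] show ?case
    proof eventually_elim
      case (elim N)
      have b: "0 < real (bst N)" using bst_ge[of N] elim(1) by simp
      have "(\<Sum>l<N. f l (x l) - (\<integral>y. f l y \<partial>\<mu>)) + (\<Sum>l<N. real (Suc l) * ((e l - 2) / real (Suc l))) \<le> (\<Sum>l<N. f l (x l))"
        unfolding sum.distrib[symmetric]
      proof (rule sum_mono)
        fix l
        have "real (Suc l) * ((e l - 2) / real (Suc l)) = e l - 2" by simp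
        then show "f l (x l) - (\<integral>y. f l y \<partial>\<mu>) + real (Suc l) * ((e l - 2) / real (Suc l)) \<le> f l (x l)" using E[of l] by linarith
      qed
      then have "(\<Sum>l<N. f l (x l) - (\<integral>y. f l y \<partial>\<mu>)) / real (bst N) + (\<Sum>l<N. real (Suc l) * ((e l - 2) / real (Suc l))) / real (bst N)
         \<le> (\<Sum>l<N. f l (x l)) / real (bst N)"
        unfolding add_divide_distrib[symmetric] using b by (intro divide_right_mono) auto
      then have "h - \<epsilon> \<le> (\<Sum>l<N. f l (x l)) / real (bst N)" using elim(2) by linarith
      then show ?case using b by (simp add: pos_le_divide_eq mult.commute)
    qed
  qed
qed

text \<open>Invariance alone makes the mean of a block sum equal to the block length times the
  integral; independence of the blocks takes the place of ergodicity.\<close>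

lemma uc_block_limit:
  assumes F: "uc Dg F"
  shows "AE x in PP. (\<lambda>N. (\<Sum>l<N. bsum F (Suc l) (x l)) / real (bst N)) \<longlonglongrightarrow> (\<integral>\<omega>. F \<omega> \<partial>\<mu>)"
proof -
  obtain C where C: "0 \<le> C" "\<And>\<omega>. \<omega> \<in> seqs Dg \<Longrightarrow> \<bar>F \<omega>\<bar> \<le> C" using uc_bounded[OF finite_Dg F] by blast
  have m: "F \<in> borel_measurable (shiftM Dg)" by (rule uc_measurable[OF finite_Dg F])
  note ib = integral_bsum[OF inv_mu m C(2)]
  have "AE x in PP. (\<lambda>N. (\<Sum>l<N. bsum F (Suc l) (x l) - (\<integral>y. bsum F (Suc l) y \<partial>\<mu>)) / real (bst N)) \<longlonglongrightarrow> 0"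
  proof (rule M.block_lln[of "\<lambda>l. bsum F (Suc l)" "C + 1"])
    show "bsum F (Suc l) \<in> borel_measurable \<mu>" for l using ib(1)[of "Suc l"] by (rule borel_measurable_integrable)
    show "0 < C + 1" using C by simp
    fix l \<omega> assume "\<omega> \<in> space \<mu>"
    then have w: "\<omega> \<in> seqs Dg" by (simp add: space_mu)
    have "- C \<le> F \<omega>" "F \<omega> \<le> C" if "\<omega> \<in> seqs Dg" for \<omega> using C(2)[OF that] by auto
    then have "real (Suc l) * (- C) \<le> bsum F (Suc l) \<omega>" "bsum F (Suc l) \<omega> \<le> real (Suc l) * C"
      using bsum_bounds[of \<omega> Dg "- C" F C "Suc l"] w by simp_all
    then have "\<bar>bsum F (Suc l) \<omega>\<bar> \<le> C * real (Suc l)" unfolding abs_le_iff by (simp add: mult.commute)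
    also have "\<dots> \<le> (C + 1) * real (Suc l)" by (intro mult_right_mono) auto
    finally show "\<bar>bsum F (Suc l) \<omega>\<bar> \<le> (C + 1) * real (Suc l)" .
  qed
  then show ?thesis
  proof eventually_elim
    case (elim x)
    have "(\<lambda>N. (\<Sum>l<N. bsum F (Suc l) (x l) - (\<integral>y. bsum F (Suc l) y \<partial>\<mu>)) / real (bst N) + (\<Sum>l<N. real (Suc l) * (\<integral>\<omega>. F \<omega> \<partial>\<mu>)) / real (bst N)) \<longlonglongrightarrow> 0 + (\<integral>\<omega>. F \<omega> \<partial>\<mu>)"
      by (intro tendsto_add elim cesaro_blocks tendsto_const)
    moreover have "(\<Sum>l<N. bsum F (Suc l) (x l) - (\<integral>y. bsum F (Suc l) y \<partial>\<mu>)) / real (bst N) + (\<Sum>l<N. real (Suc l) * (\<integral>\<omega>. F \<omega> \<partial>\<mu>)) / real (bst N)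
       = (\<Sum>l<N. bsum F (Suc l) (x l)) / real (bst N)" for N
      unfolding add_divide_distrib[symmetric] sum.distrib[symmetric]
      by (intro arg_cong2[where f = "(/)"] sum.cong refl) (simp add: ib(2) del: of_nat_Suc)
    ultimately show ?case by simp
  qed
qed

lemma uc_block_upper:
  assumes F: "uc Dg F" and \<epsilon>: "0 < \<epsilon>"
  shows "AE x in PP. eventually (\<lambda>N. (\<Sum>l<N. bsum F (Suc l) (x l)) \<le> real (bst N) * ((\<integral>\<omega>. F \<omega> \<partial>\<mu>) + \<epsilon>)) sequentially"
  using uc_block_limit[OF F]
proof eventually_elim
  case (elim x)
  then have "eventually (\<lambda>N. (\<Sum>l<N. bsum F (Suc l) (x l)) / real (bst N) < (\<integral>\<omega>. F \<omega> \<partial>\<mu>) + \<epsilon>) sequentially"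
    by (rule order_tendstoD(2)) (use \<epsilon> in simp)
  with eventually_gt_at_top[of 0] show ?case
  proof eventually_elim
    case (elim N)
    have b: "0 < real (bst N)" using bst_ge[of N] elim(1) by simp
    then show ?case using elim(2) by (simp add: pos_divide_less_eq mult.commute)
  qed
qed

lemma bsum_cong_la: "pre n \<omega> = pre n \<omega>' \<Longrightarrow> bsum la n \<omega> = bsum la n \<omega>'"
  unfolding bsum_def by (intro sum.cong refl) (simp add: la_def shift_pow pre_eq_iff)

lemma bsum_cong_lb: "pre n \<omega> = pre n \<omega>' \<Longrightarrow> bsum lb n \<omega> = bsum lb n \<omega>'"
  unfolding bsum_def by (intro sum.cong refl) (simp add: lb_def shift_pow pre_eq_iff)

lemma bsum_la_conc: "bsum la (bst N) (conc x) = (\<Sum>l<N. bsum la (Suc l) (x l))"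
  unfolding bsum_conc_blocks by (intro sum.cong refl bsum_cong_la pre_conc_block)

lemma bsum_lb_conc: "bsum lb (bst N) (conc x) = (\<Sum>l<N. bsum lb (Suc l) (x l))"
  unfolding bsum_conc_blocks by (intro sum.cong refl bsum_cong_lb pre_conc_block)

text \<open>The word lengths in a key reveal the stopping levels, and these depend only on earlier
  digits. Hence the fibre is a cylinder condition expressed with the stopping levels of the fixed
  \<open>x\<close>.\<close>

lemma key_fibre:
  assumes x: "x \<in> space PP" and r: "0 < \<rho>"
  shows "{x'\<in>space PP. key \<rho> (conc x') = key \<rho> (conc x)} =
    {x'\<in>space PP. pre (stp aA \<rho> (conc x)) (conc x') = pre (stp aA \<rho> (conc x)) (conc x) \<and>
      map fst (pre (stp bB \<rho> (conc x)) (conc x')) = map fst (pre (stp bB \<rho> (conc x)) (conc x))}"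
proof (intro Collect_cong conj_cong refl)
  fix x' assume x': "x' \<in> space PP"
  have w: "conc x \<in> seqs Dg" "conc x' \<in> seqs Dg" using x x' by (auto simp: space_PP intro!: conc_seqs)
  let ?n = "stp aA \<rho> (conc x)" and ?L = "stp bB \<rho> (conc x)"
  show "key \<rho> (conc x') = key \<rho> (conc x) \<longleftrightarrow> pre ?n (conc x') = pre ?n (conc x) \<and> map fst (pre ?L (conc x')) = map fst (pre ?L (conc x))"
  proof
    assume k: "key \<rho> (conc x') = key \<rho> (conc x)"
    then have "length (fst (key \<rho> (conc x'))) = length (fst (key \<rho> (conc x)))" "length (snd (key \<rho> (conc x'))) = length (snd (key \<rho> (conc x)))" by simp_all
    then have "stp aA \<rho> (conc x') = ?n" "stp bB \<rho> (conc x') = ?L" by (simp_all add: key_def)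
    then show "pre ?n (conc x') = pre ?n (conc x) \<and> map fst (pre ?L (conc x')) = map fst (pre ?L (conc x))"
      using k by (simp add: key_def pre_proj)
  next
    assume e: "pre ?n (conc x') = pre ?n (conc x) \<and> map fst (pre ?L (conc x')) = map fst (pre ?L (conc x))"
    then have e1: "\<forall>t<?n. conc x' t = conc x t" and e2: "\<forall>t<?L. fst (conc x' t) = fst (conc x t)"
      unfolding pre_eq_iff pre_proj[symmetric] by (auto simp: proj_v_def)
    have "stp aA \<rho> (conc x') = ?n" by (rule X.stp_cong[OF w(2,1) r]) (use e1 in simp)
    moreover have "stp bB \<rho> (conc x') = ?L" by (rule Y.stp_cong[OF w(2,1) r]) (use e2 in \<open>simp add: bB_def\<close>)
    ultimately show "key \<rho> (conc x') = key \<rho> (conc x)" using e by (simp add: key_def pre_proj)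
  qed
qed

lemma key_fibre_sets:
  assumes x: "x \<in> space PP" and r: "0 < \<rho>"
  shows "{x'\<in>space PP. key \<rho> (conc x') = key \<rho> (conc x)} \<in> sets PP"
proof -
  have m: "conc \<in> measurable PP (shiftM Dg)" by (rule measurable_conc[OF sets_mu])
  have "{x'\<in>space PP. Q (pre n (conc x'))} \<in> sets PP" for Q n
  proof -
    have "{x'\<in>space PP. Q (pre n (conc x'))} = conc -` {\<omega>\<in>space (shiftM Dg). Q (pre n \<omega>)} \<inter> space PP"
      using measurable_space[OF m] by auto
    also have "\<dots> \<in> sets PP" by (rule measurable_sets[OF m measurable_pre_pred[OF refl finite_Dg]])
    finally show ?thesis .
  qed
  note c = this
  show ?thesis unfolding key_fibre[OF assms] by (rule sets.sets_Collect_conj) (rule c[of "\<lambda>xs. map fst xs = _"], rule c[of "\<lambda>xs. xs = _"])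
qed

text \<open>The key determines the blocks before \<open>N\<close> completely and the blocks from
  \<open>N\<close> up to \<open>N' - 1\<close> by their rows. Independence turns the mass into a
  product. The probability of a complete block is that of its rows times the conditional
  probability, hence the factors with \<open>iv\<close> and \<open>ic\<close>.\<close>

lemma key_fibre_prob:
  assumes x: "x \<in> space PP" and r: "0 < \<rho>"
    and N: "bst N \<le> stp aA \<rho> (conc x)" "bst N' \<le> stp bB \<rho> (conc x)" "N \<le> N'"
  shows "P.prob {x'\<in>space PP. key \<rho> (conc x') = key \<rho> (conc x)} \<le> exp (- ((\<Sum>l<N. ic l (x l)) + (\<Sum>l<N'. iv l (x l))))"
proof -
  define Xs where "Xs = (\<lambda>l. if l < N then {\<omega>\<in>space \<mu>. pre (Suc l) \<omega> = pre (Suc l) (x l)}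
     else {\<omega>\<in>space \<mu>. pre (Suc l) (proj_v \<omega>) = pre (Suc l) (proj_v (x l))})"
  have Xs: "Xs l \<in> sets \<mu>" for l unfolding Xs_def by (simp add: cyl_sets vcyl_sets)
  have sub: "{x'\<in>space PP. key \<rho> (conc x') = key \<rho> (conc x)} \<subseteq> P.emb UNIV {..<N'} (PiE {..<N'} Xs)"
  proof
    fix x' assume "x' \<in> {x'\<in>space PP. key \<rho> (conc x') = key \<rho> (conc x)}"
    then have x': "x' \<in> space PP" and e: "pre (stp aA \<rho> (conc x)) (conc x') = pre (stp aA \<rho> (conc x)) (conc x)"
      "map fst (pre (stp bB \<rho> (conc x)) (conc x')) = map fst (pre (stp bB \<rho> (conc x)) (conc x))"
      unfolding key_fibre[OF x r] by auto
    have e1: "\<forall>t<stp aA \<rho> (conc x). conc x' t = conc x t" and e2: "\<forall>t<stp bB \<rho> (conc x). fst (conc x' t) = fst (conc x t)"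
      using e unfolding pre_eq_iff pre_proj[symmetric] by (auto simp: proj_v_def)
    have "x' l \<in> Xs l" if l: "l < N'" for l
    proof (cases "l < N")
      case True
      have "x' l t = x l t" if t: "t < Suc l" for t
      proof -
        have "bst l + t < bst (Suc l)" using t by (simp add: bst_Suc)
        also have "\<dots> \<le> bst N" using True by (intro bst_mono) simp
        finally have "bst l + t < stp aA \<rho> (conc x)" using N(1) by linarith
        then show ?thesis using e1 conc_at[OF t, of x] conc_at[OF t, of x'] by metis
      qed
      then show ?thesis using True x' by (simp add: Xs_def pre_eq_iff space_PP space_mu)
    next
      case False
      have "fst (x' l t) = fst (x l t)" if t: "t < Suc l" for t
      proof -
        have "bst l + t < bst (Suc l)" using t by (simp add: bst_Suc)
        also have "\<dots> \<le> bst N'" using l by (intro bst_mono) simp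
        finally have "bst l + t < stp bB \<rho> (conc x)" using N(2) by linarith
        then show ?thesis using e2 conc_at[OF t, of x] conc_at[OF t, of x'] by metis
      qed
      then show ?thesis using False x' by (simp add: Xs_def pre_eq_iff space_PP space_mu proj_v_def)
    qed
    then show "x' \<in> P.emb UNIV {..<N'} (PiE {..<N'} Xs)"
      using x' by (auto simp: prod_emb_def space_PiM PiE_iff)
  qed
  have "P.prob {x'\<in>space PP. key \<rho> (conc x') = key \<rho> (conc x)} \<le> P.prob (P.emb UNIV {..<N'} (PiE {..<N'} Xs))"
    by (rule P.finite_measure_mono[OF sub]) (use Xs in \<open>auto intro!: measurable_prod_emb sets_PiM_I_finite\<close>)
  also have "\<dots> = (\<Prod>l<N'. measure \<mu> (Xs l))" using Xs by (intro P.measure_PiM_emb) auto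
  also have "\<dots> \<le> (\<Prod>l<N'. exp (- ((if l < N then ic l (x l) else 0) + iv l (x l))))"
  proof (intro prod_mono conjI)
    fix l
    let ?w = "pre (Suc l) (x l)"
    let ?v = "map fst ?w"
    have v: "vp ?v \<le> exp (- iv l (x l))"
    proof (cases "vp ?v = 0")
      case False
      then have "0 < vp ?v" using wp_bounds(4)[of ?v] by simp
      moreover have "iv l (x l) \<le> - ln (vp ?v)" by (simp add: iv_def pre_proj)
      ultimately show ?thesis by (metis exp_le_cancel_iff exp_ln le_minus_iff)
    qed simp
    show "measure \<mu> (Xs l) \<le> exp (- ((if l < N then ic l (x l) else 0) + iv l (x l)))"
    proof (cases "l < N")
      case True
      then have "measure \<mu> (Xs l) = wp ?w" by (simp add: Xs_def wp_def)
      also have "\<dots> \<le> exp (- ic l (x l)) * exp (- iv l (x l))"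
      proof (cases "wp ?w = 0")
        case False
        then have p: "0 < wp ?w" "0 < vp ?v" using wp_bounds(1,2)[of ?w] by linarith+
        have "ic l (x l) \<le> - ln (wp ?w / vp ?v)" by (simp add: ic_def)
        then have "ln (wp ?w / vp ?v) \<le> - ic l (x l)" by simp
        then have "exp (ln (wp ?w / vp ?v)) \<le> exp (- ic l (x l))" by (simp only: exp_le_cancel_iff)
        then have "wp ?w / vp ?v \<le> exp (- ic l (x l))" using p by simp
        then have "(wp ?w / vp ?v) * vp ?v \<le> exp (- ic l (x l)) * exp (- iv l (x l))"
          using v p by (intro mult_mono) auto
        then show ?thesis using p by simp
      qed simp
      finally show ?thesis using True by (simp add: exp_add[symmetric])
    next
      case False
      then have "measure \<mu> (Xs l) = vp ?v" by (simp add: Xs_def vp_def pre_proj)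
      then show ?thesis using v False by simp
    qed
  qed simp
  also have "\<dots> = exp (- (\<Sum>l<N'. (if l < N then ic l (x l) else 0) + iv l (x l)))"
    by (simp add: exp_sum[symmetric] sum_negf del: minus_add_distrib)
  also have "(\<Sum>l<N'. (if l < N then ic l (x l) else 0) + iv l (x l)) = (\<Sum>l<N. ic l (x l)) + (\<Sum>l<N'. iv l (x l))"
  proof -
    have "(\<Sum>l<N'. if l < N then ic l (x l) else 0) = (\<Sum>l\<in>{..<N'} \<inter> {l. l < N}. ic l (x l))"
      using sum.inter_restrict[of "{..<N'}" "\<lambda>l. ic l (x l)" "{l. l < N}"] by simp
    also have "{..<N'} \<inter> {l. l < N} = {..<N}" using N(3) by auto
    finally show ?thesis by (simp add: sum.distrib)
  qed
  finally show ?thesis .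
qed

lemma bsum_la_mono: "\<omega> \<in> seqs Dg \<Longrightarrow> n \<le> k \<Longrightarrow> bsum la n \<omega> \<le> bsum la k \<omega>"
proof -
  assume w: "\<omega> \<in> seqs Dg" and "n \<le> k"
  then have k: "n + (k - n) = k" by simp
  have "0 \<le> real (k - n) * lmin" using lmin_pos by (intro mult_nonneg_nonneg) auto
  then show ?thesis
    using bsum_add[of la n "k - n" \<omega>] bsum_l(2)[OF shift_pow_seqs[OF w], of "k - n" n]
    unfolding k by linarith
qed

lemma bsum_lb_mono: "\<omega> \<in> seqs Dg \<Longrightarrow> n \<le> k \<Longrightarrow> bsum lb n \<omega> \<le> bsum lb k \<omega>"
proof -
  assume w: "\<omega> \<in> seqs Dg" and "n \<le> k"
  then have k: "n + (k - n) = k" by simp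
  have "0 \<le> real (k - n) * lmin" using lmin_pos by (intro mult_nonneg_nonneg) auto
  then show ?thesis
    using bsum_add[of lb n "k - n" \<omega>] bsum_l(1)[OF shift_pow_seqs[OF w], of "k - n" n]
    unfolding k by linarith
qed

text \<open>The last block makes up the proportion \<open>2 / (M + 2)\<close> of the total
  length.\<close>

lemma bst_loss:
  assumes "0 < \<epsilon>" "2 / \<epsilon> \<le> real M + 2"
  shows "(1 - \<epsilon>) * real (bst (Suc M)) \<le> real (bst M)"
proof -
  have "2 \<le> \<epsilon> * (real M + 2)" using assms by (simp add: pos_divide_le_eq mult.commute)
  then have "real (Suc M) * 2 \<le> real (Suc M) * (\<epsilon> * (real M + 2))" by (intro mult_left_mono) auto
  also have "\<dots> = \<epsilon> * (2 * real (bst (Suc M)))" unfolding bst_real by (simp add: algebra_simps)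
  finally have "real (Suc M) \<le> \<epsilon> * real (bst (Suc M))" by simp
  then show ?thesis by (simp add: bst_Suc algebra_simps)
qed

text \<open>The dimension with entropies and exponents worsened by \<epsilon>; the factor
  \<open>1 - \<epsilon>\<close> pays for an incomplete block. Cutting off at 0 is legitimate because
  information sums are nonnegative, and it allows lower bounds on lengths to be multiplied
  in.\<close>

definition rate :: "real \<Rightarrow> real" where
  "rate \<epsilon> = (1 - \<epsilon>) * (max 0 (hD - hV - \<epsilon>) / (LA + \<epsilon>) + max 0 (hV - \<epsilon>) / (LB + \<epsilon>))"

lemma LA_LB: "0 < LB" "LB \<le> LA" "0 < LA"
  using lyap_bounds[OF prob_mu sets_mu] lmin_pos by auto

lemma rate_close:
  assumes "t < D_LY p a b \<mu>" shows "\<exists>\<epsilon>. 0 < \<epsilon> \<and> \<epsilon> < 1 \<and> t < rate \<epsilon>"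
proof -
  have lim: "(rate \<longlongrightarrow> (1 - 0) * (max 0 (hD - hV - 0) / (LA + 0) + max 0 (hV - 0) / (LB + 0))) (at_right 0)"
    unfolding rate_def[abs_def] using LA_LB by (intro tendsto_intros) auto
  have le: "D_LY p a b \<mu> \<le> (1 - 0) * (max 0 (hD - hV - 0) / (LA + 0) + max 0 (hV - 0) / (LB + 0))"
  proof -
    have "D_LY p a b \<mu> = (hD - hV) / LA + hV / LB"
      unfolding D_LY_eq[OF inv_mu] Dfun_def by (simp add: diff_divide_distrib left_diff_distrib)
    also have "\<dots> \<le> max 0 (hD - hV) / LA + max 0 hV / LB"
      using LA_LB by (intro add_mono divide_right_mono) auto
    finally show ?thesis by simp
  qed
  have "eventually (\<lambda>\<epsilon>. t < rate \<epsilon>) (at_right 0)"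
    by (rule order_tendstoD(1)[OF lim]) (use assms le in linarith)
  then obtain b where b: "0 < b" "\<And>y. 0 < y \<Longrightarrow> y < b \<Longrightarrow> t < rate y"
    unfolding eventually_at_right_field by blast
  show ?thesis using b(1) by (intro exI[of _ "min b 1 / 2"]) (auto intro!: b(2))
qed

text \<open>One index \<open>N\<close> serves all points of \<open>G\<close>, which later yields a
  uniform range of scales for the mass distribution principle.\<close>

lemma good_set:
  assumes \<phi>: "uc Dg \<phi>" and \<epsilon>: "0 < \<epsilon>"
  shows "\<exists>N G. G \<in> sets PP \<and> 0 < P.prob G \<and> (\<forall>x\<in>G.
     (x \<in> space PP \<and> (\<lambda>N. (\<Sum>l<N. bsum \<phi> (Suc l) (x l)) / real (bst N)) \<longlonglongrightarrow> (\<integral>\<omega>. \<phi> \<omega> \<partial>\<mu>)) \<and>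
     (\<forall>n\<ge>N. (\<Sum>l<n. bsum la (Suc l) (x l)) \<le> real (bst n) * (LA + \<epsilon>) \<and>
       (\<Sum>l<n. bsum lb (Suc l) (x l)) \<le> real (bst n) * (LB + \<epsilon>) \<and>
       real (bst n) * (hD - hV - \<epsilon>) \<le> (\<Sum>l<n. ic l (x l)) \<and>
       real (bst n) * (hV - \<epsilon>) \<le> (\<Sum>l<n. iv l (x l))))"
proof (rule P.positive_good_set)
  show "AE x in PP. x \<in> space PP \<and> (\<lambda>N. (\<Sum>l<N. bsum \<phi> (Suc l) (x l)) / real (bst N)) \<longlonglongrightarrow> (\<integral>\<omega>. \<phi> \<omega> \<partial>\<mu>)"
    using uc_block_limit[OF \<phi>] AE_space by eventually_elim simp
  have limD: "(\<lambda>l. blockH Dg \<mu> (Suc l) / real (Suc l)) \<longlonglongrightarrow> hD"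
    by (rule shift_measure.hs_lim[OF shift_measure_D[OF inv_mu]])
  have limV: "(\<lambda>l. blockH Vg (pv \<mu>) (Suc l) / real (Suc l)) \<longlonglongrightarrow> hV"
    by (rule shift_measure.hs_lim[OF shift_measure_V[OF inv_mu]])
  have c: "AE x in PP. eventually (\<lambda>N. real (bst N) * (hD - hV - \<epsilon>) \<le> (\<Sum>l<N. ic l (x l))) sequentially"
    by (rule info_lower_limit[OF ic_meas ic_bounds ic_expect _ \<epsilon>])
       (use tendsto_diff[OF limD limV] in \<open>simp add: diff_divide_distrib\<close>)
  have v: "AE x in PP. eventually (\<lambda>N. real (bst N) * (hV - \<epsilon>) \<le> (\<Sum>l<N. iv l (x l))) sequentially"
    by (rule info_lower_limit[OF iv_meas iv_bounds iv_expect limV \<epsilon>])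
  show "AE x in PP. eventually (\<lambda>n. (\<Sum>l<n. bsum la (Suc l) (x l)) \<le> real (bst n) * (LA + \<epsilon>) \<and>
       (\<Sum>l<n. bsum lb (Suc l) (x l)) \<le> real (bst n) * (LB + \<epsilon>) \<and>
       real (bst n) * (hD - hV - \<epsilon>) \<le> (\<Sum>l<n. ic l (x l)) \<and>
       real (bst n) * (hV - \<epsilon>) \<le> (\<Sum>l<n. iv l (x l))) sequentially"
    using uc_block_upper[OF uc_la \<epsilon>] uc_block_upper[OF uc_lb \<epsilon>] c v
    by eventually_elim (intro eventually_conj)
  fix n
  have comp: "(\<lambda>x. f (x l)) \<in> borel_measurable PP" if f: "f \<in> borel_measurable \<mu>" for f :: "_ \<Rightarrow> real" and l
  proof -
    have "(\<lambda>x. x l) \<in> measurable PP \<mu>" by (rule measurable_component_singleton) simp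
    then show ?thesis by (rule measurable_compose[OF _ f])
  qed
  have bm: "bsum F k \<in> borel_measurable \<mu>" if F: "uc Dg F" for F k
  proof -
    obtain C where C: "\<And>\<omega>. \<omega> \<in> seqs Dg \<Longrightarrow> \<bar>F \<omega>\<bar> \<le> C" using uc_bounded[OF finite_Dg F] by blast
    show ?thesis
      by (rule borel_measurable_integrable[OF integral_bsum(1)[OF inv_mu uc_measurable[OF finite_Dg F] C]])
  qed
  show "{x\<in>space PP. (\<Sum>l<n. bsum la (Suc l) (x l)) \<le> real (bst n) * (LA + \<epsilon>) \<and>
       (\<Sum>l<n. bsum lb (Suc l) (x l)) \<le> real (bst n) * (LB + \<epsilon>) \<and>
       real (bst n) * (hD - hV - \<epsilon>) \<le> (\<Sum>l<n. ic l (x l)) \<and>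
       real (bst n) * (hV - \<epsilon>) \<le> (\<Sum>l<n. iv l (x l))} \<in> sets PP"
    by (intro sets.sets_Collect_conj borel_measurable_le borel_measurable_sum borel_measurable_const comp
          bm uc_la uc_lb ic_meas iv_meas)
qed

text \<open>For \<open>x\<close> in \<open>G\<close> and \<open>R = - ln \<rho>\<close>, the square
  at scale \<rho> fixes complete blocks of total length about \<open>R / LA\<close> and the rows of
  blocks of total length about \<open>R / LB\<close>. Their information is at least
  \<open>R * rate \<epsilon>\<close>, hence at least \<open>R * t\<close>, so the mass is at most
  \<open>\<rho> powr t\<close>.\<close>

theorem lower_bound:
  assumes \<phi>: "uc Dg \<phi>" and t: "0 < t" "t < D_LY p a b \<mu>" and s: "0 \<le> s" "s \<le> t"
  shows "hausdorff_measure s (cod ` birkhoff_level p m \<phi> (\<integral>\<omega>. \<phi> \<omega> \<partial>\<mu>)) \<noteq> 0"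
proof -
  obtain \<epsilon> where e: "0 < \<epsilon>" "\<epsilon> < 1" "t < rate \<epsilon>" using rate_close[OF t(2)] by blast
  from good_set[OF \<phi> e(1)] obtain N0 G where G: "G \<in> sets PP" "0 < P.prob G"
    and GG: "\<forall>x\<in>G. (x \<in> space PP \<and> (\<lambda>N. (\<Sum>l<N. bsum \<phi> (Suc l) (x l)) / real (bst N)) \<longlonglongrightarrow> (\<integral>\<omega>. \<phi> \<omega> \<partial>\<mu>)) \<and>
     (\<forall>n\<ge>N0. (\<Sum>l<n. bsum la (Suc l) (x l)) \<le> real (bst n) * (LA + \<epsilon>) \<and>
       (\<Sum>l<n. bsum lb (Suc l) (x l)) \<le> real (bst n) * (LB + \<epsilon>) \<and>
       real (bst n) * (hD - hV - \<epsilon>) \<le> (\<Sum>l<n. ic l (x l)) \<and>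
       real (bst n) * (hV - \<epsilon>) \<le> (\<Sum>l<n. iv l (x l)))"
    by (elim exE conjE)
  note GN = bspec[OF GG, THEN conjunct2, rule_format]
  have Gsp: "x \<in> space PP" if "x \<in> G" for x
    using bspec[OF GG that] by (rule conjunct1[OF conjunct1])
  have Glim: "(\<lambda>N. (\<Sum>l<N. bsum \<phi> (Suc l) (x l)) / real (bst N)) \<longlonglongrightarrow> (\<integral>\<omega>. \<phi> \<omega> \<partial>\<mu>)" if "x \<in> G" for x
    using bspec[OF GG that] by (rule conjunct2[OF conjunct1])
  have GA: "(\<Sum>l<n. bsum la (Suc l) (x l)) \<le> real (bst n) * (LA + \<epsilon>)" if "x \<in> G" "n \<ge> N0" for x n
    using GN[OF that] by (rule conjunct1)
  have GB: "(\<Sum>l<n. bsum lb (Suc l) (x l)) \<le> real (bst n) * (LB + \<epsilon>)" if "x \<in> G" "n \<ge> N0" for x n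
    using GN[OF that, THEN conjunct2] by (rule conjunct1)
  have GC: "real (bst n) * (hD - hV - \<epsilon>) \<le> (\<Sum>l<n. ic l (x l))" if "x \<in> G" "n \<ge> N0" for x n
    using GN[OF that, THEN conjunct2, THEN conjunct2] by (rule conjunct1)
  have GV: "real (bst n) * (hV - \<epsilon>) \<le> (\<Sum>l<n. iv l (x l))" if "x \<in> G" "n \<ge> N0" for x n
    using GN[OF that, THEN conjunct2, THEN conjunct2] by (rule conjunct2)
  obtain C where C: "\<forall>\<rho> U. 0 < \<rho> \<longrightarrow> \<rho> < 1 \<longrightarrow> bounded U \<longrightarrow> diameter U \<le> \<rho> \<longrightarrow>
     finite (key \<rho> ` {\<omega>\<in>seqs Dg. cod \<omega> \<in> U}) \<and> card (key \<rho> ` {\<omega>\<in>seqs Dg. cod \<omega> \<in> U}) \<le> C"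
    using key_count ..
  obtain N2 :: nat where N2: "2 / \<epsilon> \<le> real N2" using real_arch_simple by blast
  define N1 where "N1 = max N0 N2"
  \<comment> \<open>Below this scale even digits contracting at the fastest rate \<open>lmax\<close>
    need more than \<open>bst (Suc N1)\<close> steps to reach length \<rho>; this forces
    \<open>N1 \<le> N\<close> below.\<close>
  define r0 where "r0 = exp (- (lmax * real (bst (Suc N1))))"
  have lmax0: "0 < lmax" using lmin_pos lmin_le_lmax by linarith
  have r0: "0 < r0" "r0 \<le> 1" using lmax0 by (simp_all add: r0_def)
  have cs: "conc x \<in> seqs Dg" if "x \<in> space PP" for x using that by (auto simp: space_PP intro!: conc_seqs)
  show ?thesis
  proof (rule P.mass_distribution[where Z = "\<lambda>x. cod (conc x)" and key = "\<lambda>\<rho> x. key \<rho> (conc x)" and C = C, OF G _ t(1) r0 _ _ _ s])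
    fix x assume x: "x \<in> G"
    then have "\<And>l. x l \<in> seqs Dg" using Gsp by (simp add: space_PP)
    from block_average_imp_average[OF \<phi> finite_Dg this Glim[OF x]]
    show "cod (conc x) \<in> cod ` birkhoff_level p m \<phi> (\<integral>\<omega>. \<phi> \<omega> \<partial>\<mu>)"
      unfolding level_set_eq using cs[OF Gsp[OF x]] by blast
  next
    fix U :: "(real \<times> real) set" and \<rho> :: real assume U: "0 < \<rho>" "\<rho> < r0" "bounded U" "diameter U \<le> \<rho>"
    let ?K = "key \<rho> ` {\<omega>\<in>seqs Dg. cod \<omega> \<in> U}"
    have K: "finite ?K" "card ?K \<le> C" using C U r0 by auto
    have sub: "(\<lambda>x. key \<rho> (conc x)) ` {x\<in>space PP. cod (conc x) \<in> U} \<subseteq> ?K" using cs by blast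
    show "finite ((\<lambda>x. key \<rho> (conc x)) ` {x\<in>space PP. cod (conc x) \<in> U}) \<and>
       card ((\<lambda>x. key \<rho> (conc x)) ` {x\<in>space PP. cod (conc x) \<in> U}) \<le> C"
      using finite_subset[OF sub K(1)] card_mono[OF K(1) sub] K(2) by linarith
  next
    fix \<rho> x assume r: "0 < \<rho>" "\<rho> < r0" and x: "x \<in> G"
    show "{x'\<in>space PP. key \<rho> (conc x') = key \<rho> (conc x)} \<in> P.events"
      by (rule key_fibre_sets[OF Gsp[OF x] r(1)])
  next
    fix \<rho> x assume r: "0 < \<rho>" "\<rho> < r0" and x: "x \<in> G"
    have w: "conc x \<in> seqs Dg" by (rule cs[OF Gsp[OF x]])
    define n L where "n = stp aA \<rho> (conc x)" and "L = stp bB \<rho> (conc x)"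
    define N N' where "N = blk n" and "N' = blk L"
    define R where "R = - ln \<rho>"
    have R: "lmax * real (bst (Suc N1)) < R"
    proof -
      have "ln \<rho> < ln r0" using r by simp
      then show ?thesis by (simp add: R_def r0_def)
    qed
    have R0: "0 < R" using r r0 by (simp add: R_def)
    have "n \<le> L" unfolding n_def L_def by (rule stp_a_le_b[OF w r(1)])
    then have NN: "N \<le> N'" unfolding N_def N'_def by (rule blk_mono)
    have "exp (- bsum la n (conc x)) \<le> \<rho>" using X.stp_le[OF w r(1)] by (simp add: n_def rat_a[OF w])
    then have "ln (exp (- bsum la n (conc x))) \<le> ln \<rho>" using r(1) by (subst ln_le_cancel_iff) auto
    then have "R \<le> bsum la n (conc x)" by (simp add: R_def)
    also have "\<dots> \<le> bsum la (bst (Suc N)) (conc x)"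
      using blk_bounds(2)[of n] by (intro bsum_la_mono w) (simp add: N_def)
    finally have Ra: "R \<le> bsum la (bst (Suc N)) (conc x)" .
    have "exp (- bsum lb L (conc x)) \<le> \<rho>" using Y.stp_le[OF w r(1)] by (simp add: L_def rat_b[OF w])
    then have "ln (exp (- bsum lb L (conc x))) \<le> ln \<rho>" using r(1) by (subst ln_le_cancel_iff) auto
    then have "R \<le> bsum lb L (conc x)" by (simp add: R_def)
    also have "\<dots> \<le> bsum lb (bst (Suc N')) (conc x)"
      using blk_bounds(2)[of L] by (intro bsum_lb_mono w) (simp add: N'_def)
    finally have Rb: "R \<le> bsum lb (bst (Suc N')) (conc x)" .
    have "lmax * real (bst (Suc N1)) < lmax * real (bst (Suc N))"
      using R Ra bsum_l(3)[OF w, of "bst (Suc N)"] by (simp add: mult.commute)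
    then have "bst (Suc N1) < bst (Suc N)" using lmax0 by simp
    then have N: "N1 \<le> N" using bst_mono[of "Suc N" "Suc N1"] by (cases "N1 \<le> N") auto
    then have N0: "N0 \<le> N" "N0 \<le> N'" "N0 \<le> Suc N" "N0 \<le> Suc N'" and N2': "N2 \<le> N" "N2 \<le> N'" using NN by (auto simp: N1_def)
    have lossA: "(1 - \<epsilon>) * real (bst (Suc N)) \<le> real (bst N)"
      using N2 N2' by (intro bst_loss e(1)) linarith
    have lossB: "(1 - \<epsilon>) * real (bst (Suc N')) \<le> real (bst N')"
      using N2 N2' by (intro bst_loss e(1)) linarith
    have stA: "R / (LA + \<epsilon>) \<le> real (bst (Suc N))"
      using order_trans[OF Ra[unfolded bsum_la_conc] GA[OF x N0(3)]] LA_LB e(1) by (simp add: pos_divide_le_eq)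
    have stB: "R / (LB + \<epsilon>) \<le> real (bst (Suc N'))"
      using order_trans[OF Rb[unfolded bsum_lb_conc] GB[OF x N0(4)]] LA_LB e(1) by (simp add: pos_divide_le_eq)
    have infA: "(1 - \<epsilon>) * (R / (LA + \<epsilon>)) * max 0 (hD - hV - \<epsilon>) \<le> (\<Sum>l<N. ic l (x l))"
    proof -
      have "(1 - \<epsilon>) * (R / (LA + \<epsilon>)) \<le> (1 - \<epsilon>) * real (bst (Suc N))" using stA e(2) by (intro mult_left_mono) auto
      then have "(1 - \<epsilon>) * (R / (LA + \<epsilon>)) * max 0 (hD - hV - \<epsilon>) \<le> real (bst N) * max 0 (hD - hV - \<epsilon>)"
        using lossA by (intro mult_right_mono) auto
      also have "\<dots> \<le> (\<Sum>l<N. ic l (x l))"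
        using GC[OF x N0(1)] sum_nonneg[of "{..<N}" "\<lambda>l. ic l (x l)"] ic_bounds(1) by (simp add: max_def)
      finally show ?thesis .
    qed
    have infB: "(1 - \<epsilon>) * (R / (LB + \<epsilon>)) * max 0 (hV - \<epsilon>) \<le> (\<Sum>l<N'. iv l (x l))"
    proof -
      have "(1 - \<epsilon>) * (R / (LB + \<epsilon>)) \<le> (1 - \<epsilon>) * real (bst (Suc N'))" using stB e(2) by (intro mult_left_mono) auto
      then have "(1 - \<epsilon>) * (R / (LB + \<epsilon>)) * max 0 (hV - \<epsilon>) \<le> real (bst N') * max 0 (hV - \<epsilon>)"
        using lossB by (intro mult_right_mono) auto
      also have "\<dots> \<le> (\<Sum>l<N'. iv l (x l))"
        using GV[OF x N0(2)] sum_nonneg[of "{..<N'}" "\<lambda>l. iv l (x l)"] iv_bounds(1) by (simp add: max_def)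
      finally show ?thesis .
    qed
    have "R * rate \<epsilon> = (1 - \<epsilon>) * (R / (LA + \<epsilon>)) * max 0 (hD - hV - \<epsilon>) + (1 - \<epsilon>) * (R / (LB + \<epsilon>)) * max 0 (hV - \<epsilon>)"
      by (simp add: rate_def distrib_left mult_ac)
    then have low: "R * rate \<epsilon> \<le> (\<Sum>l<N. ic l (x l)) + (\<Sum>l<N'. iv l (x l))" using infA infB by linarith
    have "P.prob {x'\<in>space PP. key \<rho> (conc x') = key \<rho> (conc x)} \<le> exp (- ((\<Sum>l<N. ic l (x l)) + (\<Sum>l<N'. iv l (x l))))"
      by (rule key_fibre_prob[OF Gsp[OF x] r(1) _ _ NN]) (use blk_bounds(1) in \<open>auto simp: N_def N'_def n_def L_def\<close>)
    also have "\<dots> \<le> exp (- (R * t))" using low mult_left_mono[OF less_imp_le[OF e(3)] less_imp_le[OF R0]] by simp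
    also have "\<dots> = \<rho> powr t" using r(1) by (simp add: R_def powr_def mult.commute)
    finally show "P.prob {x'\<in>space PP. key \<rho> (conc x') = key \<rho> (conc x)} \<le> \<rho> powr t" .
  qed
qed

end

section \<open>Mixtures and continuity in the level\<close>

text \<open>The convex combination with weight \<open>t\<close> on \<nu>, as a Bernoulli choice
  between the measures, so that facts about \<open>bind\<close> give invariance and
  integrals.\<close>

definition mix :: "real \<Rightarrow> 'a measure \<Rightarrow> 'a measure \<Rightarrow> 'a measure" where
  "mix t \<mu> \<nu> = bind (measure_pmf (bernoulli_pmf t)) (\<lambda>x. if x then \<nu> else \<mu>)"

lemma mix_kernel:
  assumes "\<mu> \<in> inv_meas A" "\<nu> \<in> inv_meas A"
  shows "(\<lambda>x. if x then \<nu> else \<mu>) \<in> measurable (measure_pmf P) (subprob_algebra (shiftM A))"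
  using assms by (auto simp: inv_meas_def space_subprob_algebra prob_space_imp_subprob_space)

lemma mix_inv:
  assumes "\<mu> \<in> inv_meas A" "\<nu> \<in> inv_meas A"
  shows "mix t \<mu> \<nu> \<in> inv_meas A"
  unfolding inv_meas_def
proof (intro CollectI conjI)
  note k = mix_kernel[OF assms, of "bernoulli_pmf t"]
  show "prob_space (mix t \<mu> \<nu>)"
    unfolding mix_def
    by (rule prob_space.prob_space_bind[OF prob_space_measure_pmf _ k])
       (use assms in \<open>auto simp: inv_meas_def\<close>)
  show "sets (mix t \<mu> \<nu>) = sets (shiftM A)"
    unfolding mix_def by (rule sets_bind) (use assms in \<open>auto simp: inv_meas_def\<close>)
  have "distr (mix t \<mu> \<nu>) (shiftM A) shift =
      measure_pmf (bernoulli_pmf t) \<bind> (\<lambda>x. distr (if x then \<nu> else \<mu>) (shiftM A) shift)"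
    unfolding mix_def by (rule distr_bind[OF k _ measurable_shift]) simp
  also have "(\<lambda>x. distr (if x then \<nu> else \<mu>) (shiftM A) shift) = (\<lambda>x. if x then \<nu> else \<mu>)"
    using assms by (auto simp: inv_meas_def)
  finally show "distr (mix t \<mu> \<nu>) (shiftM A) shift = mix t \<mu> \<nu>" by (simp add: mix_def)
qed

lemma integral_mix:
  assumes A: "finite A" and \<mu>: "\<mu> \<in> inv_meas A" "\<nu> \<in> inv_meas A" and t: "0 \<le> t" "t \<le> 1" and F: "uc A F"
  shows "(\<integral>\<omega>. F \<omega> \<partial>mix t \<mu> \<nu>) = (1 - t) * (\<integral>\<omega>. F \<omega> \<partial>\<mu>) + t * (\<integral>\<omega>. F \<omega> \<partial>\<nu>)"
proof -
  obtain C where C: "\<forall>\<omega>\<in>seqs A. \<bar>F \<omega>\<bar> \<le> C" using uc_bounded[OF A F] by blast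
  have "(\<integral>\<omega>. F \<omega> \<partial>mix t \<mu> \<nu>) = (\<integral>x. (\<integral>\<omega>. F \<omega> \<partial>(if x then \<nu> else \<mu>)) \<partial>bernoulli_pmf t)"
    unfolding mix_def
    by (rule integral_bind[OF uc_measurable[OF A F] _ mix_kernel[OF \<mu>] measure_pmf.finite_measure_axioms,
          where B = C and B' = 1])
       (use C \<mu> in \<open>auto simp: space_shiftM inv_meas_def prob_space.emeasure_space_1\<close>)
  also have "\<dots> = (1 - t) * (\<integral>\<omega>. F \<omega> \<partial>\<mu>) + t * (\<integral>\<omega>. F \<omega> \<partial>\<nu>)"
    using t by simp
  finally show ?thesis .
qed

lemma inv_meas_preimage:
  assumes "\<mu> \<in> inv_meas A" "S \<in> sets (shiftM A)"
  shows "measure \<mu> (shift -` S \<inter> seqs A) = measure \<mu> S"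
proof -
  have s: "sets \<mu> = sets (shiftM A)" "distr \<mu> (shiftM A) shift = \<mu>" using assms by (auto simp: inv_meas_def)
  have "measure \<mu> S = measure (distr \<mu> (shiftM A) shift) S" by (simp add: s(2))
  also have "\<dots> = measure \<mu> (shift -` S \<inter> space \<mu>)"
    by (rule measure_distr) (simp_all add: measurable_cong_sets[OF s(1) refl] measurable_shift assms(2))
  finally show ?thesis by (simp add: space_eq_seqs[OF s(1)])
qed

context lg begin

text \<open>The Krylov-Bogolyubov construction along the orbit of a constant sequence.\<close>

lemma inv_meas_ne: "inv_meas Dg \<noteq> {}"
proof -
  obtain e where "e \<in> Dg" using Dg_ne by blast
  define \<omega> where "\<omega> = (\<lambda>_::nat. e)"
  have w: "\<omega> \<in> seqs Dg" using \<open>e \<in> Dg\<close> by (simp add: seqs_def \<omega>_def)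
  have "\<exists>r \<mu>. strict_mono r \<and> \<mu> \<in> inv_meas Dg \<and>
    (\<forall>F. uc Dg F \<longrightarrow> (\<lambda>j. \<integral>x. F x \<partial>emp Dg (Suc (r j)) \<omega>) \<longlonglongrightarrow> (\<integral>\<omega>. F \<omega> \<partial>\<mu>))"
  proof (rule invariant_limit[OF finite_Dg])
    show "prob_space (emp Dg (Suc j) \<omega>)" for j by (rule prob_space_emp[OF w])
    show "sets (emp Dg (Suc j) \<omega>) = sets (shiftM Dg)" for j by (rule sets_emp)
    fix S assume S: "S \<in> sets (shiftM Dg)"
    show "(\<lambda>j. measure (emp Dg (Suc j) \<omega>) (shift -` S \<inter> seqs Dg) - measure (emp Dg (Suc j) \<omega>) S) \<longlonglongrightarrow> 0"
    proof (rule Lim_null_comparison[OF _ LIMSEQ_inverse_real_of_nat])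
      show "eventually (\<lambda>j. norm (measure (emp Dg (Suc j) \<omega>) (shift -` S \<inter> seqs Dg) - measure (emp Dg (Suc j) \<omega>) S)
          \<le> inverse (real (Suc j))) sequentially"
        using emp_almost_invariant[OF w zero_less_Suc S] by (intro always_eventually allI) (simp add: inverse_eq_divide)
    qed
  qed
  then show ?thesis by blast
qed

text \<open>Compactness when the mean is only approximately \<alpha>. With \<open>s = 0\<close> it
  shows that extreme means are attained; with larger \<open>s\<close> it gives upper semicontinuity
  in \<alpha>.\<close>

lemma usc_closed:
  assumes \<phi>: "uc Dg \<phi>"
    and ex: "\<And>n. \<exists>\<mu>\<in>inv_meas Dg. \<bar>(\<integral>\<omega>. \<phi> \<omega> \<partial>\<mu>) - \<alpha>\<bar> \<le> inverse (real (Suc n)) \<and> s \<le> D_LY p a b \<mu>"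
  shows "\<exists>\<mu>\<in>inv_meas Dg. (\<integral>\<omega>. \<phi> \<omega> \<partial>\<mu>) = \<alpha> \<and> s \<le> D_LY p a b \<mu>"
proof -
  have "\<forall>n. \<exists>\<mu>. \<mu> \<in> inv_meas Dg \<and> \<bar>(\<integral>\<omega>. \<phi> \<omega> \<partial>\<mu>) - \<alpha>\<bar> \<le> inverse (real (Suc n)) \<and> s \<le> D_LY p a b \<mu>"
    using ex by blast
  from choice[OF this] obtain e where e: "\<And>n. e n \<in> inv_meas Dg"
    "\<And>n. \<bar>(\<integral>\<omega>. \<phi> \<omega> \<partial>e n) - \<alpha>\<bar> \<le> inverse (real (Suc n))" "\<And>n. s \<le> D_LY p a b (e n)" by blast
  show ?thesis
  proof (rule D_LY_usc[of e])
    show "prob_space (e j)" "sets (e j) = sets (shiftM Dg)" for j using e(1)[of j] by (auto simp: inv_meas_def)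
    show "(\<lambda>j. measure (e j) (shift -` S \<inter> seqs Dg) - measure (e j) S) \<longlonglongrightarrow> 0" if S: "S \<in> sets (shiftM Dg)" for S
      by (simp add: inv_meas_preimage[OF e(1) S])
    have "(\<lambda>j. (\<integral>\<omega>. \<phi> \<omega> \<partial>e j) - \<alpha>) \<longlonglongrightarrow> 0"
      by (rule Lim_null_comparison[OF _ LIMSEQ_inverse_real_of_nat]) (use e(2) in simp)
    then show "(\<lambda>j. \<integral>\<omega>. \<phi> \<omega> \<partial>e j) \<longlonglongrightarrow> \<alpha>" by (rule LIM_zero_cancel)
    show "eventually (\<lambda>j. s \<le> Dfun (\<integral>\<omega>. gfun r \<kappa> \<omega> \<partial>e j)
        (\<integral>\<omega>. gfun r' \<kappa>' (proj_v \<omega>) \<partial>e j) (\<integral>\<omega>. la \<omega> \<partial>e j) (\<integral>\<omega>. lb \<omega> \<partial>e j)) sequentially"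
      if "adm Dg r \<kappa>" "adm Vg r' \<kappa>'" for r \<kappa> r' \<kappa>'
      using order_trans[OF e(3) D_LY_le_gfun[OF e(1) that]] by simp
  qed (rule \<phi>)
qed

text \<open>Entropy is the infimum over weights of integrals that are affine in the measure, hence
  concave.\<close>

lemma hs_mix:
  assumes \<mu>: "\<mu> \<in> inv_meas Dg" "\<nu> \<in> inv_meas Dg" and t: "0 \<le> t" "t \<le> 1"
  shows "(1 - t) * hs Dg \<mu> + t * hs Dg \<nu> \<le> hs Dg (mix t \<mu> \<nu>)"
    and "(1 - t) * hs Vg (pv \<mu>) + t * hs Vg (pv \<nu>) \<le> hs Vg (pv (mix t \<mu> \<nu>))"
proof -
  note M = mix_inv[OF \<mu>, of t]
  have sm: "sets (mix t \<mu> \<nu>) = sets (shiftM Dg)" using M by (auto simp: inv_meas_def)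
  show "(1 - t) * hs Dg \<mu> + t * hs Dg \<nu> \<le> hs Dg (mix t \<mu> \<nu>)"
  proof (rule field_le_epsilon)
    fix \<delta> :: real assume "0 < \<delta>"
    from shift_measure.hs_approx[OF shift_measure_D[OF M] this]
    obtain r \<kappa> where g: "adm Dg r \<kappa>" "(\<integral>\<omega>. gfun r \<kappa> \<omega> \<partial>mix t \<mu> \<nu>) < hs Dg (mix t \<mu> \<nu>) + \<delta>" by blast
    have "(1 - t) * hs Dg \<mu> + t * hs Dg \<nu> \<le> (1 - t) * (\<integral>\<omega>. gfun r \<kappa> \<omega> \<partial>\<mu>) + t * (\<integral>\<omega>. gfun r \<kappa> \<omega> \<partial>\<nu>)"
      using t by (intro add_mono mult_left_mono shift_measure.hs_le_gfun[OF shift_measure_D] \<mu> g(1)) auto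
    also have "\<dots> = (\<integral>\<omega>. gfun r \<kappa> \<omega> \<partial>mix t \<mu> \<nu>)"
      by (rule integral_mix[OF finite_Dg \<mu> t uc_gfun, symmetric])
    finally show "(1 - t) * hs Dg \<mu> + t * hs Dg \<nu> \<le> hs Dg (mix t \<mu> \<nu>) + \<delta>" using g(2) by linarith
  qed
  show "(1 - t) * hs Vg (pv \<mu>) + t * hs Vg (pv \<nu>) \<le> hs Vg (pv (mix t \<mu> \<nu>))"
  proof (rule field_le_epsilon)
    fix \<delta> :: real assume "0 < \<delta>"
    from shift_measure.hs_approx[OF shift_measure_V[OF M] this]
    obtain r \<kappa> where g: "adm Vg r \<kappa>" "(\<integral>\<omega>. gfun r \<kappa> \<omega> \<partial>pv (mix t \<mu> \<nu>)) < hs Vg (pv (mix t \<mu> \<nu>)) + \<delta>" by blast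
    have "(1 - t) * hs Vg (pv \<mu>) + t * hs Vg (pv \<nu>)
        \<le> (1 - t) * (\<integral>\<omega>. gfun r \<kappa> (proj_v \<omega>) \<partial>\<mu>) + t * (\<integral>\<omega>. gfun r \<kappa> (proj_v \<omega>) \<partial>\<nu>)"
      using t by (intro add_mono mult_left_mono hs_pv_le_gfun \<mu> g(1)) auto
    also have "\<dots> = (\<integral>\<omega>. gfun r \<kappa> (proj_v \<omega>) \<partial>mix t \<mu> \<nu>)"
      by (rule integral_mix[OF finite_Dg \<mu> t uc_proj[OF uc_gfun], symmetric])
    also have "\<dots> = (\<integral>\<omega>. gfun r \<kappa> \<omega> \<partial>pv (mix t \<mu> \<nu>))"
      by (simp add: integral_pv[OF sm] gfun_measurable finite_Vg)
    finally show "(1 - t) * hs Vg (pv \<mu>) + t * hs Vg (pv \<nu>) \<le> hs Vg (pv (mix t \<mu> \<nu>)) + \<delta>" using g(2) by linarith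
  qed
qed

text \<open>Along mixtures the mean moves affinely from that of \<mu> to that of \<nu>, while
  concavity of entropy bounds the dimension from below by a function \<open>g\<close> that is
  continuous at 0 with \<open>g 0 = D_LY p a b \<mu>\<close>.\<close>

lemma D_LY_lsc:
  assumes \<phi>: "uc Dg \<phi>" and \<mu>: "\<mu> \<in> inv_meas Dg" "\<nu> \<in> inv_meas Dg" and x: "x < D_LY p a b \<mu>"
  shows "\<exists>\<eta>>0. \<forall>\<alpha>\<in>closed_segment (\<integral>\<omega>. \<phi> \<omega> \<partial>\<mu>) (\<integral>\<omega>. \<phi> \<omega> \<partial>\<nu>). \<bar>\<alpha> - (\<integral>\<omega>. \<phi> \<omega> \<partial>\<mu>)\<bar> < \<eta> \<longrightarrow>
     (\<exists>\<kappa>\<in>inv_meas Dg. (\<integral>\<omega>. \<phi> \<omega> \<partial>\<kappa>) = \<alpha> \<and> x < D_LY p a b \<kappa>)"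
proof -
  let ?I = "\<lambda>F t. (1 - t) * (\<integral>\<omega>. F \<omega> \<partial>\<mu>) + t * (\<integral>\<omega>. F \<omega> \<partial>\<nu>)"
  define g where "g t = Dfun ((1 - t) * hs Dg \<mu> + t * hs Dg \<nu>) ((1 - t) * hs Vg (pv \<mu>) + t * hs Vg (pv \<nu>))
     (?I la t) (?I lb t)" for t :: real
  let ?\<alpha> = "\<integral>\<omega>. \<phi> \<omega> \<partial>\<mu>" and ?\<beta> = "\<integral>\<omega>. \<phi> \<omega> \<partial>\<nu>"
  have sm: "prob_space \<mu>" "sets \<mu> = sets (shiftM Dg)" using \<mu> by (auto simp: inv_meas_def)
  have "(g \<longlongrightarrow> g 0) (at 0)"
    unfolding g_def[abs_def]
    by (intro tendsto_Dfun tendsto_intros) (use lyap_bounds[OF sm] lmin_pos in auto)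
  moreover have "g 0 = D_LY p a b \<mu>" by (simp add: g_def D_LY_eq[OF \<mu>(1)])
  ultimately have "eventually (\<lambda>t. x < g t) (at 0)" using x by (intro order_tendstoD(1)) auto
  then obtain \<delta> where \<delta>: "0 < \<delta>" "\<And>t. t \<noteq> 0 \<Longrightarrow> \<bar>t\<bar> < \<delta> \<Longrightarrow> x < g t"
    unfolding eventually_at by (auto simp: dist_real_def)
  have ge: "x < D_LY p a b (mix t \<mu> \<nu>)" if t: "0 \<le> t" "t \<le> 1" "t = 0 \<or> t < \<delta>" for t
  proof -
    note M = mix_inv[OF \<mu>, of t]
    have sM: "prob_space (mix t \<mu> \<nu>)" "sets (mix t \<mu> \<nu>) = sets (shiftM Dg)" using M by (auto simp: inv_meas_def)
    have "x < g t" using \<delta>(2)[of t] t x \<open>g 0 = D_LY p a b \<mu>\<close> by (cases "t = 0") auto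
    also have "g t \<le> D_LY p a b (mix t \<mu> \<nu>)"
      unfolding g_def D_LY_eq[OF M] integral_mix[OF finite_Dg \<mu> t(1,2) uc_la, symmetric]
        integral_mix[OF finite_Dg \<mu> t(1,2) uc_lb, symmetric]
      by (intro Dfun_mono hs_mix \<mu> t) (use lyap_bounds[OF sM] lmin_pos in auto)
    finally show ?thesis .
  qed
  \<comment> \<open>The mean moves by \<open>t\<close> times the distance of the two means, so a
    displacement below \<eta> means \<open>t < \<delta>\<close>. If the means coincide, the segment
    is a single point.\<close>
  define \<eta> where "\<eta> = (if ?\<alpha> = ?\<beta> then 1 else \<delta> * \<bar>?\<beta> - ?\<alpha>\<bar>)"
  have "0 < \<eta>" using \<delta>(1) by (simp add: \<eta>_def)
  moreover have "\<exists>\<kappa>\<in>inv_meas Dg. (\<integral>\<omega>. \<phi> \<omega> \<partial>\<kappa>) = \<alpha> \<and> x < D_LY p a b \<kappa>"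
    if \<alpha>: "\<alpha> \<in> closed_segment ?\<alpha> ?\<beta>" "\<bar>\<alpha> - ?\<alpha>\<bar> < \<eta>" for \<alpha>
  proof (cases "?\<alpha> = ?\<beta>")
    case True
    then show ?thesis using \<alpha>(1) \<mu>(1) x by auto
  next
    case False
    obtain t where t: "0 \<le> t" "t \<le> 1" "\<alpha> = (1 - t) * ?\<alpha> + t * ?\<beta>" using \<alpha>(1) by (auto simp: closed_segment_def)
    have "\<alpha> - ?\<alpha> = t * (?\<beta> - ?\<alpha>)" using t(3) by (simp add: algebra_simps)
    then have "t * \<bar>?\<beta> - ?\<alpha>\<bar> < \<delta> * \<bar>?\<beta> - ?\<alpha>\<bar>" using \<alpha>(2) False t(1) by (simp add: \<eta>_def abs_mult)
    then have "t < \<delta>" by (simp add: mult_less_cancel_right)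
    then show ?thesis
      using ge[OF t(1,2)] mix_inv[OF \<mu>, of t] integral_mix[OF finite_Dg \<mu> t(1,2) \<phi>] t(3) by auto
  qed
  ultimately show ?thesis by blast
qed

section \<open>Attained means, the dimension formula and its continuity\<close>

definition amin :: "((nat \<Rightarrow> nat \<times> nat) \<Rightarrow> real) \<Rightarrow> real" where
  "amin \<phi> = Inf ((\<lambda>\<mu>. \<integral>\<omega>. \<phi> \<omega> \<partial>\<mu>) ` inv_meas Dg)"

definition amax :: "((nat \<Rightarrow> nat \<times> nat) \<Rightarrow> real) \<Rightarrow> real" where
  "amax \<phi> = Sup ((\<lambda>\<mu>. \<integral>\<omega>. \<phi> \<omega> \<partial>\<mu>) ` inv_meas Dg)"

definition D_max :: "((nat \<Rightarrow> nat \<times> nat) \<Rightarrow> real) \<Rightarrow> real \<Rightarrow> real" where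
  "D_max \<phi> \<alpha> = Sup (D_LY p a b ` {\<mu> \<in> inv_meas Dg. (\<integral>\<omega>. \<phi> \<omega> \<partial>\<mu>) = \<alpha>})"

lemma means_bounded:
  assumes \<phi>: "uc Dg \<phi>"
  shows "bdd_below ((\<lambda>\<mu>. \<integral>\<omega>. \<phi> \<omega> \<partial>\<mu>) ` inv_meas Dg)" "bdd_above ((\<lambda>\<mu>. \<integral>\<omega>. \<phi> \<omega> \<partial>\<mu>) ` inv_meas Dg)"
proof -
  obtain C where C: "\<forall>\<omega>\<in>seqs Dg. \<bar>\<phi> \<omega>\<bar> \<le> C" using uc_bounded[OF finite_Dg \<phi>] by blast
  have "\<bar>\<integral>\<omega>. \<phi> \<omega> \<partial>\<mu>\<bar> \<le> C" if "\<mu> \<in> inv_meas Dg" for \<mu>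
  proof -
    have s: "prob_space \<mu>" "sets \<mu> = sets (shiftM Dg)" using that by (auto simp: inv_meas_def)
    interpret prob_space \<mu> by (rule s(1))
    have i: "integrable \<mu> \<phi>" by (rule uc_integrable[OF finite_Dg \<phi> s])
    have sp: "space \<mu> = seqs Dg" by (rule space_eq_seqs[OF s(2)])
    have "\<bar>\<integral>\<omega>. \<phi> \<omega> \<partial>\<mu>\<bar> \<le> (\<integral>\<omega>. \<bar>\<phi> \<omega>\<bar> \<partial>\<mu>)" by (rule integral_abs_bound)
    also have "\<dots> \<le> (\<integral>\<omega>. C \<partial>\<mu>)" using i C by (intro integral_mono) (auto simp: sp)
    finally show ?thesis by (simp add: prob_space)
  qed
  then have "-C \<le> (\<integral>\<omega>. \<phi> \<omega> \<partial>\<mu>)" "(\<integral>\<omega>. \<phi> \<omega> \<partial>\<mu>) \<le> C" if "\<mu> \<in> inv_meas Dg" for \<mu>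
    using that by (force simp: abs_le_iff)+
  then show "bdd_below ((\<lambda>\<mu>. \<integral>\<omega>. \<phi> \<omega> \<partial>\<mu>) ` inv_meas Dg)" "bdd_above ((\<lambda>\<mu>. \<integral>\<omega>. \<phi> \<omega> \<partial>\<mu>) ` inv_meas Dg)"
    by (auto intro!: bdd_belowI2[of _ "-C"] bdd_aboveI2[of _ _ C])
qed

lemma amin_attained:
  assumes \<phi>: "uc Dg \<phi>" shows "\<exists>\<mu>\<in>inv_meas Dg. (\<integral>\<omega>. \<phi> \<omega> \<partial>\<mu>) = amin \<phi>"
proof -
  have "\<exists>\<mu>\<in>inv_meas Dg. (\<integral>\<omega>. \<phi> \<omega> \<partial>\<mu>) = amin \<phi> \<and> 0 \<le> D_LY p a b \<mu>"
  proof (rule usc_closed[OF \<phi>])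
    fix n
    have "amin \<phi> < amin \<phi> + inverse (real (Suc n))" by simp
    then obtain \<mu> where \<mu>: "\<mu> \<in> inv_meas Dg" "(\<integral>\<omega>. \<phi> \<omega> \<partial>\<mu>) < amin \<phi> + inverse (real (Suc n))"
      unfolding amin_def using cINF_less_iff[OF inv_meas_ne means_bounded(1)[OF \<phi>]] by blast
    moreover have "amin \<phi> \<le> (\<integral>\<omega>. \<phi> \<omega> \<partial>\<mu>)"
      unfolding amin_def by (rule cINF_lower[OF means_bounded(1)[OF \<phi>] \<mu>(1)])
    ultimately show "\<exists>\<mu>\<in>inv_meas Dg. \<bar>(\<integral>\<omega>. \<phi> \<omega> \<partial>\<mu>) - amin \<phi>\<bar> \<le> inverse (real (Suc n)) \<and> 0 \<le> D_LY p a b \<mu>"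
      using D_LY_nonneg[OF \<mu>(1)] by (intro bexI[OF _ \<mu>(1)]) auto
  qed
  then show ?thesis by blast
qed

lemma amax_attained:
  assumes \<phi>: "uc Dg \<phi>" shows "\<exists>\<mu>\<in>inv_meas Dg. (\<integral>\<omega>. \<phi> \<omega> \<partial>\<mu>) = amax \<phi>"
proof -
  have "\<exists>\<mu>\<in>inv_meas Dg. (\<integral>\<omega>. \<phi> \<omega> \<partial>\<mu>) = amax \<phi> \<and> 0 \<le> D_LY p a b \<mu>"
  proof (rule usc_closed[OF \<phi>])
    fix n
    have "amax \<phi> - inverse (real (Suc n)) < amax \<phi>" by simp
    then obtain \<mu> where \<mu>: "\<mu> \<in> inv_meas Dg" "amax \<phi> - inverse (real (Suc n)) < (\<integral>\<omega>. \<phi> \<omega> \<partial>\<mu>)"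
      unfolding amax_def using less_cSUP_iff[OF inv_meas_ne means_bounded(2)[OF \<phi>]] by blast
    moreover have "(\<integral>\<omega>. \<phi> \<omega> \<partial>\<mu>) \<le> amax \<phi>"
      unfolding amax_def by (rule cSUP_upper[OF \<mu>(1) means_bounded(2)[OF \<phi>]])
    ultimately show "\<exists>\<mu>\<in>inv_meas Dg. \<bar>(\<integral>\<omega>. \<phi> \<omega> \<partial>\<mu>) - amax \<phi>\<bar> \<le> inverse (real (Suc n)) \<and> 0 \<le> D_LY p a b \<mu>"
      using D_LY_nonneg[OF \<mu>(1)] by (intro bexI[OF _ \<mu>(1)]) auto
  qed
  then show ?thesis by blast
qed

lemma mean_exists:
  assumes \<phi>: "uc Dg \<phi>" and \<alpha>: "\<alpha> \<in> {amin \<phi>..amax \<phi>}"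
  shows "\<exists>\<mu>\<in>inv_meas Dg. (\<integral>\<omega>. \<phi> \<omega> \<partial>\<mu>) = \<alpha>"
proof -
  obtain \<mu> where \<mu>: "\<mu> \<in> inv_meas Dg" "(\<integral>\<omega>. \<phi> \<omega> \<partial>\<mu>) = amin \<phi>" using amin_attained[OF \<phi>] by blast
  obtain \<nu> where \<nu>: "\<nu> \<in> inv_meas Dg" "(\<integral>\<omega>. \<phi> \<omega> \<partial>\<nu>) = amax \<phi>" using amax_attained[OF \<phi>] by blast
  have "\<alpha> \<in> closed_segment (amin \<phi>) (amax \<phi>)" using \<alpha> by (auto simp: closed_segment_eq_real_ivl)
  then obtain t where t: "0 \<le> t" "t \<le> 1" "\<alpha> = (1 - t) * amin \<phi> + t * amax \<phi>" by (auto simp: closed_segment_def)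
  show ?thesis
    using mix_inv[OF \<mu>(1) \<nu>(1), of t] integral_mix[OF finite_Dg \<mu>(1) \<nu>(1) t(1,2) \<phi>] t(3) \<mu>(2) \<nu>(2) by auto
qed

lemma D_max_upper:
  assumes "\<mu> \<in> inv_meas Dg" shows "D_LY p a b \<mu> \<le> D_max \<phi> (\<integral>\<omega>. \<phi> \<omega> \<partial>\<mu>)"
proof -
  obtain C where "\<forall>\<mu>\<in>inv_meas Dg. D_LY p a b \<mu> \<le> C" using D_LY_bounded by blast
  then have "bdd_above (D_LY p a b ` {\<kappa> \<in> inv_meas Dg. (\<integral>\<omega>. \<phi> \<omega> \<partial>\<kappa>) = (\<integral>\<omega>. \<phi> \<omega> \<partial>\<mu>)})"
    by (intro bdd_aboveI2[of _ _ C]) auto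
  then show ?thesis unfolding D_max_def by (rule cSUP_upper[rotated]) (use assms in simp)
qed

lemma less_D_max:
  assumes \<phi>: "uc Dg \<phi>" "\<alpha> \<in> {amin \<phi>..amax \<phi>}" and x: "x < D_max \<phi> \<alpha>"
  shows "\<exists>\<mu>\<in>inv_meas Dg. (\<integral>\<omega>. \<phi> \<omega> \<partial>\<mu>) = \<alpha> \<and> x < D_LY p a b \<mu>"
proof -
  have "D_LY p a b ` {\<mu> \<in> inv_meas Dg. (\<integral>\<omega>. \<phi> \<omega> \<partial>\<mu>) = \<alpha>} \<noteq> {}" using mean_exists[OF \<phi>] by auto
  from less_cSupD[OF this x[unfolded D_max_def]] show ?thesis by auto
qed

lemma D_max_nonneg: "uc Dg \<phi> \<Longrightarrow> \<alpha> \<in> {amin \<phi>..amax \<phi>} \<Longrightarrow> 0 \<le> D_max \<phi> \<alpha>"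
proof -
  assume \<phi>: "uc Dg \<phi>" "\<alpha> \<in> {amin \<phi>..amax \<phi>}"
  obtain \<mu> where \<mu>: "\<mu> \<in> inv_meas Dg" "(\<integral>\<omega>. \<phi> \<omega> \<partial>\<mu>) = \<alpha>" using mean_exists[OF \<phi>] by (rule bexE)
  show ?thesis using D_LY_nonneg[OF \<mu>(1)] D_max_upper[OF \<mu>(1), of \<phi>] unfolding \<mu>(2) by linarith
qed

lemma hausdorff_dim_eq_D_max:
  assumes \<phi>: "uc Dg \<phi>" "\<alpha> \<in> {amin \<phi>..amax \<phi>}"
  shows "hausdorff_dim (cod ` birkhoff_level p m \<phi> \<alpha>) = D_max \<phi> \<alpha>"
proof (rule antisym)
  let ?E = "cod ` birkhoff_level p m \<phi> \<alpha>"
  have D0: "0 \<le> D_max \<phi> \<alpha>" by (rule D_max_nonneg[OF \<phi>])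
  have null: "hausdorff_measure s ?E = 0" if s: "D_max \<phi> \<alpha> < s" for s
  proof (rule upper_bound[OF \<phi>(1)])
    show "0 < s" using s D0 by linarith
    \<comment> \<open>\<open>upper_bound\<close> wants a level below \<open>s\<close> that no
      measure with mean \<alpha> reaches; the midpoint lies strictly between the supremum and
      \<open>s\<close>.\<close>
    show "(D_max \<phi> \<alpha> + s) / 2 < s" using s by simp
    show "\<not> (\<exists>\<mu>\<in>inv_meas Dg. (\<integral>\<omega>. \<phi> \<omega> \<partial>\<mu>) = \<alpha> \<and> (D_max \<phi> \<alpha> + s) / 2 \<le> D_LY p a b \<mu>)"
    proof
      assume "\<exists>\<mu>\<in>inv_meas Dg. (\<integral>\<omega>. \<phi> \<omega> \<partial>\<mu>) = \<alpha> \<and> (D_max \<phi> \<alpha> + s) / 2 \<le> D_LY p a b \<mu>"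
      then obtain \<mu> where \<mu>: "\<mu> \<in> inv_meas Dg" "(\<integral>\<omega>. \<phi> \<omega> \<partial>\<mu>) = \<alpha>" "(D_max \<phi> \<alpha> + s) / 2 \<le> D_LY p a b \<mu>" by blast
      show False using D_max_upper[OF \<mu>(1), of \<phi>] \<mu>(2,3) s by simp
    qed
  qed
  show "hausdorff_dim ?E \<le> D_max \<phi> \<alpha>"
  proof (rule dense_ge)
    fix s assume s: "D_max \<phi> \<alpha> < s"
    show "hausdorff_dim ?E \<le> s" by (rule hausdorff_dim_le[OF _ null[OF s]]) (use s D0 in linarith)
  qed
  have s0: "0 \<le> D_max \<phi> \<alpha> + 1" "hausdorff_measure (D_max \<phi> \<alpha> + 1) ?E = 0"
    by (use D0 in linarith, rule null) simp
  have "{s. 0 \<le> s \<and> hausdorff_measure s ?E = 0} \<noteq> {}" using s0 by blast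
  then have h0: "0 \<le> hausdorff_dim ?E"
    unfolding hausdorff_dim_def by (rule cInf_greatest) simp
  have h: "t \<le> hausdorff_dim ?E" if t: "0 < t" "t < D_max \<phi> \<alpha>" for t
  proof (rule hausdorff_dim_ge[OF _ s0])
    fix s assume s: "0 \<le> s" "s \<le> t"
    from less_D_max[OF \<phi> t(2)]
    obtain \<mu> where \<mu>: "\<mu> \<in> inv_meas Dg" "(\<integral>\<omega>. \<phi> \<omega> \<partial>\<mu>) = \<alpha>" "t < D_LY p a b \<mu>" by (elim bexE conjE)
    have "lg_measure p m a c b d \<mu>" by (intro lg_measure.intro lg_axioms lg_measure_axioms.intro \<mu>(1))
    from lg_measure.lower_bound[OF this \<phi>(1) t(1) \<mu>(3) s] show "hausdorff_measure s ?E \<noteq> 0" unfolding \<mu>(2) .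
  qed
  show "D_max \<phi> \<alpha> \<le> hausdorff_dim ?E"
  \<comment> \<open>\<open>lower_bound\<close> requires a positive \<open>t\<close>, so a vanishing
    supremum is settled by nonnegativity of the dimension.\<close>
  proof (cases "D_max \<phi> \<alpha> = 0")
    case False
    then have "0 < D_max \<phi> \<alpha>" using D0 by simp
    then show ?thesis by (rule dense_le_bounded) (rule h)
  qed (use h0 in simp)
qed

text \<open>From below, a nearly optimal measure is mixed with measures of extreme mean, one for
  each side of \<open>\<alpha>0\<close>. From above, means that converge to \<open>\<alpha>0\<close>
  and violate the bound would produce, by compactness, a measure with mean \<open>\<alpha>0\<close>
  and too large a dimension.\<close>

lemma continuous_D_max:
  assumes \<phi>: "uc Dg \<phi>" shows "continuous_on {amin \<phi>..amax \<phi>} (D_max \<phi>)"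
  unfolding continuous_on_iff
proof (intro ballI allI impI)
  let ?J = "{amin \<phi>..amax \<phi>}"
  fix \<alpha>0 and e :: real assume \<alpha>0: "\<alpha>0 \<in> ?J" and e: "0 < e"
  obtain \<mu>1 where \<mu>1: "\<mu>1 \<in> inv_meas Dg" "(\<integral>\<omega>. \<phi> \<omega> \<partial>\<mu>1) = amin \<phi>" using amin_attained[OF \<phi>] by blast
  obtain \<mu>2 where \<mu>2: "\<mu>2 \<in> inv_meas Dg" "(\<integral>\<omega>. \<phi> \<omega> \<partial>\<mu>2) = amax \<phi>" using amax_attained[OF \<phi>] by blast
  obtain \<mu> where \<mu>: "\<mu> \<in> inv_meas Dg" "(\<integral>\<omega>. \<phi> \<omega> \<partial>\<mu>) = \<alpha>0" "D_max \<phi> \<alpha>0 - e < D_LY p a b \<mu>"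
    using less_D_max[OF \<phi> \<alpha>0, of "D_max \<phi> \<alpha>0 - e"] e by auto
  obtain \<eta>1 where \<eta>1: "0 < \<eta>1" "\<And>\<alpha>. \<alpha> \<in> closed_segment \<alpha>0 (amin \<phi>) \<Longrightarrow> \<bar>\<alpha> - \<alpha>0\<bar> < \<eta>1 \<Longrightarrow>
     \<exists>\<kappa>\<in>inv_meas Dg. (\<integral>\<omega>. \<phi> \<omega> \<partial>\<kappa>) = \<alpha> \<and> D_max \<phi> \<alpha>0 - e < D_LY p a b \<kappa>"
    using D_LY_lsc[OF \<phi> \<mu>(1) \<mu>1(1) \<mu>(3)] unfolding \<mu>(2) \<mu>1(2) by blast
  obtain \<eta>2 where \<eta>2: "0 < \<eta>2" "\<And>\<alpha>. \<alpha> \<in> closed_segment \<alpha>0 (amax \<phi>) \<Longrightarrow> \<bar>\<alpha> - \<alpha>0\<bar> < \<eta>2 \<Longrightarrow>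
     \<exists>\<kappa>\<in>inv_meas Dg. (\<integral>\<omega>. \<phi> \<omega> \<partial>\<kappa>) = \<alpha> \<and> D_max \<phi> \<alpha>0 - e < D_LY p a b \<kappa>"
    using D_LY_lsc[OF \<phi> \<mu>(1) \<mu>2(1) \<mu>(3)] unfolding \<mu>(2) \<mu>2(2) by blast
  have low: "D_max \<phi> \<alpha>0 - e < D_max \<phi> \<alpha>" if \<alpha>: "\<alpha> \<in> ?J" "\<bar>\<alpha> - \<alpha>0\<bar> < min \<eta>1 \<eta>2" for \<alpha>
  proof -
    have "\<alpha> \<in> closed_segment \<alpha>0 (amin \<phi>) \<or> \<alpha> \<in> closed_segment \<alpha>0 (amax \<phi>)"
      using \<alpha>(1) \<alpha>0 by (auto simp: closed_segment_eq_real_ivl)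
    then obtain \<kappa> where "\<kappa> \<in> inv_meas Dg" "(\<integral>\<omega>. \<phi> \<omega> \<partial>\<kappa>) = \<alpha>" "D_max \<phi> \<alpha>0 - e < D_LY p a b \<kappa>"
      using \<eta>1(2)[of \<alpha>] \<eta>2(2)[of \<alpha>] \<alpha>(2) by auto
    then show ?thesis using D_max_upper[of \<kappa> \<phi>] by simp
  qed
  have "\<exists>n. \<forall>\<alpha>\<in>?J. \<bar>\<alpha> - \<alpha>0\<bar> \<le> inverse (real (Suc n)) \<longrightarrow> D_max \<phi> \<alpha> < D_max \<phi> \<alpha>0 + e"
  proof (rule ccontr)
    assume "\<not> ?thesis"
    then have "\<forall>n. \<exists>\<alpha>\<in>?J. \<bar>\<alpha> - \<alpha>0\<bar> \<le> inverse (real (Suc n)) \<and> D_max \<phi> \<alpha>0 + e \<le> D_max \<phi> \<alpha>"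
      by (simp only: Ball_def Bex_def not_ex not_all not_imp not_less simp_thms)
    then have far: "\<exists>\<alpha>\<in>?J. \<bar>\<alpha> - \<alpha>0\<bar> \<le> inverse (real (Suc n)) \<and> D_max \<phi> \<alpha>0 + e \<le> D_max \<phi> \<alpha>" for n ..
    have "\<exists>\<mu>\<in>inv_meas Dg. (\<integral>\<omega>. \<phi> \<omega> \<partial>\<mu>) = \<alpha>0 \<and> D_max \<phi> \<alpha>0 + e/2 \<le> D_LY p a b \<mu>"
    proof (rule usc_closed[OF \<phi>])
      fix n
      obtain \<alpha> where \<alpha>: "\<alpha> \<in> ?J" "\<bar>\<alpha> - \<alpha>0\<bar> \<le> inverse (real (Suc n))" "D_max \<phi> \<alpha>0 + e \<le> D_max \<phi> \<alpha>" using far by blast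
      \<comment> \<open>Halving \<open>e\<close> gives the strict inequality that
        \<open>less_D_max\<close> asks for.\<close>
      have "D_max \<phi> \<alpha>0 + e/2 < D_max \<phi> \<alpha>" using \<alpha>(3) e by linarith
      then obtain \<mu> where \<mu>: "\<mu> \<in> inv_meas Dg" "(\<integral>\<omega>. \<phi> \<omega> \<partial>\<mu>) = \<alpha>" "D_max \<phi> \<alpha>0 + e/2 < D_LY p a b \<mu>"
        using less_D_max[OF \<phi> \<alpha>(1)] by blast
      show "\<exists>\<mu>\<in>inv_meas Dg. \<bar>(\<integral>\<omega>. \<phi> \<omega> \<partial>\<mu>) - \<alpha>0\<bar> \<le> inverse (real (Suc n)) \<and> D_max \<phi> \<alpha>0 + e/2 \<le> D_LY p a b \<mu>"
        using \<mu>(2,3) \<alpha>(2) by (intro bexI[OF _ \<mu>(1)]) simp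
    qed
    then obtain \<kappa> where \<kappa>: "\<kappa> \<in> inv_meas Dg" "(\<integral>\<omega>. \<phi> \<omega> \<partial>\<kappa>) = \<alpha>0" "D_max \<phi> \<alpha>0 + e/2 \<le> D_LY p a b \<kappa>" by blast
    show False using D_max_upper[OF \<kappa>(1), of \<phi>] \<kappa>(2,3) e by simp
  qed
  then obtain n where up: "\<And>\<alpha>. \<alpha> \<in> ?J \<Longrightarrow> \<bar>\<alpha> - \<alpha>0\<bar> \<le> inverse (real (Suc n)) \<Longrightarrow> D_max \<phi> \<alpha> < D_max \<phi> \<alpha>0 + e" by blast
  show "\<exists>d>0. \<forall>\<alpha>\<in>?J. dist \<alpha> \<alpha>0 < d \<longrightarrow> dist (D_max \<phi> \<alpha>) (D_max \<phi> \<alpha>0) < e"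
  proof (intro exI conjI ballI impI)
    show "0 < min (min \<eta>1 \<eta>2) (inverse (real (Suc n)))" using \<eta>1(1) \<eta>2(1) by simp
    fix \<alpha> assume \<alpha>: "\<alpha> \<in> ?J" "dist \<alpha> \<alpha>0 < min (min \<eta>1 \<eta>2) (inverse (real (Suc n)))"
    then have "\<bar>\<alpha> - \<alpha>0\<bar> < min \<eta>1 \<eta>2" "\<bar>\<alpha> - \<alpha>0\<bar> \<le> inverse (real (Suc n))" unfolding dist_real_def by linarith+
    then show "dist (D_max \<phi> \<alpha>) (D_max \<phi> \<alpha>0) < e"
      using low[OF \<alpha>(1)] up[OF \<alpha>(1)] unfolding dist_real_def by linarith
  qed
qed

end

theorem mainTheorem1:
  fixes p :: nat and m :: "nat \<Rightarrow> nat"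
    and a c :: "nat \<Rightarrow> nat \<Rightarrow> real" and b d :: "nat \<Rightarrow> real"
    and \<phi> :: "(nat \<Rightarrow> nat \<times> nat) \<Rightarrow> real"
  assumes LG: "LG_system p m a b c d"
    and cont: "continuous_on (SigmaS p m) \<phi>"
  shows "(\<forall>\<alpha>\<in>{alpha_min p m \<phi> .. alpha_max p m \<phi>}.
           hausdorff_dim (coding a b c d ` birkhoff_level p m \<phi> \<alpha>) =
           Sup (D_LY p a b ` {\<mu> \<in> inv_measures p m. (\<integral>\<omega>. \<phi> \<omega> \<partial>\<mu>) = \<alpha>})) \<and>
         continuous_on {alpha_min p m \<phi> .. alpha_max p m \<phi>}
           (\<lambda>\<alpha>. hausdorff_dim (coding a b c d ` birkhoff_level p m \<phi> \<alpha>))"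
proof -
  interpret lg p m a c b d by unfold_locales (rule LG)
  have \<phi>: "uc (digits p m) \<phi>"
    by (rule continuous_imp_uc[OF finite_Dg]) (use cont in \<open>simp add: SigmaS_eq\<close>)
  have J: "alpha_min p m \<phi> = amin \<phi>" "alpha_max p m \<phi> = amax \<phi>"
    by (simp_all add: alpha_min_def alpha_max_def amin_def amax_def inv_measures_eq)
  have dim: "hausdorff_dim (coding a b c d ` birkhoff_level p m \<phi> \<alpha>) = D_max \<phi> \<alpha>" if "\<alpha> \<in> {amin \<phi>..amax \<phi>}" for \<alpha>
    by (rule hausdorff_dim_eq_D_max[OF \<phi> that])
  have "continuous_on {amin \<phi>..amax \<phi>} (\<lambda>\<alpha>. hausdorff_dim (coding a b c d ` birkhoff_level p m \<phi> \<alpha>))"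
    by (rule iffD2[OF continuous_on_cong[OF refl dim] continuous_D_max[OF \<phi>]])
  then show ?thesis unfolding J using dim by (simp add: D_max_def inv_measures_eq)
qed

end
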